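(* Let $U=ae_r+be_\theta+ce_z$ be an axisymmetric solution of the Euler equation on the solid torus $M$ on $[0,T)$, $T<\infty$, with pressure $P$, flow $\eta$, vorticity $\omega$ and initial velocity $U_0=a_0e_r+b_0e_\theta+c_0e_z$. Suppose $c_0$ and $b_0$ are both odd in $z$, with $\int_0^T|\omega(t,r_0,0)|\,dt=\infty$ for either $r_0=0$ or $r_0=1$ (here $\omega(t,r_0,0)$ is the vorticity at $r=r_0$, $z=0$). Then one cannot find curve-shortening variations of the geodesic $\eta$ on time intervals $[a,b]\subset[0,T)$ that are supported in arbitrarily small neighborhoods of the set $\{r=r_0,\ z=0\}$; that is, for each such $[a,b]$ there is a neighborhood $N$ of $\{r=r_0,z=0\}$ in $M$ such that no variation of $\eta|_{[a,b]}$ supported in $N$ is curve-shortening. In addition the pressure Laplacian and the sectional curvature must both approach negative infinity in the sense that $$\int_0^T\inf_{x\in M}\Delta P(t,x)\,dt=\int_0^T\inf_{V\in T_{\mathrm{id}}\mathrm{Diff}_\mu(M)}K(U(t),V)\,dt=-\infty .$$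
   Context: Configuration domain: $M=\{(x,y,z): x^2+y^2\le 1,\ -\pi\le z\le \pi\}/\{(x,y,-\pi)\equiv(x,y,\pi)\}$ with the flat metric and cylindrical coordinates $(r,\theta,z)$; $e_r,e_\theta,e_z$ are the usual cylindrical unit vector fields. An axisymmetric velocity field is $U=ae_r+be_\theta+ce_z$ with $a,b,c$ functions of $(t,r,z)$ only; $U$ is tangent to $\partial M$ (i.e. $a=0$ at $r=1$). The Euler equation is $U_t+U\cdot\nabla U=-\nabla P$, $\operatorname{div}U=0$, $U|_{t=0}=U_0$, where the pressure $P$ is determined (up to a function of time) by $\Delta P=-\operatorname{Tr}((\nabla U)^2)$ with $\langle\nabla P,e_r\rangle=-\langle U\cdot\nabla U,e_r\rangle$ at $r=1$. Solutions are assumed smooth on $[0,T)$. The vorticity is $\omega=\operatorname{curl}U$; the flow is defined by $\eta_t(t,x)=U(t,\eta(t,x))$, $\eta(0,x)=x$. Odd in $z$ refers to $z\mapsto -z$, $z\in[-\pi,\pi]$. Riemannian structure: $\mathrm{Diff}_\mu(M)$ is the group of volume-preserving diffeomorphisms of $M$ with the right-invariant $L^2$ metric given at the identity by $\langle\langle u,u\rangle\rangle=\int_M\langle u,u\rangle\,d\mu$ on $T_{\mathrm{id}}\mathrm{Diff}_\mu(M)$, the divergence-free vector fields tangent to $\partial M$; its geodesics are exactly the flows $\eta(t)$ of solutions of the Euler equation. A variation of $\eta|_{[a,b]}$ is a smooth one-parameter family $\eta_\sigma(t)\in\mathrm{Diff}_\mu(M)$, $t\in[a,b]$, with $\eta_0=\eta$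 and $\eta_\sigma(a)=\eta(a)$, $\eta_\sigma(b)=\eta(b)$; it is supported in $N$ if $\eta_\sigma(t,x)=\eta(t,x)$ for $x\notin N$; it is curve-shortening if the second variation at $\sigma=0$ of the energy $\tfrac12\int_a^b\int_M|\partial_t\eta_\sigma|^2\,d\mu\,dt$ (equivalently, the index form on the variation field) is negative. The sectional curvature is $K(U,V)=\langle\langle R(U,V)V,U\rangle\rangle/(\|U\|^2\|V\|^2-\langle\langle U,V\rangle\rangle^2)$ for linearly independent $U,V$, where $\langle\langle R(U,V)V,U\rangle\rangle=\int_M\nabla^2P(V,V)\,d\mu-\int_M|\nabla Q|^2\,d\mu$, with $P$ the pressure of $U$ and $Q$ solving $\Delta Q=-\operatorname{div}(U\cdot\nabla V)$ with $\langle\nabla Q+U\cdot\nabla V,e_r\rangle=0$ at $r=1$; the infimum is over those $V$ linearly independent of $U(t)$. *)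

theory Defs
  imports "HOL-Analysis.Analysis"
begin

text \<open>
  The solid torus \<open>M\<close> is handled through its universal cover, the closed solid cylinder
  \<open>cyl\<close>: functions and vector fields on \<open>M\<close> are functions on \<open>cyl\<close> of period \<open>2 * pi\<close> in the
  third coordinate, self-maps of \<open>M\<close> are represented by lifts to \<open>cyl\<close>, and integrals over \<open>M\<close>
  are integrals over the fundamental domain \<open>fund\<close>.  Nothing below depends on the values of
  functions outside \<open>cyl\<close>.
\<close>

definition cyl :: "(real^3) set" where
  "cyl = {x. (x$1)\<^sup>2 + (x$2)\<^sup>2 \<le> 1}"

definition fund :: "(real^3) set" where
  "fund = {x \<in> cyl. -pi \<le> x$3 \<and> x$3 \<le> pi}"

definition integral_M :: "(real^3 \<Rightarrow> real) \<Rightarrow> real" where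
  "integral_M f = set_lebesgue_integral lebesgue fund f"

definition cylpt :: "real \<Rightarrow> real \<Rightarrow> real \<Rightarrow> real^3" where
  "cylpt r \<theta> z = vector [r * cos \<theta>, r * sin \<theta>, z]"

definition e_r :: "real \<Rightarrow> real^3" where
  "e_r \<theta> = vector [cos \<theta>, sin \<theta>, 0]"

definition e_theta :: "real \<Rightarrow> real^3" where
  "e_theta \<theta> = vector [- sin \<theta>, cos \<theta>, 0]"

definition e_z :: "real^3" where
  "e_z = vector [0, 0, 1]"

definition z_periodic :: "(real^3 \<Rightarrow> 'b) \<Rightarrow> bool" where
  "z_periodic f \<longleftrightarrow> (\<forall>x\<in>cyl. f (x + (2 * pi) *\<^sub>R e_z) = f x)"

subsection \<open>Smoothness and differential operators\<close>

text \<open>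
  Derivatives are taken within the closed domain, so that they make sense up to the boundary.
  All sets to which this is applied are convex with nonempty interior, hence the derivative
  within the set is unique and \<open>frechet_derivative\<close> denotes it.
\<close>

primrec Ck_on :: "nat \<Rightarrow> ('a::real_normed_vector \<Rightarrow> 'b::real_normed_vector) \<Rightarrow> 'a set \<Rightarrow> bool" where
  "Ck_on 0 f S \<longleftrightarrow> continuous_on S f"
| "Ck_on (Suc k) f S \<longleftrightarrow> f differentiable_on S \<and>
     (\<forall>v. Ck_on k (\<lambda>x. frechet_derivative f (at x within S) v) S)"

definition smooth_on :: "('a::real_normed_vector \<Rightarrow> 'b::real_normed_vector) \<Rightarrow> 'a set \<Rightarrow> bool" where
  "smooth_on f S \<longleftrightarrow> (\<forall>k. Ck_on k f S)"

definition pd :: "3 \<Rightarrow> (real^3 \<Rightarrow> 'b::real_normed_vector) \<Rightarrow> real^3 \<Rightarrow> 'b" where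
  "pd i f x = frechet_derivative f (at x within cyl) (axis i 1)"

definition grad :: "(real^3 \<Rightarrow> real) \<Rightarrow> real^3 \<Rightarrow> real^3" where
  "grad f x = (\<chi> i. pd i f x)"

definition divergence :: "(real^3 \<Rightarrow> real^3) \<Rightarrow> real^3 \<Rightarrow> real" where
  "divergence V x = (\<Sum>i\<in>UNIV. pd i V x $ i)"

definition curl :: "(real^3 \<Rightarrow> real^3) \<Rightarrow> real^3 \<Rightarrow> real^3" where
  "curl V x = vector [pd 2 V x $ 3 - pd 3 V x $ 2,
                      pd 3 V x $ 1 - pd 1 V x $ 3,
                      pd 1 V x $ 2 - pd 2 V x $ 1]"

definition laplacian :: "(real^3 \<Rightarrow> real) \<Rightarrow> real^3 \<Rightarrow> real" where
  "laplacian f x = (\<Sum>i\<in>UNIV. pd i (pd i f) x)"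

definition hessian :: "(real^3 \<Rightarrow> real) \<Rightarrow> real^3 \<Rightarrow> real^3 \<Rightarrow> real^3 \<Rightarrow> real" where
  "hessian f x v w = (\<Sum>i\<in>UNIV. \<Sum>j\<in>UNIV. pd i (pd j f) x * v$i * w$j)"

text \<open>The covariant derivative \<open>U \<cdot> \<nabla>V\<close> of the flat metric.\<close>

definition advect :: "(real^3 \<Rightarrow> real^3) \<Rightarrow> (real^3 \<Rightarrow> real^3) \<Rightarrow> real^3 \<Rightarrow> real^3" where
  "advect U V x = frechet_derivative V (at x within cyl) (U x)"

definition trace_grad_sq :: "(real^3 \<Rightarrow> real^3) \<Rightarrow> real^3 \<Rightarrow> real" where
  "trace_grad_sq V x = (\<Sum>i\<in>UNIV. \<Sum>j\<in>UNIV. (pd i V x $ j) * (pd j V x $ i))"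

subsection \<open>Axisymmetric solutions of the Euler equation\<close>

definition tangent_bdry :: "(real^3 \<Rightarrow> real^3) \<Rightarrow> bool" where
  "tangent_bdry V \<longleftrightarrow> (\<forall>\<theta> z. V (cylpt 1 \<theta> z) \<bullet> e_r \<theta> = 0)"

text \<open>
  The pressure is only determined up to a function of time, so no regularity in time is imposed
  on it; joint smoothness of \<open>\<nabla>P\<close> follows from the equation.
\<close>

definition euler_solution ::
  "real \<Rightarrow> (real \<Rightarrow> real^3 \<Rightarrow> real^3) \<Rightarrow> (real \<Rightarrow> real^3 \<Rightarrow> real) \<Rightarrow> bool" where
  "euler_solution T U P \<longleftrightarrow>
     smooth_on (\<lambda>(t, x). U t x) ({0..<T} \<times> cyl) \<and>
     (\<forall>t\<in>{0..<T}.
        z_periodic (U t) \<and> tangent_bdry (U t) \<and>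
        smooth_on (P t) cyl \<and> z_periodic (P t) \<and>
        (\<forall>x\<in>cyl.
           vector_derivative (\<lambda>s. U s x) (at t within {0..<T}) + advect (U t) (U t) x
             = - grad (P t) x \<and>
           divergence (U t) x = 0 \<and>
           laplacian (P t) x = - trace_grad_sq (U t) x) \<and>
        (\<forall>\<theta> z. grad (P t) (cylpt 1 \<theta> z) \<bullet> e_r \<theta>
                 = - (advect (U t) (U t) (cylpt 1 \<theta> z) \<bullet> e_r \<theta>)))"

text \<open>
  On the axis \<open>r = 0\<close> the decomposition is required for every angle, which
  forces \<open>a = b = 0\<close> there.
\<close>

definition axisymmetric :: "real \<Rightarrow> (real \<Rightarrow> real^3 \<Rightarrow> real^3) \<Rightarrow>
    (real \<Rightarrow> real \<Rightarrow> real \<Rightarrow> real) \<Rightarrow> (real \<Rightarrow> real \<Rightarrow> real \<Rightarrow> real) \<Rightarrow> (real \<Rightarrow> real \<Rightarrow> real \<Rightarrow> real) \<Rightarrow> bool" where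
  "axisymmetric T U a b c \<longleftrightarrow>
     (\<forall>t\<in>{0..<T}. \<forall>r\<in>{0..1}. \<forall>\<theta> z.
        U t (cylpt r \<theta> z) = a t r z *\<^sub>R e_r \<theta> + b t r z *\<^sub>R e_theta \<theta> + c t r z *\<^sub>R e_z)"

definition odd_in_z :: "(real \<Rightarrow> real \<Rightarrow> real) \<Rightarrow> bool" where
  "odd_in_z f \<longleftrightarrow> (\<forall>r\<in>{0..1}. \<forall>z\<in>{-pi..pi}. f r (- z) = - f r z)"

definition is_flow ::
  "real \<Rightarrow> (real \<Rightarrow> real^3 \<Rightarrow> real^3) \<Rightarrow> (real \<Rightarrow> real^3 \<Rightarrow> real^3) \<Rightarrow> bool" where
  "is_flow T U \<eta> \<longleftrightarrow>
     (\<forall>x\<in>cyl. \<eta> 0 x = x \<and>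
        (\<forall>t\<in>{0..<T}. \<eta> t x \<in> cyl \<and>
           ((\<lambda>s. \<eta> s x) has_vector_derivative U t (\<eta> t x)) (at t within {0..<T})))"

subsection \<open>Volume-preserving diffeomorphisms and variations\<close>

text \<open>
  Lifts of diffeomorphisms of \<open>M\<close> preserving the volume form.  A diffeomorphism of \<open>M\<close> acts on
  the fundamental group, the integers, by \<open>k = 1\<close> or \<open>k = -1\<close>.
\<close>

definition Diff_mu :: "(real^3 \<Rightarrow> real^3) set" where
  "Diff_mu = {\<phi>. bij_betw \<phi> cyl cyl \<and> smooth_on \<phi> cyl \<and> smooth_on (inv_into cyl \<phi>) cyl \<and>
     (\<exists>k\<in>{1, -1}. \<forall>x\<in>cyl. \<phi> (x + (2 * pi) *\<^sub>R e_z) = \<phi> x + (2 * pi * k) *\<^sub>R e_z) \<and>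
     (\<forall>x\<in>cyl. det (matrix (frechet_derivative \<phi> (at x within cyl))) = 1)}"

text \<open>
  \<open>H \<sigma> t x\<close> is the family \<open>\<eta>\<^sub>\<sigma>(t, x)\<close>, defined for \<open>\<sigma>\<close> in \<open>{-\<epsilon><..<\<epsilon>}\<close>.
\<close>

definition is_variation :: "(real \<Rightarrow> real^3 \<Rightarrow> real^3) \<Rightarrow> real \<Rightarrow> real \<Rightarrow> real \<Rightarrow>
    (real \<Rightarrow> real \<Rightarrow> real^3 \<Rightarrow> real^3) \<Rightarrow> bool" where
  "is_variation \<eta> t1 t2 \<epsilon> H \<longleftrightarrow>
     0 < \<epsilon> \<and>
     smooth_on (\<lambda>(\<sigma>, t, x). H \<sigma> t x) ({-\<epsilon><..<\<epsilon>} \<times> {t1..t2} \<times> cyl) \<and>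
     (\<forall>\<sigma>\<in>{-\<epsilon><..<\<epsilon>}. \<forall>t\<in>{t1..t2}. H \<sigma> t \<in> Diff_mu) \<and>
     (\<forall>t\<in>{t1..t2}. \<forall>x\<in>cyl. H 0 t x = \<eta> t x) \<and>
     (\<forall>\<sigma>\<in>{-\<epsilon><..<\<epsilon>}. \<forall>x\<in>cyl. H \<sigma> t1 x = \<eta> t1 x \<and> H \<sigma> t2 x = \<eta> t2 x)"

definition supported_in :: "(real \<Rightarrow> real^3 \<Rightarrow> real^3) \<Rightarrow> real \<Rightarrow> real \<Rightarrow> real \<Rightarrow>
    (real \<Rightarrow> real \<Rightarrow> real^3 \<Rightarrow> real^3) \<Rightarrow> (real^3) set \<Rightarrow> bool" where
  "supported_in \<eta> t1 t2 \<epsilon> H N \<longleftrightarrow>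
     (\<forall>\<sigma>\<in>{-\<epsilon><..<\<epsilon>}. \<forall>t\<in>{t1..t2}. \<forall>x\<in>cyl - N. H \<sigma> t x = \<eta> t x)"

definition energy :: "real \<Rightarrow> real \<Rightarrow> (real \<Rightarrow> real^3 \<Rightarrow> real^3) \<Rightarrow> real" where
  "energy t1 t2 \<gamma> = 1/2 * set_lebesgue_integral lebesgue {t1..t2}
     (\<lambda>t. integral_M (\<lambda>x. (norm (vector_derivative (\<lambda>s. \<gamma> s x) (at t within {t1..t2})))\<^sup>2))"

definition curve_shortening :: "real \<Rightarrow> real \<Rightarrow> (real \<Rightarrow> real \<Rightarrow> real^3 \<Rightarrow> real^3) \<Rightarrow> bool" where
  "curve_shortening t1 t2 H \<longleftrightarrow> deriv (deriv (\<lambda>\<sigma>. energy t1 t2 (H \<sigma>))) 0 < 0"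

text \<open>Preimages in \<open>cyl\<close> of the open neighbourhoods of \<open>{r = r0, z = 0}\<close> in \<open>M\<close>.\<close>

definition nbhd_circle :: "real \<Rightarrow> (real^3) set \<Rightarrow> bool" where
  "nbhd_circle r0 N \<longleftrightarrow>
     openin (top_of_set cyl) N \<and> (\<forall>x. x + (2 * pi) *\<^sub>R e_z \<in> N \<longleftrightarrow> x \<in> N) \<and>
     (\<forall>\<theta>. cylpt r0 \<theta> 0 \<in> N)"

subsection \<open>Sectional curvature\<close>

definition T_id_Diff_mu :: "(real^3 \<Rightarrow> real^3) set" where
  "T_id_Diff_mu = {V. smooth_on V cyl \<and> z_periodic V \<and> tangent_bdry V \<and>
     (\<forall>x\<in>cyl. divergence V x = 0)}"

definition L2_inner :: "(real^3 \<Rightarrow> real^3) \<Rightarrow> (real^3 \<Rightarrow> real^3) \<Rightarrow> real" where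
  "L2_inner U V = integral_M (\<lambda>x. U x \<bullet> V x)"

definition lin_indep :: "(real^3 \<Rightarrow> real^3) \<Rightarrow> (real^3 \<Rightarrow> real^3) \<Rightarrow> bool" where
  "lin_indep U V \<longleftrightarrow>
     (\<forall>\<alpha> \<beta>. (\<forall>x\<in>cyl. \<alpha> *\<^sub>R U x + \<beta> *\<^sub>R V x = 0) \<longrightarrow> \<alpha> = 0 \<and> \<beta> = 0)"

text \<open>
  A solution of the Neumann problem; any two differ by a constant, so its gradient is
  well defined.
\<close>

definition curv_potential :: "(real^3 \<Rightarrow> real^3) \<Rightarrow> (real^3 \<Rightarrow> real^3) \<Rightarrow> real^3 \<Rightarrow> real" where
  "curv_potential U V = (SOME Q. smooth_on Q cyl \<and> z_periodic Q \<and>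
     (\<forall>x\<in>cyl. laplacian Q x = - divergence (advect U V) x) \<and>
     (\<forall>\<theta> z. (grad Q (cylpt 1 \<theta> z) + advect U V (cylpt 1 \<theta> z)) \<bullet> e_r \<theta> = 0))"

text \<open>Here \<open>P\<close> is the pressure of \<open>U\<close>.\<close>

definition sectional_curvature ::
  "(real^3 \<Rightarrow> real) \<Rightarrow> (real^3 \<Rightarrow> real^3) \<Rightarrow> (real^3 \<Rightarrow> real^3) \<Rightarrow> real" where
  "sectional_curvature P U V =
     (integral_M (\<lambda>x. hessian P x (V x) (V x))
        - integral_M (\<lambda>x. (norm (grad (curv_potential U V) x))\<^sup>2))
     / (L2_inner U U * L2_inner V V - (L2_inner U V)\<^sup>2)"

text \<open>
  The Lebesgue integral over \<open>{0..<T}\<close> of an extended real function, as the integral of the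
  positive part minus that of the negative part (\<open>e2ennreal\<close> sends negative numbers to 0).
  Since \<open>\<infinity> - \<infinity> = \<infinity>\<close> in \<open>ereal\<close>, the value \<open>-\<infinity>\<close> means that the positive part has a finite
  integral and the negative part an infinite one.
\<close>

definition time_integral :: "real \<Rightarrow> (real \<Rightarrow> ereal) \<Rightarrow> ereal" where
  "time_integral T f =
     enn2ereal (\<integral>\<^sup>+t\<in>{0..<T}. e2ennreal (f t) \<partial>lborel)
     - enn2ereal (\<integral>\<^sup>+t\<in>{0..<T}. e2ennreal (- f t) \<partial>lborel)"

end

theory Submission
  imports Defs
begin

text \<open>
  The rotation by \<open>pi\<close> about the \<open>x\<close>-axis preserves the initial velocity, hence by uniqueness the
  solution, so \<open>b\<close> and \<open>c\<close> stay odd in \<open>z\<close>.  The vorticity therefore vanishes at the origin, which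
  excludes \<open>r0 = 0\<close>, and the circle \<open>r = 1\<close>, \<open>z = 0\<close> consists of stagnation points.  With
  \<open>s = \<partial>\<^sub>z c\<close> and \<open>\<nu> = \<partial>\<^sub>z b\<close> there, the equation and the symmetry of the Hessian of \<open>P\<close> give
  \<open>\<nu>' = - s \<nu>\<close>, \<open>P\<^sub>r\<^sub>r = s' - s\<^sup>2\<close>, \<open>P\<^sub>z\<^sub>z = - (s' + s\<^sup>2)\<close> and \<open>\<Delta>P = - 2 s\<^sup>2\<close>, all other entries of
  the Hessian vanishing.  The vorticity is \<open>|\<nu>|\<close>, and \<open>\<integral>|\<nu>| = \<infinity>\<close> forces \<open>\<integral>s\<^sup>2 = \<infinity>\<close>, which
  settles the pressure Laplacian.  For the curvature, divergence-free fields concentrated at the circle and oscillating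
  rapidly see only the trace \<open>- 2 s\<^sup>2\<close>, and the energy of \<open>U\<close> is conserved.  For the
  variations, \<open>w = - s\<close> and \<open>w = s\<close> solve the Riccati equations \<open>w' + w\<^sup>2 = - P\<^sub>r\<^sub>r\<close> and
  \<open>w' + w\<^sup>2 = - P\<^sub>z\<^sub>z\<close>, so the index form at the circle is nonnegative, with room to perturb.
\<close>

section \<open>Calculus on convex sets with interior\<close>

text \<open>The critical circle lies on the wall \<open>r = 1\<close>, where every derivative is
  one-sided, and \<open>P\<close> is known only up to a function of time. So the calculus is set up
  relative to convex sets with interior, the Hessian of \<open>P\<close> is read off from the
  momentum equation, and the divergence theorem comes from translation invariance of Lebesgue
  measure and a cutoff at the wall. It yields both the uniqueness behind the symmetry and the
  conservation of energy. For the curvature an upper bound suffices: the potential term enters with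
  a minus sign, and the Gram determinant is at most the product of the squared norms. Independence
  of the test field from \<open>U\<close> comes from its missing swirl, because
  \<open>\<nu>\<close>, a solution of a linear equation, cannot vanish once its integral diverges.
  For the variations the energies of \<open>H \<sigma>\<close> and of the geodesic are compared
  directly for all small \<open>\<sigma>\<close>; a local minimum has no negative second derivative.
  The room in the Riccati inequality is an exponentially small number depending on the length of the
  time interval and on the maximum of \<open>|s|\<close>, which is why the neighbourhood depends on
  the interval.\<close>

definition solid :: "'a::real_normed_vector set \<Rightarrow> bool" where
  "solid S \<longleftrightarrow> convex S \<and> interior S \<noteq> {}"

abbreviation dird :: "'a::real_normed_vector set \<Rightarrow> ('a \<Rightarrow> 'b::real_normed_vector) \<Rightarrow> 'a \<Rightarrow> 'a \<Rightarrow> 'b" where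
  "dird S f v \<equiv> (\<lambda>x. frechet_derivative f (at x within S) v)"

lemma has_vector_derivative_along_segment:
  assumes S: "convex S" "x \<in> S" "y \<in> S"
    and f: "(f has_derivative D) (at (x + s *\<^sub>R (y - x)) within S)" and s: "s \<in> {0..1}"
  shows "((\<lambda>s. f (x + s *\<^sub>R (y - x))) has_vector_derivative D (y - x)) (at s within {0..1})"
proof -
  have sub: "(\<lambda>s. x + s *\<^sub>R (y - x)) ` {0..1} \<subseteq> S"
  proof safe
    fix s :: real assume "s \<in> {0..1}"
    then have "(1 - s) *\<^sub>R x + s *\<^sub>R y \<in> S" using S by (auto simp: convex_def)
    moreover have "(1 - s) *\<^sub>R x + s *\<^sub>R y = x + s *\<^sub>R (y - x)" by (simp add: algebra_simps)
    ultimately show "x + s *\<^sub>R (y - x) \<in> S" by simp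
  qed
  have g: "((\<lambda>s. x + s *\<^sub>R (y - x)) has_derivative (\<lambda>h. h *\<^sub>R (y - x))) (at s within {0..1})"
    by (auto intro!: derivative_eq_intros)
  have "((\<lambda>s. f (x + s *\<^sub>R (y - x))) has_derivative (\<lambda>h. D (h *\<^sub>R (y - x)))) (at s within {0..1})"
    using diff_chain_within[OF g has_derivative_subset[OF f sub]] by (simp add: o_def)
  moreover have "linear D" using f has_derivative_linear by blast
  ultimately show ?thesis
    unfolding has_vector_derivative_def by (simp add: linear_cmul)
qed

text \<open>The point may lie on the boundary. Two derivatives agree on \<open>y - x\<close> for
  every \<open>y\<close> in \<open>S\<close>, by uniqueness of one-sided derivatives along segments.
  As \<open>S\<close> contains a ball, every vector is a multiple of a difference of two such
  directions, and linearity does the rest.\<close>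

lemma has_derivative_within_solid_unique:
  fixes f :: "'a::real_normed_vector \<Rightarrow> 'b::real_normed_vector"
  assumes S: "solid S" "x \<in> S"
    and D1: "(f has_derivative D1) (at x within S)" and D2: "(f has_derivative D2) (at x within S)"
  shows "D1 = D2"
proof -
  have lin: "linear D1" "linear D2" using D1 D2 has_derivative_linear by blast+
  have eq: "D1 (y - x) = D2 (y - x)" if y: "y \<in> S" for y
  proof -
    have "((\<lambda>s. f (x + s *\<^sub>R (y - x))) has_vector_derivative D (y - x)) (at 0 within {0..1})"
      if "(f has_derivative D) (at x within S)" for D
      using has_vector_derivative_along_segment[of S x y f D 0] that S y by (simp add: solid_def)
    then show ?thesis
      using vector_derivative_unique_within_closed_interval[of 0 1 0] D1 D2
      by (metis atLeastAtMost_iff cbox_interval order_refl zero_less_one zero_less_one_class.zero_le_one)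
  qed
  obtain y e where e: "0 < e" "ball y e \<subseteq> S"
    using S by (auto simp: solid_def mem_interior)
  show ?thesis
  proof
    fix v :: 'a
    \<comment> \<open>Small enough for \<open>y + s *\<^sub>R v\<close> to stay in the ball; the
      \<open>+ 1\<close> covers \<open>v = 0\<close>.\<close>
    define s where "s = e / (2 * (norm v + 1))"
    have s: "0 < s" unfolding s_def using e by (simp add: add_nonneg_pos)
    have "norm (s *\<^sub>R v) < e"
    proof -
      have "norm (s *\<^sub>R v) = e * norm v / (2 * (norm v + 1))" using e by (simp add: s_def)
      also have "\<dots> < e"
      proof -
        have "0 < 2 * (norm v + 1)" by (simp add: add_nonneg_pos)
        moreover have "e * norm v < e * (2 * (norm v + 1))"
          using e by (intro mult_strict_left_mono) (auto simp: add_nonneg_pos)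
        ultimately show ?thesis by (simp add: pos_divide_less_eq)
      qed
      finally show ?thesis .
    qed
    then have "y + s *\<^sub>R v \<in> S" "y \<in> S" using e by (auto simp: dist_norm intro!: subsetD[OF e(2)])
    then have "D1 (s *\<^sub>R v + (y - x)) = D2 (s *\<^sub>R v + (y - x))" "D1 (y - x) = D2 (y - x)"
      using eq[of "y + s *\<^sub>R v"] eq[of y] by (simp_all add: algebra_simps)
    then have "s *\<^sub>R D1 v = s *\<^sub>R D2 v"
      using lin by (simp add: linear_add linear_cmul)
    then show "D1 v = D2 v" using s by simp
  qed
qed

lemma frechet_derivative_solid:
  assumes "solid S" "x \<in> S" "(f has_derivative D) (at x within S)"
  shows "frechet_derivative f (at x within S) = D"
  using assms has_derivative_within_solid_unique differentiableI frechet_derivative_works by blast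

lemma smooth_on_has_derivative:
  assumes "smooth_on f S" "x \<in> S"
  shows "(f has_derivative frechet_derivative f (at x within S)) (at x within S)"
proof -
  have "Ck_on (Suc 0) f S" using assms unfolding smooth_on_def by blast
  then show ?thesis using assms(2) by (simp add: differentiable_on_def frechet_derivative_works)
qed

lemma smooth_on_dird: "smooth_on f S \<Longrightarrow> smooth_on (dird S f v) S"
  unfolding smooth_on_def by (metis Ck_on.simps(2))

lemma smooth_on_continuous: "smooth_on f S \<Longrightarrow> continuous_on S f"
  unfolding smooth_on_def by (metis Ck_on.simps(1))

lemma smooth_on_dird_continuous:
  assumes "smooth_on f S"
  shows "continuous_on S (dird S f v)"
proof -
  have "smooth_on (dird S f v) S" using assms by (rule smooth_on_dird)
  then show ?thesis by (rule smooth_on_continuous)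
qed

lemma smooth_on_linear:
  assumes "smooth_on f S" "x \<in> S"
  shows "linear (frechet_derivative f (at x within S))"
  using smooth_on_has_derivative[OF assms] by (rule has_derivative_linear)

text \<open>The mean value theorem is used twice: along \<open>v\<close> for the increment of
  \<open>f\<close> across \<open>w\<close>, then along \<open>w\<close> for the derivative of
  \<open>f\<close> in direction \<open>v\<close>.\<close>

lemma second_difference_mean_value:
  fixes f :: "'a::real_normed_vector \<Rightarrow> real"
  assumes h: "0 < h" and S: "\<And>s t. \<lbrakk>s \<in> {0..h}; t \<in> {0..h}\<rbrakk> \<Longrightarrow> x + s *\<^sub>R v + t *\<^sub>R w \<in> S"
    and f: "\<And>y. y \<in> S \<Longrightarrow> (f has_derivative f' y) (at y)"
    and f2: "\<And>y. y \<in> S \<Longrightarrow> ((\<lambda>z. f' z v) has_derivative f'' y) (at y)"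
  shows "\<exists>s t. s \<in> {0..h} \<and> t \<in> {0..h} \<and>
    f (x + h *\<^sub>R v + h *\<^sub>R w) - f (x + h *\<^sub>R v) - f (x + h *\<^sub>R w) + f x
     = h * h * f'' (x + s *\<^sub>R v + t *\<^sub>R w) w"
proof -
  have der: "((\<lambda>s. f (x + s *\<^sub>R v + t *\<^sub>R w)) has_real_derivative f' (x + s *\<^sub>R v + t *\<^sub>R w) v) (at s)"
    if "s \<in> {0..h}" "t \<in> {0..h}" for s t
  proof -
    have g: "((\<lambda>s. x + s *\<^sub>R v + t *\<^sub>R w) has_derivative (\<lambda>k. k *\<^sub>R v)) (at s)"
      by (auto intro!: derivative_eq_intros)
    have D: "(f has_derivative f' (x + s *\<^sub>R v + t *\<^sub>R w)) (at (x + s *\<^sub>R v + t *\<^sub>R w))"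
      by (intro f S that)
    have "((\<lambda>s. f (x + s *\<^sub>R v + t *\<^sub>R w)) has_derivative (\<lambda>k. f' (x + s *\<^sub>R v + t *\<^sub>R w) (k *\<^sub>R v))) (at s)"
      using diff_chain_at[OF g D] by (simp add: o_def)
    moreover have "(\<lambda>k. f' (x + s *\<^sub>R v + t *\<^sub>R w) (k *\<^sub>R v)) = (*) (f' (x + s *\<^sub>R v + t *\<^sub>R w) v)"
      using has_derivative_linear[OF D] by (auto simp: linear_cmul mult.commute)
    ultimately show ?thesis by (simp add: has_field_derivative_def)
  qed
  define \<phi> where "\<phi> s = f (x + s *\<^sub>R v + h *\<^sub>R w) - f (x + s *\<^sub>R v + 0 *\<^sub>R w)" for s
  have d\<phi>: "(\<phi> has_real_derivative f' (x + s *\<^sub>R v + h *\<^sub>R w) v - f' (x + s *\<^sub>R v + 0 *\<^sub>R w) v) (at s)"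
    if "0 \<le> s" "s \<le> h" for s
    unfolding \<phi>_def by (intro DERIV_diff der) (use that h in auto)
  obtain s where s: "0 < s" "s < h"
    "\<phi> h - \<phi> 0 = (h - 0) * (f' (x + s *\<^sub>R v + h *\<^sub>R w) v - f' (x + s *\<^sub>R v + 0 *\<^sub>R w) v)"
    using MVT2[OF h d\<phi>] by blast
  have der2: "((\<lambda>t. f' (x + s *\<^sub>R v + t *\<^sub>R w) v) has_real_derivative f'' (x + s *\<^sub>R v + t *\<^sub>R w) w) (at t)"
    if "0 \<le> t" "t \<le> h" for t
  proof -
    have g: "((\<lambda>t. x + s *\<^sub>R v + t *\<^sub>R w) has_derivative (\<lambda>k. k *\<^sub>R w)) (at t)"
      by (auto intro!: derivative_eq_intros)
    have D: "((\<lambda>z. f' z v) has_derivative f'' (x + s *\<^sub>R v + t *\<^sub>R w)) (at (x + s *\<^sub>R v + t *\<^sub>R w))"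
      by (intro f2 S) (use that s in auto)
    have "((\<lambda>t. f' (x + s *\<^sub>R v + t *\<^sub>R w) v) has_derivative (\<lambda>k. f'' (x + s *\<^sub>R v + t *\<^sub>R w) (k *\<^sub>R w))) (at t)"
      using diff_chain_at[OF g D] by (simp add: o_def)
    moreover have "(\<lambda>k. f'' (x + s *\<^sub>R v + t *\<^sub>R w) (k *\<^sub>R w)) = (*) (f'' (x + s *\<^sub>R v + t *\<^sub>R w) w)"
      using has_derivative_linear[OF D] by (auto simp: linear_cmul mult.commute)
    ultimately show ?thesis by (simp add: has_field_derivative_def)
  qed
  obtain t where t: "0 < t" "t < h"
    "f' (x + s *\<^sub>R v + h *\<^sub>R w) v - f' (x + s *\<^sub>R v + 0 *\<^sub>R w) v = (h - 0) * f'' (x + s *\<^sub>R v + t *\<^sub>R w) w"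
    using MVT2[OF h der2] by blast
  show ?thesis
    by (rule exI[of _ s], rule exI[of _ t]) (use s t in \<open>simp add: \<phi>_def algebra_simps\<close>)
qed

text \<open>The second difference is symmetric in \<open>v\<close> and \<open>w\<close>, so it
  equals \<open>h * h\<close> times either mixed derivative at some nearby point. If the two
  differed at \<open>x\<close>, continuity would keep them apart by less than half the gap each on a
  small parallelogram, a contradiction.\<close>

lemma mixed_partials_interior:
  fixes f :: "'a::real_normed_vector \<Rightarrow> real"
  assumes S: "open S" "x \<in> S"
    and f: "\<And>y. y \<in> S \<Longrightarrow> (f has_derivative f' y) (at y)"
    and v: "\<And>y. y \<in> S \<Longrightarrow> ((\<lambda>z. f' z v) has_derivative fv y) (at y)"
    and w: "\<And>y. y \<in> S \<Longrightarrow> ((\<lambda>z. f' z w) has_derivative fw y) (at y)"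
    and cv: "continuous_on S (\<lambda>y. fv y w)" and cw: "continuous_on S (\<lambda>y. fw y v)"
  shows "fv x w = fw x v"
proof (rule ccontr)
  assume "fv x w \<noteq> fw x v"
  define e where "e = \<bar>fv x w - fw x v\<bar> / 2"
  have e: "0 < e" using \<open>fv x w \<noteq> fw x v\<close> by (simp add: e_def)
  obtain d1 where d1: "0 < d1" "\<And>y. \<lbrakk>y \<in> S; dist y x < d1\<rbrakk> \<Longrightarrow> dist (fv y w) (fv x w) < e"
    using cv S e by (metis continuous_on_iff)
  obtain d2 where d2: "0 < d2" "\<And>y. \<lbrakk>y \<in> S; dist y x < d2\<rbrakk> \<Longrightarrow> dist (fw y v) (fw x v) < e"
    using cw S e by (metis continuous_on_iff)
  obtain d3 where d3: "0 < d3" "ball x d3 \<subseteq> S" using S openE by blast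
  define d where "d = min d1 (min d2 d3)"
  have d: "0 < d" using d1 d2 d3 by (simp add: d_def)
  define h where "h = d / (2 * (norm v + norm w + 1))"
  have pos: "0 < 2 * (norm v + norm w + 1)" by (simp add: add_nonneg_pos)
  have h: "0 < h" unfolding h_def using d pos by simp
  have hb: "h * (norm v + norm w) < d"
  proof -
    have "h * (norm v + norm w) = d * (norm v + norm w) / (2 * (norm v + norm w + 1))" by (simp add: h_def)
    also have "\<dots> < d"
    proof -
      have "d * (norm v + norm w) < d * (2 * (norm v + norm w + 1))"
        using d by (intro mult_strict_left_mono) (auto simp: add_nonneg_pos)
      then show ?thesis using pos by (simp add: pos_divide_less_eq)
    qed
    finally show ?thesis .
  qed
  have near: "dist (x + s *\<^sub>R v + t *\<^sub>R w) x < d" if "s \<in> {0..h}" "t \<in> {0..h}" for s t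
  proof -
    have "dist (x + s *\<^sub>R v + t *\<^sub>R w) x = norm (s *\<^sub>R v + t *\<^sub>R w)" by (simp add: dist_norm add.assoc)
    also have "\<dots> \<le> norm (s *\<^sub>R v) + norm (t *\<^sub>R w)" by (rule norm_triangle_ineq)
    also have "\<dots> \<le> h * norm v + h * norm w"
      using that by (auto intro!: add_mono mult_right_mono)
    also have "\<dots> < d" using hb by (simp add: algebra_simps)
    finally show ?thesis .
  qed
  have inS: "x + s *\<^sub>R v + t *\<^sub>R w \<in> S" if "s \<in> {0..h}" "t \<in> {0..h}" for s t
    using near[OF that] d3 by (auto simp: d_def dist_commute intro!: subsetD[OF d3(2)])
  obtain s1 t1 where 1: "s1 \<in> {0..h}" "t1 \<in> {0..h}"
    "f (x + h *\<^sub>R v + h *\<^sub>R w) - f (x + h *\<^sub>R v) - f (x + h *\<^sub>R w) + f x = h * h * fv (x + s1 *\<^sub>R v + t1 *\<^sub>R w) w"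
    using second_difference_mean_value[of h x v w S f f' fv, OF h inS f v] by blast
  have inS': "x + s *\<^sub>R w + t *\<^sub>R v \<in> S" if "s \<in> {0..h}" "t \<in> {0..h}" for s t
    using inS[OF that(2,1)] by (simp add: algebra_simps)
  obtain s2 t2 where 2: "s2 \<in> {0..h}" "t2 \<in> {0..h}"
    "f (x + h *\<^sub>R w + h *\<^sub>R v) - f (x + h *\<^sub>R w) - f (x + h *\<^sub>R v) + f x = h * h * fw (x + s2 *\<^sub>R w + t2 *\<^sub>R v) v"
    using second_difference_mean_value[of h x w v S f f' fw, OF h inS' f w] by blast
  have "x + h *\<^sub>R w + h *\<^sub>R v = x + h *\<^sub>R v + h *\<^sub>R w" by (simp add: algebra_simps)
  then have "h * h * fv (x + s1 *\<^sub>R v + t1 *\<^sub>R w) w = h * h * fw (x + s2 *\<^sub>R w + t2 *\<^sub>R v) v"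
    using 1(3) 2(3) by (simp add: algebra_simps)
  then have eq: "fv (x + s1 *\<^sub>R v + t1 *\<^sub>R w) w = fw (x + s2 *\<^sub>R w + t2 *\<^sub>R v) v" using h by simp
  have "dist (fv (x + s1 *\<^sub>R v + t1 *\<^sub>R w) w) (fv x w) < e"
    by (rule d1(2)) (use inS[OF 1(1,2)] near[OF 1(1,2)] in \<open>auto simp: d_def\<close>)
  moreover have "dist (fw (x + s2 *\<^sub>R w + t2 *\<^sub>R v) v) (fw x v) < e"
    by (rule d2(2)) (use inS'[OF 2(1,2)] near[OF 2(2,1)] in \<open>auto simp: d_def algebra_simps\<close>)
  ultimately show False using eq by (auto simp: e_def dist_real_def field_simps abs_if split: if_splits)
qed

text \<open>Inner products with fixed vectors reduce the interior case to real functions. The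
  identity reaches the boundary by continuity, a convex set with interior points being contained in
  the closure of its interior.\<close>

lemma mixed_partials:
  fixes f :: "'a::euclidean_space \<Rightarrow> 'b::real_inner"
  assumes S: "solid S" "x \<in> S" and f: "smooth_on f S"
  shows "dird S (dird S f v) w x = dird S (dird S f w) v x"
proof -
  have int: "dird S (dird S f v) w y = dird S (dird S f w) v y" if y: "y \<in> interior S" for y
  proof -
    have der: "(g has_derivative frechet_derivative g (at z within S)) (at z)"
      if "smooth_on g S" "z \<in> interior S" for g :: "'a \<Rightarrow> 'b" and z
      using smooth_on_has_derivative[OF that(1)] that(2) interior_subset at_within_interior by (metis subsetD)
    have cont: "continuous_on (interior S) (dird S (dird S f a) b)" for a b
      using smooth_on_dird_continuous[OF smooth_on_dird[OF f]] continuous_on_subset interior_subset by blast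
    have "dird S (dird S f v) w y \<bullet> b = dird S (dird S f w) v y \<bullet> b" for b
      by (rule mixed_partials_interior[of "interior S" y "\<lambda>z. f z \<bullet> b" "\<lambda>z h. dird S f h z \<bullet> b" v
            "\<lambda>z h. dird S (dird S f v) h z \<bullet> b" w "\<lambda>z h. dird S (dird S f w) h z \<bullet> b"])
        (use y in \<open>auto intro!: has_derivative_inner_left der f smooth_on_dird continuous_on_inner cont continuous_on_const\<close>)
    then show ?thesis by (metis inner_commute vector_eq_rdot)
  qed
  have cl: "x \<in> closure (interior S)"
    using convex_closure_interior[of S] closure_subset[of S] S by (auto simp: solid_def)
  have c: "continuous_on S (\<lambda>x. dird S (dird S f v) w x - dird S (dird S f w) v x)"
    by (intro continuous_on_diff smooth_on_dird_continuous smooth_on_dird f)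
  obtain X where X: "\<And>n. X n \<in> interior S" "X \<longlonglongrightarrow> x"
    using cl by (auto simp: closure_sequential)
  have "\<forall>\<^sub>F n in sequentially. X n \<in> S"
    using X(1) interior_subset[of S] by (auto intro: always_eventually)
  then have "(\<lambda>n. dird S (dird S f v) w (X n) - dird S (dird S f w) v (X n)) \<longlonglongrightarrow>
      dird S (dird S f v) w x - dird S (dird S f w) v x"
    by (rule continuous_on_tendsto_compose[OF c X(2) S(2)])
  then have "(\<lambda>n. 0::'b) \<longlonglongrightarrow> dird S (dird S f v) w x - dird S (dird S f w) v x"
    using int X(1) by simp
  then show ?thesis by (metis LIMSEQ_const_iff eq_iff_diff_eq_0)
qed

lemma has_derivative_slice_right:
  assumes "(F has_derivative D) (at (a, b) within A \<times> B)" "a \<in> A"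
  shows "((\<lambda>b. F (a, b)) has_derivative (\<lambda>v. D (0, v))) (at b within B)"
proof -
  have g: "((\<lambda>b. (a, b)) has_derivative (\<lambda>v. (0, v))) (at b within B)"
    by (auto intro!: derivative_eq_intros)
  have "(\<lambda>b. (a, b)) ` B \<subseteq> A \<times> B" using assms by auto
  from diff_chain_within[OF g has_derivative_subset[OF assms(1) this]] show ?thesis by (simp add: o_def)
qed

lemma has_derivative_slice_left:
  assumes "(F has_derivative D) (at (a, b) within A \<times> B)" "b \<in> B"
  shows "((\<lambda>a. F (a, b)) has_derivative (\<lambda>v. D (v, 0))) (at a within A)"
proof -
  have g: "((\<lambda>a. (a, b)) has_derivative (\<lambda>v. (v, 0))) (at a within A)"
    by (auto intro!: derivative_eq_intros)
  have "(\<lambda>a. (a, b)) ` A \<subseteq> A \<times> B" using assms by auto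
  from diff_chain_within[OF g has_derivative_subset[OF assms(1) this]] show ?thesis by (simp add: o_def)
qed

lemma has_vector_derivative_slice_left:
  assumes "(F has_derivative D) (at (a::real, b) within A \<times> B)" "b \<in> B"
  shows "((\<lambda>a. F (a, b)) has_vector_derivative D (1, 0)) (at a within A)"
proof -
  have "(\<lambda>v. D (v, 0)) = (\<lambda>v. v *\<^sub>R D (1, 0))"
  proof
    fix v :: real
    show "D (v, 0) = v *\<^sub>R D (1, 0)"
      using linear_cmul[OF has_derivative_linear[OF assms(1)], of v "(1, 0)"] by simp
  qed
  then show ?thesis using has_derivative_slice_left[OF assms] unfolding has_vector_derivative_def by metis
qed

lemma solid_Times: "solid A \<Longrightarrow> solid B \<Longrightarrow> solid (A \<times> B)"
  by (auto simp: solid_def convex_Times interior_Times)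

lemma solid_real_interval: "a < b \<Longrightarrow> solid {a..b}" "a < b \<Longrightarrow> solid {a..<b}" "a < b \<Longrightarrow> solid {a<..<b}"
  for a :: real
  by (auto simp: solid_def interior_atLeastAtMost_real)

section \<open>Geometry of the solid torus\<close>

lemma e_z_nth [simp]: "e_z $ 1 = 0" "e_z $ 2 = 0" "e_z $ 3 = 1"
  by (simp_all add: e_z_def)

lemma cylpt_nth [simp]: "cylpt r \<theta> z $ 1 = r * cos \<theta>" "cylpt r \<theta> z $ 2 = r * sin \<theta>" "cylpt r \<theta> z $ 3 = z"
  by (simp_all add: cylpt_def)

lemma e_r_nth [simp]: "e_r \<theta> $ 1 = cos \<theta>" "e_r \<theta> $ 2 = sin \<theta>" "e_r \<theta> $ 3 = 0"
  by (simp_all add: e_r_def)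

lemma e_theta_nth [simp]: "e_theta \<theta> $ 1 = - sin \<theta>" "e_theta \<theta> $ 2 = cos \<theta>" "e_theta \<theta> $ 3 = 0"
  by (simp_all add: e_theta_def)

lemma inner_3: "(x::real^3) \<bullet> y = x$1 * y$1 + x$2 * y$2 + x$3 * y$3"
  by (simp add: inner_vec_def sum_3)

lemma norm_3_sq: "(norm (x::real^3))\<^sup>2 = (x$1)\<^sup>2 + (x$2)\<^sup>2 + (x$3)\<^sup>2"
  unfolding power2_norm_eq_inner inner_3 by (simp add: power2_eq_square)

lemma vec3_expand: "(v::real^3) = (\<Sum>i\<in>UNIV. v$i *\<^sub>R axis i 1)"
  using basis_expansion[of v] by (simp add: scalar_mult_eq_scaleR)

lemma axis_nth_3 [simp]:
  "axis 1 a $ (2::3) = (0::real)" "axis 1 a $ (3::3) = (0::real)"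
  "axis 2 a $ (1::3) = (0::real)" "axis 2 a $ (3::3) = (0::real)"
  "axis 3 a $ (1::3) = (0::real)" "axis 3 a $ (2::3) = (0::real)"
  by (simp_all add: axis_def)

lemma e_z_axis: "e_z = axis 3 1"
  by (simp add: vec_eq_iff forall_3)

definition rsq :: "real^3 \<Rightarrow> real" where
  "rsq x = (x$1)\<^sup>2 + (x$2)\<^sup>2"

lemma rsq_nonneg [simp]: "0 \<le> rsq x"
  by (simp add: rsq_def)

lemma cyl_iff: "x \<in> cyl \<longleftrightarrow> rsq x \<le> 1"
  by (simp add: cyl_def rsq_def)

lemma rsq_cylpt [simp]: "rsq (cylpt r \<theta> z) = r\<^sup>2"
  by (simp add: rsq_def power_mult_distrib sin_cos_squared_add2 flip: distrib_left)

lemma cylpt_in_cyl: "r \<in> {0..1} \<Longrightarrow> cylpt r \<theta> z \<in> cyl"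
  by (simp add: cyl_iff power_le_one)

lemma cyl_cylpt:
  assumes "x \<in> cyl"
  obtains r \<theta> where "r \<in> {0..1}" "x = cylpt r \<theta> (x$3)"
proof -
  have r: "sqrt (rsq x) \<in> {0..1}" using assms by (auto simp: cyl_iff)
  obtain \<theta> where "x$1 = sqrt (rsq x) * cos \<theta>" "x$2 = sqrt (rsq x) * sin \<theta>"
  proof (cases "rsq x = 0")
    case True
    then have "x$1 = 0" "x$2 = 0" by (simp_all add: rsq_def sum_power2_eq_zero_iff)
    then show ?thesis using that True by simp
  next
    case False
    then have p: "0 < sqrt (rsq x)" using rsq_nonneg[of x] by (simp del: rsq_nonneg)
    have "(x$1 / sqrt (rsq x))\<^sup>2 + (x$2 / sqrt (rsq x))\<^sup>2 = 1"
      using False by (simp add: power_divide rsq_def flip: add_divide_distrib)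
    then obtain \<theta> where "x$1 / sqrt (rsq x) = cos \<theta>" "x$2 / sqrt (rsq x) = sin \<theta>"
      using sincos_total_2pi by metis
    then show ?thesis using that[of \<theta>] p by (simp add: field_simps)
  qed
  then have "x = cylpt (sqrt (rsq x)) \<theta> (x$3)" by (simp add: vec_eq_iff forall_3)
  then show ?thesis using that r by blast
qed

lemma continuous_on_rsq [continuous_intros]: "continuous_on S rsq"
  unfolding rsq_def by (intro continuous_intros)

lemma closed_cyl: "closed cyl"
proof -
  have "closed {x. rsq x \<le> 1}" by (intro closed_Collect_le continuous_intros)
  moreover have "cyl = {x. rsq x \<le> 1}" by (auto simp: cyl_iff)
  ultimately show ?thesis by metis
qed

lemma convex_cyl: "convex cyl"
proof -
  have "linear (\<lambda>x::real^3. (x$1, x$2))"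
    by (rule linearI) auto
  then have "convex ((\<lambda>x::real^3. (x$1, x$2)) -` cball 0 1)"
    by (rule convex_linear_vimage) simp
  moreover have "(\<lambda>x::real^3. (x$1, x$2)) -` cball 0 1 = cyl"
    by (auto simp: cyl_def norm_Pair)
  ultimately show ?thesis by simp
qed

lemma open_rsq_less: "open {x. rsq x < 1}"
  by (intro open_Collect_less continuous_intros)

lemma interior_cyl_supset: "{x. rsq x < 1} \<subseteq> interior cyl"
  by (rule interior_maximal[OF _ open_rsq_less]) (auto simp: cyl_iff)

lemma solid_cyl: "solid cyl"
proof -
  have "rsq 0 < 1" by (simp add: rsq_def)
  then show ?thesis using interior_cyl_supset by (auto simp: solid_def convex_cyl)
qed

text \<open>The wall is part of the frontier of a convex set, and such frontiers are
  negligible.\<close>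

lemma AE_rsq_neq_1: "AE x in lborel. rsq x \<noteq> 1"
proof -
  have sub: "{x. rsq x = 1} \<subseteq> frontier cyl"
  proof
    fix x :: "real^3" assume "x \<in> {x. rsq x = 1}"
    then have x: "rsq x = 1" by simp
    have "x \<notin> interior cyl"
    proof
      assume "x \<in> interior cyl"
      then obtain e where e: "0 < e" "ball x e \<subseteq> cyl" by (auto simp: mem_interior)
      \<comment> \<open>A point pushed radially outwards leaves the cylinder, so wall points are not
        interior.\<close>
      define y where "y = x + (e / 2) *\<^sub>R (\<chi> i. if i = 3 then 0 else x$i)"
      have n: "norm (\<chi> i::3. if i = 3 then 0 else x$i) = 1"
        using x by (simp add: norm_eq_sqrt_inner inner_3 rsq_def power2_eq_square)
      have "dist x y < e" using e n by (simp add: y_def dist_norm)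
      then have "y \<in> cyl" using e by auto
      moreover have "rsq y = (1 + e/2)\<^sup>2 * rsq x"
        by (simp add: rsq_def y_def power2_eq_square algebra_simps)
      moreover have "1 < (1 + e/2)\<^sup>2" using e(1) by (simp add: one_less_power)
      ultimately show False using x by (simp add: cyl_iff)
    qed
    moreover have "x \<in> closure cyl" using x closure_closed[OF closed_cyl] by (simp add: cyl_iff)
    ultimately show "x \<in> frontier cyl" by (simp add: frontier_def)
  qed
  have "negligible {x. rsq x = 1}"
    using negligible_convex_frontier[OF convex_cyl] sub negligible_subset by blast
  then have "{x. rsq x = 1} \<in> null_sets lebesgue" by (simp add: negligible_iff_null_sets)
  moreover have "{x. rsq x = 1} \<in> sets borel"
    by (intro borel_closed closed_Collect_eq continuous_intros)
  ultimately have "{x. rsq x = 1} \<in> null_sets lborel"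
    by (simp add: null_sets_completion_iff)
  from AE_not_in[OF this] show ?thesis by simp
qed

lemma fund_subset_cyl: "fund \<subseteq> cyl"
  by (auto simp: fund_def)

lemma fund_iff: "x \<in> fund \<longleftrightarrow> x \<in> cyl \<and> \<bar>x$3\<bar> \<le> pi"
  by (auto simp: fund_def)

lemma bounded_cyl_strip: "bounded {x \<in> cyl. \<bar>x$3\<bar> \<le> b}"
proof (rule boundedI)
  fix x assume "x \<in> {x \<in> cyl. \<bar>x$3\<bar> \<le> b}"
  then have x: "rsq x \<le> 1" "\<bar>x$3\<bar> \<le> b" by (auto simp: cyl_iff)
  have "(norm x)\<^sup>2 = rsq x + (x$3)\<^sup>2" by (simp add: norm_3_sq rsq_def)
  also have "\<dots> \<le> 1 + b\<^sup>2" using x by (intro add_mono) (auto simp: abs_le_square_iff[symmetric])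
  finally show "norm x \<le> sqrt (1 + b\<^sup>2)" by (rule real_le_rsqrt)
qed

lemma compact_cyl_strip: "compact {x \<in> cyl. \<bar>x$3\<bar> \<le> b}"
proof -
  have "closed {x::real^3. \<bar>x$3\<bar> \<le> b}" by (intro closed_Collect_le continuous_intros)
  then have "closed (cyl \<inter> {x. \<bar>x$3\<bar> \<le> b})" using closed_cyl by auto
  moreover have "cyl \<inter> {x. \<bar>x$3\<bar> \<le> b} = {x \<in> cyl. \<bar>x$3\<bar> \<le> b}" by auto
  ultimately show ?thesis using bounded_cyl_strip by (simp add: compact_eq_bounded_closed)
qed

lemma fund_eq: "fund = {x \<in> cyl. \<bar>x$3\<bar> \<le> pi}"
  by (auto simp: fund_iff)

lemma compact_fund: "compact fund"
  unfolding fund_eq by (rule compact_cyl_strip)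

lemma convex_fund: "convex fund"
proof -
  have "convex {x::real^3. axis 3 1 \<bullet> x \<le> pi}" "convex {x::real^3. axis 3 1 \<bullet> x \<ge> - pi}"
    by (rule convex_halfspace_le, rule convex_halfspace_ge)
  then have "convex (cyl \<inter> ({x. axis 3 1 \<bullet> x \<le> pi} \<inter> {x. axis 3 1 \<bullet> x \<ge> - pi}))"
    by (intro convex_Int convex_cyl)
  moreover have "cyl \<inter> ({x. axis 3 1 \<bullet> x \<le> pi} \<inter> {x. axis 3 1 \<bullet> x \<ge> - pi}) = fund"
    by (auto simp: fund_def inner_axis')
  ultimately show ?thesis by metis
qed

lemma interior_fund_supset: "{x. rsq x < 1 \<and> \<bar>x$3\<bar> < pi} \<subseteq> interior fund"
proof (rule interior_maximal)
  show "open {x. rsq x < 1 \<and> \<bar>x$3\<bar> < pi}"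
    by (intro open_Collect_conj open_Collect_less continuous_intros)
qed (auto simp: fund_iff cyl_iff)

lemma solid_fund: "solid fund"
proof -
  have "rsq 0 < 1 \<and> \<bar>(0::real^3)$3\<bar> < pi" by (simp add: rsq_def)
  then show ?thesis using interior_fund_supset by (auto simp: solid_def convex_fund)
qed

lemma rsq_shift [simp]: "rsq (x + s *\<^sub>R e_z) = rsq x"
  by (simp add: rsq_def)

lemma cyl_shift [simp]: "x + s *\<^sub>R e_z \<in> cyl \<longleftrightarrow> x \<in> cyl"
  by (simp add: cyl_iff)

lemma z_periodic_int:
  assumes "z_periodic f" "x \<in> cyl"
  shows "f (x + (2 * pi * of_int k) *\<^sub>R e_z) = f x"
proof -
  have nat: "f (y + (2 * pi * of_nat n) *\<^sub>R e_z) = f y" if "y \<in> cyl" for y n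
  proof (induction n)
    case (Suc n)
    have "y + (2 * pi * of_nat (Suc n)) *\<^sub>R e_z = (y + (2 * pi * of_nat n) *\<^sub>R e_z) + (2 * pi) *\<^sub>R e_z"
      by (simp add: algebra_simps)
    then show ?case using assms(1) Suc that unfolding z_periodic_def by (metis cyl_shift)
  qed simp
  show ?thesis
  proof (cases "0 \<le> k")
    case True
    then show ?thesis using nat[OF assms(2), of "nat k"] by simp
  next
    case False
    define y where "y = x + (2 * pi * of_int k) *\<^sub>R e_z"
    have "y \<in> cyl" using assms(2) by (simp add: y_def)
    moreover have "y + (2 * pi * of_nat (nat (- k))) *\<^sub>R e_z = x"
      using False by (simp add: y_def flip: scaleR_add_left)
    ultimately show ?thesis using nat[of y "nat (- k)"] unfolding y_def by metis
  qed
qed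

lemma cyl_shift_fund_half:
  assumes "x \<in> cyl"
  obtains k :: int where "x + (2 * pi * of_int k) *\<^sub>R e_z \<in> fund" "(x + (2 * pi * of_int k) *\<^sub>R e_z) $ 3 < pi"
proof -
  define k where "k = \<lfloor>(x$3 + pi) / (2 * pi)\<rfloor>"
  have "of_int k \<le> (x$3 + pi) / (2 * pi)" "(x$3 + pi) / (2 * pi) < of_int k + 1"
    unfolding k_def by linarith+
  then have "2 * pi * of_int k \<le> x$3 + pi" "x$3 + pi < 2 * pi * (of_int k + 1)"
    by (simp_all add: field_simps)
  then have "- pi \<le> x$3 + 2 * pi * of_int (- k)" "x$3 + 2 * pi * of_int (- k) < pi"
    by (simp_all add: algebra_simps)
  moreover have "x + (2 * pi * of_int (- k)) *\<^sub>R e_z \<in> cyl" using assms by (simp only: cyl_shift)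
  ultimately show ?thesis by (intro that[of "- k"]) (auto simp: fund_def)
qed

lemma cyl_shift_fund:
  assumes "x \<in> cyl"
  obtains k :: int where "x + (2 * pi * of_int k) *\<^sub>R e_z \<in> fund"
  using cyl_shift_fund_half[OF assms] by metis

lemma z_periodic_bounded:
  fixes f :: "real^3 \<Rightarrow> 'b::real_normed_vector"
  assumes "z_periodic f" "continuous_on fund f"
  obtains B where "0 < B" "\<And>x. x \<in> cyl \<Longrightarrow> norm (f x) \<le> B"
proof -
  have "bounded (f ` fund)" using assms compact_fund compact_continuous_image compact_imp_bounded by blast
  then obtain B where B: "0 < B" "\<And>x. x \<in> fund \<Longrightarrow> norm (f x) \<le> B" by (auto simp: bounded_pos)
  have "norm (f x) \<le> B" if x: "x \<in> cyl" for x
  proof -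
    obtain k :: int where "x + (2 * pi * of_int k) *\<^sub>R e_z \<in> fund" using cyl_shift_fund[OF x] .
    then show ?thesis using B(2) z_periodic_int[OF assms(1) x] by metis
  qed
  then show ?thesis using that B(1) by blast
qed

section \<open>Derivatives of periodic functions on the cylinder\<close>

lemma z_periodic_derivative:
  assumes f: "z_periodic f" "x \<in> cyl" and D: "(f has_derivative D) (at x within cyl)"
  shows "(f has_derivative D) (at (x + (2 * pi) *\<^sub>R e_z) within cyl)"
proof -
  let ?y = "x + (2 * pi) *\<^sub>R e_z"
  have g: "((\<lambda>y. y - (2 * pi) *\<^sub>R e_z) has_derivative (\<lambda>v. v)) (at ?y within cyl)"
    by (auto intro!: derivative_eq_intros)
  have sh: "y - (2 * pi) *\<^sub>R e_z \<in> cyl" if "y \<in> cyl" for y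
    using that cyl_shift[of y "- 2 * pi"] by simp
  have "(f has_derivative D) (at (?y - (2 * pi) *\<^sub>R e_z) within (\<lambda>y. y - (2 * pi) *\<^sub>R e_z) ` cyl)"
    using has_derivative_subset[OF D, of "(\<lambda>y. y - (2 * pi) *\<^sub>R e_z) ` cyl"] sh by auto
  from diff_chain_within[OF g this] have "((\<lambda>y. f (y - (2 * pi) *\<^sub>R e_z)) has_derivative D) (at ?y within cyl)"
    by (simp add: o_def)
  then show ?thesis
  proof (rule has_derivative_transform[rotated 2])
    show "f y = f (y - (2 * pi) *\<^sub>R e_z)" if "y \<in> cyl" for y
      using f(1) sh[OF that] unfolding z_periodic_def by (metis diff_add_cancel)
  qed (use f in simp)
qed

text \<open>The derivative is an explicit second argument, so that products, reflections and time
  slices come with a known formula for it. Continuity is asked direction by direction, which in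
  finite dimension is continuity of the derivative.\<close>

definition C1_torus :: "(real^3 \<Rightarrow> 'b::real_normed_vector) \<Rightarrow> (real^3 \<Rightarrow> real^3 \<Rightarrow> 'b) \<Rightarrow> bool" where
  "C1_torus f f' \<longleftrightarrow> z_periodic f \<and> (\<forall>x\<in>cyl. (f has_derivative f' x) (at x within cyl)) \<and>
     (\<forall>v. continuous_on cyl (\<lambda>x. f' x v))"

lemma C1_torus_continuous: "C1_torus f f' \<Longrightarrow> continuous_on cyl f"
  unfolding C1_torus_def continuous_on_eq_continuous_within
  using has_derivative_continuous by blast

lemma C1_torus_linear: "C1_torus f f' \<Longrightarrow> x \<in> cyl \<Longrightarrow> linear (f' x)"
  unfolding C1_torus_def using has_derivative_linear by blast

lemma C1_torus_derivative_periodic: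
  assumes "C1_torus f f'"
  shows "z_periodic (\<lambda>x. f' x v)"
  unfolding z_periodic_def
proof
  fix x assume x: "x \<in> cyl"
  let ?y = "x + (2 * pi) *\<^sub>R e_z"
  have "(f has_derivative f' x) (at ?y within cyl)"
    using assms x z_periodic_derivative by (auto simp: C1_torus_def)
  moreover have "(f has_derivative f' ?y) (at ?y within cyl)" "?y \<in> cyl" using assms x by (auto simp: C1_torus_def)
  ultimately show "f' ?y v = f' x v" using has_derivative_within_solid_unique[OF solid_cyl] by metis
qed

text \<open>Periodicity reduces the bound to the compact set \<open>fund\<close>, where each of the
  three partial derivatives is bounded.\<close>

lemma C1_torus_derivative_bounded:
  fixes f :: "real^3 \<Rightarrow> 'b::real_normed_vector"
  assumes f: "C1_torus f f'"
  obtains L where "0 < L" "\<And>x v. x \<in> cyl \<Longrightarrow> norm (f' x v) \<le> L * norm v"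
proof -
  have "\<exists>B. 0 < B \<and> (\<forall>x\<in>cyl. norm (f' x (axis i 1)) \<le> B)" for i
  proof -
    have "continuous_on fund (\<lambda>x. f' x (axis i 1))"
      using f continuous_on_subset[OF _ fund_subset_cyl] by (auto simp: C1_torus_def)
    then show ?thesis using z_periodic_bounded[OF C1_torus_derivative_periodic[OF f]] by metis
  qed
  then obtain B where B: "\<And>i. 0 < B i" "\<And>i x. x \<in> cyl \<Longrightarrow> norm (f' x (axis i 1)) \<le> B i" by metis
  show ?thesis
  proof
    show "0 < (\<Sum>i\<in>UNIV. B i)" using B(1) by (intro sum_pos) auto
    fix x :: "real^3" and v assume x: "x \<in> cyl"
    have "f' x v = (\<Sum>i\<in>UNIV. v$i *\<^sub>R f' x (axis i 1))"
      using C1_torus_linear[OF f x] by (subst vec3_expand[of v]) (simp only: linear_sum linear_cmul)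
    also have "norm \<dots> \<le> (\<Sum>i\<in>UNIV. \<bar>v$i\<bar> * norm (f' x (axis i 1)))"
      by (rule order_trans[OF norm_sum]) simp
    also have "\<dots> \<le> (\<Sum>i\<in>UNIV. norm v * B i)"
      using B x component_le_norm_cart[of v] by (intro sum_mono mult_mono) auto
    finally show "norm (f' x v) \<le> (\<Sum>i\<in>UNIV. B i) * norm v"
      by (simp add: sum_distrib_left mult.commute)
  qed
qed

lemma lipschitz_on_cyl:
  fixes f :: "real^3 \<Rightarrow> 'b::real_normed_vector"
  assumes "\<And>x. x \<in> cyl \<Longrightarrow> (f has_derivative f' x) (at x within cyl)"
    and "\<And>x v. x \<in> cyl \<Longrightarrow> norm (f' x v) \<le> L * norm v" "x \<in> cyl" "y \<in> cyl"
  shows "norm (f x - f y) \<le> L * norm (x - y)"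
proof (rule differentiable_bound[OF convex_cyl assms(1)])
  show "onorm (f' z) \<le> L" if "z \<in> cyl" for z
    using assms(2)[OF that] by (rule onorm_le)
qed (use assms in auto)

lemma C1_torus_lipschitz:
  fixes f :: "real^3 \<Rightarrow> 'b::real_normed_vector"
  assumes f: "C1_torus f f'"
  obtains L where "0 < L" "\<And>x y. \<lbrakk>x \<in> cyl; y \<in> cyl\<rbrakk> \<Longrightarrow> norm (f x - f y) \<le> L * norm (x - y)"
proof -
  obtain L where L: "0 < L" "\<And>x v. x \<in> cyl \<Longrightarrow> norm (f' x v) \<le> L * norm v"
    using C1_torus_derivative_bounded[OF f] by metis
  have "norm (f x - f y) \<le> L * norm (x - y)" if "x \<in> cyl" "y \<in> cyl" for x y
    by (rule lipschitz_on_cyl[of f f']) (use f L(2) that in \<open>auto simp: C1_torus_def\<close>)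
  then show ?thesis using that L(1) by blast
qed

section \<open>Integration\<close>

text \<open>\<open>lborel\<close> carries the product structure that Fubini requires. On continuous
  integrands it agrees with the \<open>lebesgue\<close> integrals of the definitions, see
  \<open>integral_M_Int_on\<close>.\<close>

abbreviation Int_on :: "'a::euclidean_space set \<Rightarrow> ('a \<Rightarrow> real) \<Rightarrow> real" where
  "Int_on K f \<equiv> set_lebesgue_integral lborel K f"

lemma set_integrable_compact:
  fixes f :: "'a::euclidean_space \<Rightarrow> real"
  assumes "compact K" "continuous_on K f"
  shows "set_integrable lborel K f"
  unfolding set_integrable_def using borel_integrable_compact[OF assms] .

lemma Int_on_add:
  "\<lbrakk>compact K; continuous_on K f; continuous_on K g\<rbrakk> \<Longrightarrow> Int_on K (\<lambda>x. f x + g x) = Int_on K f + Int_on K g"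
  by (rule set_integral_add) (auto intro: set_integrable_compact)

lemma Int_on_diff:
  "\<lbrakk>compact K; continuous_on K f; continuous_on K g\<rbrakk> \<Longrightarrow> Int_on K (\<lambda>x. f x - g x) = Int_on K f - Int_on K g"
  by (rule set_integral_diff) (auto intro: set_integrable_compact)

lemma Int_on_mono:
  "\<lbrakk>compact K; continuous_on K f; continuous_on K g; \<And>x. x \<in> K \<Longrightarrow> f x \<le> g x\<rbrakk> \<Longrightarrow> Int_on K f \<le> Int_on K g"
  by (rule set_integral_mono) (auto intro: set_integrable_compact)

lemma Int_on_cong: "(\<And>x. x \<in> K \<Longrightarrow> f x = g x) \<Longrightarrow> Int_on K f = Int_on K g"
  unfolding set_lebesgue_integral_def by (rule Bochner_Integration.integral_cong) (auto split: split_indicator)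

lemma Int_on_nonneg: "(\<And>x. x \<in> K \<Longrightarrow> 0 \<le> f x) \<Longrightarrow> 0 \<le> Int_on K f"
  unfolding set_lebesgue_integral_def by (rule Bochner_Integration.integral_nonneg) (auto split: split_indicator)

lemma Int_on_const: "compact K \<Longrightarrow> Int_on K (\<lambda>x. c) = measure lborel K * c"
  unfolding set_lebesgue_integral_def
  by (simp add: emeasure_compact_finite less_top[symmetric] borel_compact)

text \<open>The part of the interior where \<open>f\<close> does not vanish is open and null, hence
  empty; the zero set is closed and therefore contains the closure of the interior.\<close>

lemma Int_on_eq_0D:
  assumes K: "compact K" "solid K" and f: "continuous_on K f" "\<And>x. x \<in> K \<Longrightarrow> 0 \<le> f x"
    and I: "Int_on K f \<le> 0" and x: "x \<in> K"
  shows "f x = 0"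
proof -
  have "Int_on K f = 0" using I Int_on_nonneg[OF f(2)] by force
  moreover have "integrable lborel (\<lambda>x. indicator K x *\<^sub>R f x)"
    using set_integrable_compact[OF K(1) f(1)] by (simp add: set_integrable_def)
  ultimately have AE: "AE x in lborel. indicator K x *\<^sub>R f x = 0"
    using f(2) unfolding set_lebesgue_integral_def
    by (subst (asm) integral_nonneg_eq_0_iff_AE) (auto split: split_indicator)
  define W where "W = interior K - {x \<in> K. f x = 0}"
  have cl: "closed {x \<in> K. f x = 0}"
    using continuous_closed_preimage_constant[OF f(1)] K compact_imp_closed by blast
  then have "open W" unfolding W_def by (intro open_Diff) auto
  moreover have "W \<in> null_sets lborel"
  proof -
    have "AE x in lborel. x \<notin> W"
      using AE by eventually_elim (use interior_subset[of K] in \<open>auto simp: W_def\<close>)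
    then show ?thesis using \<open>open W\<close> by (subst AE_iff_null_sets) auto
  qed
  then have "negligible W" using negligible_iff_null_sets null_sets_completionI by blast
  ultimately have "W = {}" using open_not_negligible by blast
  then have int: "interior K \<subseteq> {x \<in> K. f x = 0}" using interior_subset by (auto simp: W_def)
  have "closure (interior K) \<subseteq> {x \<in> K. f x = 0}" using int cl closure_minimal by blast
  moreover have "x \<in> closure (interior K)"
    using convex_closure_interior[of K] K closure_subset x by (auto simp: solid_def)
  ultimately show ?thesis by auto
qed

lemma integral_M_Int_on:
  assumes "continuous_on fund f"
  shows "integral_M f = Int_on fund f"
  unfolding integral_M_def set_lebesgue_integral_def
proof (rule integral_completion)
  show "(\<lambda>x. indicat_real fund x *\<^sub>R f x) \<in> borel_measurable lborel"
    using borel_measurable_continuous_on_indicator[OF borel_compact[OF compact_fund] assms] by simp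
qed

lemma integral_M_nonneg: "(\<And>x. x \<in> fund \<Longrightarrow> 0 \<le> f x) \<Longrightarrow> 0 \<le> integral_M f"
  unfolding integral_M_def set_lebesgue_integral_def
  by (rule Bochner_Integration.integral_nonneg) (auto split: split_indicator)

text \<open>Compactness of \<open>K\<close> makes the continuity of \<open>f'\<close> at
  \<open>t0\<close> uniform in \<open>x\<close>, so the first-order remainder is uniformly small and
  can be integrated. \<open>J\<close> may contain its end points, as \<open>{0..<T}\<close>
  does.\<close>

lemma has_real_derivative_Int_on:
  fixes f f' :: "real \<Rightarrow> 'a::euclidean_space \<Rightarrow> real"
  assumes K: "compact K" and J: "convex J" "t0 \<in> J"
    and f: "\<And>t x. \<lbrakk>t \<in> J; x \<in> K\<rbrakk> \<Longrightarrow> ((\<lambda>t. f t x) has_real_derivative f' t x) (at t within J)"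
    and cf: "\<And>t. t \<in> J \<Longrightarrow> continuous_on K (f t)"
    and cf': "continuous_on (J \<times> K) (\<lambda>(t, x). f' t x)"
  shows "((\<lambda>t. Int_on K (f t)) has_real_derivative Int_on K (f' t0)) (at t0 within J)"
proof -
  have cf0: "continuous_on K (f' t0)"
  proof -
    have "continuous_on K (\<lambda>x. (t0, x))" by (intro continuous_intros)
    from continuous_on_compose2[OF cf' this] show ?thesis using J by auto
  qed
  define M where "M = measure lborel K"
  have M: "0 \<le> M" by (simp add: M_def)
  have main: "\<exists>d>0. \<forall>t\<in>J. norm (t - t0) < d \<longrightarrow>
      norm (Int_on K (f t) - Int_on K (f t0) - Int_on K (f' t0) * (t - t0)) \<le> e * norm (t - t0)" if e: "0 < e" for e
  proof -
    \<comment> \<open>\<open>M + 1\<close> instead of \<open>M\<close>, because \<open>K\<close> may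
      be a null set.\<close>
    define e' where "e' = e / (M + 1)"
    have e': "0 < e'" using e M by (simp add: e'_def add_nonneg_pos)
    have e'M: "M * e' \<le> e" using e M by (simp add: e'_def field_simps)
    obtain X0 where X0: "t0 \<in> X0" "open X0"
      "\<forall>t\<in>X0 \<inter> J. \<forall>x\<in>K. dist (f' t x) (f' t0 x) \<le> e'"
      using continuous_on_prod_compactE[OF cf' K J(2) e'] by auto
    obtain d where d: "0 < d" "ball t0 d \<subseteq> X0" using X0 openE by blast
    have pt: "\<bar>f t x - f t0 x - f' t0 x * (t - t0)\<bar> \<le> e' * \<bar>t - t0\<bar>"
      if t: "t \<in> J" "\<bar>t - t0\<bar> < d" and x: "x \<in> K" for t x
    proof -
      \<comment> \<open>Without its linear part the function has derivative at most
        \<open>e'\<close> near \<open>t0\<close>, and the mean value inequality bounds the remainder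
        by a constant free of \<open>x\<close>.\<close>
      define g where "g s = f s x - f' t0 x * s" for s
      have cv: "convex (J \<inter> ball t0 d)" using J by (intro convex_Int) auto
      have "norm (g t - g t0) \<le> e' * norm (t - t0)"
      proof (rule differentiable_bound[OF cv])
        fix s assume s: "s \<in> J \<inter> ball t0 d"
        have "(g has_real_derivative f' s x - f' t0 x) (at s within J)"
          unfolding g_def using s x by (auto intro!: derivative_eq_intros f)
        then show "(g has_derivative (*) (f' s x - f' t0 x)) (at s within J \<inter> ball t0 d)"
          unfolding has_field_derivative_def by (rule has_derivative_subset) auto
        have "\<bar>f' s x - f' t0 x\<bar> \<le> e'" using X0(3) s d x by (auto simp: dist_real_def)
        then show "onorm ((*) (f' s x - f' t0 x)) \<le> e'"
          by (intro onorm_le) (simp add: abs_mult mult_right_mono)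
      qed (use t d J in \<open>auto simp: dist_real_def\<close>)
      then show ?thesis by (simp add: g_def algebra_simps)
    qed
    show ?thesis
    proof (intro exI[of _ d] conjI ballI impI d(1))
      fix t assume t: "t \<in> J" "norm (t - t0) < d"
      have c: "continuous_on K (\<lambda>x. f t x - f t0 x - f' t0 x * (t - t0))"
        using t J by (intro continuous_intros cf cf0)
      have eq: "Int_on K (\<lambda>x. f t x - f t0 x - f' t0 x * (t - t0)) =
          Int_on K (f t) - Int_on K (f t0) - Int_on K (f' t0) * (t - t0)"
        using t J by (subst Int_on_diff Int_on_diff[OF K], (intro continuous_intros cf cf0 K; simp)+)+ simp
      have "Int_on K (\<lambda>x. f t x - f t0 x - f' t0 x * (t - t0)) \<le> Int_on K (\<lambda>x. e' * \<bar>t - t0\<bar>)"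
        using pt[OF t(1)] t(2) by (intro Int_on_mono K c continuous_intros) (fastforce simp: abs_le_iff)
      moreover have "Int_on K (\<lambda>x. - (e' * \<bar>t - t0\<bar>)) \<le> Int_on K (\<lambda>x. f t x - f t0 x - f' t0 x * (t - t0))"
        using pt[OF t(1)] t(2) by (intro Int_on_mono K c continuous_intros) (fastforce simp: abs_le_iff)
      ultimately have "\<bar>Int_on K (f t) - Int_on K (f t0) - Int_on K (f' t0) * (t - t0)\<bar> \<le> M * (e' * \<bar>t - t0\<bar>)"
        unfolding eq Int_on_const[OF K] by (simp add: M_def abs_le_iff)
      also have "\<dots> \<le> e * \<bar>t - t0\<bar>" using e'M mult_right_mono[of "M * e'" e "\<bar>t - t0\<bar>"] by (simp add: mult.assoc)
      finally show "norm (Int_on K (f t) - Int_on K (f t0) - Int_on K (f' t0) * (t - t0)) \<le> e * norm (t - t0)" by simp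
    qed
  qed
  show ?thesis
    unfolding has_field_derivative_def has_derivative_within_alt
    using main by (auto intro: bounded_linear_mult_right)
qed

lemma Int_on_Times:
  fixes g :: "'a::euclidean_space \<times> 'b::euclidean_space \<Rightarrow> real"
  assumes A: "compact A" and B: "compact B" and g: "continuous_on (A \<times> B) g"
  shows "Int_on (A \<times> B) g = Int_on A (\<lambda>s. Int_on B (\<lambda>x. g (s, x)))"
    and "Int_on (A \<times> B) g = Int_on B (\<lambda>x. Int_on A (\<lambda>s. g (s, x)))"
proof -
  have int: "integrable (lborel \<Otimes>\<^sub>M lborel) (\<lambda>(s, x). indicator (A \<times> B) (s, x) *\<^sub>R g (s, x))"
    using set_integrable_compact[OF compact_Times[OF A B] g]
    by (simp add: set_integrable_def lborel_prod case_prod_beta')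
  have eq: "Int_on (A \<times> B) g = integral\<^sup>L (lborel \<Otimes>\<^sub>M lborel) (\<lambda>(s, x). indicator (A \<times> B) (s, x) *\<^sub>R g (s, x))"
    by (simp add: set_lebesgue_integral_def lborel_prod case_prod_beta')
  have "Int_on A (\<lambda>s. Int_on B (\<lambda>x. g (s, x))) = (LBINT s. LBINT x. indicator (A \<times> B) (s, x) *\<^sub>R g (s, x))"
    unfolding set_lebesgue_integral_def
    by (auto intro!: Bochner_Integration.integral_cong simp: indicator_times mult.assoc)
  then show "Int_on (A \<times> B) g = Int_on A (\<lambda>s. Int_on B (\<lambda>x. g (s, x)))"
    using lborel_pair.integral_fst[OF int] eq by simp
  have "Int_on B (\<lambda>x. Int_on A (\<lambda>s. g (s, x))) = (LBINT x. LBINT s. indicator (A \<times> B) (s, x) *\<^sub>R g (s, x))"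
    unfolding set_lebesgue_integral_def
    by (auto intro!: Bochner_Integration.integral_cong simp: indicator_times mult_ac simp flip: integral_mult_right_zero)
  then show "Int_on (A \<times> B) g = Int_on B (\<lambda>x. Int_on A (\<lambda>s. g (s, x)))"
    using lborel_pair.integral_snd[OF int] eq by simp
qed

section \<open>Algebra of periodic functions of class C1\<close>

lemma C1_torusD:
  assumes "C1_torus f f'"
  shows "z_periodic f" "\<And>x. x \<in> cyl \<Longrightarrow> (f has_derivative f' x) (at x within cyl)"
    "\<And>v. continuous_on cyl (\<lambda>x. f' x v)"
  using assms by (auto simp: C1_torus_def)

lemma C1_torus_mult:
  fixes f g :: "real^3 \<Rightarrow> real"
  assumes f: "C1_torus f f'" and g: "C1_torus g g'"
  shows "C1_torus (\<lambda>x. f x * g x) (\<lambda>x v. f x * g' x v + f' x v * g x)"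
  unfolding C1_torus_def
proof (intro conjI ballI allI)
  show "z_periodic (\<lambda>x. f x * g x)" using C1_torusD(1)[OF f] C1_torusD(1)[OF g] by (simp add: z_periodic_def)
  show "((\<lambda>x. f x * g x) has_derivative (\<lambda>v. f x * g' x v + f' x v * g x)) (at x within cyl)" if "x \<in> cyl" for x
    by (rule has_derivative_mult[OF C1_torusD(2)[OF f that] C1_torusD(2)[OF g that]])
  show "continuous_on cyl (\<lambda>x. f x * g' x v + f' x v * g x)" for v
    by (intro continuous_intros C1_torus_continuous[OF f] C1_torus_continuous[OF g] C1_torusD(3)[OF f] C1_torusD(3)[OF g])
qed

lemma C1_torus_diff:
  assumes f: "C1_torus f f'" and g: "C1_torus g g'"
  shows "C1_torus (\<lambda>x. f x - g x) (\<lambda>x v. f' x v - g' x v)"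
  using assms by (auto simp: C1_torus_def z_periodic_def intro!: has_derivative_diff continuous_on_diff)

lemma C1_torus_const: "C1_torus (\<lambda>x. c) (\<lambda>x v. 0)"
  by (auto simp: C1_torus_def z_periodic_def intro!: continuous_intros)

lemma C1_torus_nth:
  fixes f :: "real^3 \<Rightarrow> real^3"
  assumes f: "C1_torus f f'"
  shows "C1_torus (\<lambda>x. f x $ i) (\<lambda>x v. f' x v $ i)"
  unfolding C1_torus_def
proof (intro conjI ballI allI)
  show "z_periodic (\<lambda>x. f x $ i)" using C1_torusD(1)[OF f] by (simp add: z_periodic_def)
  show "((\<lambda>x. f x $ i) has_derivative (\<lambda>v. f' x v $ i)) (at x within cyl)" if "x \<in> cyl" for x
    using bounded_linear.has_derivative[OF bounded_linear_vec_nth C1_torusD(2)[OF f that]] .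
  show "continuous_on cyl (\<lambda>x. f' x v $ i)" for v
    by (intro continuous_intros C1_torusD(3)[OF f])
qed

lemma C1_torus_scaleR:
  fixes f :: "real^3 \<Rightarrow> real" and g :: "real^3 \<Rightarrow> 'b::real_normed_vector"
  assumes f: "C1_torus f f'" and g: "C1_torus g g'"
  shows "C1_torus (\<lambda>x. f x *\<^sub>R g x) (\<lambda>x v. f x *\<^sub>R g' x v + f' x v *\<^sub>R g x)"
  unfolding C1_torus_def
proof (intro conjI ballI allI)
  show "z_periodic (\<lambda>x. f x *\<^sub>R g x)" using C1_torusD(1)[OF f] C1_torusD(1)[OF g] by (simp add: z_periodic_def)
  show "((\<lambda>x. f x *\<^sub>R g x) has_derivative (\<lambda>v. f x *\<^sub>R g' x v + f' x v *\<^sub>R g x)) (at x within cyl)" if "x \<in> cyl" for x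
    by (rule has_derivative_scaleR[OF C1_torusD(2)[OF f that] C1_torusD(2)[OF g that]])
  show "continuous_on cyl (\<lambda>x. f x *\<^sub>R g' x v + f' x v *\<^sub>R g x)" for v
    by (intro continuous_intros C1_torus_continuous[OF f] C1_torus_continuous[OF g] C1_torusD(3)[OF f] C1_torusD(3)[OF g])
qed

lemma C1_torus_inner:
  fixes f g :: "real^3 \<Rightarrow> 'b::real_inner"
  assumes f: "C1_torus f f'" and g: "C1_torus g g'"
  shows "C1_torus (\<lambda>x. f x \<bullet> g x) (\<lambda>x v. f x \<bullet> g' x v + f' x v \<bullet> g x)"
  unfolding C1_torus_def
proof (intro conjI ballI allI)
  show "z_periodic (\<lambda>x. f x \<bullet> g x)" using C1_torusD(1)[OF f] C1_torusD(1)[OF g] by (simp add: z_periodic_def)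
  show "((\<lambda>x. f x \<bullet> g x) has_derivative (\<lambda>v. f x \<bullet> g' x v + f' x v \<bullet> g x)) (at x within cyl)" if "x \<in> cyl" for x
    by (rule has_derivative_inner[OF C1_torusD(2)[OF f that] C1_torusD(2)[OF g that]])
  show "continuous_on cyl (\<lambda>x. f x \<bullet> g' x v + f' x v \<bullet> g x)" for v
    by (intro continuous_intros C1_torus_continuous[OF f] C1_torus_continuous[OF g] C1_torusD(3)[OF f] C1_torusD(3)[OF g])
qed

lemma C1_torus_rsq_power:
  "C1_torus (\<lambda>x. rsq x ^ n) (\<lambda>x v. real n * rsq x ^ (n - 1) * (2 * (x$1 * v$1 + x$2 * v$2)))"
  unfolding C1_torus_def
proof (intro conjI ballI allI)
  show "z_periodic (\<lambda>x. rsq x ^ n)" by (simp add: z_periodic_def)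
  have "(rsq has_derivative (\<lambda>v. 2 * (x$1 * v$1 + x$2 * v$2))) (at x within cyl)" for x
    unfolding rsq_def by (auto intro!: derivative_eq_intros bounded_linear.has_derivative[OF bounded_linear_vec_nth] simp: algebra_simps)
  then show "((\<lambda>x. rsq x ^ n) has_derivative (\<lambda>v. real n * rsq x ^ (n - 1) * (2 * (x$1 * v$1 + x$2 * v$2)))) (at x within cyl)" for x
    by (auto intro!: derivative_eq_intros)
  show "continuous_on cyl (\<lambda>x. real n * rsq x ^ (n - 1) * (2 * (x$1 * v$1 + x$2 * v$2)))" for v
    by (intro continuous_intros)
qed

section \<open>Translations and fundamental domains\<close>

lemma integral_translate:
  fixes f :: "'a::euclidean_space \<Rightarrow> real"
  assumes "f \<in> borel_measurable borel"
  shows "(LBINT x. f (x + c)) = (LBINT x. f x)"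
proof -
  have "(LBINT x. f x) = integral\<^sup>L (distr lborel borel ((+) c)) f" by (simp add: lborel_distr_plus)
  also have "\<dots> = (LBINT x. f (c + x))" by (rule integral_distr) (use assms in auto)
  finally show ?thesis by (simp add: add.commute)
qed

text \<open>A fundamental domain of the translation by \<open>2 pi\<close>.\<close>

definition tile :: "(real^3) set \<Rightarrow> bool" where
  "tile A \<longleftrightarrow> A \<in> sets borel \<and> A \<subseteq> cyl \<and> bounded A \<and>
     (\<forall>y\<in>cyl. \<exists>!k::int. y + (2 * pi * of_int k) *\<^sub>R e_z \<in> A)"

lemma integrable_bounded_support:
  fixes f :: "real^3 \<Rightarrow> real"
  assumes "f \<in> borel_measurable borel" and "\<And>x. \<bar>f x\<bar> \<le> B" and "\<And>x. R < norm x \<Longrightarrow> f x = 0"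
  shows "integrable lborel f"
proof (rule Bochner_Integration.integrable_bound)
  show "integrable lborel (\<lambda>x. indicator (cball 0 R) x *\<^sub>R B)"
    by (rule borel_integrable_compact) auto
  show "AE x in lborel. norm (f x) \<le> norm (indicator (cball 0 R) x *\<^sub>R B)"
  proof (rule AE_I2)
    fix x :: "real^3"
    show "norm (f x) \<le> norm (indicator (cball 0 R) x *\<^sub>R B)"
      using assms(2)[of x] assms(3)[of x] by (cases "norm x \<le> R") auto
  qed
qed (use assms in simp)

text \<open>Two fundamental domains are equidecomposable by the deck translations: the piece of
  \<open>A\<close> that the shift by \<open>2 pi k\<close> sends into \<open>B\<close> is moved
  there, and the periodic integrand does not notice. Boundedness leaves finitely many
  \<open>k\<close>.\<close>

lemma tile_integral_eq:
  assumes A: "tile A" and B: "tile B" and g: "z_periodic g" "continuous_on cyl g"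
  shows "Int_on A g = Int_on B g"
proof -
  define G where "G x = indicator cyl x * g x" for x
  have mG: "G \<in> borel_measurable borel"
    using borel_measurable_continuous_on_indicator[OF borel_closed[OF closed_cyl] g(2)] by (simp add: G_def[abs_def])
  have mA: "A \<in> sets borel" "B \<in> sets borel" using A B by (auto simp: tile_def)
  obtain M where M: "0 < M" "\<And>x. x \<in> cyl \<Longrightarrow> norm (g x) \<le> M"
    using z_periodic_bounded[OF g(1) continuous_on_subset[OF g(2) fund_subset_cyl]] by metis
  have GM: "\<bar>G x\<bar> \<le> M" for x using M by (auto simp: G_def split: split_indicator)
  have sh: "G (x + (2 * pi * of_int k) *\<^sub>R e_z) = G x" for x k
    using z_periodic_int[OF g(1)] by (auto simp: G_def split: split_indicator)
  obtain R where R: "\<And>x. x \<in> A \<Longrightarrow> norm x \<le> R" "\<And>x. x \<in> B \<Longrightarrow> norm x \<le> R"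
    using A B bounded_Un[of A B] unfolding tile_def bounded_iff by blast
  obtain K :: int where K: "R < of_int K" using ex_less_of_int by blast
  have bound: "k \<in> {-K..K}" if "x \<in> A \<union> B" "x + (2 * pi * of_int k) *\<^sub>R e_z \<in> A \<union> B" for x k
  proof -
    have "\<bar>x$3\<bar> \<le> R" "\<bar>(x + (2 * pi * of_int k) *\<^sub>R e_z)$3\<bar> \<le> R"
      using that R component_le_norm_cart order_trans by blast+
    then have "\<bar>2 * pi * of_int k\<bar> \<le> 2 * R" by (simp add: abs_le_iff)
    then have "pi * \<bar>of_int k\<bar> \<le> R" by (simp add: abs_mult)
    moreover have "1 * \<bar>of_int k :: real\<bar> \<le> pi * \<bar>of_int k\<bar>" using pi_gt3 by (intro mult_right_mono) auto
    ultimately have "\<bar>of_int k\<bar> < real_of_int K" using K by linarith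
    then show ?thesis by (simp add: abs_less_iff)
  qed
  have one: "(\<Sum>k\<in>{-K..K}. indicator T (x + (2 * pi * of_int k) *\<^sub>R e_z)) = (1::real)"
    if x: "x \<in> S" and ST: "tile S" "tile T" "S \<subseteq> A \<union> B" "T \<subseteq> A \<union> B" for S T x
  proof -
    have "x \<in> cyl" using x ST by (auto simp: tile_def)
    then obtain k0 :: int where k0: "x + (2 * pi * of_int k0) *\<^sub>R e_z \<in> T"
      "\<And>k. x + (2 * pi * of_int k) *\<^sub>R e_z \<in> T \<Longrightarrow> k = k0"
      using ST(2) by (force simp: tile_def)
    have "k0 \<in> {-K..K}" using bound[of x k0] x k0(1) ST(3,4) by blast
    moreover have "indicator T (x + (2 * pi * of_int k) *\<^sub>R e_z) = (if k = k0 then 1 else (0::real))" for k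
      using k0(1) k0(2)[of k] unfolding indicator_def by (cases "k = k0") auto
    ultimately show ?thesis by simp
  qed
  have int: "integrable lborel (\<lambda>x. indicator A x * indicator B (x + c) * G x)" for c
  proof (rule integrable_bounded_support[of _ M R])
    show "(\<lambda>x. indicator A x * indicator B (x + c) * G x) \<in> borel_measurable borel" using mA mG by measurable
    show "\<bar>indicator A x * indicator B (x + c) * G x\<bar> \<le> M" for x
      using GM[of x] M(1) by (auto split: split_indicator)
    show "indicator A x * indicator B (x + c) * G x = 0" if "R < norm x" for x
      using R(1)[of x] that by (auto split: split_indicator)
  qed
  have int': "integrable lborel (\<lambda>x. indicator A (x + c) * indicator B x * G x)" for c
  proof (rule integrable_bounded_support[of _ M R])
    show "(\<lambda>x. indicator A (x + c) * indicator B x * G x) \<in> borel_measurable borel" using mA mG by measurable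
    show "\<bar>indicator A (x + c) * indicator B x * G x\<bar> \<le> M" for x
      using GM[of x] M(1) by (auto split: split_indicator)
    show "indicator A (x + c) * indicator B x * G x = 0" if "R < norm x" for x
      using R(2)[of x] that by (auto split: split_indicator)
  qed
  \<comment> \<open>\<open>A\<close> is cut into pieces according to the unique shift that carries a
    point into \<open>B\<close>; \<open>one\<close> says that the indicators of the pieces add up to
    1.\<close>
  have "Int_on A g = (LBINT x. \<Sum>k\<in>{-K..K}. indicator A x * indicator B (x + (2 * pi * of_int k) *\<^sub>R e_z) * G x)"
    unfolding set_lebesgue_integral_def
  proof (rule Bochner_Integration.integral_cong)
    fix x
    have "x \<in> A \<Longrightarrow> x \<in> cyl" using A by (auto simp: tile_def)
    then show "indicator A x *\<^sub>R g x = (\<Sum>k\<in>{-K..K}. indicator A x * indicator B (x + (2 * pi * of_int k) *\<^sub>R e_z) * G x)"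
      using one[of x A B] A B
      by (cases "x \<in> A") (simp_all add: G_def mult.assoc flip: sum_distrib_right)
  qed simp
  also have "\<dots> = (\<Sum>k\<in>{-K..K}. LBINT x. indicator A x * indicator B (x + (2 * pi * of_int k) *\<^sub>R e_z) * G x)"
    by (rule Bochner_Integration.integral_sum) (rule int)
  \<comment> \<open>Each piece is translated into \<open>B\<close>, with \<open>G\<close> unchanged
    by \<open>sh\<close>.\<close>
  also have "\<dots> = (\<Sum>k\<in>{-K..K}. LBINT x. indicator A (x + (2 * pi * of_int (- k)) *\<^sub>R e_z) * indicator B x * G x)"
  proof (rule sum.cong[OF refl])
    fix k
    have "(LBINT x. indicator A x * indicator B (x + (2 * pi * of_int k) *\<^sub>R e_z) * G x)
        = (LBINT x. indicator A (x + (2 * pi * of_int k) *\<^sub>R e_z + (2 * pi * of_int (- k)) *\<^sub>R e_z)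
            * indicator B (x + (2 * pi * of_int k) *\<^sub>R e_z) * G (x + (2 * pi * of_int k) *\<^sub>R e_z))"
      unfolding sh by simp
    also have "\<dots> = (LBINT x. indicator A (x + (2 * pi * of_int (- k)) *\<^sub>R e_z) * indicator B x * G x)"
      by (rule integral_translate[of "\<lambda>x. indicator A (x + (2 * pi * of_int (- k)) *\<^sub>R e_z) * indicator B x * G x"])
        (use mA mG in measurable)
    finally show "(LBINT x. indicator A x * indicator B (x + (2 * pi * of_int k) *\<^sub>R e_z) * G x)
      = (LBINT x. indicator A (x + (2 * pi * of_int (- k)) *\<^sub>R e_z) * indicator B x * G x)" .
  qed
  also have "\<dots> = (\<Sum>k\<in>{-K..K}. LBINT x. indicator A (x + (2 * pi * of_int k) *\<^sub>R e_z) * indicator B x * G x)"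
    by (rule sum.reindex_bij_witness[of _ uminus uminus]) auto
  also have "\<dots> = (LBINT x. \<Sum>k\<in>{-K..K}. indicator A (x + (2 * pi * of_int k) *\<^sub>R e_z) * indicator B x * G x)"
    by (rule Bochner_Integration.integral_sum[symmetric]) (rule int')
  also have "\<dots> = Int_on B g"
    unfolding set_lebesgue_integral_def
  proof (rule Bochner_Integration.integral_cong)
    fix x
    have "x \<in> B \<Longrightarrow> x \<in> cyl" using B by (auto simp: tile_def)
    then show "(\<Sum>k\<in>{-K..K}. indicator A (x + (2 * pi * of_int k) *\<^sub>R e_z) * indicator B x * G x) = indicator B x *\<^sub>R g x"
      using one[of x B A] A B
      by (cases "x \<in> B") (simp_all add: G_def flip: sum_distrib_right)
  qed simp
  finally show ?thesis .
qed

lemma tile_strip: "tile {x \<in> cyl. a \<le> x$3 \<and> x$3 < a + 2 * pi}" (is "tile ?A")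
  unfolding tile_def
proof (intro conjI ballI)
  have "closed {x::real^3. a \<le> x$3}" "open {x::real^3. x$3 < a + 2 * pi}"
    by (intro closed_Collect_le open_Collect_less continuous_intros)+
  then have "cyl \<inter> {x::real^3. a \<le> x$3} \<inter> {x. x$3 < a + 2 * pi} \<in> sets borel"
    using closed_cyl by (intro sets.Int) auto
  moreover have "cyl \<inter> {x::real^3. a \<le> x$3} \<inter> {x. x$3 < a + 2 * pi} = ?A" by auto
  ultimately show "?A \<in> sets borel" by metis
  show "bounded ?A"
    by (rule bounded_subset[OF bounded_cyl_strip[of "\<bar>a\<bar> + 2 * pi"]]) auto
  fix y :: "real^3" assume y: "y \<in> cyl"
  have "\<exists>!k::int. a \<le> y$3 + 2 * pi * of_int k \<and> y$3 + 2 * pi * of_int k < a + 2 * pi"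
  proof
    define k where "k = \<lfloor>(y$3 - a) / (2 * pi)\<rfloor>"
    have "of_int k \<le> (y$3 - a) / (2 * pi)" "(y$3 - a) / (2 * pi) < of_int k + 1"
      unfolding k_def by linarith+
    then have "2 * pi * of_int k \<le> y$3 - a" "y$3 - a < 2 * pi * (of_int k + 1)"
      by (simp_all add: field_simps)
    then show "a \<le> y$3 + 2 * pi * of_int (- k) \<and> y$3 + 2 * pi * of_int (- k) < a + 2 * pi"
      by (simp add: algebra_simps)
    fix j :: int assume j: "a \<le> y$3 + 2 * pi * of_int j \<and> y$3 + 2 * pi * of_int j < a + 2 * pi"
    then have "(y$3 - a) / (2 * pi) \<ge> of_int (- j)" "(y$3 - a) / (2 * pi) < of_int (- j) + 1"
      by (simp_all add: field_simps)
    then have "k = - j" unfolding k_def by (intro floor_unique) auto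
    then show "j = - k" by simp
  qed
  then show "\<exists>!k::int. y + (2 * pi * of_int k) *\<^sub>R e_z \<in> ?A" using y by simp
qed auto

lemma AE_nth_neq: "AE x in lborel. (x::real^3)$3 \<noteq> c"
proof -
  have "{x::real^3. x$3 = c} \<in> null_sets lebesgue"
    using negligible_hyperplane[of "axis 3 1 :: real^3" c]
    by (simp add: negligible_iff_null_sets inner_axis' axis_eq_0_iff)
  moreover have "{x::real^3. x$3 = c} \<in> sets borel"
    by (intro borel_closed closed_Collect_eq continuous_intros)
  ultimately have "{x::real^3. x$3 = c} \<in> null_sets lborel" by (simp add: null_sets_completion_iff)
  from AE_not_in[OF this] show ?thesis by simp
qed

text \<open>\<open>fund\<close> contains both faces \<open>z = - pi\<close> and
  \<open>z = pi\<close> and so is not a tile; it differs from a half-open strip by a null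
  set.\<close>

lemma Int_on_fund_tile:
  assumes A: "tile A" and g: "z_periodic g" "continuous_on cyl g"
  shows "Int_on A g = Int_on fund g"
proof -
  let ?H = "{x \<in> cyl. - pi \<le> x$3 \<and> x$3 < - pi + 2 * pi}"
  have H: "?H \<in> sets borel" using tile_strip[of "- pi"] by (simp add: tile_def)
  have "Int_on A g = Int_on ?H g" by (rule tile_integral_eq[OF A tile_strip g])
  also have "\<dots> = Int_on fund g"
    unfolding set_lebesgue_integral_def
  proof (rule integral_cong_AE)
    show "AE x in lborel. indicat_real ?H x *\<^sub>R g x = indicat_real fund x *\<^sub>R g x"
      using AE_nth_neq[of pi] by eventually_elim (auto simp: fund_def split: split_indicator)
    show "(\<lambda>x. indicat_real fund x *\<^sub>R g x) \<in> borel_measurable lborel"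
      using borel_measurable_continuous_on_indicator[OF borel_compact[OF compact_fund]
          continuous_on_subset[OF g(2) fund_subset_cyl]] by simp
    show "(\<lambda>x. indicat_real ?H x *\<^sub>R g x) \<in> borel_measurable lborel"
      using borel_measurable_continuous_on_indicator[OF H continuous_on_subset[OF g(2)]] by auto
  qed
  finally show ?thesis .
qed

section \<open>The divergence theorem on the solid torus\<close>

lemma difference_quotient_tendsto:
  fixes g :: "'a::real_normed_vector \<Rightarrow> real"
  assumes g: "(g has_derivative D) (at x within S)"
    and h: "h \<longlonglongrightarrow> 0" "\<And>n. h n \<noteq> 0" and S: "\<forall>\<^sub>F n in sequentially. x + h n *\<^sub>R v \<in> S"
  shows "(\<lambda>n. (g (x + h n *\<^sub>R v) - g x) / h n) \<longlonglongrightarrow> D v"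
proof -
  define T where "T = {s. x + s *\<^sub>R v \<in> S}"
  have p: "((\<lambda>s. x + s *\<^sub>R v) has_derivative (\<lambda>s. s *\<^sub>R v)) (at 0 within T)"
    by (auto intro!: derivative_eq_intros)
  have "(g has_derivative D) (at (x + 0 *\<^sub>R v) within (\<lambda>s. x + s *\<^sub>R v) ` T)"
    by (rule has_derivative_subset[of _ _ _ S]) (use g in \<open>auto simp: T_def\<close>)
  from diff_chain_within[OF p this]
  have "((\<lambda>s. g (x + s *\<^sub>R v)) has_derivative (\<lambda>s. D (s *\<^sub>R v))) (at 0 within T)" by (simp add: o_def)
  moreover have "(\<lambda>s. D (s *\<^sub>R v)) = (*) (D v)"
    using has_derivative_linear[OF g] by (auto simp: linear_cmul)
  ultimately have "((\<lambda>s. g (x + s *\<^sub>R v)) has_real_derivative D v) (at 0 within T)"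
    by (simp add: has_field_derivative_def)
  then have lim: "((\<lambda>s. (g (x + s *\<^sub>R v) - g x) / s) \<longlongrightarrow> D v) (at 0 within T)"
    by (simp add: has_field_derivative_iff)
  have "filterlim h (at 0 within T) sequentially"
    unfolding filterlim_at using h S by (auto simp: T_def elim: eventually_mono)
  from filterlim_compose[OF lim this] show ?thesis .
qed

lemma step_seq: "(\<lambda>n. inverse (real (Suc n))) \<longlonglongrightarrow> 0" "inverse (real (Suc n)) \<noteq> 0"
  "0 < inverse (real (Suc n))" "inverse (real (Suc n)) \<le> 1"
  using LIMSEQ_inverse_real_of_nat by (auto simp: field_simps)

text \<open>A vertical translation turns one strip of height \<open>2 pi\<close> into another, and
  all of them are tiles.\<close>

lemma Int_on_fund_translate_vertical:
  assumes g: "z_periodic g" "continuous_on cyl g"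
  shows "Int_on fund (\<lambda>x. g (x + h *\<^sub>R e_z)) = Int_on fund g"
proof -
  let ?g = "\<lambda>x. g (x + h *\<^sub>R e_z)"
  have per: "z_periodic ?g"
    unfolding z_periodic_def
  proof
    fix x assume "x \<in> cyl"
    then have "g ((x + h *\<^sub>R e_z) + (2 * pi) *\<^sub>R e_z) = g (x + h *\<^sub>R e_z)"
      using g(1) cyl_shift unfolding z_periodic_def by blast
    then show "g (x + (2 * pi) *\<^sub>R e_z + h *\<^sub>R e_z) = g (x + h *\<^sub>R e_z)"
      by (simp only: add.assoc add.commute[of "h *\<^sub>R e_z"])
  qed
  have cont: "continuous_on cyl ?g"
    by (rule continuous_on_compose2[OF g(2)]) (auto intro!: continuous_intros)
  have "Int_on fund ?g = Int_on {x \<in> cyl. - h \<le> x$3 \<and> x$3 < - h + 2 * pi} ?g"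
    by (rule Int_on_fund_tile[OF tile_strip per cont, symmetric])
  also have "\<dots> = (LBINT x. indicator {x \<in> cyl. 0 \<le> x$3 \<and> x$3 < 0 + 2 * pi} (x + h *\<^sub>R e_z) *\<^sub>R g (x + h *\<^sub>R e_z))"
    unfolding set_lebesgue_integral_def
    by (rule Bochner_Integration.integral_cong) (auto split: split_indicator)
  also have "\<dots> = Int_on {x \<in> cyl. 0 \<le> x$3 \<and> x$3 < 0 + 2 * pi} g"
    unfolding set_lebesgue_integral_def
  proof (rule integral_translate)
    show "(\<lambda>x. indicat_real {x \<in> cyl. 0 \<le> x$3 \<and> x$3 < 0 + 2 * pi} x *\<^sub>R g x) \<in> borel_measurable borel"
      by (rule borel_measurable_continuous_on_indicator)
        (use tile_strip[of 0] continuous_on_subset[OF g(2)] in \<open>auto simp: tile_def\<close>)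
  qed
  also have "\<dots> = Int_on fund g" by (rule Int_on_fund_tile[OF tile_strip g])
  finally show ?thesis .
qed

text \<open>Difference quotients in direction \<open>z\<close> have integral 0 by translation
  invariance. They are dominated by the Lipschitz constant, so the limit may be taken under the
  integral.\<close>

lemma Int_on_fund_derivative_vertical:
  assumes g: "C1_torus g g'"
  shows "Int_on fund (\<lambda>x. g' x e_z) = 0"
proof -
  define h where "h n = inverse (real (Suc n))" for n
  have h: "h \<longlonglongrightarrow> 0" "\<And>n. h n \<noteq> 0" "\<And>n. 0 < h n" using step_seq by (auto simp: h_def[abs_def])
  obtain L where L: "0 < L" "\<And>x y. \<lbrakk>x \<in> cyl; y \<in> cyl\<rbrakk> \<Longrightarrow> norm (g x - g y) \<le> L * norm (x - y)"
    using C1_torus_lipschitz[OF g] by metis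
  have n1: "norm e_z = 1" by (simp add: e_z_axis norm_axis_1)
  have cg: "continuous_on cyl g" by (rule C1_torus_continuous[OF g])
  have csh: "continuous_on fund (\<lambda>x. g (x + c *\<^sub>R e_z))" for c
    by (rule continuous_on_compose2[OF cg]) (use fund_subset_cyl in \<open>auto intro!: continuous_intros\<close>)
  have zero: "Int_on fund (\<lambda>x. (g (x + h n *\<^sub>R e_z) - g x) / h n) = 0" for n
    using Int_on_fund_translate_vertical[OF C1_torusD(1)[OF g] cg, of "h n"]
      Int_on_diff[OF compact_fund csh csh[of 0], of "h n"] by simp
  have "(\<lambda>n. Int_on fund (\<lambda>x. (g (x + h n *\<^sub>R e_z) - g x) / h n)) \<longlonglongrightarrow> Int_on fund (\<lambda>x. g' x e_z)"
    unfolding set_lebesgue_integral_def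
  proof (rule integral_dominated_convergence[where w="\<lambda>x. indicator fund x *\<^sub>R L"])
    show "(\<lambda>x. indicat_real fund x *\<^sub>R g' x e_z) \<in> borel_measurable lborel"
      using borel_measurable_continuous_on_indicator[OF borel_compact[OF compact_fund]
          continuous_on_subset[OF C1_torusD(3)[OF g] fund_subset_cyl]] by simp
    show "(\<lambda>x. indicat_real fund x *\<^sub>R ((g (x + h n *\<^sub>R e_z) - g x) / h n)) \<in> borel_measurable lborel" for n
      using borel_measurable_continuous_on_indicator[OF borel_compact[OF compact_fund]
          continuous_on_divide[OF continuous_on_diff[OF csh csh[of 0]] continuous_on_const]] h(2) by auto
    show "integrable lborel (\<lambda>x. indicator fund x *\<^sub>R L)"
      by (rule borel_integrable_compact[OF compact_fund]) auto
    show "AE x in lborel. (\<lambda>n. indicat_real fund x *\<^sub>R ((g (x + h n *\<^sub>R e_z) - g x) / h n))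
        \<longlonglongrightarrow> indicat_real fund x *\<^sub>R g' x e_z"
    proof (rule AE_I2)
      fix x :: "real^3"
      show "(\<lambda>n. indicat_real fund x *\<^sub>R ((g (x + h n *\<^sub>R e_z) - g x) / h n)) \<longlonglongrightarrow> indicat_real fund x *\<^sub>R g' x e_z"
      proof (cases "x \<in> fund")
        case True
        then have "x \<in> cyl" using fund_subset_cyl by auto
        from difference_quotient_tendsto[OF C1_torusD(2)[OF g this] h(1,2), of e_z] True this
        show ?thesis by simp
      qed simp
    qed
    show "AE x in lborel. norm (indicat_real fund x *\<^sub>R ((g (x + h n *\<^sub>R e_z) - g x) / h n)) \<le> indicator fund x *\<^sub>R L" for n
    proof (rule AE_I2)
      fix x :: "real^3"
      show "norm (indicat_real fund x *\<^sub>R ((g (x + h n *\<^sub>R e_z) - g x) / h n)) \<le> indicator fund x *\<^sub>R L"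
      proof (cases "x \<in> fund")
        case True
        then have "x \<in> cyl" using fund_subset_cyl by auto
        then have "norm (g (x + h n *\<^sub>R e_z) - g x) \<le> L * h n"
          using L(2)[of "x + h n *\<^sub>R e_z" x] h(3)[of n] n1 by simp
        then show ?thesis using True h(3)[of n] by (simp add: divide_le_eq)
      qed simp
    qed
  qed
  then show ?thesis unfolding zero using LIMSEQ_unique tendsto_const by blast
qed

lemma boundary_crossing:
  assumes "x \<in> cyl" "y \<notin> cyl"
  obtains b where "rsq b = 1" "norm (x - b) \<le> norm (x - y)"
proof -
  have "continuous_on {0..1} (\<lambda>s. rsq (x + s *\<^sub>R (y - x)))"
    by (rule continuous_on_compose2[OF continuous_on_rsq[of UNIV]]) (auto intro!: continuous_intros)
  then obtain s where s: "0 \<le> s" "s \<le> 1" "rsq (x + s *\<^sub>R (y - x)) = 1"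
    using IVT'[of "\<lambda>s. rsq (x + s *\<^sub>R (y - x))" 0 1 1] assms by (auto simp: cyl_iff)
  moreover have "norm (x - (x + s *\<^sub>R (y - x))) \<le> norm (x - y)"
    using s mult_right_mono[of s 1 "norm (y - x)"] by (simp add: norm_minus_commute)
  ultimately show ?thesis using that by blast
qed

text \<open>Since \<open>g\<close> vanishes on the wall, its extension by 0 is still Lipschitz in
  horizontal directions, so translation invariance on the whole space and dominated convergence
  apply. Horizontal shifts preserve the condition on the height, hence the faces
  \<open>z = pi\<close> and \<open>z = - pi\<close> do no harm.\<close>

lemma Int_on_fund_derivative_horizontal:
  assumes g: "C1_torus g g'" and g0: "\<And>x. rsq x = 1 \<Longrightarrow> g x = 0" and v: "v $ 3 = 0"
  shows "Int_on fund (\<lambda>x. g' x v) = 0"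
proof -
  define h where "h n = inverse (real (Suc n))" for n
  have h: "h \<longlonglongrightarrow> 0" "\<And>n. h n \<noteq> 0" "\<And>n. 0 < h n" "\<And>n. h n \<le> 1"
    using step_seq by (auto simp: h_def[abs_def])
  obtain L where L: "0 < L" "\<And>x y. \<lbrakk>x \<in> cyl; y \<in> cyl\<rbrakk> \<Longrightarrow> norm (g x - g y) \<le> L * norm (x - y)"
    using C1_torus_lipschitz[OF g] by metis
  have cg: "continuous_on cyl g" by (rule C1_torus_continuous[OF g])
  define G where "G x = indicator fund x *\<^sub>R g x" for x
  have mG: "G \<in> borel_measurable borel"
    using borel_measurable_continuous_on_indicator[OF borel_compact[OF compact_fund]
        continuous_on_subset[OF cg fund_subset_cyl]] by (simp add: G_def[abs_def])
  have iG: "integrable lborel G"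
    using set_integrable_compact[OF compact_fund continuous_on_subset[OF cg fund_subset_cyl]]
    by (simp add: G_def[abs_def] set_integrable_def)
  have iGs: "integrable lborel (\<lambda>x. G (x + c))" for c
  proof -
    have "integrable (distr lborel borel ((+) c)) G" using iG by (simp add: lborel_distr_plus)
    then show ?thesis using mG by (subst (asm) integrable_distr_eq) (auto simp: add.commute)
  qed
  have zero: "(LBINT x. (G (x + h n *\<^sub>R v) - G x) / h n) = 0" for n
    using integral_translate[OF mG, of "h n *\<^sub>R v"] Bochner_Integration.integral_diff[OF iGs iG] by simp
  \<comment> \<open>If \<open>y\<close> lies outside the cylinder, the segment from \<open>x\<close>
    meets the wall at a point \<open>b\<close> with \<open>g b = 0\<close>, which is no farther from
    \<open>x\<close> than \<open>y\<close> is.\<close>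
  have half: "norm (G y - G x) \<le> L * norm (x - y)" if xy: "x \<in> cyl" "x $ 3 = y $ 3" for x y
  proof (cases "y \<in> cyl")
    case True
    then have "norm (g y - g x) \<le> L * norm (x - y)" using xy L(2)[of y x] by (simp add: norm_minus_commute)
    then show ?thesis using xy True L(1) by (cases "\<bar>x$3\<bar> \<le> pi") (simp_all add: G_def fund_iff)
  next
    case False
    obtain b where b: "rsq b = 1" "norm (x - b) \<le> norm (x - y)" using boundary_crossing[OF xy(1) False] .
    have "norm (G y - G x) \<le> norm (g x - g b)"
      using False g0[OF b(1)] by (auto simp: G_def fund_def split: split_indicator)
    also have "\<dots> \<le> L * norm (x - b)" using L(2) xy(1) b(1) by (simp add: cyl_iff)
    also have "\<dots> \<le> L * norm (x - y)" using L b by simp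
    finally show ?thesis .
  qed
  have lip: "norm (G y - G x) \<le> L * norm (x - y)" if "x $ 3 = y $ 3" for x y
  proof -
    consider "x \<in> cyl" | "y \<in> cyl" | "x \<notin> cyl" "y \<notin> cyl" by blast
    then show ?thesis
    proof cases
      case 1 then show ?thesis using half that by blast
    next
      case 2 then show ?thesis using half[of y x] that by (simp add: norm_minus_commute)
    next
      case 3 then show ?thesis using L(1) by (simp add: G_def fund_def)
    qed
  qed
  obtain R where R: "\<And>x. x \<in> fund \<Longrightarrow> norm x \<le> R"
    using compact_imp_bounded[OF compact_fund] by (auto simp: bounded_iff)
  \<comment> \<open>The steps \<open>h n\<close> are at most 1, so off this ball both
    \<open>x\<close> and the shifted point miss \<open>fund\<close>.\<close>
  let ?B = "cball (0::real^3) (R + norm v)"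
  have "(\<lambda>n. LBINT x. (G (x + h n *\<^sub>R v) - G x) / h n) \<longlonglongrightarrow> Int_on fund (\<lambda>x. g' x v)"
    unfolding set_lebesgue_integral_def
  proof (rule integral_dominated_convergence[where w="\<lambda>x. indicator ?B x *\<^sub>R (L * norm v)"])
    show "(\<lambda>x. indicat_real fund x *\<^sub>R g' x v) \<in> borel_measurable lborel"
      using borel_measurable_continuous_on_indicator[OF borel_compact[OF compact_fund]
          continuous_on_subset[OF C1_torusD(3)[OF g] fund_subset_cyl]] by simp
    show "(\<lambda>x. (G (x + h n *\<^sub>R v) - G x) / h n) \<in> borel_measurable lborel" for n
      using mG by measurable
    show "integrable lborel (\<lambda>x. indicator ?B x *\<^sub>R (L * norm v))"
      by (rule borel_integrable_compact) auto
    show "AE x in lborel. (\<lambda>n. (G (x + h n *\<^sub>R v) - G x) / h n) \<longlonglongrightarrow> indicat_real fund x *\<^sub>R g' x v"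
      using AE_rsq_neq_1
    proof eventually_elim
      fix x :: "real^3" assume "rsq x \<noteq> 1"
      have lim: "(\<lambda>n. x + h n *\<^sub>R v) \<longlonglongrightarrow> x"
        using tendsto_add[OF tendsto_const tendsto_scaleR[OF h(1) tendsto_const]] by fastforce
      have strip: "\<bar>(x + h n *\<^sub>R v)$3\<bar> \<le> pi \<longleftrightarrow> \<bar>x$3\<bar> \<le> pi" for n using v by simp
      consider "rsq x < 1" "\<bar>x$3\<bar> \<le> pi" | "rsq x > 1" | "\<bar>x$3\<bar> > pi" using \<open>rsq x \<noteq> 1\<close> by linarith
      then show "(\<lambda>n. (G (x + h n *\<^sub>R v) - G x) / h n) \<longlonglongrightarrow> indicat_real fund x *\<^sub>R g' x v"
      proof cases
        case 1
        then have x: "x \<in> fund" "x \<in> cyl" by (auto simp: fund_iff cyl_iff)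
        have "\<forall>\<^sub>F n in sequentially. rsq (x + h n *\<^sub>R v) < 1"
          using topological_tendstoD[OF lim open_rsq_less] 1 by simp
        then have ev: "\<forall>\<^sub>F n in sequentially. x + h n *\<^sub>R v \<in> cyl"
          by eventually_elim (simp add: cyl_iff)
        have "(\<lambda>n. (g (x + h n *\<^sub>R v) - g x) / h n) \<longlonglongrightarrow> g' x v"
          by (rule difference_quotient_tendsto[OF C1_torusD(2)[OF g x(2)] h(1,2) ev])
        moreover have "\<forall>\<^sub>F n in sequentially. (g (x + h n *\<^sub>R v) - g x) / h n = (G (x + h n *\<^sub>R v) - G x) / h n"
          using ev by eventually_elim (use x 1 strip in \<open>simp add: G_def fund_iff\<close>)
        ultimately show ?thesis using x(1) by (simp add: filterlim_cong)
      next
        case 2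
        have "open {x. 1 < rsq x}" by (intro open_Collect_less continuous_intros)
        from topological_tendstoD[OF lim this] 2
        have "\<forall>\<^sub>F n in sequentially. 1 < rsq (x + h n *\<^sub>R v)" by simp
        then have "\<forall>\<^sub>F n in sequentially. (G (x + h n *\<^sub>R v) - G x) / h n = 0"
          by eventually_elim (use 2 in \<open>simp add: G_def fund_iff cyl_iff\<close>)
        from tendsto_eventually[OF this] show ?thesis using 2 by (simp add: fund_iff cyl_iff)
      next
        case 3
        then have "(\<lambda>n. (G (x + h n *\<^sub>R v) - G x) / h n) = (\<lambda>n. 0)"
          using strip by (auto simp: G_def fund_iff fun_eq_iff)
        then show ?thesis using 3 by (simp add: fund_iff)
      qed
    qed
    show "AE x in lborel. norm ((G (x + h n *\<^sub>R v) - G x) / h n) \<le> indicator ?B x *\<^sub>R (L * norm v)" for n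
    proof (rule AE_I2)
      fix x :: "real^3"
      show "norm ((G (x + h n *\<^sub>R v) - G x) / h n) \<le> indicator ?B x *\<^sub>R (L * norm v)"
      proof (cases "x \<in> ?B")
        case True
        have "norm (G (x + h n *\<^sub>R v) - G x) \<le> L * (h n * norm v)"
          using lip[of x "x + h n *\<^sub>R v"] v h(3)[of n] by simp
        then show ?thesis using True h(3)[of n] by (simp add: divide_le_eq mult_ac)
      next
        case False
        have "norm x \<le> norm (x + h n *\<^sub>R v) + norm (h n *\<^sub>R v)"
          using norm_triangle_ineq4[of "x + h n *\<^sub>R v" "h n *\<^sub>R v"] by simp
        also have "norm (h n *\<^sub>R v) \<le> 1 * norm v" using h(3,4)[of n] by (simp add: mult_left_le_one_le)
        finally have "R < norm (x + h n *\<^sub>R v)" using False by simp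
        moreover have "R < norm x"
        proof -
          have "R + norm v < norm x" using False by simp
          moreover have "0 \<le> norm v" by simp
          ultimately show ?thesis by linarith
        qed
        ultimately have "x \<notin> fund" "x + h n *\<^sub>R v \<notin> fund" using R by fastforce+
        then show ?thesis using False by (simp add: G_def)
      qed
    qed
  qed
  then show ?thesis unfolding zero using LIMSEQ_unique tendsto_const by blast
qed

lemma tangent_bdry_rsq:
  assumes F: "tangent_bdry F" and x: "rsq x = 1"
  shows "x$1 * F x $ 1 + x$2 * F x $ 2 = 0"
proof -
  have "x \<in> cyl" using x by (simp add: cyl_iff)
  then obtain r \<theta> where r: "r \<in> {0..1}" "x = cylpt r \<theta> (x$3)" by (rule cyl_cylpt)
  then have "r\<^sup>2 = 1" using x rsq_cylpt by metis
  then have "r = 1" using r(1) by (simp add: power2_eq_1_iff)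
  then have x1: "x = cylpt 1 \<theta> (x$3)" using r by simp
  then have "F x \<bullet> e_r \<theta> = 0" using F unfolding tangent_bdry_def by metis
  moreover have "x$1 = cos \<theta>" "x$2 = sin \<theta>" using x1 by (metis cylpt_nth mult_1)+
  ultimately show ?thesis by (simp add: inner_3 mult.commute)
qed

text \<open>
  \<open>F\<close> is multiplied by the cutoff \<open>1 - r\<^sup>2\<^sup>n\<close>, which vanishes on the boundary.  The error
  \<open>2 n r\<^sup>2\<^sup>n\<^sup>-\<^sup>2 (x F\<^sub>1 + y F\<^sub>2)\<close> is dominated because the tangency gives
  \<open>x F\<^sub>1 + y F\<^sub>2 = O(1 - r\<^sup>2)\<close>.
\<close>

lemma divergence_theorem_torus:
  assumes F: "C1_torus F F'" and tan: "tangent_bdry F"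
  shows "Int_on fund (\<lambda>x. \<Sum>i\<in>UNIV. F' x (axis i 1) $ i) = 0"
proof -
  define k where "k x = x$1 * F x $ 1 + x$2 * F x $ 2" for x
  define dv where "dv x = (\<Sum>i\<in>UNIV. F' x (axis i 1) $ i)" for x
  obtain B where B: "0 < B" "\<And>x v. x \<in> cyl \<Longrightarrow> norm (F' x v) \<le> B * norm v"
    using C1_torus_derivative_bounded[OF F] by metis
  obtain L where L: "0 < L" "\<And>x y. \<lbrakk>x \<in> cyl; y \<in> cyl\<rbrakk> \<Longrightarrow> norm (k x - k y) \<le> L * norm (x - y)"
  proof -
    have lin: "C1_torus (\<lambda>x. (x$1, x$2)) (\<lambda>x v. (v$1, v$2))"
      unfolding C1_torus_def
      by (auto simp: z_periodic_def intro!: derivative_eq_intros continuous_intros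
          bounded_linear.has_derivative[OF bounded_linear_vec_nth])
    have "C1_torus (\<lambda>x. (F x $ 1, F x $ 2)) (\<lambda>x v. (F' x v $ 1, F' x v $ 2))"
      using C1_torus_nth[OF F, of 1] C1_torus_nth[OF F, of 2]
      by (auto simp: C1_torus_def z_periodic_def intro!: has_derivative_Pair continuous_on_Pair)
    from C1_torus_inner[OF lin this] have "C1_torus k (\<lambda>x v. (x$1, x$2) \<bullet> (F' x v $ 1, F' x v $ 2) + (v$1, v$2) \<bullet> (F x $ 1, F x $ 2))"
      by (simp add: k_def[abs_def])
    from C1_torus_lipschitz[OF this] that show ?thesis by metis
  qed
  have k0: "k x = 0" if "rsq x = 1" for x using tangent_bdry_rsq[OF tan that] by (simp add: k_def)
  \<comment> \<open>\<open>x\<close> is compared with its radial projection \<open>y\<close> to the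
    wall, where \<open>k\<close> vanishes. Points of the axis have no projection, but there
    \<open>k\<close> is 0.\<close>
  have kb: "\<bar>k x\<bar> \<le> L * (1 - rsq x)" if x: "x \<in> cyl" for x
  proof (cases "rsq x = 0")
    case True
    then have "x$1 = 0" "x$2 = 0" by (simp_all add: rsq_def sum_power2_eq_zero_iff)
    then show ?thesis using True L by (simp add: k_def)
  next
    case False
    define q where "q = sqrt (rsq x)"
    have q: "0 < q" "q \<le> 1" "q\<^sup>2 = rsq x" using False x rsq_nonneg[of x] by (simp_all add: q_def cyl_iff del: rsq_nonneg)
    define y :: "real^3" where "y = vector [x$1 / q, x$2 / q, x$3]"
    have "rsq y = rsq x / q\<^sup>2" by (simp add: y_def rsq_def power_divide add_divide_distrib)
    then have "rsq y = 1" using q False by simp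
    moreover have "norm (x - y) = 1 - q"
    proof -
      have "x - y = (1 - 1/q) *\<^sub>R vector [x$1, x$2, 0]"
        by (simp add: vec_eq_iff forall_3 y_def field_simps)
      moreover have "norm (vector [x$1, x$2, 0] :: real^3) = q"
        by (simp add: norm_eq_sqrt_inner inner_3 q_def rsq_def power2_eq_square)
      ultimately have "norm (x - y) = \<bar>1 - 1/q\<bar> * q" by simp
      also have "\<dots> = 1 - q" using q by (simp add: abs_if field_simps)
      finally show ?thesis .
    qed
    moreover have "1 - q \<le> 1 - rsq x" using q by (simp flip: q(3)) (simp add: power2_eq_square mult_left_le)
    ultimately have "\<bar>k x\<bar> \<le> L * (1 - q)" using L(2)[OF x, of y] k0[of y] by (simp add: cyl_iff)
    also have "\<dots> \<le> L * (1 - rsq x)" using \<open>1 - q \<le> 1 - rsq x\<close> L(1) by simp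
    finally show ?thesis .
  qed
  \<comment> \<open>\<open>n s^(n-1)\<close> is at most the geometric sum
    \<open>1 + s + ... + s^(n-1)\<close>, whose product with \<open>1 - s\<close> is
    \<open>1 - s^n\<close>. With \<open>kb\<close> this dominates the cutoff error uniformly in
    \<open>n\<close>.\<close>
  have geo: "real n * s ^ (n - 1) * (1 - s) \<le> 1" if "0 \<le> s" "s \<le> 1" for s :: real and n
  proof -
    have "real n * s ^ (n - 1) \<le> (\<Sum>i<n. s ^ i)"
    proof -
      have "(\<Sum>i<n. s ^ (n - 1)) \<le> (\<Sum>i<n. s ^ i)"
        using that by (intro sum_mono power_decreasing) auto
      then show ?thesis by simp
    qed
    then have "real n * s ^ (n - 1) * (1 - s) \<le> (\<Sum>i<n. s ^ i) * (1 - s)"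
      using that by (intro mult_right_mono) auto
    also have "\<dots> = 1 - s ^ n" using one_diff_power_eq[of s n] by (simp add: mult.commute)
    also have "\<dots> \<le> 1" using that by simp
    finally show ?thesis .
  qed
  \<comment> \<open>The divergence of \<open>(1 - rsq^n) F\<close>.\<close>
  define w where "w n x = (1 - rsq x ^ n) * dv x - 2 * (real n * rsq x ^ (n - 1)) * k x" for n x
  have zero: "Int_on fund (w n) = 0" for n
  proof -
    define \<phi> where "\<phi> x = 1 - rsq x ^ n" for x
    define \<phi>' where "\<phi>' x v = 0 - real n * rsq x ^ (n - 1) * (2 * (x$1 * v$1 + x$2 * v$2))" for x v :: "real^3"
    have \<phi>: "C1_torus \<phi> \<phi>'"
      unfolding \<phi>_def[abs_def] \<phi>'_def[abs_def] by (rule C1_torus_diff[OF C1_torus_const C1_torus_rsq_power])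
    define g' where "g' i x v = \<phi> x * F' x v $ i + \<phi>' x v * F x $ i" for i :: 3 and x v
    have gi: "C1_torus (\<lambda>x. \<phi> x * F x $ i) (g' i)" for i
      unfolding g'_def[abs_def] by (rule C1_torus_mult[OF \<phi> C1_torus_nth[OF F]])
    have c: "continuous_on fund (\<lambda>x. g' i x v)" for i v
      using C1_torusD(3)[OF gi] continuous_on_subset fund_subset_cyl by blast
    have "Int_on fund (\<lambda>x. g' 1 x (axis 1 1)) = 0" "Int_on fund (\<lambda>x. g' 2 x (axis 2 1)) = 0"
      by (rule Int_on_fund_derivative_horizontal[OF gi]; simp add: \<phi>_def)+
    moreover have "Int_on fund (\<lambda>x. g' 3 x (axis 3 1)) = 0"
      using Int_on_fund_derivative_vertical[OF gi] by (simp add: e_z_axis)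
    moreover have "Int_on fund (\<lambda>x. g' 1 x (axis 1 1) + g' 2 x (axis 2 1) + g' 3 x (axis 3 1))
       = Int_on fund (\<lambda>x. g' 1 x (axis 1 1)) + Int_on fund (\<lambda>x. g' 2 x (axis 2 1)) + Int_on fund (\<lambda>x. g' 3 x (axis 3 1))"
      by (simp add: Int_on_add[OF compact_fund] c continuous_on_add)
    moreover have "w n x = g' 1 x (axis 1 1) + g' 2 x (axis 2 1) + g' 3 x (axis 3 1)" for x
      by (simp add: w_def g'_def \<phi>_def \<phi>'_def dv_def k_def sum_3 algebra_simps)
    ultimately show ?thesis by (simp add: w_def[abs_def])
  qed
  have dvb: "\<bar>dv x\<bar> \<le> 3 * B" if "x \<in> cyl" for x
  proof -
    have "\<bar>F' x (axis i 1) $ i\<bar> \<le> B" for i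
      using component_le_norm_cart[of "F' x (axis i 1)" i] B(2)[OF that, of "axis i 1"] by (simp add: norm_axis_1)
    from this[of 1] this[of 2] this[of 3] show ?thesis unfolding dv_def sum_3 by linarith
  qed
  have cF: "continuous_on fund F" using C1_torus_continuous[OF F] continuous_on_subset fund_subset_cyl by blast
  have cdv: "continuous_on fund dv"
    unfolding dv_def[abs_def]
    by (intro continuous_intros continuous_on_subset[OF C1_torusD(3)[OF F] fund_subset_cyl])
  have cw: "continuous_on fund (w n)" for n
    unfolding w_def[abs_def] k_def by (intro continuous_intros cdv cF)
  have "(\<lambda>n. Int_on fund (w n)) \<longlonglongrightarrow> Int_on fund dv"
    unfolding set_lebesgue_integral_def
  proof (rule integral_dominated_convergence[where w="\<lambda>x. indicator fund x *\<^sub>R (3 * B + 2 * L)"])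
    show "(\<lambda>x. indicat_real fund x *\<^sub>R dv x) \<in> borel_measurable lborel"
      using borel_measurable_continuous_on_indicator[OF borel_compact[OF compact_fund] cdv] by simp
    show "(\<lambda>x. indicat_real fund x *\<^sub>R w n x) \<in> borel_measurable lborel" for n
      using borel_measurable_continuous_on_indicator[OF borel_compact[OF compact_fund] cw] by simp
    show "integrable lborel (\<lambda>x. indicator fund x *\<^sub>R (3 * B + 2 * L))"
      by (rule borel_integrable_compact[OF compact_fund]) auto
    show "AE x in lborel. (\<lambda>n. indicat_real fund x *\<^sub>R w n x) \<longlonglongrightarrow> indicat_real fund x *\<^sub>R dv x"
      using AE_rsq_neq_1
    proof eventually_elim
      fix x :: "real^3" assume n1: "rsq x \<noteq> 1"
      show "(\<lambda>n. indicat_real fund x *\<^sub>R w n x) \<longlonglongrightarrow> indicat_real fund x *\<^sub>R dv x"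
      proof (cases "x \<in> fund")
        case True
        then have s: "\<bar>rsq x\<bar> < 1" using n1 by (auto simp: fund_iff cyl_iff)
        have p: "(\<lambda>n. rsq x ^ n) \<longlonglongrightarrow> 0" using LIMSEQ_power_zero[of "rsq x"] s by simp
        have np: "(\<lambda>n. real n * rsq x ^ (n - 1)) \<longlonglongrightarrow> 0"
        proof -
          have "(\<lambda>n. real n * rsq x ^ n) \<longlonglongrightarrow> 0" using powser_times_n_limit_0[of "rsq x"] s by simp
          from tendsto_add[OF this p]
          have "(\<lambda>n. real (Suc n) * rsq x ^ (Suc n - 1)) \<longlonglongrightarrow> 0" by (simp add: algebra_simps)
          then show ?thesis by (rule LIMSEQ_imp_Suc)
        qed
        have "(\<lambda>n. w n x) \<longlonglongrightarrow> (1 - 0) * dv x - 2 * 0 * k x"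
          unfolding w_def by (intro tendsto_intros p np)
        then show ?thesis using True by simp
      qed simp
    qed
    show "AE x in lborel. norm (indicat_real fund x *\<^sub>R w n x) \<le> indicator fund x *\<^sub>R (3 * B + 2 * L)" for n
    proof (rule AE_I2)
      fix x :: "real^3"
      show "norm (indicat_real fund x *\<^sub>R w n x) \<le> indicator fund x *\<^sub>R (3 * B + 2 * L)"
      proof (cases "x \<in> fund")
        case True
        then have x: "x \<in> cyl" "rsq x \<le> 1" using fund_subset_cyl by (auto simp: cyl_iff)
        have "\<bar>1 - rsq x ^ n\<bar> \<le> 1" using x by (simp add: power_le_one)
        then have 1: "\<bar>(1 - rsq x ^ n) * dv x\<bar> \<le> 1 * (3 * B)"
          unfolding abs_mult using dvb[OF x(1)] by (intro mult_mono) auto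
        have "\<bar>real n * rsq x ^ (n - 1) * k x\<bar> \<le> real n * rsq x ^ (n - 1) * (L * (1 - rsq x))"
          unfolding abs_mult using kb[OF x(1)] by (intro mult_mono) (auto simp: abs_mult)
        also have "\<dots> = L * (real n * rsq x ^ (n - 1) * (1 - rsq x))" by simp
        also have "\<dots> \<le> L * 1" using geo[of "rsq x" n] x L(1) by (intro mult_left_mono) auto
        finally have 2: "\<bar>real n * rsq x ^ (n - 1) * k x\<bar> \<le> L" by simp
        have "w n x = (1 - rsq x ^ n) * dv x - 2 * (real n * rsq x ^ (n - 1) * k x)" by (simp add: w_def)
        then have "\<bar>w n x\<bar> \<le> 3 * B + 2 * L" using 1 2 by linarith
        then show ?thesis using True by simp
      qed simp
    qed
  qed
  then have "(\<lambda>n::nat. 0::real) \<longlonglongrightarrow> Int_on fund dv" by (simp add: zero)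
  then show ?thesis using LIMSEQ_unique tendsto_const unfolding dv_def[abs_def] by blast
qed

text \<open>A lift of a diffeomorphism of the torus conjugates the deck translation to itself or to
  its inverse, so it permutes the orbits and carries fundamental domains to fundamental
  domains.\<close>

lemma tile_diffeo_image:
  assumes \<phi>: "\<phi> \<in> Diff_mu"
  shows "tile (\<phi> ` {x \<in> cyl. - pi \<le> x$3 \<and> x$3 < - pi + 2 * pi})" (is "tile (\<phi> ` ?H)")
proof -
  have bij: "bij_betw \<phi> cyl cyl" and sm: "smooth_on \<phi> cyl" using \<phi> by (auto simp: Diff_mu_def)
  have inj: "inj_on \<phi> cyl" and im: "\<phi> ` cyl = cyl" using bij by (auto simp: bij_betw_def)
  obtain \<kappa> :: real where \<kappa>: "\<kappa> \<in> {1, -1}" "\<And>x. x \<in> cyl \<Longrightarrow> \<phi> (x + (2 * pi) *\<^sub>R e_z) = \<phi> x + (2 * pi * \<kappa>) *\<^sub>R e_z"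
    using \<phi> unfolding Diff_mu_def by blast
  obtain j :: int where j: "j * j = 1" "\<kappa> = of_int j" using \<kappa>(1) by (force intro: that[of 1] that[of "-1"])
  have H: "?H \<subseteq> fund" by (auto simp: fund_def)
  have cont: "continuous_on cyl \<phi>" by (rule smooth_on_continuous[OF sm])
  have step: "\<phi> (x + (2 * pi * of_int k) *\<^sub>R e_z) = \<phi> x + (2 * pi * of_int (k * j)) *\<^sub>R e_z" if x: "x \<in> cyl" for x k
  proof -
    \<comment> \<open>Subtracting the linear winding part leaves a periodic map, so that
      \<open>z_periodic_int\<close> gives all integer shifts at once.\<close>
    define \<psi> where "\<psi> x = \<phi> x - (\<kappa> * x$3) *\<^sub>R e_z" for x
    have "z_periodic \<psi>" using \<kappa>(2) by (auto simp: z_periodic_def \<psi>_def algebra_simps)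
    from z_periodic_int[OF this x, of k] show ?thesis
      using j(2) by (auto simp: \<psi>_def algebra_simps)
  qed
  \<comment> \<open>A difference of two compact sets, which makes the image of the half-open strip
    Borel.\<close>
  have eq: "\<phi> ` ?H = \<phi> ` fund - \<phi> ` {x \<in> cyl. pi \<le> x$3 \<and> x$3 \<le> pi}"
    using inj by (subst inj_on_image_set_diff[symmetric, of \<phi> cyl]) (auto simp: fund_def)
  have c1: "compact (\<phi> ` fund)"
    using compact_continuous_image[OF continuous_on_subset[OF cont fund_subset_cyl] compact_fund] .
  have c2: "compact (\<phi> ` {x \<in> cyl. pi \<le> x$3 \<and> x$3 \<le> pi})"
  proof (rule compact_continuous_image)
    show "continuous_on {x \<in> cyl. pi \<le> x$3 \<and> x$3 \<le> pi} \<phi>" by (rule continuous_on_subset[OF cont]) auto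
    have "closed {x::real^3. pi \<le> x$3 \<and> x$3 \<le> pi}"
      by (intro closed_Collect_conj closed_Collect_le continuous_intros)
    from compact_Int_closed[OF compact_fund this]
    show "compact {x \<in> cyl. pi \<le> x$3 \<and> x$3 \<le> pi}"
      by (rule back_subst[of compact]) (auto simp: fund_def)
  qed
  have borel: "\<phi> ` ?H \<in> sets borel" unfolding eq by (intro sets.Diff borel_compact c1 c2)
  have "bounded (\<phi> ` ?H)"
    using bounded_subset[OF compact_imp_bounded[OF c1] image_mono[OF H]] .
  moreover have "\<phi> ` ?H \<subseteq> cyl" using im H fund_subset_cyl by blast
  moreover have "\<exists>!k::int. y + (2 * pi * of_int k) *\<^sub>R e_z \<in> \<phi> ` ?H" if y: "y \<in> cyl" for y
  proof -
    have "y \<in> \<phi> ` cyl" using y im by simp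
    then obtain x where x: "x \<in> cyl" "\<phi> x = y" by auto
    have "\<exists>!k::int. x + (2 * pi * of_int k) *\<^sub>R e_z \<in> ?H" using tile_strip[of "- pi"] x(1) unfolding tile_def by blast
    then obtain k where k: "x + (2 * pi * of_int k) *\<^sub>R e_z \<in> ?H"
      "\<And>l. x + (2 * pi * of_int l) *\<^sub>R e_z \<in> ?H \<Longrightarrow> l = k" unfolding Ex1_def by blast
    show ?thesis
    proof
      show "y + (2 * pi * of_int (k * j)) *\<^sub>R e_z \<in> \<phi> ` ?H"
        using imageI[OF k(1), of \<phi>] step[OF x(1), of k] x(2) by simp
      fix l assume "y + (2 * pi * of_int l) *\<^sub>R e_z \<in> \<phi> ` ?H"
      then obtain x' where x': "x' \<in> ?H" "\<phi> x' = y + (2 * pi * of_int l) *\<^sub>R e_z" by force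
      \<comment> \<open>\<open>j\<close> is 1 or -1 and hence its own inverse: the index of the
        shift in the image is \<open>j\<close> times the index in the source.\<close>
      have "l * j * j = l" using j(1) by (simp add: mult.assoc)
      then have "\<phi> (x + (2 * pi * of_int (l * j)) *\<^sub>R e_z) = \<phi> x'" using step[OF x(1), of "l * j"] x(2) x'(2) by metis
      then have "x + (2 * pi * of_int (l * j)) *\<^sub>R e_z = x'"
        using inj x'(1) x(1) by (simp add: inj_on_eq_iff)
      then have "l * j = k" using k(2)[of "l * j"] x'(1) by simp
      then show "l = k * j" using \<open>l * j * j = l\<close> by simp
    qed
  qed
  ultimately show ?thesis using borel unfolding tile_def by blast
qed

text \<open>Change of variables with Jacobian 1 on the half-open strip, where \<open>\<phi>\<close>
  is injective; the image is another tile and the integral of \<open>g\<close> over it is the one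
  over \<open>fund\<close>.\<close>

lemma Int_on_fund_volume_preserving:
  fixes g :: "real^3 \<Rightarrow> real"
  assumes \<phi>: "\<phi> \<in> Diff_mu" and g: "z_periodic g" "continuous_on cyl g"
  shows "Int_on fund (\<lambda>x. g (\<phi> x)) = Int_on fund g"
proof -
  let ?H = "{x \<in> cyl. - pi \<le> x$3 \<and> x$3 < - pi + 2 * pi}"
  have bij: "bij_betw \<phi> cyl cyl" and sm: "smooth_on \<phi> cyl" using \<phi> by (auto simp: Diff_mu_def)
  have inj: "inj_on \<phi> cyl" and im: "\<phi> ` cyl = cyl" using bij by (auto simp: bij_betw_def)
  have H: "?H \<subseteq> fund" "?H \<subseteq> cyl" by (auto simp: fund_def)
  have tile: "tile ?H" by (rule tile_strip)
  then have Hb: "?H \<in> sets borel" by (simp add: tile_def)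
  let ?D = "\<lambda>x. frechet_derivative \<phi> (at x within cyl)"
  have det: "det (matrix (?D x)) = 1" if "x \<in> cyl" for x using \<phi> that by (auto simp: Diff_mu_def)
  have der: "(\<phi> has_derivative ?D x) (at x within ?H)" if "x \<in> ?H" for x
    by (rule has_derivative_subset[OF smooth_on_has_derivative[OF sm] H(2)]) (use that in auto)
  have ti: "tile (\<phi> ` ?H)" by (rule tile_diffeo_image[OF \<phi>])
  have iA: "set_integrable lborel A g" if A: "tile A" for A
  proof -
    obtain M where M: "0 < M" "\<And>x. x \<in> cyl \<Longrightarrow> norm (g x) \<le> M"
      using z_periodic_bounded[OF g(1) continuous_on_subset[OF g(2) fund_subset_cyl]] by metis
    obtain R where R: "\<And>x. x \<in> A \<Longrightarrow> norm x \<le> R" using A unfolding tile_def bounded_iff by blast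
    show ?thesis
      unfolding set_integrable_def
    proof (rule integrable_bounded_support[of _ M R])
      show "(\<lambda>x. indicat_real A x *\<^sub>R g x) \<in> borel_measurable borel"
        by (rule borel_measurable_continuous_on_indicator) (use A continuous_on_subset[OF g(2)] in \<open>auto simp: tile_def\<close>)
      show "\<bar>indicat_real A x *\<^sub>R g x\<bar> \<le> M" for x
        using M A by (auto simp: tile_def split: split_indicator)
      show "indicat_real A x *\<^sub>R g x = 0" if "R < norm x" for x
        using R[of x] that by (auto split: split_indicator)
    qed
  qed
  have gabs: "g absolutely_integrable_on (\<phi> ` ?H)"
  proof -
    have "(\<lambda>x. indicat_real (\<phi> ` ?H) x *\<^sub>R g x) \<in> borel_measurable lborel"
      using borel_measurable_integrable[OF iA[OF ti, unfolded set_integrable_def]] .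
    from integrable_completion[OF this] show ?thesis
      using iA[OF ti] by (simp add: set_integrable_def)
  qed
  have cg: "continuous_on cyl (\<lambda>x. g (\<phi> x))"
    by (rule continuous_on_compose2[OF g(2) smooth_on_continuous[OF sm]]) (use im in auto)
  let ?b = "integral (\<phi> ` ?H) g"
  \<comment> \<open>The change-of-variables theorem concerns integrands with values in
    \<open>real^'n\<close>, so \<open>g\<close> passes through \<open>real^1\<close>.\<close>
  have "(\<lambda>x. vec (g x) :: real^1) absolutely_integrable_on (\<phi> ` ?H) \<and> integral (\<phi> ` ?H) (\<lambda>x. vec (g x) :: real^1) = vec ?b"
    using gabs by (simp add: absolutely_integrable_on_1_iff integral_on_1_eq)
  then have "integral ?H (\<lambda>x. \<bar>det (matrix (?D x))\<bar> *\<^sub>R (vec (g (\<phi> x)) :: real^1)) = vec ?b"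
    using has_absolute_integral_change_of_variables[OF _ der inj_on_subset[OF inj H(2)], of "\<lambda>y. vec (g y) :: real^1" "vec ?b"] Hb
    by auto
  then have "integral ?H (\<lambda>x. \<bar>det (matrix (?D x))\<bar> * g (\<phi> x)) = ?b"
    by (simp add: integral_on_1_eq)
  moreover have "integral ?H (\<lambda>x. \<bar>det (matrix (?D x))\<bar> * g (\<phi> x)) = integral ?H (\<lambda>x. g (\<phi> x))"
    by (rule Henstock_Kurzweil_Integration.integral_cong) (use det H in auto)
  ultimately have hk: "integral ?H (\<lambda>x. g (\<phi> x)) = integral (\<phi> ` ?H) g" by simp
  have iH: "set_integrable lborel ?H (\<lambda>x. g (\<phi> x))"
    by (rule set_integrable_subset[OF set_integrable_compact[OF compact_fund continuous_on_subset[OF cg fund_subset_cyl]] _ H(1)])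
      (use Hb in simp)
  have "Int_on fund (\<lambda>x. g (\<phi> x)) = Int_on ?H (\<lambda>x. g (\<phi> x))"
    unfolding set_lebesgue_integral_def
  proof (rule integral_cong_AE)
    show "AE x in lborel. indicat_real fund x *\<^sub>R g (\<phi> x) = indicat_real ?H x *\<^sub>R g (\<phi> x)"
      using AE_nth_neq[of pi] by eventually_elim (auto simp: fund_def split: split_indicator)
    show "(\<lambda>x. indicat_real fund x *\<^sub>R g (\<phi> x)) \<in> borel_measurable lborel"
      using borel_measurable_continuous_on_indicator[OF borel_compact[OF compact_fund]
          continuous_on_subset[OF cg fund_subset_cyl]] by simp
    show "(\<lambda>x. indicat_real ?H x *\<^sub>R g (\<phi> x)) \<in> borel_measurable lborel"
      using borel_measurable_continuous_on_indicator[OF Hb continuous_on_subset[OF cg H(2)]] by simp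
  qed
  also have "\<dots> = integral ?H (\<lambda>x. g (\<phi> x))" by (rule set_borel_integral_eq_integral(2)[OF iH])
  also have "\<dots> = integral (\<phi> ` ?H) g" by (rule hk)
  also have "\<dots> = Int_on (\<phi> ` ?H) g" by (rule set_borel_integral_eq_integral(2)[OF iA[OF ti], symmetric])
  also have "\<dots> = Int_on fund g" by (rule Int_on_fund_tile[OF ti g])
  finally show ?thesis .
qed

section \<open>The Euler equation and its reflection symmetry\<close>

lemma vector_derivative_solid:
  assumes S: "solid S" "t \<in> S" and f: "(f has_vector_derivative y) (at t within S)"
  shows "vector_derivative f (at t within S) = y"
proof -
  have "(f has_vector_derivative vector_derivative f (at t within S)) (at t within S)"
    unfolding vector_derivative_def using f by (rule someI)
  then have "(\<lambda>h. h *\<^sub>R vector_derivative f (at t within S)) = (\<lambda>h. h *\<^sub>R y)"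
    using f has_derivative_within_solid_unique[OF S] unfolding has_vector_derivative_def by blast
  then have "1 *\<^sub>R vector_derivative f (at t within S) = 1 *\<^sub>R y" by meson
  then show ?thesis by simp
qed

text \<open>The divergence theorem for \<open>|w|^2 V\<close>, whose divergence is
  \<open>2 w . (V . grad w)\<close> because \<open>V\<close> is divergence-free.\<close>

lemma transport_orthogonal:
  fixes w :: "real^3 \<Rightarrow> real^3"
  assumes w: "C1_torus w w'" and V: "C1_torus V V'" "tangent_bdry V"
    and div: "\<And>x. x \<in> cyl \<Longrightarrow> (\<Sum>i\<in>UNIV. V' x (axis i 1) $ i) = 0"
  shows "Int_on fund (\<lambda>x. w x \<bullet> w' x (V x)) = 0"
proof -
  let ?F = "\<lambda>x. (w x \<bullet> w x) *\<^sub>R V x"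
  let ?F' = "\<lambda>x v. (w x \<bullet> w x) *\<^sub>R V' x v + (w x \<bullet> w' x v + w' x v \<bullet> w x) *\<^sub>R V x"
  have "C1_torus ?F ?F'" by (rule C1_torus_scaleR[OF C1_torus_inner[OF w w] V(1)])
  moreover have "tangent_bdry ?F" using V(2) by (simp add: tangent_bdry_def)
  ultimately have "Int_on fund (\<lambda>x. \<Sum>i\<in>UNIV. ?F' x (axis i 1) $ i) = 0" by (rule divergence_theorem_torus)
  moreover have "(\<Sum>i\<in>UNIV. ?F' x (axis i 1) $ i) = 2 * (w x \<bullet> w' x (V x))" if "x \<in> fund" for x
  proof -
    have x: "x \<in> cyl" using that fund_subset_cyl by auto
    have "w' x (V x) = (\<Sum>i\<in>UNIV. V x $ i *\<^sub>R w' x (axis i 1))"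
      using C1_torus_linear[OF w x] by (subst vec3_expand[of "V x"]) (simp only: linear_sum linear_cmul)
    then have "w x \<bullet> w' x (V x) = (\<Sum>i\<in>UNIV. V x $ i * (w x \<bullet> w' x (axis i 1)))"
      by (simp add: inner_sum_right)
    moreover have "(\<Sum>i\<in>UNIV. ?F' x (axis i 1) $ i) = (w x \<bullet> w x) * (\<Sum>i\<in>UNIV. V' x (axis i 1) $ i)
        + 2 * (\<Sum>i\<in>UNIV. V x $ i * (w x \<bullet> w' x (axis i 1)))"
      by (simp add: sum.distrib sum_distrib_left inner_commute algebra_simps)
    ultimately show ?thesis using div[OF x] by simp
  qed
  ultimately have "Int_on fund (\<lambda>x. 2 * (w x \<bullet> w' x (V x))) = 0"
    using Int_on_cong[of fund "\<lambda>x. \<Sum>i\<in>UNIV. ?F' x (axis i 1) $ i" "\<lambda>x. 2 * (w x \<bullet> w' x (V x))"] by simp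
  then show ?thesis by simp
qed

text \<open>The divergence theorem for \<open>q w\<close>: gradients are orthogonal to
  divergence-free fields tangent to the wall, which is how the pressure drops out of energy
  estimates.\<close>

lemma gradient_orthogonal:
  assumes q: "C1_torus q q'" and w: "C1_torus w w'" "tangent_bdry w"
    and div: "\<And>x. x \<in> cyl \<Longrightarrow> (\<Sum>i\<in>UNIV. w' x (axis i 1) $ i) = 0"
  shows "Int_on fund (\<lambda>x. q' x (w x)) = 0"
proof -
  let ?F = "\<lambda>x. q x *\<^sub>R w x"
  let ?F' = "\<lambda>x v. q x *\<^sub>R w' x v + q' x v *\<^sub>R w x"
  have "C1_torus ?F ?F'" by (rule C1_torus_scaleR[OF q w(1)])
  moreover have "tangent_bdry ?F" using w(2) by (simp add: tangent_bdry_def)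
  ultimately have "Int_on fund (\<lambda>x. \<Sum>i\<in>UNIV. ?F' x (axis i 1) $ i) = 0" by (rule divergence_theorem_torus)
  moreover have "(\<Sum>i\<in>UNIV. ?F' x (axis i 1) $ i) = q' x (w x)" if "x \<in> fund" for x
  proof -
    have x: "x \<in> cyl" using that fund_subset_cyl by auto
    have "q' x (w x) = (\<Sum>i\<in>UNIV. w x $ i * q' x (axis i 1))"
      using C1_torus_linear[OF q x] by (subst vec3_expand[of "w x"]) (simp only: linear_sum linear_cmul real_scaleR_def)
    moreover have "(\<Sum>i\<in>UNIV. ?F' x (axis i 1) $ i) = q x * (\<Sum>i\<in>UNIV. w' x (axis i 1) $ i)
        + (\<Sum>i\<in>UNIV. w x $ i * q' x (axis i 1))"
      by (simp add: sum.distrib sum_distrib_left mult.commute)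
    ultimately show ?thesis using div[OF x] by simp
  qed
  ultimately show ?thesis
    using Int_on_cong[of fund "\<lambda>x. \<Sum>i\<in>UNIV. ?F' x (axis i 1) $ i" "\<lambda>x. q' x (w x)"] by simp
qed

lemma gronwall:
  fixes g :: "real \<Rightarrow> real"
  assumes g: "\<And>t. t \<in> {0..b} \<Longrightarrow> (g has_real_derivative g' t) (at t within {0..b})"
    and le: "\<And>t. t \<in> {0..b} \<Longrightarrow> g' t \<le> K * g t" and t: "t \<in> {0..b}"
  shows "g t \<le> g 0 * exp (K * t)"
proof -
  let ?f = "\<lambda>t. g t * exp (- K * t)"
  have d: "(?f has_real_derivative (g' s - K * g s) * exp (- K * s)) (at s within {0..b})" if "s \<in> {0..b}" for s
    by (rule derivative_eq_intros g[OF that] refl | simp)+ (simp add: algebra_simps)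
  have "?f t \<le> ?f 0"
  proof (rule DERIV_nonpos_imp_decreasing_open[of 0 t ?f])
    show "0 \<le> t" using t by simp
    have "continuous_on {0..b} ?f"
      unfolding continuous_on_eq_continuous_within using d DERIV_continuous by blast
    then show "continuous_on {0..t} ?f" by (rule continuous_on_subset) (use t in auto)
    fix s assume s: "0 < s" "s < t"
    have "(?f has_real_derivative (g' s - K * g s) * exp (- K * s)) (at s)"
      using d[of s] s t at_within_interior[of s "{0..b}"] by simp
    moreover have "(g' s - K * g s) * exp (- K * s) \<le> 0"
      using le[of s] s t by (intro mult_nonpos_nonneg) auto
    ultimately show "\<exists>y. (?f has_real_derivative y) (at s) \<and> y \<le> 0" by blast
  qed
  then have "g t * exp (- K * t) * exp (K * t) \<le> g 0 * exp (K * t)" by (intro mult_right_mono) auto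
  then show ?thesis by (simp add: mult.assoc flip: exp_add)
qed

text \<open>A rotation, not the reflection in \<open>z\<close>: it reverses the angle together with
  \<open>z\<close>, so the invariant axisymmetric fields have \<open>a\<close> even and both
  \<open>b\<close> and \<open>c\<close> odd in \<open>z\<close>.\<close>

definition flip :: "real^3 \<Rightarrow> real^3" where
  "flip x = vector [x$1, - (x$2), - (x$3)]"

lemma flip_nth [simp]: "flip x $ 1 = x$1" "flip x $ 2 = - (x$2)" "flip x $ 3 = - (x$3)"
  by (simp_all add: flip_def)

lemma linear_flip: "linear flip"
  by (rule linearI) (simp_all add: vec_eq_iff forall_3)

lemma bounded_linear_flip: "bounded_linear flip"
  using linear_flip linear_conv_bounded_linear by blast

lemma flip_flip [simp]: "flip (flip x) = x"
  by (simp add: vec_eq_iff forall_3)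

lemma flip_cyl [simp]: "flip x \<in> cyl \<longleftrightarrow> x \<in> cyl"
  by (simp add: cyl_iff rsq_def)

lemma inner_flip: "flip x \<bullet> y = x \<bullet> flip y"
  by (simp add: inner_3)

lemma norm_flip [simp]: "norm (flip x) = norm x"
  by (simp add: norm_eq_sqrt_inner inner_flip)

lemma flip_cylpt: "flip (cylpt r \<theta> z) = cylpt r (- \<theta>) (- z)"
  by (simp add: vec_eq_iff forall_3)

lemma flip_frame: "flip (e_r \<theta>) = e_r (- \<theta>)" "flip (e_theta \<theta>) = - e_theta (- \<theta>)" "flip e_z = - e_z"
  by (simp_all add: vec_eq_iff forall_3)

lemma C1_torus_linear_image:
  assumes f: "C1_torus f f'" and L: "bounded_linear L"
  shows "C1_torus (\<lambda>x. L (f x)) (\<lambda>x v. L (f' x v))"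
  unfolding C1_torus_def
proof (intro conjI ballI allI)
  show "z_periodic (\<lambda>x. L (f x))" using C1_torusD(1)[OF f] by (simp add: z_periodic_def)
  show "((\<lambda>x. L (f x)) has_derivative (\<lambda>v. L (f' x v))) (at x within cyl)" if "x \<in> cyl" for x
    using bounded_linear.has_derivative[OF L C1_torusD(2)[OF f that]] .
  show "continuous_on cyl (\<lambda>x. L (f' x v))" for v
    by (rule bounded_linear.continuous_on[OF L C1_torusD(3)[OF f]])
qed

lemma C1_torus_flip:
  assumes f: "C1_torus f f'"
  shows "C1_torus (\<lambda>x. f (flip x)) (\<lambda>x v. f' (flip x) (flip v))"
  unfolding C1_torus_def
proof (intro conjI ballI allI)
  show "z_periodic (\<lambda>x. f (flip x))"
    unfolding z_periodic_def
  proof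
    fix x :: "real^3" assume "x \<in> cyl"
    then have "f (flip x + (2 * pi * of_int (-1)) *\<^sub>R e_z) = f (flip x)"
      by (intro z_periodic_int[OF C1_torusD(1)[OF f]]) simp
    moreover have "flip (x + (2 * pi) *\<^sub>R e_z) = flip x + (2 * pi * of_int (-1)) *\<^sub>R e_z"
      by (simp add: vec_eq_iff forall_3)
    ultimately show "f (flip (x + (2 * pi) *\<^sub>R e_z)) = f (flip x)" by simp
  qed
  have im: "flip ` cyl \<subseteq> cyl" by auto
  show "((\<lambda>x. f (flip x)) has_derivative (\<lambda>v. f' (flip x) (flip v))) (at x within cyl)" if "x \<in> cyl" for x
  proof -
    have g: "(flip has_derivative flip) (at x within cyl)"
      by (rule bounded_linear_imp_has_derivative[OF bounded_linear_flip])
    have "(f has_derivative f' (flip x)) (at (flip x) within flip ` cyl)"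
      by (rule has_derivative_subset[OF C1_torusD(2)[OF f] im]) (use that in simp)
    from diff_chain_within[OF g this] show ?thesis by (simp add: o_def)
  qed
  show "continuous_on cyl (\<lambda>x. f' (flip x) (flip v))" for v
    by (rule continuous_on_compose2[OF C1_torusD(3)[OF f] linear_continuous_on[OF bounded_linear_flip]])
      (use im in auto)
qed

lemma div_flip:
  assumes "linear A"
  shows "(\<Sum>i\<in>UNIV. flip (A (flip (axis i 1))) $ i) = (\<Sum>i\<in>UNIV. A (axis i 1) $ (i::3))"
proof -
  have "flip (axis 1 1) = axis 1 1" "flip (axis 2 1) = - axis 2 1" "flip (axis 3 1) = - axis 3 1"
    by (simp_all add: vec_eq_iff forall_3)
  then show ?thesis using assms by (simp add: sum_3 linear_neg)
qed

section \<open>Derivatives of a solution and conservation of energy\<close>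

locale euler =
  fixes T :: real and U :: "real \<Rightarrow> real^3 \<Rightarrow> real^3" and P :: "real \<Rightarrow> real^3 \<Rightarrow> real"
  assumes T: "0 < T" and sol: "euler_solution T U P"
begin

definition dom :: "(real \<times> (real^3)) set" where "dom = {0..<T} \<times> cyl"
definition F :: "real \<times> (real^3) \<Rightarrow> real^3" where "F = (\<lambda>(t, x). U t x)"
text \<open>A directional derivative of the joint map \<open>F\<close>, not of \<open>U t\<close>:
  joint continuity in time and space and the exchange of time and space derivatives then follow from
  the smoothness of \<open>F\<close>.\<close>

definition DU :: "real \<Rightarrow> real^3 \<Rightarrow> real^3 \<Rightarrow> real^3" where "DU t x v = dird dom F (0, v) (t, x)"
definition Ut :: "real \<Rightarrow> real^3 \<Rightarrow> real^3" where "Ut t x = dird dom F (1, 0) (t, x)"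

lemma solid_dom: "solid dom"
  unfolding dom_def by (intro solid_Times solid_cyl solid_real_interval T)

lemma smooth_F: "smooth_on F dom"
  using sol by (simp add: euler_solution_def F_def dom_def)

lemma dom_iff: "(t, x) \<in> dom \<longleftrightarrow> t \<in> {0..<T} \<and> x \<in> cyl"
  by (simp add: dom_def)

lemma F_deriv: "\<lbrakk>t \<in> {0..<T}; x \<in> cyl\<rbrakk> \<Longrightarrow> (F has_derivative (\<lambda>v. dird dom F v (t, x))) (at (t, x) within dom)"
  using smooth_on_has_derivative[OF smooth_F] by (simp add: dom_iff)

lemma U_deriv: "\<lbrakk>t \<in> {0..<T}; x \<in> cyl\<rbrakk> \<Longrightarrow> (U t has_derivative DU t x) (at x within cyl)"
  using has_derivative_slice_right[of F _ t x "{0..<T}" cyl] F_deriv[of t x]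
  by (auto simp: F_def dom_def DU_def[abs_def])

lemma U_time_deriv: "\<lbrakk>t \<in> {0..<T}; x \<in> cyl\<rbrakk> \<Longrightarrow> ((\<lambda>s. U s x) has_vector_derivative Ut t x) (at t within {0..<T})"
  using has_vector_derivative_slice_left[of F _ t x "{0..<T}" cyl] F_deriv[of t x]
  by (auto simp: F_def dom_def Ut_def)

lemma pd_U: "\<lbrakk>t \<in> {0..<T}; x \<in> cyl\<rbrakk> \<Longrightarrow> pd i (U t) x = DU t x (axis i 1)"
  unfolding pd_def using frechet_derivative_solid[OF solid_cyl _ U_deriv] by simp

lemma advect_U: "\<lbrakk>t \<in> {0..<T}; x \<in> cyl\<rbrakk> \<Longrightarrow> advect V (U t) x = DU t x (V x)"
  unfolding advect_def using frechet_derivative_solid[OF solid_cyl _ U_deriv] by simp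

lemma DU_continuous: "continuous_on dom (\<lambda>(t, x). DU t x v)"
  using smooth_on_dird_continuous[OF smooth_F, of "(0, v)"] by (simp add: DU_def case_prod_beta')

lemma Ut_continuous: "continuous_on dom (\<lambda>(t, x). Ut t x)"
  using smooth_on_dird_continuous[OF smooth_F, of "(1, 0)"] by (simp add: Ut_def case_prod_beta')

lemma U_continuous: "continuous_on dom (\<lambda>(t, x). U t x)"
  using smooth_on_continuous[OF smooth_F] by (simp add: F_def)

lemma slice_continuous:
  assumes "continuous_on dom (\<lambda>(t, x). f t x)" "t \<in> {0..<T}"
  shows "continuous_on cyl (f t)"
proof -
  have "continuous_on cyl (\<lambda>x. (t, x))" by (intro continuous_intros)
  moreover have "(\<lambda>x. (t, x)) ` cyl \<subseteq> dom" using assms(2) by (auto simp: dom_def)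
  ultimately have "continuous_on cyl (\<lambda>x. (\<lambda>(t, x). f t x) (t, x))"
    by (rule continuous_on_compose2[OF assms(1)])
  then show ?thesis by simp
qed

lemma U_periodic: "t \<in> {0..<T} \<Longrightarrow> z_periodic (U t)"
  using sol by (simp add: euler_solution_def)

lemma U_tangent: "t \<in> {0..<T} \<Longrightarrow> tangent_bdry (U t)"
  using sol by (simp add: euler_solution_def)

lemma U_C1: "t \<in> {0..<T} \<Longrightarrow> C1_torus (U t) (DU t)"
  using U_periodic U_deriv slice_continuous[OF DU_continuous] by (simp add: C1_torus_def)

lemma DU_linear: "\<lbrakk>t \<in> {0..<T}; x \<in> cyl\<rbrakk> \<Longrightarrow> linear (DU t x)"
  using C1_torus_linear[OF U_C1] .

lemma divergence_free: "\<lbrakk>t \<in> {0..<T}; x \<in> cyl\<rbrakk> \<Longrightarrow> (\<Sum>i\<in>UNIV. DU t x (axis i 1) $ i) = 0"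
  using sol by (simp add: euler_solution_def divergence_def pd_U)

lemma momentum:
  assumes "t \<in> {0..<T}" "x \<in> cyl"
  shows "Ut t x + DU t x (U t x) = - grad (P t) x"
proof -
  have "vector_derivative (\<lambda>s. U s x) (at t within {0..<T}) = Ut t x"
    by (rule vector_derivative_solid[OF solid_real_interval(2)[OF T] assms(1) U_time_deriv[OF assms]])
  then show ?thesis
    using sol assms advect_U[OF assms, of "U t"] unfolding euler_solution_def by metis
qed

lemma P_deriv:
  assumes "t \<in> {0..<T}" "x \<in> cyl"
  shows "(P t has_derivative (\<lambda>v. grad (P t) x \<bullet> v)) (at x within cyl)"
proof -
  have s: "smooth_on (P t) cyl" using sol assms by (simp add: euler_solution_def)
  let ?D = "frechet_derivative (P t) (at x within cyl)"
  have "?D v = grad (P t) x \<bullet> v" for v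
  proof -
    have "?D v = (\<Sum>i\<in>UNIV. v$i * ?D (axis i 1))"
      using smooth_on_linear[OF s assms(2)]
      by (subst vec3_expand[of v]) (simp only: linear_sum linear_cmul real_scaleR_def)
    then show ?thesis by (simp add: grad_def pd_def inner_vec_def mult.commute)
  qed
  then have "?D = (\<lambda>v. grad (P t) x \<bullet> v)" by blast
  then show ?thesis using smooth_on_has_derivative[OF s assms(2)] by simp
qed

text \<open>The momentum equation expresses the pressure gradient by terms that are jointly
  continuous.\<close>

lemma grad_P_continuous: "continuous_on dom (\<lambda>(t, x). grad (P t) x)"
proof -
  have "continuous_on dom (\<lambda>(t, x). - (Ut t x + (\<Sum>i\<in>UNIV. U t x $ i *\<^sub>R DU t x (axis i 1))))"
    using U_continuous Ut_continuous DU_continuous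
    by (auto simp: case_prod_beta' intro!: continuous_intros)
  moreover have "- (Ut t x + (\<Sum>i\<in>UNIV. U t x $ i *\<^sub>R DU t x (axis i 1))) = grad (P t) x" if "(t, x) \<in> dom" for t x
  proof -
    have "DU t x (U t x) = (\<Sum>i\<in>UNIV. U t x $ i *\<^sub>R DU t x (axis i 1))"
      using that DU_linear by (subst vec3_expand[of "U t x"]) (simp only: linear_sum linear_cmul dom_iff)
    then show ?thesis using momentum[of t x] that by (simp add: dom_iff)
  qed
  ultimately show ?thesis by (simp add: case_prod_beta' cong: continuous_on_cong)
qed

lemma P_C1: "t \<in> {0..<T} \<Longrightarrow> C1_torus (P t) (\<lambda>x v. grad (P t) x \<bullet> v)"
  using P_deriv slice_continuous[OF grad_P_continuous] sol
  by (auto simp: C1_torus_def euler_solution_def intro!: continuous_intros)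

lemma DU_bounded:
  assumes "0 \<le> b" "b < T"
  obtains C where "0 < C" "\<And>t x v. \<lbrakk>t \<in> {0..b}; x \<in> cyl\<rbrakk> \<Longrightarrow> norm (DU t x v) \<le> C * norm v"
proof -
  have sub: "{0..b} \<times> fund \<subseteq> dom" using assms fund_subset_cyl by (auto simp: dom_def)
  have "\<exists>B. 0 < B \<and> (\<forall>t\<in>{0..b}. \<forall>x\<in>fund. norm (DU t x (axis i 1)) \<le> B)" for i
  proof -
    have "compact ((\<lambda>(t, x). DU t x (axis i 1)) ` ({0..b} \<times> fund))"
      by (intro compact_continuous_image continuous_on_subset[OF DU_continuous sub] compact_Times compact_fund compact_Icc)
    then obtain B where "0 < B" "\<forall>y\<in>(\<lambda>(t, x). DU t x (axis i 1)) ` ({0..b} \<times> fund). norm y \<le> B"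
      using compact_imp_bounded bounded_pos by metis
    then show ?thesis by (intro exI[of _ B]) auto
  qed
  then obtain B where B: "\<And>i. 0 < B i" "\<And>i t x. \<lbrakk>t \<in> {0..b}; x \<in> fund\<rbrakk> \<Longrightarrow> norm (DU t x (axis i 1)) \<le> B i" by metis
  have Bc: "norm (DU t x (axis i 1)) \<le> B i" if tx: "t \<in> {0..b}" "x \<in> cyl" for i t x
  proof -
    have t: "t \<in> {0..<T}" using tx assms by auto
    obtain k :: int where k: "x + (2 * pi * of_int k) *\<^sub>R e_z \<in> fund" using cyl_shift_fund[OF tx(2)] by metis
    have "DU t (x + (2 * pi * of_int k) *\<^sub>R e_z) (axis i 1) = DU t x (axis i 1)"
      by (rule z_periodic_int[OF C1_torus_derivative_periodic[OF U_C1[OF t]] tx(2)])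
    then show ?thesis using B(2)[OF tx(1) k, of i] by simp
  qed
  show ?thesis
  proof
    show "0 < (\<Sum>i\<in>UNIV. B i)" using B(1) by (intro sum_pos) auto
    fix t and x v :: "real^3" assume tx: "t \<in> {0..b}" "x \<in> cyl"
    then have t: "t \<in> {0..<T}" using assms by auto
    have "DU t x v = (\<Sum>i\<in>UNIV. v$i *\<^sub>R DU t x (axis i 1))"
      using DU_linear[OF t tx(2)] by (subst vec3_expand[of v]) (simp only: linear_sum linear_cmul)
    also have "norm \<dots> \<le> (\<Sum>i\<in>UNIV. \<bar>v$i\<bar> * norm (DU t x (axis i 1)))"
      by (rule order_trans[OF norm_sum]) simp
    also have "\<dots> \<le> (\<Sum>i\<in>UNIV. norm v * B i)"
      using Bc[OF tx] component_le_norm_cart[of v] by (intro sum_mono mult_mono) auto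
    finally show "norm (DU t x v) \<le> (\<Sum>i\<in>UNIV. B i) * norm v"
      by (simp add: sum_distrib_left mult.commute)
  qed
qed

lemma Ut_eq:
  assumes "t \<in> {0..<T}" "x \<in> cyl"
  shows "Ut t x = - DU t x (U t x) - grad (P t) x"
proof -
  have "Ut t x = (Ut t x + DU t x (U t x)) - DU t x (U t x)" by simp
  then show ?thesis unfolding momentum[OF assms] by simp
qed

lemma dom_fund: "{0..<T} \<times> fund \<subseteq> dom"
  using fund_subset_cyl by (auto simp: dom_def)

lemma fund_continuous:
  assumes "continuous_on dom (\<lambda>(t, x). f t x)" "t \<in> {0..<T}"
  shows "continuous_on fund (f t)"
  using slice_continuous[OF assms] fund_subset_cyl continuous_on_subset by blast

lemma flip_continuous:
  assumes "continuous_on dom (\<lambda>(t, x). f t x)"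
  shows "continuous_on dom (\<lambda>(t, x). f t (flip x))"
proof -
  have "continuous_on dom (\<lambda>p. (fst p, flip (snd p)))"
    by (intro continuous_intros bounded_linear.continuous_on[OF bounded_linear_flip])
  moreover have "(\<lambda>p. (fst p, flip (snd p))) ` dom \<subseteq> dom" by (auto simp: dom_def)
  ultimately have "continuous_on dom (\<lambda>p. (\<lambda>(t, x). f t x) (fst p, flip (snd p)))"
    by (rule continuous_on_compose2[OF assms])
  then show ?thesis by (simp add: case_prod_beta')
qed

lemma U_self_inner_deriv:
  assumes t: "t \<in> {0..<T}"
  shows "((\<lambda>t. Int_on fund (\<lambda>x. U t x \<bullet> U t x)) has_real_derivative Int_on fund (\<lambda>x. 2 * (U t x \<bullet> Ut t x))) (at t within {0..<T})"
proof (rule has_real_derivative_Int_on[OF compact_fund _ t])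
  fix s x assume s: "s \<in> {0..<T}" and x: "x \<in> fund"
  then have "((\<lambda>s. U s x \<bullet> U s x) has_vector_derivative U s x \<bullet> Ut s x + Ut s x \<bullet> U s x) (at s within {0..<T})"
    using fund_subset_cyl by (intro bounded_bilinear.has_vector_derivative[OF bounded_bilinear_inner] U_time_deriv) auto
  then show "((\<lambda>s. U s x \<bullet> U s x) has_real_derivative 2 * (U s x \<bullet> Ut s x)) (at s within {0..<T})"
    by (simp add: has_real_derivative_iff_has_vector_derivative inner_commute)
next
  show "continuous_on fund (\<lambda>x. U s x \<bullet> U s x)" if "s \<in> {0..<T}" for s
    using that by (intro continuous_intros fund_continuous[OF U_continuous])
  have "continuous_on dom (\<lambda>(t, x). 2 * (U t x \<bullet> Ut t x))"
    using U_continuous Ut_continuous by (auto simp: case_prod_beta' intro!: continuous_intros)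
  then show "continuous_on ({0..<T} \<times> fund) (\<lambda>(t, x). 2 * (U t x \<bullet> Ut t x))"
    by (rule continuous_on_subset[OF _ dom_fund])
qed auto

text \<open>The momentum equation splits \<open>U . U\<^sub>t\<close> into a transport term and a
  gradient term, and both integrate to 0 by the orthogonality lemmas.\<close>

lemma energy_conserved:
  assumes t: "t \<in> {0..<T}"
  shows "Int_on fund (\<lambda>x. U t x \<bullet> U t x) = Int_on fund (\<lambda>x. U 0 x \<bullet> U 0 x)"
proof -
  have zero: "Int_on fund (\<lambda>x. 2 * (U s x \<bullet> Ut s x)) = 0" if s: "s \<in> {0..<T}" for s
  proof -
    have c: "continuous_on fund (\<lambda>x. U s x \<bullet> DU s x (U s x))" "continuous_on fund (\<lambda>x. grad (P s) x \<bullet> U s x)"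
    proof -
      have "continuous_on fund (\<lambda>x. - grad (P s) x - Ut s x)"
        by (intro continuous_intros fund_continuous[OF grad_P_continuous s] fund_continuous[OF Ut_continuous s])
      moreover have "- grad (P s) x - Ut s x = DU s x (U s x)" if "x \<in> fund" for x
        using Ut_eq[OF s, of x] that fund_subset_cyl by auto
      ultimately have "continuous_on fund (\<lambda>x. DU s x (U s x))" by (simp cong: continuous_on_cong)
      then show "continuous_on fund (\<lambda>x. U s x \<bullet> DU s x (U s x))"
        by (intro continuous_intros fund_continuous[OF U_continuous s])
      show "continuous_on fund (\<lambda>x. grad (P s) x \<bullet> U s x)"
        by (intro continuous_intros fund_continuous[OF grad_P_continuous s] fund_continuous[OF U_continuous s])
    qed
    have "Int_on fund (\<lambda>x. U s x \<bullet> DU s x (U s x)) = 0"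
      by (rule transport_orthogonal[OF U_C1[OF s] U_C1[OF s] U_tangent[OF s] divergence_free[OF s]])
    moreover have "Int_on fund (\<lambda>x. grad (P s) x \<bullet> U s x) = 0"
      by (rule gradient_orthogonal[OF P_C1[OF s] U_C1[OF s] U_tangent[OF s] divergence_free[OF s]])
    ultimately have "Int_on fund (\<lambda>x. U s x \<bullet> DU s x (U s x) + grad (P s) x \<bullet> U s x) = 0"
      by (simp add: Int_on_add[OF compact_fund c])
    moreover have "Int_on fund (\<lambda>x. 2 * (U s x \<bullet> Ut s x)) =
        Int_on fund (\<lambda>x. - 2 * (U s x \<bullet> DU s x (U s x) + grad (P s) x \<bullet> U s x))"
    proof (rule Int_on_cong)
      fix x assume "x \<in> fund"
      then have "Ut s x = - grad (P s) x - DU s x (U s x)"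
        using Ut_eq[OF s, of x] fund_subset_cyl by auto
      then show "2 * (U s x \<bullet> Ut s x) = - 2 * (U s x \<bullet> DU s x (U s x) + grad (P s) x \<bullet> U s x)"
        by (simp add: inner_diff_right inner_commute)
    qed
    ultimately show ?thesis unfolding set_integral_mult_right by simp
  qed
  have "\<exists>c. \<forall>s\<in>{0..<T}. Int_on fund (\<lambda>x. U s x \<bullet> U s x) = c"
  proof (rule has_derivative_zero_constant)
    show "((\<lambda>t. Int_on fund (\<lambda>x. U t x \<bullet> U t x)) has_derivative (\<lambda>h. 0)) (at s within {0..<T})"
      if "s \<in> {0..<T}" for s
    proof -
      have "(*) (0::real) = (\<lambda>h. 0)" by auto
      then show ?thesis using U_self_inner_deriv[OF that] unfolding zero[OF that] has_field_derivative_def by simp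
    qed
  qed auto
  then obtain c where "\<And>s. s \<in> {0..<T} \<Longrightarrow> Int_on fund (\<lambda>x. U s x \<bullet> U s x) = c" by blast
  from this[OF t] this[of 0] show ?thesis using T by simp
qed

text \<open>The reflected field solves the same equation; Gronwall's inequality for the energy of the difference.\<close>

lemma flip_symmetric:
  assumes init: "\<And>x. x \<in> cyl \<Longrightarrow> flip (U 0 (flip x)) = U 0 x"
    and t: "t \<in> {0..<T}" and x: "x \<in> cyl"
  shows "flip (U t (flip x)) = U t x"
proof -
  define V where "V t x = flip (U t (flip x))" for t x
  define DV where "DV t x v = flip (DU t (flip x) (flip v))" for t x v
  define Vt where "Vt t x = flip (Ut t (flip x))" for t x
  define w where "w t x = U t x - V t x" for t x
  define w' where "w' t x v = DU t x v - DV t x v" for t x v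
  define wt where "wt t x = Ut t x - Vt t x" for t x
  have V_C1: "C1_torus (V s) (DV s)" if "s \<in> {0..<T}" for s
    unfolding V_def[abs_def] DV_def[abs_def]
    by (rule C1_torus_linear_image[OF C1_torus_flip[OF U_C1[OF that]] bounded_linear_flip])
  have w_C1: "C1_torus (w s) (w' s)" if "s \<in> {0..<T}" for s
    unfolding w_def[abs_def] w'_def[abs_def] by (rule C1_torus_diff[OF U_C1[OF that] V_C1[OF that]])
  have w_tan: "tangent_bdry (w s)" if "s \<in> {0..<T}" for s
    unfolding tangent_bdry_def
  proof (intro allI)
    fix \<theta> z
    have "V s (cylpt 1 \<theta> z) \<bullet> e_r \<theta> = U s (cylpt 1 (- \<theta>) (- z)) \<bullet> e_r (- \<theta>)"
      by (simp add: V_def inner_flip flip_cylpt flip_frame)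
    then show "w s (cylpt 1 \<theta> z) \<bullet> e_r \<theta> = 0"
      using U_tangent[OF that] by (simp add: w_def inner_diff_left tangent_bdry_def)
  qed
  have w_div: "(\<Sum>i\<in>UNIV. w' s x (axis i 1) $ i) = 0" if "s \<in> {0..<T}" "x \<in> cyl" for s x
  proof -
    have "(\<Sum>i\<in>UNIV. DV s x (axis i 1) $ i) = 0"
      using div_flip[OF DU_linear[OF that(1)]] divergence_free[OF that(1)] that(2) by (simp add: DV_def)
    then show ?thesis using divergence_free[OF that] by (simp add: w'_def sum_subtractf)
  qed
  have V_time: "((\<lambda>s. V s x) has_vector_derivative Vt s x) (at s within {0..<T})" if "s \<in> {0..<T}" "x \<in> cyl" for s x
    unfolding V_def Vt_def
    by (rule bounded_linear.has_vector_derivative[OF bounded_linear_flip U_time_deriv]) (use that in auto)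
  have w_time: "((\<lambda>s. w s x) has_vector_derivative wt s x) (at s within {0..<T})" if "s \<in> {0..<T}" "x \<in> cyl" for s x
    unfolding w_def wt_def by (intro has_vector_derivative_diff U_time_deriv V_time that)
  \<comment> \<open>The difference of the two Euler equations, with the quadratic term arranged as
    \<open>U . grad w + w . grad V\<close>: the first half is pure transport, the second is linear
    in \<open>w\<close> without derivatives of \<open>w\<close>.\<close>
  have eq: "wt s x = - w' s x (U s x) - DV s x (w s x) - grad (P s) x + flip (grad (P s) (flip x))"
    if "s \<in> {0..<T}" "x \<in> cyl" for s x
  proof -
    have a: "Vt s x = - DV s x (V s x) - flip (grad (P s) (flip x))"
    proof -
      have "Ut s (flip x) = - DU s (flip x) (U s (flip x)) - grad (P s) (flip x)"
        using Ut_eq[of s "flip x"] that by simp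
      then show ?thesis
        by (simp add: Vt_def DV_def V_def linear_diff[OF linear_flip] linear_neg[OF linear_flip])
    qed
    have b: "Ut s x = - DU s x (U s x) - grad (P s) x"
      by (rule Ut_eq[OF that])
    have c: "DV s x (w s x) = DV s x (U s x) - DV s x (V s x)"
      using linear_diff[OF C1_torus_linear[OF V_C1[OF that(1)] that(2)]] by (simp add: w_def)
    show ?thesis unfolding wt_def w'_def c unfolding a b by simp
  qed
  have cV: "continuous_on dom (\<lambda>(t, x). V t x)" "continuous_on dom (\<lambda>(t, x). Vt t x)"
    using bounded_linear.continuous_on[OF bounded_linear_flip flip_continuous[OF U_continuous]]
      bounded_linear.continuous_on[OF bounded_linear_flip flip_continuous[OF Ut_continuous]]
    by (simp_all add: V_def Vt_def case_prod_beta')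
  have cw: "continuous_on dom (\<lambda>(t, x). w t x)" "continuous_on dom (\<lambda>(t, x). wt t x)"
    using cV U_continuous Ut_continuous by (auto simp: w_def wt_def case_prod_beta' intro!: continuous_intros)
  define E where "E t = Int_on fund (\<lambda>x. w t x \<bullet> w t x)" for t
  have E': "(E has_real_derivative Int_on fund (\<lambda>x. 2 * (w s x \<bullet> wt s x))) (at s within {0..<T})"
    if s: "s \<in> {0..<T}" for s
    unfolding E_def[abs_def]
  proof (rule has_real_derivative_Int_on[OF compact_fund _ s])
    fix s x assume s: "s \<in> {0..<T}" and x: "x \<in> fund"
    then have "((\<lambda>s. w s x \<bullet> w s x) has_vector_derivative w s x \<bullet> wt s x + wt s x \<bullet> w s x) (at s within {0..<T})"
      using fund_subset_cyl by (intro bounded_bilinear.has_vector_derivative[OF bounded_bilinear_inner] w_time) auto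
    then show "((\<lambda>s. w s x \<bullet> w s x) has_real_derivative 2 * (w s x \<bullet> wt s x)) (at s within {0..<T})"
      by (simp add: has_real_derivative_iff_has_vector_derivative inner_commute)
  next
    show "continuous_on fund (\<lambda>x. w s x \<bullet> w s x)" if "s \<in> {0..<T}" for s
      using that by (intro continuous_intros fund_continuous[OF cw(1)])
    have "continuous_on dom (\<lambda>(t, x). 2 * (w t x \<bullet> wt t x))"
      using cw by (auto simp: case_prod_beta' intro!: continuous_intros)
    then show "continuous_on ({0..<T} \<times> fund) (\<lambda>(t, x). 2 * (w t x \<bullet> wt t x))"
      by (rule continuous_on_subset[OF _ dom_fund])
  qed auto
  have t0: "0 \<le> t" "t < T" using t by auto
  obtain C where C: "0 < C" "\<And>s x v. \<lbrakk>s \<in> {0..t}; x \<in> cyl\<rbrakk> \<Longrightarrow> norm (DU s x v) \<le> C * norm v"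
    using DU_bounded[OF t0] by metis
  \<comment> \<open>Transport and both pressure terms integrate to 0, leaving
    \<open>- 2 w . (w . grad V)\<close>. The constant \<open>C\<close> bounds \<open>DU\<close>,
    hence also \<open>DV\<close>, because \<open>flip\<close> is an isometry.\<close>
  have E_le: "Int_on fund (\<lambda>x. 2 * (w s x \<bullet> wt s x)) \<le> 2 * C * E s" if st: "s \<in> {0..t}" for s
  proof -
    have s: "s \<in> {0..<T}" using st t by auto
    have V3: "continuous_on fund (\<lambda>x. w s x \<bullet> w s x)" by (intro continuous_intros fund_continuous[OF cw(1) s])
    have wexp: "w' s x (U s x) = (\<Sum>i\<in>UNIV. U s x $ i *\<^sub>R w' s x (axis i 1))"
      "DV s x (w s x) = (\<Sum>i\<in>UNIV. w s x $ i *\<^sub>R DV s x (axis i 1))" if "x \<in> fund" for x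
    proof -
      have x: "x \<in> cyl" using that fund_subset_cyl by auto
      show "w' s x (U s x) = (\<Sum>i\<in>UNIV. U s x $ i *\<^sub>R w' s x (axis i 1))"
        using C1_torus_linear[OF w_C1[OF s] x] by (subst vec3_expand[of "U s x"]) (simp only: linear_sum linear_cmul)
      show "DV s x (w s x) = (\<Sum>i\<in>UNIV. w s x $ i *\<^sub>R DV s x (axis i 1))"
        using C1_torus_linear[OF V_C1[OF s] x] by (subst vec3_expand[of "w s x"]) (simp only: linear_sum linear_cmul)
    qed
    have cD: "continuous_on fund (\<lambda>x. w' s x v)" "continuous_on fund (\<lambda>x. DV s x v)" for v
      using C1_torusD(3)[OF w_C1[OF s]] C1_torusD(3)[OF V_C1[OF s]] continuous_on_subset[OF _ fund_subset_cyl] by blast+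
    have "continuous_on fund (\<lambda>x. w s x \<bullet> (\<Sum>i\<in>UNIV. U s x $ i *\<^sub>R w' s x (axis i 1)))"
      "continuous_on fund (\<lambda>x. w s x \<bullet> (\<Sum>i\<in>UNIV. w s x $ i *\<^sub>R DV s x (axis i 1)))"
      by (intro continuous_intros cD fund_continuous[OF cw(1) s] fund_continuous[OF U_continuous s])+
    then have c: "continuous_on fund (\<lambda>x. w s x \<bullet> w' s x (U s x))" "continuous_on fund (\<lambda>x. w s x \<bullet> DV s x (w s x))"
      using wexp by (simp_all cong: continuous_on_cong)
    have c2: "continuous_on fund (\<lambda>x. grad (P s) x \<bullet> w s x)" "continuous_on fund (\<lambda>x. grad (P s) (flip x) \<bullet> flip (w s x))"
      by (intro continuous_intros fund_continuous[OF grad_P_continuous s] fund_continuous[OF flip_continuous[OF grad_P_continuous] s]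
          fund_continuous[OF cw(1) s] bounded_linear.continuous_on[OF bounded_linear_flip])+
    have I1: "Int_on fund (\<lambda>x. w s x \<bullet> w' s x (U s x)) = 0"
      by (rule transport_orthogonal[OF w_C1[OF s] U_C1[OF s] U_tangent[OF s] divergence_free[OF s]])
    have I2: "Int_on fund (\<lambda>x. grad (P s) x \<bullet> w s x) = 0"
      by (rule gradient_orthogonal[OF P_C1[OF s] w_C1[OF s] w_tan[OF s] w_div[OF s]])
    have I3: "Int_on fund (\<lambda>x. grad (P s) (flip x) \<bullet> flip (w s x)) = 0"
      by (rule gradient_orthogonal[OF C1_torus_flip[OF P_C1[OF s]] w_C1[OF s] w_tan[OF s] w_div[OF s]])
    have "Int_on fund (\<lambda>x. 2 * (w s x \<bullet> wt s x)) =
        Int_on fund (\<lambda>x. 2 * (- (w s x \<bullet> w' s x (U s x)) - w s x \<bullet> DV s x (w s x) - grad (P s) x \<bullet> w s x + grad (P s) (flip x) \<bullet> flip (w s x)))"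
      using eq[OF s] fund_subset_cyl
      by (intro Int_on_cong) (auto simp: inner_diff_right inner_add_right inner_commute inner_flip[symmetric])
    also have "\<dots> = - 2 * Int_on fund (\<lambda>x. w s x \<bullet> DV s x (w s x))"
    proof -
      have "Int_on fund (\<lambda>x. - (w s x \<bullet> w' s x (U s x)) - w s x \<bullet> DV s x (w s x) - grad (P s) x \<bullet> w s x + grad (P s) (flip x) \<bullet> flip (w s x))
        = Int_on fund (\<lambda>x. - 1 * (w s x \<bullet> w' s x (U s x))) - Int_on fund (\<lambda>x. w s x \<bullet> DV s x (w s x))
          - Int_on fund (\<lambda>x. grad (P s) x \<bullet> w s x) + Int_on fund (\<lambda>x. grad (P s) (flip x) \<bullet> flip (w s x))"
        by (simp add: Int_on_add[OF compact_fund] Int_on_diff[OF compact_fund] c c2 continuous_on_diff continuous_on_minus)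
      also have "\<dots> = - Int_on fund (\<lambda>x. w s x \<bullet> DV s x (w s x))"
        unfolding set_integral_mult_right I1 I2 I3 by simp
      finally show ?thesis unfolding set_integral_mult_right by simp
    qed
    also have "\<dots> = Int_on fund (\<lambda>x. - 2 * (w s x \<bullet> DV s x (w s x)))"
      by (simp only: set_integral_mult_right)
    also have "\<dots> \<le> Int_on fund (\<lambda>x. 2 * C * (w s x \<bullet> w s x))"
    proof (rule Int_on_mono[OF compact_fund])
      fix x assume "x \<in> fund"
      then have x: "flip x \<in> cyl" using fund_subset_cyl by auto
      have "- (w s x \<bullet> DV s x (w s x)) \<le> norm (w s x) * norm (DV s x (w s x))"
        using Cauchy_Schwarz_ineq2[of "w s x" "DV s x (w s x)"] by linarith
      also have "\<dots> \<le> norm (w s x) * (C * norm (w s x))"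
        using C(2)[OF st x, of "flip (w s x)"] by (intro mult_left_mono) (auto simp: DV_def)
      finally have "- (w s x \<bullet> DV s x (w s x)) \<le> C * (w s x \<bullet> w s x)"
        by (simp add: dot_square_norm power2_eq_square mult_ac)
      then show "- 2 * (w s x \<bullet> DV s x (w s x)) \<le> 2 * C * (w s x \<bullet> w s x)" by simp
    qed (intro continuous_intros c V3)+
    also have "\<dots> = 2 * C * E s" by (simp add: E_def)
    finally show ?thesis .
  qed
  have "E t \<le> E 0 * exp (2 * C * t)"
  proof (rule gronwall[where g'="\<lambda>s. Int_on fund (\<lambda>x. 2 * (w s x \<bullet> wt s x))" and b=t])
    show "(E has_real_derivative Int_on fund (\<lambda>x. 2 * (w s x \<bullet> wt s x))) (at s within {0..t})" if "s \<in> {0..t}" for s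
      by (rule DERIV_subset[OF E'[of s]]) (use that t in auto)
  qed (use E_le t in auto)
  moreover have "E 0 = 0"
  proof -
    have "E 0 = Int_on fund (\<lambda>x. 0)"
      unfolding E_def using init fund_subset_cyl by (intro Int_on_cong) (auto simp: w_def V_def)
    then show ?thesis by simp
  qed
  ultimately have "E t \<le> 0" by simp
  have cwt: "continuous_on fund (\<lambda>x. w t x \<bullet> w t x)"
    by (intro continuous_intros fund_continuous[OF cw(1) t])
  have "w t y \<bullet> w t y = 0" if "y \<in> fund" for y
    by (rule Int_on_eq_0D[OF compact_fund solid_fund cwt _ _ that]) (use \<open>E t \<le> 0\<close> in \<open>auto simp: E_def\<close>)
  then have w0: "w t y = 0" if "y \<in> fund" for y using that by simp
  obtain k :: int where "x + (2 * pi * of_int k) *\<^sub>R e_z \<in> fund" using cyl_shift_fund[OF x] by metis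
  then have "w t x = 0" using w0 z_periodic_int[OF C1_torusD(1)[OF w_C1[OF t]] x] by metis
  then show ?thesis by (simp add: w_def V_def)
qed

end

text \<open>The device for reading off entries of velocity gradients: if a component
  \<open>L\<close> of \<open>G\<close> vanishes along a path, that component of the derivative in
  the direction of the path is 0. One-sided paths ending at the wall or the axis are
  allowed.\<close>

lemma derivative_along_zero_path:
  assumes J: "solid J" "s \<in> J" and \<gamma>: "(\<gamma> has_vector_derivative v) (at s within J)" "\<gamma> ` J \<subseteq> S"
    and G: "(G has_derivative G') (at (\<gamma> s) within S)" and L: "bounded_linear L"
    and zero: "\<And>s. s \<in> J \<Longrightarrow> L (G (\<gamma> s)) = 0"
  shows "L (G' v) = 0"
proof -
  have "(\<gamma> has_derivative (\<lambda>h. h *\<^sub>R v)) (at s within J)" using \<gamma>(1) by (simp add: has_vector_derivative_def)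
  from diff_chain_within[OF this has_derivative_subset[OF G \<gamma>(2)]]
  have "((\<lambda>s. G (\<gamma> s)) has_derivative (\<lambda>h. G' (h *\<^sub>R v))) (at s within J)" by (simp add: o_def)
  from bounded_linear.has_derivative[OF L this]
  have "((\<lambda>s. L (G (\<gamma> s))) has_derivative (\<lambda>h. L (G' (h *\<^sub>R v)))) (at s within J)" .
  moreover have "((\<lambda>s. L (G (\<gamma> s))) has_derivative (\<lambda>h. 0)) (at s within J)"
    by (rule has_derivative_transform[OF J(2) _ has_derivative_const]) (use zero in auto)
  ultimately have "(\<lambda>h. L (G' (h *\<^sub>R v))) = (\<lambda>h. 0)" by (rule has_derivative_within_solid_unique[OF J])
  then have "L (G' (1 *\<^sub>R v)) = 0" by meson
  then show ?thesis by simp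
qed

lemma C1_torus_zero:
  assumes f: "C1_torus f f'" and zero: "\<And>x. x \<in> cyl \<Longrightarrow> f x = 0" and x: "x \<in> cyl"
  shows "f' x v = 0"
proof -
  have "(f has_derivative (\<lambda>h. 0)) (at x within cyl)"
    by (rule has_derivative_transform[OF x _ has_derivative_const]) (use zero in auto)
  then have "f' x = (\<lambda>h. 0)" by (rule has_derivative_within_solid_unique[OF solid_cyl x C1_torusD(2)[OF f x]])
  then show ?thesis by simp
qed

lemma C1_torus_coord: "i \<noteq> 3 \<Longrightarrow> C1_torus (\<lambda>x. x $ i) (\<lambda>x v. v $ i)"
  using exhaust_3[of i] unfolding C1_torus_def z_periodic_def
  by (auto intro!: bounded_linear_imp_has_derivative bounded_linear_vec_nth)

lemma z_periodic_zeroI: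
  assumes "z_periodic f" "\<And>x. x \<in> fund \<Longrightarrow> f x = 0" "x \<in> cyl"
  shows "f x = 0"
proof -
  obtain k :: int where "x + (2 * pi * of_int k) *\<^sub>R e_z \<in> fund" using cyl_shift_fund[OF assms(3)] by metis
  then show ?thesis using assms(2) z_periodic_int[OF assms(1,3)] by metis
qed

lemma solid_UNIV: "solid (UNIV :: 'a::euclidean_space set)"
  by (simp add: solid_def)

lemma trace_frame:
  fixes A :: "real^3 \<Rightarrow> real^3"
  assumes "linear A"
  shows "(\<Sum>i\<in>UNIV. A (axis i 1) $ i) = A (e_r \<theta>) \<bullet> e_r \<theta> + A (e_theta \<theta>) \<bullet> e_theta \<theta> + A e_z \<bullet> e_z"
proof -
  have "e_r \<theta> = cos \<theta> *\<^sub>R axis 1 1 + sin \<theta> *\<^sub>R axis 2 1" "e_theta \<theta> = (- sin \<theta>) *\<^sub>R axis 1 1 + cos \<theta> *\<^sub>R axis 2 1"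
    by (simp_all add: vec_eq_iff forall_3)
  then have A: "A (e_r \<theta>) = cos \<theta> *\<^sub>R A (axis 1 1) + sin \<theta> *\<^sub>R A (axis 2 1)"
    "A (e_theta \<theta>) = (- sin \<theta>) *\<^sub>R A (axis 1 1) + cos \<theta> *\<^sub>R A (axis 2 1)"
    using assms by (simp_all add: linear_add linear_cmul linear_diff linear_neg)
  have "A (e_r \<theta>) \<bullet> e_r \<theta> + A (e_theta \<theta>) \<bullet> e_theta \<theta> = A (axis 1 1) $ 1 + A (axis 2 1) $ 2"
  proof -
    have alg: "(C * p + S * q) * C + (C * r + S * s) * S + ((C * s - S * r) * C - (C * q - S * p) * S) = p + s"
      if "S\<^sup>2 + C\<^sup>2 = 1" for p q r s C S :: real
      using that by algebra
    show ?thesis unfolding A inner_3 by (simp add: alg[OF sin_cos_squared_add])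
  qed
  then show ?thesis by (simp add: sum_3 inner_3 e_z_axis)
qed

lemma frame_expand: "(v::real^3) = (v \<bullet> e_r \<theta>) *\<^sub>R e_r \<theta> + (v \<bullet> e_theta \<theta>) *\<^sub>R e_theta \<theta> + (v \<bullet> e_z) *\<^sub>R e_z"
proof -
  have "v$1 = (v$1 * cos \<theta> + v$2 * sin \<theta>) * cos \<theta> - (v$2 * cos \<theta> - v$1 * sin \<theta>) * sin \<theta>"
    "v$2 = (v$1 * cos \<theta> + v$2 * sin \<theta>) * sin \<theta> + (v$2 * cos \<theta> - v$1 * sin \<theta>) * cos \<theta>"
    using sin_cos_squared_add[of \<theta>] by algebra+
  then show ?thesis by (simp add: vec_eq_iff forall_3 inner_3 algebra_simps)
qed

lemma frame_inner [simp]: "e_r \<theta> \<bullet> e_r \<theta> = 1" "e_theta \<theta> \<bullet> e_theta \<theta> = 1" "e_z \<bullet> e_z = 1"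
  "e_r \<theta> \<bullet> e_theta \<theta> = 0" "e_theta \<theta> \<bullet> e_r \<theta> = 0" "e_r \<theta> \<bullet> e_z = 0" "e_z \<bullet> e_r \<theta> = 0"
  "e_theta \<theta> \<bullet> e_z = 0" "e_z \<bullet> e_theta \<theta> = 0"
  by (simp_all add: inner_3 flip: power2_eq_square)

section \<open>Consequences of odd initial data\<close>

locale euler_odd = euler +
  fixes a b c :: "real \<Rightarrow> real \<Rightarrow> real \<Rightarrow> real"
  assumes axi: "axisymmetric T U a b c" and odd: "odd_in_z (c 0)" "odd_in_z (b 0)"
begin

lemma U_cylpt:
  assumes "t \<in> {0..<T}" "r \<in> {0..1}"
  shows "U t (cylpt r \<theta> z) = a t r z *\<^sub>R e_r \<theta> + b t r z *\<^sub>R e_theta \<theta> + c t r z *\<^sub>R e_z"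
  using axi assms by (simp add: axisymmetric_def)

text \<open>Only \<open>b\<close> and \<open>c\<close> are prescribed odd; that \<open>a\<close> is
  even comes from incompressibility. The difference of the field and its image under
  \<open>flip\<close> is divergence-free and purely radial, equal to \<open>\<alpha> e_r\<close>, so
  \<open>r \<alpha>\<close> is constant in \<open>r\<close>, and it is 0 at the axis.\<close>

lemma initial_flip:
  assumes x: "x \<in> cyl"
  shows "flip (U 0 (flip x)) = U 0 x"
proof -
  have t0: "0 \<in> {0..<T}" using T by simp
  define w where "w x = U 0 x - flip (U 0 (flip x))" for x
  define w' where "w' x v = DU 0 x v - flip (DU 0 (flip x) (flip v))" for x v
  have w: "C1_torus w w'"
    unfolding w_def[abs_def] w'_def[abs_def]
    by (rule C1_torus_diff[OF U_C1[OF t0] C1_torus_linear_image[OF C1_torus_flip[OF U_C1[OF t0]] bounded_linear_flip]])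
  have div: "(\<Sum>i\<in>UNIV. w' x (axis i 1) $ i) = 0" if "x \<in> cyl" for x
    using div_flip[OF DU_linear[OF t0]] divergence_free[OF t0] that by (simp add: w'_def sum_subtractf)
  define \<alpha> where "\<alpha> r z = a 0 r z - a 0 r (- z)" for r z
  have wf: "w (cylpt r \<theta> z) = \<alpha> r z *\<^sub>R e_r \<theta>" if r: "r \<in> {0..1}" "\<bar>z\<bar> \<le> pi" for r \<theta> z
  proof -
    have "b 0 r (- z) = - b 0 r z" "c 0 r (- z) = - c 0 r z"
      using odd r by (auto simp: odd_in_z_def abs_le_iff)
    then have "flip (U 0 (flip (cylpt r \<theta> z))) = a 0 r (- z) *\<^sub>R e_r \<theta> + b 0 r z *\<^sub>R e_theta \<theta> + c 0 r z *\<^sub>R e_z"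
      by (simp add: flip_cylpt U_cylpt[OF t0 r(1)] linear_add[OF linear_flip] linear_cmul[OF linear_flip]
          linear_neg[OF linear_flip] linear_diff[OF linear_flip] flip_frame)
    then show ?thesis by (simp add: w_def \<alpha>_def U_cylpt[OF t0 r(1)] algebra_simps)
  qed
  have fund_pt: "\<exists>r \<theta> z. r \<in> {0..1} \<and> \<bar>z\<bar> \<le> pi \<and> y = cylpt r \<theta> z" if y: "y \<in> fund" for y
  proof -
    have "y \<in> cyl" using y fund_subset_cyl by auto
    then obtain r \<theta> where "r \<in> {0..1}" "y = cylpt r \<theta> (y$3)" by (rule cyl_cylpt)
    then show ?thesis using y by (auto simp: fund_iff)
  qed
  have w3: "w y $ 3 = 0" if "y \<in> cyl" for y
  proof (rule z_periodic_zeroI[OF C1_torusD(1)[OF C1_torus_nth[OF w]] _ that])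
    fix y assume "y \<in> fund"
    then obtain r \<theta> z where "r \<in> {0..1}" "\<bar>z\<bar> \<le> pi" "y = cylpt r \<theta> z" using fund_pt by blast
    then show "w y $ 3 = 0" by (simp add: wf)
  qed
  \<comment> \<open>This is \<open>r\<close> times the angular component. It vanishes identically,
    and its derivative in the second direction at \<open>(s, 0, z)\<close> says that
    \<open>s\<close> times the (2,2) entry of the gradient equals \<open>w $ 1\<close>.\<close>
  have k1: "C1_torus (\<lambda>x. x$1 * w x $ 2 - x$2 * w x $ 1)
     (\<lambda>x v. (x$1 * w' x v $ 2 + v$1 * w x $ 2) - (x$2 * w' x v $ 1 + v$2 * w x $ 1))"
    by (intro C1_torus_diff C1_torus_mult C1_torus_coord C1_torus_nth w) auto
  have k: "y$1 * w y $ 2 - y$2 * w y $ 1 = 0" if "y \<in> cyl" for y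
  proof (rule z_periodic_zeroI[OF C1_torusD(1)[OF k1] _ that])
    fix y assume "y \<in> fund"
    then obtain r \<theta> z where "r \<in> {0..1}" "\<bar>z\<bar> \<le> pi" "y = cylpt r \<theta> z" using fund_pt by blast
    then show "y$1 * w y $ 2 - y$2 * w y $ 1 = 0" by (simp add: wf)
  qed
  have \<alpha>0: "\<alpha> r z = 0" if r: "r \<in> {0..1}" and z: "\<bar>z\<bar> \<le> pi" for r z
  proof (cases "r = 0")
    case True
    \<comment> \<open>On the axis the angles 0 and \<open>pi\<close> describe the same point with
      opposite \<open>e_r\<close>.\<close>
    have "cylpt 0 0 z = cylpt 0 pi z" by (simp add: cylpt_def)
    moreover have "0 \<in> {0..1::real}" by simp
    ultimately have "\<alpha> 0 z *\<^sub>R e_r 0 = \<alpha> 0 z *\<^sub>R e_r pi" using wf[of 0 z] z by metis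
    then have "(\<alpha> 0 z *\<^sub>R e_r 0) $ 1 = (\<alpha> 0 z *\<^sub>R e_r pi) $ 1" by (rule arg_cong)
    then show ?thesis using True by (simp add: inner_3)
  next
    case False
    have seg: "cylpt s 0 z = cylpt 0 0 z + s *\<^sub>R (cylpt 1 0 z - cylpt 0 0 z)" for s
      by (simp add: vec_eq_iff forall_3)
    have e1: "cylpt 1 0 z - cylpt 0 0 z = axis 1 1" by (simp add: vec_eq_iff forall_3)
    \<comment> \<open>Along the ray the derivative of \<open>s w_1\<close> is \<open>s\<close> times
      the divergence of \<open>w\<close>, hence 0; the constant is seen to be 0 at
      \<open>s = 0\<close>.\<close>
    have "\<exists>C. \<forall>s\<in>{0..1}. s * w (cylpt s 0 z) $ 1 = C"
    proof (rule has_derivative_zero_constant)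
      fix s :: real assume s: "s \<in> {0..1}"
      let ?x = "cylpt s 0 z"
      have x: "?x \<in> cyl" by (rule cylpt_in_cyl[OF s])
      have "((\<lambda>s. w (cylpt 0 0 z + s *\<^sub>R (cylpt 1 0 z - cylpt 0 0 z))) has_vector_derivative w' ?x (cylpt 1 0 z - cylpt 0 0 z)) (at s within {0..1})"
        by (rule has_vector_derivative_along_segment[OF convex_cyl _ _ _ s])
          (use C1_torusD(2)[OF w x] seg[of s] cylpt_in_cyl in auto)
      note der = this
      have "((\<lambda>s. w (cylpt s 0 z)) has_vector_derivative w' ?x (axis 1 1)) (at s within {0..1})"
      proof -
        have "(\<lambda>s. w (cylpt s 0 z)) = (\<lambda>s. w (cylpt 0 0 z + s *\<^sub>R axis 1 1))"
          by (rule ext, rule arg_cong[of _ _ w]) (simp add: vec_eq_iff forall_3)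
        then show ?thesis using der unfolding e1 by simp
      qed
      then have "((\<lambda>s. w (cylpt s 0 z) $ 1) has_real_derivative w' ?x (axis 1 1) $ 1) (at s within {0..1})"
        unfolding has_real_derivative_iff_has_vector_derivative
        by (rule bounded_linear.has_vector_derivative[OF bounded_linear_vec_nth])
      from DERIV_mult[OF DERIV_ident this]
      have "((\<lambda>s. s * w (cylpt s 0 z) $ 1) has_real_derivative (w ?x $ 1 + s * w' ?x (axis 1 1) $ 1)) (at s within {0..1})"
        by (simp add: algebra_simps)
      moreover have "w ?x $ 1 + s * w' ?x (axis 1 1) $ 1 = 0"
      proof -
        have "s * w' ?x (axis 2 1) $ 2 - w ?x $ 1 = 0"
          using C1_torus_zero[OF k1 k x, of "axis 2 1"] by simp
        moreover have "w' ?x (axis 3 1) $ 3 = 0" by (rule C1_torus_zero[OF C1_torus_nth[OF w] w3 x])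
        ultimately have "w ?x $ 1 + s * w' ?x (axis 1 1) $ 1 = s * (\<Sum>i\<in>UNIV. w' ?x (axis i 1) $ i)"
          by (simp add: sum_3 algebra_simps)
        then show ?thesis using div[OF x] by simp
      qed
      moreover have "(*) (0::real) = (\<lambda>h. 0)" by auto
      ultimately show "((\<lambda>s. s * w (cylpt s 0 z) $ 1) has_derivative (\<lambda>h. 0)) (at s within {0..1})"
        by (simp add: has_field_derivative_def)
    qed auto
    then obtain C where C: "\<And>s. s \<in> {0..1} \<Longrightarrow> s * w (cylpt s 0 z) $ 1 = C" by blast
    have "r * w (cylpt r 0 z) $ 1 = 0" using C[OF r] C[of 0] by simp
    then show ?thesis using False wf[OF r z, of 0] by simp
  qed
  have "w x = 0"
  proof (rule z_periodic_zeroI[OF C1_torusD(1)[OF w] _ x])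
    fix y assume "y \<in> fund"
    then obtain r \<theta> z where "r \<in> {0..1}" "\<bar>z\<bar> \<le> pi" "y = cylpt r \<theta> z" using fund_pt by blast
    then show "w y = 0" by (simp add: wf \<alpha>0)
  qed
  then show ?thesis by (simp add: w_def)
qed

lemma U_flip: "\<lbrakk>t \<in> {0..<T}; x \<in> cyl\<rbrakk> \<Longrightarrow> flip (U t (flip x)) = U t x"
  using flip_symmetric initial_flip by blast

text \<open>Points with angle 0 and height 0 are fixed by \<open>flip\<close>, so the velocity there
  is fixed as well and has only its first component.\<close>

lemma b_c_zero:
  assumes t: "t \<in> {0..<T}" and r: "r \<in> {0..1}"
  shows "b t r 0 = 0" "c t r 0 = 0"
proof -
  have "flip (U t (cylpt r 0 0)) = U t (cylpt r 0 0)"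
    using U_flip[OF t cylpt_in_cyl[OF r], of 0 0] by (simp add: flip_cylpt)
  moreover have "U t (cylpt r 0 0) = vector [a t r 0, b t r 0, c t r 0]"
    by (simp add: U_cylpt[OF t r] vec_eq_iff forall_3)
  ultimately show "b t r 0 = 0" "c t r 0 = 0" by (simp_all add: vec_eq_iff forall_3)
qed

lemma U_plane: "\<lbrakk>t \<in> {0..<T}; r \<in> {0..1}\<rbrakk> \<Longrightarrow> U t (cylpt r \<theta> 0) = a t r 0 *\<^sub>R e_r \<theta>"
  by (simp add: U_cylpt b_c_zero)

lemma a_wall:
  assumes t: "t \<in> {0..<T}"
  shows "a t 1 z = 0"
proof -
  have "U t (cylpt 1 0 z) \<bullet> e_r 0 = 0" using U_tangent[OF t] by (simp add: tangent_bdry_def)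
  then show ?thesis using U_cylpt[OF t, of 1 0 z] by (simp add: inner_add_left)
qed

lemma U_wall: "t \<in> {0..<T} \<Longrightarrow> U t (cylpt 1 \<theta> z) = b t 1 z *\<^sub>R e_theta \<theta> + c t 1 z *\<^sub>R e_z"
  using U_cylpt[of t 1 \<theta> z] by (simp add: a_wall)

lemma U_circle: "t \<in> {0..<T} \<Longrightarrow> U t (cylpt 1 \<theta> 0) = 0"
  using U_plane[of t 1 \<theta>] by (simp add: a_wall)

end

section \<open>The stagnation circle\<close>

lemma cylpt_deriv_radial: "((\<lambda>s. cylpt s \<theta> z) has_vector_derivative e_r \<theta>) (at s within J)"
proof -
  have "(\<lambda>s. cylpt s \<theta> z) = (\<lambda>s. s *\<^sub>R e_r \<theta> + z *\<^sub>R e_z)" by (auto simp: vec_eq_iff forall_3)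
  then show ?thesis by (auto intro!: derivative_eq_intros)
qed

lemma cylpt_deriv_axial: "((\<lambda>s. cylpt r \<theta> s) has_vector_derivative e_z) (at s within J)"
proof -
  have "(\<lambda>s. cylpt r \<theta> s) = (\<lambda>s. r *\<^sub>R e_r \<theta> + s *\<^sub>R e_z)" by (auto simp: vec_eq_iff forall_3)
  then show ?thesis by (auto intro!: derivative_eq_intros)
qed

lemma cylpt_deriv_angular: "((\<lambda>s. cylpt 1 s z) has_vector_derivative e_theta s) (at s within J)"
proof -
  have "(\<lambda>s. cylpt 1 s z) = (\<lambda>s. cos s *\<^sub>R axis 1 1 + sin s *\<^sub>R axis 2 1 + z *\<^sub>R e_z)"
    by (auto simp: vec_eq_iff forall_3)
  moreover have "((\<lambda>s. cos s *\<^sub>R axis 1 1 + sin s *\<^sub>R axis 2 1 + z *\<^sub>R e_z) has_vector_derivative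
      (- sin s *\<^sub>R axis 1 1 + cos s *\<^sub>R axis 2 1 :: real^3)) (at s within J)"
    by (auto intro!: derivative_eq_intros)
  moreover have "- sin s *\<^sub>R axis 1 1 + cos s *\<^sub>R axis 2 1 = e_theta s"
    by (simp add: vec_eq_iff forall_3)
  ultimately show ?thesis by simp
qed


context euler
begin

definition D2U :: "real \<Rightarrow> real^3 \<Rightarrow> real^3 \<Rightarrow> real^3 \<Rightarrow> real^3" where
  "D2U t x u v = dird dom (dird dom F (0, u)) (0, v) (t, x)"
definition DUt :: "real \<Rightarrow> real^3 \<Rightarrow> real^3 \<Rightarrow> real^3" where
  "DUt t x v = dird dom (dird dom F (1, 0)) (0, v) (t, x)"

text \<open>
  The Hessian of \<open>P\<close>, obtained by differentiating the momentum equation, since \<open>P\<close> itself has no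
  regularity in time.
\<close>

definition HP :: "real \<Rightarrow> real^3 \<Rightarrow> real^3 \<Rightarrow> real^3" where
  "HP t x v = - (DUt t x v + (\<Sum>k\<in>UNIV. DU t x v $ k *\<^sub>R DU t x (axis k 1) + U t x $ k *\<^sub>R D2U t x (axis k 1) v))"

lemma dird_F_deriv:
  assumes "t \<in> {0..<T}" "x \<in> cyl"
  shows "(dird dom F u has_derivative (\<lambda>v. dird dom (dird dom F u) v (t, x))) (at (t, x) within dom)"
  using smooth_on_has_derivative[OF smooth_on_dird[OF smooth_F]] assms by (simp add: dom_iff)

lemma DU_deriv:
  assumes "t \<in> {0..<T}" "x \<in> cyl"
  shows "((\<lambda>x. DU t x u) has_derivative D2U t x u) (at x within cyl)"
  using has_derivative_slice_right[of "dird dom F (0, u)" _ t x "{0..<T}" cyl] dird_F_deriv[OF assms, of "(0, u)"] assms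
  by (auto simp: dom_def DU_def[abs_def] D2U_def[abs_def])

lemma Ut_deriv:
  assumes "t \<in> {0..<T}" "x \<in> cyl"
  shows "(Ut t has_derivative DUt t x) (at x within cyl)"
  using has_derivative_slice_right[of "dird dom F (1, 0)" _ t x "{0..<T}" cyl] dird_F_deriv[OF assms, of "(1, 0)"] assms
  by (auto simp: dom_def Ut_def[abs_def] DUt_def[abs_def])

text \<open>Time and space derivatives of the smooth joint map commute. This produces ordinary
  differential equations in \<open>t\<close> for the velocity gradient at a fixed point.\<close>

lemma DU_time_deriv:
  assumes "t \<in> {0..<T}" "x \<in> cyl"
  shows "((\<lambda>t. DU t x v) has_vector_derivative DUt t x v) (at t within {0..<T})"
proof -
  have "((\<lambda>t. DU t x v) has_vector_derivative dird dom (dird dom F (0, v)) (1, 0) (t, x)) (at t within {0..<T})"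
    using has_vector_derivative_slice_left[of "dird dom F (0, v)" _ t x "{0..<T}" cyl] dird_F_deriv[OF assms, of "(0, v)"] assms
    by (auto simp: dom_def DU_def[abs_def])
  then show ?thesis
    using mixed_partials[OF solid_dom _ smooth_F, of "(t, x)" "(0, v)" "(1, 0)"] assms
    by (simp add: DUt_def dom_iff)
qed

lemma D2U_continuous: "continuous_on dom (\<lambda>(t, x). D2U t x u v)"
  using smooth_on_dird_continuous[OF smooth_on_dird[OF smooth_F], of "(0, u)" "(0, v)"] by (simp add: D2U_def case_prod_beta')

lemma DUt_continuous: "continuous_on dom (\<lambda>(t, x). DUt t x v)"
  using smooth_on_dird_continuous[OF smooth_on_dird[OF smooth_F], of "(1, 0)" "(0, v)"] by (simp add: DUt_def case_prod_beta')

lemma HP_continuous: "continuous_on dom (\<lambda>(t, x). HP t x v)"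
  unfolding HP_def
  using U_continuous DU_continuous D2U_continuous DUt_continuous
  by (auto simp: case_prod_beta' intro!: continuous_intros)

lemma grad_P_eq:
  assumes "t \<in> {0..<T}" "x \<in> cyl"
  shows "grad (P t) x = - (Ut t x + (\<Sum>k\<in>UNIV. U t x $ k *\<^sub>R DU t x (axis k 1)))"
proof -
  have "DU t x (U t x) = (\<Sum>k\<in>UNIV. U t x $ k *\<^sub>R DU t x (axis k 1))"
    using DU_linear[OF assms] by (subst vec3_expand[of "U t x"]) (simp only: linear_sum linear_cmul)
  then show ?thesis using momentum[OF assms] by simp
qed

lemma grad_P_deriv:
  assumes t: "t \<in> {0..<T}" and x: "x \<in> cyl"
  shows "(grad (P t) has_derivative HP t x) (at x within cyl)"
proof -
  have "((\<lambda>x. - (Ut t x + (\<Sum>k\<in>UNIV. U t x $ k *\<^sub>R DU t x (axis k 1)))) has_derivative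
      (\<lambda>v. - (DUt t x v + (\<Sum>k\<in>UNIV. U t x $ k *\<^sub>R D2U t x (axis k 1) v + DU t x v $ k *\<^sub>R DU t x (axis k 1))))) (at x within cyl)"
    by (intro has_derivative_minus has_derivative_add has_derivative_sum has_derivative_scaleR
        bounded_linear.has_derivative[OF bounded_linear_vec_nth] Ut_deriv DU_deriv U_deriv t x)
  moreover have "(\<lambda>v. - (DUt t x v + (\<Sum>k\<in>UNIV. U t x $ k *\<^sub>R D2U t x (axis k 1) v + DU t x v $ k *\<^sub>R DU t x (axis k 1)))) = HP t x"
    by (auto simp: HP_def fun_eq_iff add.commute)
  ultimately have *: "((\<lambda>x. - (Ut t x + (\<Sum>k\<in>UNIV. U t x $ k *\<^sub>R DU t x (axis k 1)))) has_derivative HP t x) (at x within cyl)"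
    by simp
  show ?thesis by (rule has_derivative_transform[OF x _ *]) (rule grad_P_eq[OF t])
qed

lemma HP_linear: "\<lbrakk>t \<in> {0..<T}; x \<in> cyl\<rbrakk> \<Longrightarrow> linear (HP t x)"
  by (rule has_derivative_linear[OF grad_P_deriv])

lemma pd_pd_P:
  assumes "t \<in> {0..<T}" "x \<in> cyl"
  shows "pd i (pd j (P t)) x = HP t x (axis i 1) $ j"
proof -
  have eq: "pd j (P t) = (\<lambda>x. grad (P t) x $ j)" by (simp add: grad_def)
  show ?thesis
    unfolding eq pd_def[of i]
    using frechet_derivative_solid[OF solid_cyl assms(2) bounded_linear.has_derivative[OF bounded_linear_vec_nth grad_P_deriv[OF assms]]]
    by simp
qed

lemma hessian_P:
  assumes "t \<in> {0..<T}" "x \<in> cyl"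
  shows "hessian (P t) x v w = HP t x v \<bullet> w"
proof -
  have "HP t x v = (\<Sum>i\<in>UNIV. v$i *\<^sub>R HP t x (axis i 1))"
    using HP_linear[OF assms] by (subst vec3_expand[of v]) (simp only: linear_sum linear_cmul)
  then show ?thesis
    unfolding hessian_def pd_pd_P[OF assms] by (simp add: inner_vec_def sum_distrib_right sum_3 algebra_simps)
qed

lemma laplacian_P: "\<lbrakk>t \<in> {0..<T}; x \<in> cyl\<rbrakk> \<Longrightarrow> laplacian (P t) x = (\<Sum>i\<in>UNIV. HP t x (axis i 1) $ i)"
  by (simp add: laplacian_def pd_pd_P)

text \<open>Symmetry cannot be seen from the formula for \<open>HP\<close>; it holds because
  \<open>HP\<close> is the second derivative of \<open>P t\<close>, which is smooth in space at each
  time.\<close>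

lemma HP_symmetric:
  assumes t: "t \<in> {0..<T}" and x: "x \<in> cyl"
  shows "HP t x v \<bullet> w = HP t x w \<bullet> v"
proof -
  have s: "smooth_on (P t) cyl" using sol t by (simp add: euler_solution_def)
  have d: "dird cyl (dird cyl (P t) w) v x = HP t x v \<bullet> w" for v w
  proof -
    have "((\<lambda>x. grad (P t) x \<bullet> w) has_derivative (\<lambda>v. HP t x v \<bullet> w)) (at x within cyl)"
      by (rule has_derivative_inner_left[OF grad_P_deriv[OF t x]])
    then have "(dird cyl (P t) w has_derivative (\<lambda>v. HP t x v \<bullet> w)) (at x within cyl)"
      by (rule has_derivative_transform[OF x, rotated]) (simp add: frechet_derivative_solid[OF solid_cyl _ P_deriv[OF t]])
    from frechet_derivative_solid[OF solid_cyl x this] show ?thesis by simp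
  qed
  show ?thesis using mixed_partials[OF solid_cyl x s, of w v] by (simp only: d)
qed

end

context euler_odd
begin

text \<open>This is \<open>s\<close> of the overview, \<open>swirl_slope\<close> is
  \<open>\<nu>\<close> and \<open>axial_strain'\<close> will be \<open>s'\<close>. The base point
  has angle 0; \<open>DU_circle\<close> transfers the values to all angles.\<close>

definition axial_strain :: "real \<Rightarrow> real" where "axial_strain t = DU t (cylpt 1 0 0) e_z \<bullet> e_z"
definition swirl_slope :: "real \<Rightarrow> real" where "swirl_slope t = DU t (cylpt 1 0 0) e_z \<bullet> e_theta 0"
definition axial_strain' :: "real \<Rightarrow> real" where "axial_strain' t = DUt t (cylpt 1 0 0) e_z \<bullet> e_z"

lemma circle_in_cyl [simp]: "cylpt 1 \<theta> z \<in> cyl"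
  by (simp add: cyl_iff)

text \<open>Each column comes from a surface on which components vanish. In the plane
  \<open>z = 0\<close> the field is radial; along the circle it is 0; on the wall it has no radial
  component. Zero trace then turns the axial entry \<open>s\<close> into the radial entry
  \<open>- s\<close>.\<close>

lemma DU_circle:
  assumes t: "t \<in> {0..<T}"
  shows "DU t (cylpt 1 \<theta> 0) v =
    (- axial_strain t * (v \<bullet> e_r \<theta>)) *\<^sub>R e_r \<theta> + (v \<bullet> e_z) *\<^sub>R (swirl_slope t *\<^sub>R e_theta \<theta> + axial_strain t *\<^sub>R e_z)"
proof -
  let ?p = "cylpt 1 \<theta> 0" and ?A = "DU t (cylpt 1 \<theta> 0)"
  have lin: "linear ?A" by (rule DU_linear[OF t]) simp
  have r: "?A (e_r \<theta>) \<bullet> e = 0" if "e = e_theta \<theta> \<or> e = e_z" for e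
  proof (rule derivative_along_zero_path[where J="{0..1}" and s=1 and v="e_r \<theta>" and G'="DU t (cylpt 1 \<theta> 0)" and \<gamma>="\<lambda>s. cylpt s \<theta> 0" and G="U t" and S=cyl and L="\<lambda>u. u \<bullet> e"])
    show "U t (cylpt s \<theta> 0) \<bullet> e = 0" if "s \<in> {0..1}" for s
      using U_plane[OF t that] \<open>e = e_theta \<theta> \<or> e = e_z\<close> by auto
  qed (auto simp: solid_real_interval cylpt_in_cyl intro!: cylpt_deriv_radial U_deriv bounded_linear_inner_left t[simplified])
  have th: "?A (e_theta \<theta>) = 0"
  proof (rule derivative_along_zero_path[where J="UNIV" and s=\<theta> and v="e_theta \<theta>" and G'="DU t (cylpt 1 \<theta> 0)" and \<gamma>="\<lambda>s. cylpt 1 s 0" and G="U t" and S=cyl and L="\<lambda>u. u"])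
    show "U t (cylpt 1 s 0) = 0" for s by (rule U_circle[OF t])
  qed (auto simp: solid_UNIV intro!: cylpt_deriv_angular U_deriv bounded_linear_ident t[simplified])
  have z1: "?A e_z \<bullet> e_r \<theta> = 0"
  proof (rule derivative_along_zero_path[where J="UNIV" and s=0 and v="e_z" and G'="DU t (cylpt 1 \<theta> 0)" and \<gamma>="\<lambda>s. cylpt 1 \<theta> s" and G="U t" and S=cyl and L="\<lambda>u. u \<bullet> e_r \<theta>"])
    show "U t (cylpt 1 \<theta> s) \<bullet> e_r \<theta> = 0" for s by (simp add: U_wall[OF t] inner_add_left)
  qed (auto simp: solid_UNIV intro!: cylpt_deriv_axial U_deriv bounded_linear_inner_left t[simplified])
  \<comment> \<open>On the wall the angular and axial components do not depend on the angle, so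
    their \<open>z\<close>-derivatives may be taken at angle 0.\<close>
  have zz: "DU t (cylpt 1 \<theta> 0) e_z \<bullet> e = DU t (cylpt 1 0 0) e_z \<bullet> e'"
    if "\<And>s. U t (cylpt 1 \<theta> s) \<bullet> e = U t (cylpt 1 0 s) \<bullet> e'" for e e'
  proof -
    have d: "((\<lambda>s. U t (cylpt 1 \<phi> s) \<bullet> u) has_vector_derivative DU t (cylpt 1 \<phi> 0) e_z \<bullet> u) (at 0)" for \<phi> u
    proof -
      have "((\<lambda>s. cylpt 1 \<phi> s) has_derivative (\<lambda>h. h *\<^sub>R e_z)) (at 0)"
        using cylpt_deriv_axial by (simp add: has_vector_derivative_def)
      moreover have "(U t has_derivative DU t (cylpt 1 \<phi> 0)) (at (cylpt 1 \<phi> 0) within range (cylpt 1 \<phi>))"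
        by (rule has_derivative_subset[OF U_deriv[OF t]]) auto
      ultimately have "((\<lambda>s. U t (cylpt 1 \<phi> s)) has_derivative (\<lambda>h. DU t (cylpt 1 \<phi> 0) (h *\<^sub>R e_z))) (at 0)"
        using diff_chain_within[of "cylpt 1 \<phi>" "\<lambda>h. h *\<^sub>R e_z" 0 UNIV "U t" "DU t (cylpt 1 \<phi> 0)"] by (simp add: o_def)
      then have "((\<lambda>s. U t (cylpt 1 \<phi> s)) has_vector_derivative DU t (cylpt 1 \<phi> 0) e_z) (at 0)"
        using linear_cmul[OF DU_linear[OF t], of "cylpt 1 \<phi> 0"] by (simp add: has_vector_derivative_def)
      then show ?thesis by (rule bounded_linear.has_vector_derivative[OF bounded_linear_inner_left])
    qed
    show ?thesis using d[of \<theta> e] d[of 0 e'] that vector_derivative_unique_at by fastforce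
  qed
  have z2: "?A e_z \<bullet> e_theta \<theta> = swirl_slope t" unfolding swirl_slope_def
    by (rule zz) (simp add: U_wall[OF t] inner_add_left)
  have z3: "?A e_z \<bullet> e_z = axial_strain t" unfolding axial_strain_def
    by (rule zz) (simp add: U_wall[OF t] inner_add_left)
  have "?A (e_r \<theta>) \<bullet> e_r \<theta> = - axial_strain t"
    using trace_frame[OF lin, of \<theta>] divergence_free[OF t, of ?p] th z3 by simp
  then have r1: "?A (e_r \<theta>) = (- axial_strain t) *\<^sub>R e_r \<theta>"
    using r by (subst frame_expand[of "?A (e_r \<theta>)" \<theta>]) simp
  have r2: "?A e_z = swirl_slope t *\<^sub>R e_theta \<theta> + axial_strain t *\<^sub>R e_z"
    using z1 z2 z3 by (subst frame_expand[of "?A e_z" \<theta>]) simp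
  have "?A v = (v \<bullet> e_r \<theta>) *\<^sub>R ?A (e_r \<theta>) + (v \<bullet> e_theta \<theta>) *\<^sub>R ?A (e_theta \<theta>) + (v \<bullet> e_z) *\<^sub>R ?A e_z"
    by (subst frame_expand[of v \<theta>]) (simp only: linear_add[OF lin] linear_cmul[OF lin])
  then show ?thesis unfolding r1 r2 th by simp
qed

end

lemma linear_vec3_expand:
  fixes A :: "real^3 \<Rightarrow> 'b::real_vector"
  assumes "linear A"
  shows "A v = (\<Sum>k\<in>UNIV. v$k *\<^sub>R A (axis k 1))"
  using assms by (subst vec3_expand[of v]) (simp only: linear_sum linear_cmul)

text \<open>
  Since \<open>(\<nu>\<^sup>2)' = - 2 s \<nu>\<^sup>2 \<le> (1 + s\<^sup>2) \<nu>\<^sup>2\<close>, an integral bound on \<open>s\<^sup>2\<close> bounds \<open>\<nu>\<close>.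
\<close>

lemma linear_ode_bound:
  fixes \<nu> s :: "real \<Rightarrow> real"
  assumes t: "t1 \<le> t" and s: "continuous_on {t1..t} s"
    and \<nu>: "\<And>u. u \<in> {t1..t} \<Longrightarrow> (\<nu> has_real_derivative - s u * \<nu> u) (at u within {t1..t})"
  shows "(\<nu> t)\<^sup>2 \<le> (\<nu> t1)\<^sup>2 * exp (t - t1 + integral {t1..t} (\<lambda>u. (s u)\<^sup>2))"
proof -
  define S where "S u = u - t1 + integral {t1..u} (\<lambda>u. (s u)\<^sup>2)" for u
  have S: "(S has_real_derivative 1 + (s u)\<^sup>2) (at u within {t1..t})" if "u \<in> {t1..t}" for u
    unfolding S_def
    by (auto intro!: derivative_eq_intros integral_has_real_derivative continuous_intros s that)
  let ?h = "\<lambda>u. (\<nu> u)\<^sup>2 * exp (- S u)"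
  \<comment> \<open>The factor is an exact square:
    \<open>- 2 s - 1 - s^2 = - (1 + s)^2\<close>.\<close>
  have d: "(?h has_real_derivative - ((\<nu> u)\<^sup>2 * (1 + s u)\<^sup>2 * exp (- S u))) (at u within {t1..t})" if "u \<in> {t1..t}" for u
    by (rule derivative_eq_intros \<nu>[OF that] S[OF that] refl | simp)+
      (simp add: power2_eq_square algebra_simps)
  have "?h t \<le> ?h t1"
  proof (rule DERIV_nonpos_imp_decreasing_open[OF t])
    show "continuous_on {t1..t} ?h"
      unfolding continuous_on_eq_continuous_within using d DERIV_continuous by blast
    fix u assume u: "t1 < u" "u < t"
    have "(?h has_real_derivative - ((\<nu> u)\<^sup>2 * (1 + s u)\<^sup>2 * exp (- S u))) (at u)"
      using d[of u] u at_within_interior[of u "{t1..t}"] by simp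
    then show "\<exists>y. (?h has_real_derivative y) (at u) \<and> y \<le> 0" by force
  qed
  moreover have "S t1 = 0" by (simp add: S_def)
  ultimately have "(\<nu> t)\<^sup>2 * exp (- S t) * exp (S t) \<le> (\<nu> t1)\<^sup>2 * exp (S t)" by (intro mult_right_mono) auto
  then show ?thesis by (simp add: mult.assoc S_def flip: exp_add)
qed

lemma integral_le_nn_integral:
  fixes f :: "real \<Rightarrow> real"
  assumes f: "continuous_on {0..<T} f" "\<And>u. 0 \<le> f u" and t: "0 \<le> t1" "t < T"
  shows "ennreal (integral {t1..t} f) \<le> (\<integral>\<^sup>+u\<in>{0..<T}. ennreal (f u) \<partial>lborel)"
proof -
  have c: "continuous_on {t1..t} f" by (rule continuous_on_subset[OF f(1)]) (use t in auto)
  have i: "set_integrable lborel {t1..t} f" by (rule set_integrable_compact[OF compact_Icc c])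
  have "integral {t1..t} f = (LINT u:{t1..t}|lborel. f u)"
    by (rule set_borel_integral_eq_integral(2)[OF i, symmetric])
  also have "ennreal \<dots> = (\<integral>\<^sup>+u. ennreal (indicator {t1..t} u *\<^sub>R f u) \<partial>lborel)"
    unfolding set_lebesgue_integral_def
    by (rule nn_integral_eq_integral[symmetric]) (use i f(2) in \<open>auto simp: set_integrable_def\<close>)
  also have "\<dots> \<le> (\<integral>\<^sup>+u\<in>{0..<T}. ennreal (f u) \<partial>lborel)"
    by (rule nn_integral_mono) (use t in \<open>auto split: split_indicator\<close>)
  finally show ?thesis .
qed

lemma nn_integral_bounded_finite:
  fixes f :: "real \<Rightarrow> real"
  assumes "\<And>u. u \<in> {0..<T} \<Longrightarrow> f u \<le> M" "0 \<le> M"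
  shows "(\<integral>\<^sup>+u\<in>{0..<T}. ennreal (f u) \<partial>lborel) < \<infinity>"
proof -
  have "(\<integral>\<^sup>+u\<in>{0..<T}. ennreal (f u) \<partial>lborel) \<le> (\<integral>\<^sup>+u. ennreal M * indicator {0..<T} u \<partial>lborel)"
    by (rule nn_integral_mono) (use assms in \<open>auto split: split_indicator intro: ennreal_leI\<close>)
  also have "\<dots> = ennreal M * emeasure lborel {0..<T}" by (rule nn_integral_cmult_indicator) simp
  also have "\<dots> < \<infinity>" using emeasure_lborel_Icc_eq[of 0 T] 
    by (cases "0 \<le> T") (simp_all add: ennreal_mult_less_top)
  finally show ?thesis .
qed

text \<open>Both claims hold because a bounded \<open>\<nu>\<close> has a finite integral over
  \<open>{0..<T}\<close>. A finite integral of \<open>s^2\<close> bounds \<open>\<nu>\<close> by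
  \<open>linear_ode_bound\<close>. If \<open>\<nu>\<close> vanished at some \<open>t\<close>, the
  same estimate started at \<open>t\<close> would keep it 0 afterwards, while before
  \<open>t\<close> it is bounded by compactness.\<close>

lemma linear_ode_blowup:
  fixes \<nu> s :: "real \<Rightarrow> real"
  assumes s: "continuous_on {0..<T} s"
    and \<nu>: "\<And>u. u \<in> {0..<T} \<Longrightarrow> (\<nu> has_real_derivative - s u * \<nu> u) (at u within {0..<T})"
    and inf: "(\<integral>\<^sup>+u\<in>{0..<T}. ennreal \<bar>\<nu> u\<bar> \<partial>lborel) = \<infinity>"
  shows "(\<integral>\<^sup>+u\<in>{0..<T}. ennreal ((s u)\<^sup>2) \<partial>lborel) = \<infinity>" and "t \<in> {0..<T} \<Longrightarrow> \<nu> t \<noteq> 0"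
proof -
  have bd: "(\<nu> u)\<^sup>2 \<le> (\<nu> t1)\<^sup>2 * exp (u - t1 + integral {t1..u} (\<lambda>u. (s u)\<^sup>2))"
    if "0 \<le> t1" "t1 \<le> u" "u < T" for t1 u
  proof (rule linear_ode_bound[OF that(2)])
    have sub: "{t1..u} \<subseteq> {0..<T}" using that by auto
    show "continuous_on {t1..u} s" by (rule continuous_on_subset[OF s sub])
    show "(\<nu> has_real_derivative - s v * \<nu> v) (at v within {t1..u})" if "v \<in> {t1..u}" for v
      by (rule DERIV_subset[OF \<nu> sub]) (use sub that in blast)
  qed
  show "(\<integral>\<^sup>+u\<in>{0..<T}. ennreal ((s u)\<^sup>2) \<partial>lborel) = \<infinity>"
  proof (rule ccontr)
    assume "(\<integral>\<^sup>+u\<in>{0..<T}. ennreal ((s u)\<^sup>2) \<partial>lborel) \<noteq> \<infinity>"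
    then obtain I where I: "0 \<le> I" "(\<integral>\<^sup>+u\<in>{0..<T}. ennreal ((s u)\<^sup>2) \<partial>lborel) = ennreal I"
      by (cases "(\<integral>\<^sup>+u\<in>{0..<T}. ennreal ((s u)\<^sup>2) \<partial>lborel)") auto
    define M where "M = (\<nu> 0)\<^sup>2 * exp (T + I)"
    have "\<bar>\<nu> u\<bar> \<le> sqrt M" if u: "u \<in> {0..<T}" for u
    proof -
      have "ennreal (integral {0..u} (\<lambda>u. (s u)\<^sup>2)) \<le> ennreal I"
        unfolding I(2)[symmetric] by (rule integral_le_nn_integral) (use u s in \<open>auto intro!: continuous_intros\<close>)
      then have "integral {0..u} (\<lambda>u. (s u)\<^sup>2) \<le> I" using I(1) by (simp add: ennreal_le_iff)
      then have "exp (u - 0 + integral {0..u} (\<lambda>u. (s u)\<^sup>2)) \<le> exp (T + I)" using u by simp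
      then have "(\<nu> 0)\<^sup>2 * exp (u - 0 + integral {0..u} (\<lambda>u. (s u)\<^sup>2)) \<le> M"
        unfolding M_def by (intro mult_left_mono) auto
      then have "(\<nu> u)\<^sup>2 \<le> M" using bd[of 0 u] u by auto
      then show ?thesis using real_le_rsqrt[of "\<bar>\<nu> u\<bar>" M] by simp
    qed
    moreover have "0 \<le> sqrt M" by (simp add: M_def)
    ultimately show False using nn_integral_bounded_finite[of T "\<lambda>u. \<bar>\<nu> u\<bar>" "sqrt M"] inf by simp
  qed
  show "\<nu> t \<noteq> 0" if t: "t \<in> {0..<T}"
  proof
    assume "\<nu> t = 0"
    then have z: "\<nu> u = 0" if "t \<le> u" "u < T" for u using bd[of t u] t that by simp
    have "continuous_on {0..<T} \<nu>"
      unfolding continuous_on_eq_continuous_within using \<nu> DERIV_continuous by blast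
    then have "continuous_on {0..t} \<nu>" by (rule continuous_on_subset) (use t in auto)
    then obtain M where M: "0 < M" "\<And>u. u \<in> {0..t} \<Longrightarrow> \<bar>\<nu> u\<bar> \<le> M"
      using compact_imp_bounded[OF compact_continuous_image[OF _ compact_Icc]] by (force simp: bounded_pos)
    have "\<bar>\<nu> u\<bar> \<le> M" if "u \<in> {0..<T}" for u using M z that by (cases "u \<le> t") auto
    then show False using nn_integral_bounded_finite[of T "\<lambda>u. \<bar>\<nu> u\<bar>" M] inf M(1) by simp
  qed
qed

section \<open>Pressure Hessian and vorticity on the circle and on the axis\<close>

context euler_odd
begin

definition swirl_slope' :: "real \<Rightarrow> real" where "swirl_slope' t = DUt t (cylpt 1 0 0) e_z \<bullet> e_theta 0"

lemma strain_deriv: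
  assumes t: "t \<in> {0..<T}"
  shows "(axial_strain has_real_derivative axial_strain' t) (at t within {0..<T})"
    "(swirl_slope has_real_derivative swirl_slope' t) (at t within {0..<T})"
  unfolding axial_strain_def[abs_def] axial_strain'_def swirl_slope_def[abs_def] swirl_slope'_def
    has_real_derivative_iff_has_vector_derivative
  by (rule bounded_linear.has_vector_derivative[OF bounded_linear_inner_left DU_time_deriv[OF t]]; simp)+

lemma axis_point_continuous:
  assumes "continuous_on dom (\<lambda>(t, x). f t x)" "p \<in> cyl"
  shows "continuous_on {0..<T} (\<lambda>t. f t p)"
proof -
  have "continuous_on {0..<T} (\<lambda>t. (t, p))" by (intro continuous_intros)
  moreover have "(\<lambda>t. (t, p)) ` {0..<T} \<subseteq> dom" using assms(2) by (auto simp: dom_def)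
  ultimately have "continuous_on {0..<T} (\<lambda>t. (\<lambda>(t, x). f t x) (t, p))"
    by (rule continuous_on_compose2[OF assms(1)])
  then show ?thesis by simp
qed

lemma strain_continuous: "continuous_on {0..<T} axial_strain" "continuous_on {0..<T} axial_strain'"
  unfolding axial_strain_def[abs_def] axial_strain'_def[abs_def]
  by (intro continuous_intros axis_point_continuous[OF DU_continuous] axis_point_continuous[OF DUt_continuous]; simp)+

text \<open>\<open>DU_circle\<close> holds at all times at a fixed point with a fixed frame, so it
  may be differentiated in \<open>t\<close>.\<close>

lemma DUt_circle:
  assumes t: "t \<in> {0..<T}"
  shows "DUt t (cylpt 1 \<theta> 0) v =
    (- axial_strain' t * (v \<bullet> e_r \<theta>)) *\<^sub>R e_r \<theta> + (v \<bullet> e_z) *\<^sub>R (swirl_slope' t *\<^sub>R e_theta \<theta> + axial_strain' t *\<^sub>R e_z)"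
proof -
  have "((\<lambda>t. (- axial_strain t * (v \<bullet> e_r \<theta>)) *\<^sub>R e_r \<theta> + (v \<bullet> e_z) *\<^sub>R (swirl_slope t *\<^sub>R e_theta \<theta> + axial_strain t *\<^sub>R e_z))
     has_vector_derivative
     (- axial_strain' t * (v \<bullet> e_r \<theta>)) *\<^sub>R e_r \<theta> + (v \<bullet> e_z) *\<^sub>R (swirl_slope' t *\<^sub>R e_theta \<theta> + axial_strain' t *\<^sub>R e_z)) (at t within {0..<T})"
    by (auto intro!: derivative_eq_intros strain_deriv[OF t])
  then have "((\<lambda>t. DU t (cylpt 1 \<theta> 0) v) has_vector_derivative
     (- axial_strain' t * (v \<bullet> e_r \<theta>)) *\<^sub>R e_r \<theta> + (v \<bullet> e_z) *\<^sub>R (swirl_slope' t *\<^sub>R e_theta \<theta> + axial_strain' t *\<^sub>R e_z)) (at t within {0..<T})"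
    by (rule has_vector_derivative_transform[OF t, rotated]) (simp add: DU_circle)
  from vector_derivative_solid[OF solid_real_interval(2)[OF T] t this]
    vector_derivative_solid[OF solid_real_interval(2)[OF T] t DU_time_deriv[OF t, of "cylpt 1 \<theta> 0" v]]
  show ?thesis by simp
qed

text \<open>At a stagnation point the second derivatives of \<open>U\<close> drop out of
  \<open>HP\<close>, which becomes minus the sum of the time derivative and the square of the
  velocity gradient.\<close>

lemma HP_circle:
  assumes t: "t \<in> {0..<T}"
  shows "HP t (cylpt 1 \<theta> 0) v = ((axial_strain' t - (axial_strain t)\<^sup>2) * (v \<bullet> e_r \<theta>)) *\<^sub>R e_r \<theta>
     - (v \<bullet> e_z) *\<^sub>R ((swirl_slope' t + axial_strain t * swirl_slope t) *\<^sub>R e_theta \<theta> + (axial_strain' t + (axial_strain t)\<^sup>2) *\<^sub>R e_z)"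
proof -
  let ?p = "cylpt 1 \<theta> 0"
  have "(\<Sum>k\<in>UNIV. DU t ?p v $ k *\<^sub>R DU t ?p (axis k 1)) = DU t ?p (DU t ?p v)"
    by (rule linear_vec3_expand[OF DU_linear[OF t circle_in_cyl], symmetric])
  then have "HP t ?p v = - (DUt t ?p v + DU t ?p (DU t ?p v))"
    by (simp add: HP_def U_circle[OF t])
  also have "DU t ?p (DU t ?p v) = ((axial_strain t)\<^sup>2 * (v \<bullet> e_r \<theta>)) *\<^sub>R e_r \<theta>
      + (v \<bullet> e_z) *\<^sub>R ((axial_strain t * swirl_slope t) *\<^sub>R e_theta \<theta> + (axial_strain t)\<^sup>2 *\<^sub>R e_z)"
    unfolding DU_circle[OF t] by (simp add: inner_add_left power2_eq_square algebra_simps)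
  finally show ?thesis unfolding DUt_circle[OF t] by (simp add: algebra_simps)
qed

text \<open>\<open>HP\<close> sends \<open>e_theta\<close> to 0, so by symmetry the entry of
  \<open>HP e_z\<close> along \<open>e_theta\<close> is 0 too. That entry is, up to sign,
  \<open>\<nu>' + s \<nu>\<close>.\<close>

lemma swirl_slope_ode:
  assumes t: "t \<in> {0..<T}"
  shows "swirl_slope' t = - axial_strain t * swirl_slope t"
proof -
  have "HP t (cylpt 1 0 0) e_z \<bullet> e_theta 0 = HP t (cylpt 1 0 0) (e_theta 0) \<bullet> e_z"
    by (rule HP_symmetric[OF t]) simp
  then show ?thesis unfolding HP_circle[OF t] by (simp add: inner_diff_left inner_add_left)
qed

lemma HP_circle_form:
  assumes t: "t \<in> {0..<T}"
  shows "HP t (cylpt 1 \<theta> 0) v = ((axial_strain' t - (axial_strain t)\<^sup>2) * (v \<bullet> e_r \<theta>)) *\<^sub>R e_r \<theta>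
     - ((axial_strain' t + (axial_strain t)\<^sup>2) * (v \<bullet> e_z)) *\<^sub>R e_z"
  unfolding HP_circle[OF t] swirl_slope_ode[OF t] by simp

lemma laplacian_circle:
  assumes t: "t \<in> {0..<T}"
  shows "laplacian (P t) (cylpt 1 \<theta> 0) = - 2 * (axial_strain t)\<^sup>2"
  using trace_frame[OF HP_linear[OF t circle_in_cyl], of \<theta> 0 \<theta>]
  by (simp add: laplacian_P[OF t] HP_circle_form[OF t])

lemma norm_curl_circle:
  assumes t: "t \<in> {0..<T}"
  shows "norm (curl (U t) (cylpt 1 0 0)) = \<bar>swirl_slope t\<bar>"
proof -
  have "curl (U t) (cylpt 1 0 0) = - swirl_slope t *\<^sub>R axis 1 1"
    by (simp add: curl_def pd_U[OF t] DU_circle[OF t] vec_eq_iff forall_3 inner_3)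
  then show ?thesis by (simp add: norm_axis_1)
qed

text \<open>At the origin every off-diagonal entry of the velocity gradient is 0: in the plane
  \<open>z = 0\<close> the field is radial, along every angle, and on the axis it is axial.\<close>

lemma curl_axis:
  assumes t: "t \<in> {0..<T}"
  shows "curl (U t) (cylpt 0 0 0) = 0"
proof -
  have p: "cylpt 0 \<theta> 0 = cylpt 0 0 0" "cylpt 0 \<theta> 0 \<in> cyl" for \<theta> by (simp_all add: cylpt_def cyl_iff rsq_def)
  have r: "DU t (cylpt 0 0 0) (e_r \<theta>) \<bullet> e = 0" if e: "e = e_theta \<theta> \<or> e = e_z" for e \<theta>
  proof (rule derivative_along_zero_path[where J="{0..1}" and s=0 and v="e_r \<theta>" and G'="DU t (cylpt 0 0 0)" and
        \<gamma>="\<lambda>s. cylpt s \<theta> 0" and G="U t" and S=cyl and L="\<lambda>u. u \<bullet> e"])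
    show "U t (cylpt s \<theta> 0) \<bullet> e = 0" if "s \<in> {0..1}" for s
      using U_plane[OF t that] e by auto
    show "(U t has_derivative DU t (cylpt 0 0 0)) (at (cylpt 0 \<theta> 0) within cyl)"
      unfolding p(1)[of \<theta>] by (rule U_deriv[OF t p(2)])
  qed (auto simp: solid_real_interval cylpt_in_cyl intro!: cylpt_deriv_radial bounded_linear_inner_left)
  have z: "DU t (cylpt 0 0 0) e_z \<bullet> e_r \<theta> = 0" for \<theta>
  proof (rule derivative_along_zero_path[where J="UNIV" and s=0 and v=e_z and G'="DU t (cylpt 0 0 0)" and
        \<gamma>="\<lambda>s. cylpt 0 0 s" and G="U t" and S=cyl and L="\<lambda>u. u \<bullet> e_r \<theta>"])
    fix s
    \<comment> \<open>Comparing the angles 0 and \<open>pi\<close> at the same axis point forces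
      \<open>a\<close> and \<open>b\<close> to vanish there.\<close>
    have "cylpt 0 0 s = cylpt 0 pi s" by (simp add: cylpt_def)
    moreover have "(0::real) \<in> {0..1}" by simp
    ultimately have eq: "a t 0 s *\<^sub>R e_r 0 + b t 0 s *\<^sub>R e_theta 0 + c t 0 s *\<^sub>R e_z
      = a t 0 s *\<^sub>R e_r pi + b t 0 s *\<^sub>R e_theta pi + c t 0 s *\<^sub>R e_z" using U_cylpt[OF t] by metis
    from arg_cong[OF eq, of "\<lambda>u. u $ 1"] arg_cong[OF eq, of "\<lambda>u. u $ 2"]
    have "a t 0 s = 0" "b t 0 s = 0" by simp_all
    then show "U t (cylpt 0 0 s) \<bullet> e_r \<theta> = 0" using U_cylpt[OF t, of 0 0 s] by simp
  qed (auto simp: solid_UNIV cylpt_in_cyl intro!: cylpt_deriv_axial U_deriv t[simplified] bounded_linear_inner_left)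
  have e: "e_r 0 = axis 1 1" "e_r (pi/2) = axis 2 1" by (simp_all add: vec_eq_iff forall_3)
  show ?thesis
    using r[of "e_theta 0" 0] r[of e_z 0] r[of "e_theta (pi/2)" "pi/2"] r[of e_z "pi/2"] z[of 0] z[of "pi/2"]
    by (simp add: curl_def pd_U[OF t p(2)] e vec_eq_iff forall_3 inner_3 flip: e_z_axis)
qed

lemma strain_blowup:
  assumes r0: "r0 = 0 \<or> r0 = 1"
    and inf: "(\<integral>\<^sup>+t\<in>{0..<T}. ennreal (norm (curl (U t) (cylpt r0 0 0))) \<partial>lborel) = \<infinity>"
  shows "r0 = 1" "(\<integral>\<^sup>+t\<in>{0..<T}. ennreal ((axial_strain t)\<^sup>2) \<partial>lborel) = \<infinity>"
    "\<And>t. t \<in> {0..<T} \<Longrightarrow> swirl_slope t \<noteq> 0"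
proof -
  have "r0 \<noteq> 0"
  proof
    assume "r0 = 0"
    have "(\<integral>\<^sup>+t\<in>{0..<T}. ennreal (norm (curl (U t) (cylpt r0 0 0))) \<partial>lborel) < \<infinity>"
      by (rule nn_integral_bounded_finite[of _ _ 0]) (simp_all add: \<open>r0 = 0\<close> curl_axis)
    then show False using inf by simp
  qed
  then show "r0 = 1" using r0 by simp
  have eq: "(\<integral>\<^sup>+t\<in>{0..<T}. ennreal \<bar>swirl_slope t\<bar> \<partial>lborel) = (\<integral>\<^sup>+t\<in>{0..<T}. ennreal (norm (curl (U t) (cylpt r0 0 0))) \<partial>lborel)"
    by (rule nn_integral_cong) (auto simp: \<open>r0 = 1\<close> norm_curl_circle split: split_indicator)
  have inf': "(\<integral>\<^sup>+t\<in>{0..<T}. ennreal \<bar>swirl_slope t\<bar> \<partial>lborel) = \<infinity>" unfolding eq by (rule inf)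
  have d: "(swirl_slope has_real_derivative - axial_strain t * swirl_slope t) (at t within {0..<T})" if "t \<in> {0..<T}" for t
    using strain_deriv(2)[OF that] swirl_slope_ode[OF that] by simp
  show "(\<integral>\<^sup>+t\<in>{0..<T}. ennreal ((axial_strain t)\<^sup>2) \<partial>lborel) = \<infinity>" "\<And>t. t \<in> {0..<T} \<Longrightarrow> swirl_slope t \<noteq> 0"
    by (rule linear_ode_blowup[OF strain_continuous(1) d inf']; assumption)+
qed

end

text \<open>The sign of \<open>g\<close> makes the positive part of \<open>f\<close> vanish, so no
  \<open>\<infinity> - \<infinity>\<close> arises. The comparison uses monotonicity of the
  nonnegative integral alone, which is valid for arbitrary functions such as infima over function
  spaces.\<close>

lemma time_integral_minus_infinity:
  fixes f :: "real \<Rightarrow> ereal" and g :: "real \<Rightarrow> real"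
  assumes f: "\<And>t. t \<in> {0..<T} \<Longrightarrow> f t \<le> - ereal (g t)" and g: "\<And>t. 0 \<le> g t"
    and inf: "(\<integral>\<^sup>+t\<in>{0..<T}. ennreal (g t) \<partial>lborel) = \<infinity>"
  shows "time_integral T f = - \<infinity>"
proof -
  have "(\<integral>\<^sup>+t\<in>{0..<T}. e2ennreal (f t) \<partial>lborel) = (\<integral>\<^sup>+(t::real). 0 \<partial>lborel)"
  proof (rule nn_integral_cong)
    fix t :: real
    show "e2ennreal (f t) * indicator {0..<T} t = 0"
    proof (cases "t \<in> {0..<T}")
      case True
      have "f t \<le> 0" using order_trans[OF f[OF True], of 0] g[of t] by simp
      then show ?thesis by (simp add: e2ennreal_neg)
    qed simp
  qed
  then have 0: "(\<integral>\<^sup>+t\<in>{0..<T}. e2ennreal (f t) \<partial>lborel) = 0" by simp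
  have "(\<integral>\<^sup>+t\<in>{0..<T}. ennreal (g t) \<partial>lborel) \<le> (\<integral>\<^sup>+t\<in>{0..<T}. e2ennreal (- f t) \<partial>lborel)"
  proof (rule nn_integral_mono)
    fix t :: real
    show "ennreal (g t) * indicator {0..<T} t \<le> e2ennreal (- f t) * indicator {0..<T} t"
    proof (cases "t \<in> {0..<T}")
      case True
      have "ereal (g t) \<le> - f t" using f[OF True] ereal_minus_le_minus[of "- ereal (g t)" "f t"] by simp
      then have "e2ennreal (ereal (g t)) \<le> e2ennreal (- f t)" by (rule e2ennreal_mono)
      then show ?thesis using True by simp
    qed simp
  qed
  then have "(\<integral>\<^sup>+t\<in>{0..<T}. e2ennreal (- f t) \<partial>lborel) = \<infinity>"
    unfolding inf by (simp add: top_unique)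
  with 0 show ?thesis by (simp add: time_integral_def zero_ennreal.rep_eq)
qed

context euler_odd
begin

lemma scaled_strain_blowup:
  assumes inf: "(\<integral>\<^sup>+t\<in>{0..<T}. ennreal ((axial_strain t)\<^sup>2) \<partial>lborel) = \<infinity>" and K: "0 < K"
  shows "(\<integral>\<^sup>+t\<in>{0..<T}. ennreal (K * (axial_strain t)\<^sup>2) \<partial>lborel) = \<infinity>"
proof -
  have "continuous_on {0..<T} (\<lambda>t. (axial_strain t)\<^sup>2)" by (intro continuous_intros strain_continuous)
  from borel_measurable_continuous_on_indicator[OF _ this]
  have "(\<lambda>t. ennreal (indicator {0..<T} t *\<^sub>R (axial_strain t)\<^sup>2)) \<in> borel_measurable lborel" by simp
  also have "(\<lambda>t. ennreal (indicator {0..<T} t *\<^sub>R (axial_strain t)\<^sup>2)) = (\<lambda>t. ennreal ((axial_strain t)\<^sup>2) * indicator {0..<T} t)"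
    by (auto split: split_indicator)
  finally have m: "(\<lambda>t. ennreal ((axial_strain t)\<^sup>2) * indicator {0..<T} t) \<in> borel_measurable lborel" .
  have "(\<integral>\<^sup>+t\<in>{0..<T}. ennreal (K * (axial_strain t)\<^sup>2) \<partial>lborel)
     = (\<integral>\<^sup>+t. ennreal K * (ennreal ((axial_strain t)\<^sup>2) * indicator {0..<T} t) \<partial>lborel)"
    using K by (intro nn_integral_cong) (simp add: ennreal_mult mult.assoc)
  also have "\<dots> = ennreal K * (\<integral>\<^sup>+t\<in>{0..<T}. ennreal ((axial_strain t)\<^sup>2) \<partial>lborel)"
    by (rule nn_integral_cmult[OF m])
  finally show ?thesis using K unfolding inf by (simp add: ennreal_mult_top)
qed

lemma laplacian_blowup:
  assumes "(\<integral>\<^sup>+t\<in>{0..<T}. ennreal ((axial_strain t)\<^sup>2) \<partial>lborel) = \<infinity>"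
  shows "time_integral T (\<lambda>t. INF x\<in>cyl. ereal (laplacian (P t) x)) = - \<infinity>"
proof (rule time_integral_minus_infinity[where g="\<lambda>t. 2 * (axial_strain t)\<^sup>2"])
  show "(INF x\<in>cyl. ereal (laplacian (P t) x)) \<le> - ereal (2 * (axial_strain t)\<^sup>2)" if "t \<in> {0..<T}" for t
    by (rule INF_lower2[of "cylpt 1 0 0"]) (simp_all add: laplacian_circle[OF that])
qed (use scaled_strain_blowup[OF assms, of 2] in auto)

end

section \<open>Variations near the circle\<close>

lemma Int_on_FTC:
  fixes f :: "real \<Rightarrow> real"
  assumes "a \<le> b" "\<And>t. t \<in> {a..b} \<Longrightarrow> (f has_real_derivative f' t) (at t within {a..b})" "continuous_on {a..b} f'"
  shows "Int_on {a..b} f' = f b - f a"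
  unfolding set_lebesgue_integral_def
  by (rule integral_FTC_atLeastAtMost) (use assms in \<open>auto simp: has_real_derivative_iff_has_vector_derivative\<close>)

text \<open>
  Completing the square with a solution \<open>w = d + \<kappa>\<close> of the Riccati inequality
  \<open>w' + w\<^sup>2 \<le> d' + d\<^sup>2 - \<mu>\<close>.
\<close>

lemma riccati_form_nonneg:
  fixes d d' f f' :: "real \<Rightarrow> real"
  assumes ab: "a \<le> b"
    and d: "\<And>t. t \<in> {a..b} \<Longrightarrow> (d has_real_derivative d' t) (at t within {a..b})" "continuous_on {a..b} d'"
    and B: "\<And>t. t \<in> {a..b} \<Longrightarrow> \<bar>d t\<bar> \<le> B"
    and f: "\<And>t. t \<in> {a..b} \<Longrightarrow> (f has_real_derivative f' t) (at t within {a..b})" "continuous_on {a..b} f'"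
    and f0: "f a = 0" "f b = 0" and \<mu>: "\<mu> = exp (- (2 * B + 2) * (b - a))"
  shows "0 \<le> Int_on {a..b} (\<lambda>t. (f' t)\<^sup>2 + (d' t + (d t)\<^sup>2 - \<mu>) * (f t)\<^sup>2)"
proof -
  have B0: "0 \<le> B" using B[of a] ab by auto
  \<comment> \<open>The solution of \<open>\<kappa>' = (2 B + 2) \<kappa>\<close> with value -1 at
    \<open>b\<close>. It stays between -1 and \<open>- \<mu>\<close>; the constant
    \<open>\<mu>\<close> is its absolute value at \<open>a\<close>.\<close>
  define \<kappa> where "\<kappa> t = - exp ((2 * B + 2) * (t - b))" for t
  define w where "w t = d t + \<kappa> t" for t
  define w' where "w' t = d' t + (2 * B + 2) * \<kappa> t" for t
  have d\<kappa>: "(\<kappa> has_real_derivative (2 * B + 2) * \<kappa> t) (at t within {a..b})" for t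
    unfolding \<kappa>_def[abs_def] by (auto intro!: derivative_eq_intros)
  have dw: "(w has_real_derivative w' t) (at t within {a..b})" if "t \<in> {a..b}" for t
    unfolding w_def[abs_def] w'_def by (intro DERIV_add d(1) d\<kappa> that)
  have c\<kappa>: "continuous_on {a..b} \<kappa>" unfolding \<kappa>_def[abs_def] by (intro continuous_intros)
  have cd: "continuous_on {a..b} d" "continuous_on {a..b} f"
    unfolding continuous_on_eq_continuous_within using d(1) f(1) DERIV_continuous by blast+
  have cw: "continuous_on {a..b} w" "continuous_on {a..b} w'"
    unfolding w_def[abs_def] w'_def[abs_def] by (intro continuous_intros cd c\<kappa> d(2))+
  have ric: "w' t + (w t)\<^sup>2 \<le> d' t + (d t)\<^sup>2 - \<mu>" if t: "t \<in> {a..b}" for t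
  proof -
    have k: "- 1 \<le> \<kappa> t" "\<kappa> t \<le> - \<mu>" "\<kappa> t < 0"
    proof -
      have "(2 * B + 2) * (t - b) \<le> 0" using t B0 by (intro mult_nonneg_nonpos) auto
      then show "- 1 \<le> \<kappa> t" by (simp add: \<kappa>_def)
      have "(2 * B + 2) * (a - b) \<le> (2 * B + 2) * (t - b)" using t B0 by (intro mult_left_mono) auto
      then show "\<kappa> t \<le> - \<mu>" unfolding \<kappa>_def \<mu> by (simp add: algebra_simps)
    qed (simp add: \<kappa>_def)
    have "w' t + (w t)\<^sup>2 = d' t + (d t)\<^sup>2 + \<kappa> t * (2 * B + 2 + 2 * d t + \<kappa> t)"
      by (simp add: w_def w'_def power2_eq_square algebra_simps)
    \<comment> \<open>The bracket is at least 1, since \<open>d t\<close> is at least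
      \<open>- B\<close> and \<open>\<kappa> t\<close> at least -1; multiplication by the negative
      \<open>\<kappa> t\<close> reverses the inequality.\<close>
    also have "\<kappa> t * (2 * B + 2 + 2 * d t + \<kappa> t) \<le> \<kappa> t * 1"
      using k B[OF t] by (intro mult_left_mono_neg) auto
    finally show ?thesis using k(2) by simp
  qed
  \<comment> \<open>The derivative of \<open>w f^2\<close> integrates to 0 because \<open>f\<close>
    vanishes at both ends. Once it is subtracted, the integrand is \<open>(f' - w f)^2\<close> plus
    the slack of the Riccati inequality times \<open>f^2\<close>.\<close>
  have "Int_on {a..b} (\<lambda>t. w' t * (f t)\<^sup>2 + w t * (2 * f t * f' t)) = w b * (f b)\<^sup>2 - w a * (f a)\<^sup>2"
  proof (rule Int_on_FTC[OF ab])
    show "((\<lambda>t. w t * (f t)\<^sup>2) has_real_derivative w' t * (f t)\<^sup>2 + w t * (2 * f t * f' t)) (at t within {a..b})"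
      if "t \<in> {a..b}" for t
      by (rule derivative_eq_intros dw[OF that] f(1)[OF that] refl | simp)+
    show "continuous_on {a..b} (\<lambda>t. w' t * (f t)\<^sup>2 + w t * (2 * f t * f' t))"
      by (intro continuous_intros cw cd f(2))
  qed
  then have "0 = Int_on {a..b} (\<lambda>t. w' t * (f t)\<^sup>2 + w t * (2 * f t * f' t))" by (simp add: f0)
  also have "\<dots> \<le> Int_on {a..b} (\<lambda>t. (f' t)\<^sup>2 + (d' t + (d t)\<^sup>2 - \<mu>) * (f t)\<^sup>2)"
  proof (rule Int_on_mono[OF compact_Icc])
    fix t assume t: "t \<in> {a..b}"
    have "(w' t + (w t)\<^sup>2) * (f t)\<^sup>2 \<le> (d' t + (d t)\<^sup>2 - \<mu>) * (f t)\<^sup>2"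
      by (rule mult_right_mono[OF ric[OF t]]) simp
    moreover have "0 \<le> (f' t - w t * f t)\<^sup>2" by simp
    ultimately show "w' t * (f t)\<^sup>2 + w t * (2 * f t * f' t) \<le> (f' t)\<^sup>2 + (d' t + (d t)\<^sup>2 - \<mu>) * (f t)\<^sup>2"
      by (simp add: power2_eq_square algebra_simps)
  qed (intro continuous_intros cw cd f(2) d(2))+
  finally show ?thesis .
qed

text \<open>A one-sided bound on the second derivative in the direction \<open>v\<close> is
  integrated twice along the segment. Working within a convex set admits segments that touch the
  wall.\<close>

lemma taylor_upper:
  fixes f :: "real^3 \<Rightarrow> real"
  assumes S: "convex S" "y \<in> S" "y + v \<in> S"
    and f: "\<And>x. x \<in> S \<Longrightarrow> (f has_derivative (\<lambda>h. g x \<bullet> h)) (at x within S)"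
    and g: "\<And>x. x \<in> S \<Longrightarrow> (g has_derivative h x) (at x within S)"
    and le: "\<And>x. x \<in> S \<Longrightarrow> h x v \<bullet> v \<le> C"
  shows "f (y + v) - f y - g y \<bullet> v \<le> C / 2"
proof -
  have eq: "y + s *\<^sub>R (y + v - y) = y + s *\<^sub>R v" for s by simp
  have seg: "y + s *\<^sub>R v \<in> S" if "s \<in> {0..1}" for s
  proof -
    have "(1 - s) *\<^sub>R y + s *\<^sub>R (y + v) \<in> S" using S that by (auto simp: convex_def)
    then show ?thesis by (simp add: algebra_simps)
  qed
  have d1: "((\<lambda>s. f (y + s *\<^sub>R v)) has_real_derivative g (y + s *\<^sub>R v) \<bullet> v) (at s within {0..1})" if s: "s \<in> {0..1}" for s
    using has_vector_derivative_along_segment[OF S(1,2,3), of f "\<lambda>h. g (y + s *\<^sub>R v) \<bullet> h" s] f[OF seg[OF s]] s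
    by (simp add: has_real_derivative_iff_has_vector_derivative)
  have d2: "((\<lambda>s. g (y + s *\<^sub>R v) \<bullet> v) has_real_derivative h (y + s *\<^sub>R v) v \<bullet> v) (at s within {0..1})" if s: "s \<in> {0..1}" for s
    using bounded_linear.has_vector_derivative[OF bounded_linear_inner_left
        has_vector_derivative_along_segment[OF S(1,2,3), of g "h (y + s *\<^sub>R v)" s]] g[OF seg[OF s]] s
    by (simp add: has_real_derivative_iff_has_vector_derivative)
  have mono: "k 1 \<le> k 0" if "\<And>s. s \<in> {0..1} \<Longrightarrow> (k has_real_derivative k' s) (at s within {0..1})"
    "\<And>s. s \<in> {0..1} \<Longrightarrow> k' s \<le> 0" for k k' :: "real \<Rightarrow> real"
  proof (rule DERIV_nonpos_imp_decreasing_open[of 0 1 k])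
    show "continuous_on {0..1} k"
      unfolding continuous_on_eq_continuous_within using that(1) DERIV_continuous by blast
    fix s :: real assume s: "0 < s" "s < 1"
    then have "(k has_real_derivative k' s) (at s)"
      using that(1)[of s] at_within_interior[of s "{0..1::real}"] by simp
    then show "\<exists>y. (k has_real_derivative y) (at s) \<and> y \<le> 0" using that(2)[of s] s by auto
  qed simp
  have mono': "k s \<le> k 0" if "\<And>s. s \<in> {0..1} \<Longrightarrow> (k has_real_derivative k' s) (at s within {0..1})"
    "\<And>s. s \<in> {0..1} \<Longrightarrow> k' s \<le> 0" and s: "s \<in> {0..1}" for k k' :: "real \<Rightarrow> real" and s
  proof (rule DERIV_nonpos_imp_decreasing_open[of 0 s k])
    have "continuous_on {0..1} k"
      unfolding continuous_on_eq_continuous_within using that(1) DERIV_continuous by blast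
    then show "continuous_on {0..s} k" by (rule continuous_on_subset) (use s in auto)
    fix u :: real assume u: "0 < u" "u < s"
    then have "(k has_real_derivative k' u) (at u)"
      using that(1)[of u] at_within_interior[of u "{0..1::real}"] s by simp
    then show "\<exists>y. (k has_real_derivative y) (at u) \<and> y \<le> 0" using that(2)[of u] u s by auto
  qed (use s in simp)
  have first: "g (y + s *\<^sub>R v) \<bullet> v - C * s \<le> g y \<bullet> v" if s: "s \<in> {0..1}" for s
  proof -
    have "g (y + s *\<^sub>R v) \<bullet> v - C * s \<le> g (y + 0 *\<^sub>R v) \<bullet> v - C * 0"
    proof (rule mono'[where k="\<lambda>s. g (y + s *\<^sub>R v) \<bullet> v - C * s" and k'="\<lambda>s. h (y + s *\<^sub>R v) v \<bullet> v - C"])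
      show "((\<lambda>s. g (y + s *\<^sub>R v) \<bullet> v - C * s) has_real_derivative h (y + s *\<^sub>R v) v \<bullet> v - C) (at s within {0..1})"
        if "s \<in> {0..1}" for s
        by (rule derivative_eq_intros d2[OF that] refl | simp)+
    qed (use le seg s in auto)
    then show ?thesis by simp
  qed
  have "f (y + 1 *\<^sub>R v) - 1 * (g y \<bullet> v) - C * 1\<^sup>2 / 2 \<le> f (y + 0 *\<^sub>R v) - 0 * (g y \<bullet> v) - C * 0\<^sup>2 / 2"
  proof (rule mono[where k="\<lambda>s. f (y + s *\<^sub>R v) - s * (g y \<bullet> v) - C * s\<^sup>2 / 2" and k'="\<lambda>s. g (y + s *\<^sub>R v) \<bullet> v - g y \<bullet> v - C * s"])
    show "((\<lambda>s. f (y + s *\<^sub>R v) - s * (g y \<bullet> v) - C * s\<^sup>2 / 2) has_real_derivative g (y + s *\<^sub>R v) \<bullet> v - g y \<bullet> v - C * s) (at s within {0..1})"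
      if "s \<in> {0..1}" for s
      by (rule derivative_eq_intros d1[OF that] refl | simp)+
    show "g (y + s *\<^sub>R v) \<bullet> v - g y \<bullet> v - C * s \<le> 0" if "s \<in> {0..1}" for s
      using first[OF that] by simp
  qed
  then show ?thesis by simp
qed

context euler_odd
begin

text \<open>
  At the circle this is the Hessian of the pressure; away from it \<open>r v\<^sub>r\<close> replaces \<open>v\<^sub>r\<close>, to keep
  the form smooth on the axis.
\<close>

definition index_form :: "real \<Rightarrow> real^3 \<Rightarrow> real^3 \<Rightarrow> real" where
  "index_form t x v = (axial_strain' t - (axial_strain t)\<^sup>2) * (x$1 * v$1 + x$2 * v$2)\<^sup>2
     - (axial_strain' t + (axial_strain t)\<^sup>2) * (v$3)\<^sup>2"

text \<open>The functions \<open>u\<close>, \<open>z\<close> and \<open>\<xi> $ 3\<close> are the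
  components along \<open>(x, y)\<close>, along its quarter turn and along the axis. They decouple
  the form into three scalar Riccati problems, with \<open>d = - s\<close>, \<open>d = 0\<close> and
  \<open>d = s\<close>. The first two components carry a factor \<open>r\<close>:
  \<open>rsq x \<le> 1\<close> lets their kinetic terms be replaced by \<open>|\<xi>'|^2\<close>,
  and \<open>1/4 \<le> rsq x\<close> leaves a quarter of the margin \<open>\<mu>\<close>.\<close>

lemma index_form_positive:
  assumes t12: "0 \<le> t1" "t1 \<le> t2" "t2 < T"
    and B: "\<And>t. t \<in> {t1..t2} \<Longrightarrow> \<bar>axial_strain t\<bar> \<le> B"
    and \<mu>: "\<mu> = exp (- (2 * B + 2) * (t2 - t1))"
    and x: "1/4 \<le> rsq x" "rsq x \<le> 1"
    and \<xi>: "\<And>t. t \<in> {t1..t2} \<Longrightarrow> (\<xi> has_vector_derivative \<xi>' t) (at t within {t1..t2})" "continuous_on {t1..t2} \<xi>'"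
    and \<xi>0: "\<xi> t1 = 0" "\<xi> t2 = 0"
  shows "0 \<le> Int_on {t1..t2} (\<lambda>t. (norm (\<xi>' t))\<^sup>2 - index_form t x (\<xi> t) - \<mu> / 4 * (norm (\<xi> t))\<^sup>2)"
proof -
  have sub: "{t1..t2} \<subseteq> {0..<T}" using t12 by auto
  have cs: "continuous_on {t1..t2} axial_strain" "continuous_on {t1..t2} axial_strain'"
    using strain_continuous continuous_on_subset sub by blast+
  have ds: "(axial_strain has_real_derivative axial_strain' t) (at t within {t1..t2})" if "t \<in> {t1..t2}" for t
    by (rule DERIV_subset[OF strain_deriv(1) sub]) (use that sub in blast)
  have c\<xi>: "continuous_on {t1..t2} \<xi>"
    unfolding continuous_on_eq_continuous_within using \<xi>(1) has_vector_derivative_continuous by blast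
  define u where "u t = x$1 * \<xi> t $ 1 + x$2 * \<xi> t $ 2" for t
  define u' where "u' t = x$1 * \<xi>' t $ 1 + x$2 * \<xi>' t $ 2" for t
  define z where "z t = x$1 * \<xi> t $ 2 - x$2 * \<xi> t $ 1" for t
  define z' where "z' t = x$1 * \<xi>' t $ 2 - x$2 * \<xi>' t $ 1" for t
  have comp: "((\<lambda>t. \<xi> t $ i) has_real_derivative \<xi>' t $ i) (at t within {t1..t2})" if "t \<in> {t1..t2}" for t i
    unfolding has_real_derivative_iff_has_vector_derivative
    by (rule bounded_linear.has_vector_derivative[OF bounded_linear_vec_nth \<xi>(1)[OF that]])
  have du: "(u has_real_derivative u' t) (at t within {t1..t2})" if "t \<in> {t1..t2}" for t
    unfolding u_def[abs_def] u'_def by (auto intro!: derivative_eq_intros comp[OF that])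
  have dz: "(z has_real_derivative z' t) (at t within {t1..t2})" if "t \<in> {t1..t2}" for t
    unfolding z_def[abs_def] z'_def by (auto intro!: derivative_eq_intros comp[OF that])
  have cu: "continuous_on {t1..t2} u" "continuous_on {t1..t2} u'" "continuous_on {t1..t2} z" "continuous_on {t1..t2} z'"
    "continuous_on {t1..t2} (\<lambda>t. \<xi>' t $ 3)" "continuous_on {t1..t2} (\<lambda>t. \<xi> t $ 3)"
    unfolding u_def[abs_def] u'_def[abs_def] z_def[abs_def] z'_def[abs_def] by (intro continuous_intros c\<xi> \<xi>(2))+
  have R1: "0 \<le> Int_on {t1..t2} (\<lambda>t. (u' t)\<^sup>2 + (- axial_strain' t + (- axial_strain t)\<^sup>2 - \<mu>) * (u t)\<^sup>2)"
    by (rule riccati_form_nonneg[OF t12(2) _ _ _ du cu(2) _ _ \<mu>])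
      (use B \<xi>0 in \<open>auto intro!: DERIV_minus ds continuous_intros cs simp: u_def\<close>)
  have R2: "0 \<le> Int_on {t1..t2} (\<lambda>t. (z' t)\<^sup>2 + (0 + 0\<^sup>2 - \<mu>) * (z t)\<^sup>2)"
  proof (rule riccati_form_nonneg[OF t12(2) _ _ _ dz cu(4) _ _ \<mu>])
    show "\<bar>0\<bar> \<le> B" if "t \<in> {t1..t2}" for t using B[OF that] by simp
  qed (use \<xi>0 in \<open>auto simp: z_def\<close>)
  have R3: "0 \<le> Int_on {t1..t2} (\<lambda>t. (\<xi>' t $ 3)\<^sup>2 + (axial_strain' t + (axial_strain t)\<^sup>2 - \<mu>) * (\<xi> t $ 3)\<^sup>2)"
    by (rule riccati_form_nonneg[OF t12(2) ds cs(2) B comp cu(5) _ _ \<mu>]) (use \<xi>0 in auto)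
  have c1: "continuous_on {t1..t2} (\<lambda>t. (u' t)\<^sup>2 + (- axial_strain' t + (- axial_strain t)\<^sup>2 - \<mu>) * (u t)\<^sup>2)"
    and c2: "continuous_on {t1..t2} (\<lambda>t. (z' t)\<^sup>2 + (0 + 0\<^sup>2 - \<mu>) * (z t)\<^sup>2)"
    and c3: "continuous_on {t1..t2} (\<lambda>t. (\<xi>' t $ 3)\<^sup>2 + (axial_strain' t + (axial_strain t)\<^sup>2 - \<mu>) * (\<xi> t $ 3)\<^sup>2)"
    by (intro continuous_intros cu cs)+
  have \<mu>0: "0 < \<mu>" by (simp add: \<mu>)
  have "0 \<le> Int_on {t1..t2} (\<lambda>t. ((u' t)\<^sup>2 + (- axial_strain' t + (- axial_strain t)\<^sup>2 - \<mu>) * (u t)\<^sup>2)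
      + ((z' t)\<^sup>2 + (0 + 0\<^sup>2 - \<mu>) * (z t)\<^sup>2)
      + ((\<xi>' t $ 3)\<^sup>2 + (axial_strain' t + (axial_strain t)\<^sup>2 - \<mu>) * (\<xi> t $ 3)\<^sup>2))"
    using R1 R2 R3 by (subst Int_on_add[OF compact_Icc continuous_on_add[OF c1 c2] c3], subst Int_on_add[OF compact_Icc c1 c2]) linarith
  also have "\<dots> \<le> Int_on {t1..t2} (\<lambda>t. (norm (\<xi>' t))\<^sup>2 - index_form t x (\<xi> t) - \<mu> / 4 * (norm (\<xi> t))\<^sup>2)"
  proof (rule Int_on_mono[OF compact_Icc])
    fix t
    have a: "(u' t)\<^sup>2 + (z' t)\<^sup>2 + (\<xi>' t $ 3)\<^sup>2 \<le> (norm (\<xi>' t))\<^sup>2"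
    proof -
      have "(u' t)\<^sup>2 + (z' t)\<^sup>2 = rsq x * ((\<xi>' t $ 1)\<^sup>2 + (\<xi>' t $ 2)\<^sup>2)"
        by (simp add: u'_def z'_def rsq_def power2_eq_square algebra_simps)
      also have "\<dots> \<le> 1 * ((\<xi>' t $ 1)\<^sup>2 + (\<xi>' t $ 2)\<^sup>2)" using x by (intro mult_right_mono) auto
      finally show ?thesis by (simp add: norm_3_sq)
    qed
    have b: "1/4 * (norm (\<xi> t))\<^sup>2 \<le> (u t)\<^sup>2 + (z t)\<^sup>2 + (\<xi> t $ 3)\<^sup>2"
    proof -
      have "(u t)\<^sup>2 + (z t)\<^sup>2 = rsq x * ((\<xi> t $ 1)\<^sup>2 + (\<xi> t $ 2)\<^sup>2)"
        by (simp add: u_def z_def rsq_def power2_eq_square algebra_simps)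
      moreover have "1/4 * ((\<xi> t $ 1)\<^sup>2 + (\<xi> t $ 2)\<^sup>2) \<le> rsq x * ((\<xi> t $ 1)\<^sup>2 + (\<xi> t $ 2)\<^sup>2)"
        using x by (intro mult_right_mono) auto
      moreover have "0 \<le> (\<xi> t $ 3)\<^sup>2" by simp
      ultimately show ?thesis unfolding norm_3_sq by argo
    qed
    have "\<mu> * (1/4 * (norm (\<xi> t))\<^sup>2) \<le> \<mu> * ((u t)\<^sup>2 + (z t)\<^sup>2 + (\<xi> t $ 3)\<^sup>2)"
      using \<mu>0 b by (intro mult_left_mono) auto
    then show "((u' t)\<^sup>2 + (- axial_strain' t + (- axial_strain t)\<^sup>2 - \<mu>) * (u t)\<^sup>2)
      + ((z' t)\<^sup>2 + (0 + 0\<^sup>2 - \<mu>) * (z t)\<^sup>2)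
      + ((\<xi>' t $ 3)\<^sup>2 + (axial_strain' t + (axial_strain t)\<^sup>2 - \<mu>) * (\<xi> t $ 3)\<^sup>2)
      \<le> (norm (\<xi>' t))\<^sup>2 - index_form t x (\<xi> t) - \<mu> / 4 * (norm (\<xi> t))\<^sup>2"
      using a by (simp add: index_form_def flip: u_def) (simp add: algebra_simps)
  next
    show "continuous_on {t1..t2} (\<lambda>t. (norm (\<xi>' t))\<^sup>2 - index_form t x (\<xi> t) - \<mu> / 4 * (norm (\<xi> t))\<^sup>2)"
      unfolding index_form_def by (intro continuous_intros cs c\<xi> \<xi>(2))
  qed (intro continuous_on_add c1 c2 c3)
  finally show ?thesis .
qed

text \<open>The points of the circle are stagnation points, so nearby particles stay nearby.\<close>

lemma flow_near_circle:
  assumes \<eta>: "is_flow T U \<eta>" and t2: "0 \<le> t2" "t2 < T"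
  obtains C where "0 < C" "\<And>x \<theta> t. \<lbrakk>x \<in> cyl; t \<in> {0..t2}\<rbrakk> \<Longrightarrow>
    norm (\<eta> t x - cylpt 1 \<theta> 0) \<le> C * norm (x - cylpt 1 \<theta> 0)"
proof -
  obtain C where C: "0 < C" "\<And>t x v. \<lbrakk>t \<in> {0..t2}; x \<in> cyl\<rbrakk> \<Longrightarrow> norm (DU t x v) \<le> C * norm v"
    using DU_bounded[OF t2] by metis
  have "norm (\<eta> t x - cylpt 1 \<theta> 0) \<le> exp (C * t2) * norm (x - cylpt 1 \<theta> 0)"
    if x: "x \<in> cyl" and t: "t \<in> {0..t2}" for x \<theta> t
  proof -
    let ?p = "cylpt 1 \<theta> 0"
    have sub: "{0..t2} \<subseteq> {0..<T}" using t2 by auto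
    have \<eta>c: "\<eta> s x \<in> cyl" "((\<lambda>s. \<eta> s x) has_vector_derivative U s (\<eta> s x)) (at s within {0..t2})"
      if "s \<in> {0..t2}" for s
    proof -
      have s: "s \<in> {0..<T}" using that sub by auto
      show "\<eta> s x \<in> cyl" using \<eta> x s by (auto simp: is_flow_def)
      have "((\<lambda>s. \<eta> s x) has_vector_derivative U s (\<eta> s x)) (at s within {0..<T})"
        using \<eta> x s by (auto simp: is_flow_def)
      then show "((\<lambda>s. \<eta> s x) has_vector_derivative U s (\<eta> s x)) (at s within {0..t2})"
        by (rule has_vector_derivative_within_subset[OF _ sub])
    qed
    let ?g = "\<lambda>s. (\<eta> s x - ?p) \<bullet> (\<eta> s x - ?p)"
    have dg: "(?g has_real_derivative 2 * ((\<eta> s x - ?p) \<bullet> U s (\<eta> s x))) (at s within {0..t2})" if "s \<in> {0..t2}" for s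
    proof -
      have "((\<lambda>s. \<eta> s x - ?p) has_vector_derivative U s (\<eta> s x) - 0) (at s within {0..t2})"
        by (intro has_vector_derivative_diff \<eta>c(2)[OF that] has_vector_derivative_const)
      from bounded_bilinear.has_vector_derivative[OF bounded_bilinear_inner this this]
      show ?thesis by (simp add: has_real_derivative_iff_has_vector_derivative inner_commute)
    qed
    have "?g t \<le> ?g 0 * exp (2 * C * t)"
    proof (rule gronwall[OF dg _ t])
      fix s assume s: "s \<in> {0..t2}"
      have s': "s \<in> {0..<T}" using s sub by auto
      have "norm (U s (\<eta> s x) - U s ?p) \<le> C * norm (\<eta> s x - ?p)"
        by (rule lipschitz_on_cyl[OF U_deriv[OF s'] C(2)[OF s] \<eta>c(1)[OF s]]) auto
      then have l: "norm (U s (\<eta> s x)) \<le> C * norm (\<eta> s x - ?p)" by (simp add: U_circle[OF s'])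
      have "(\<eta> s x - ?p) \<bullet> U s (\<eta> s x) \<le> norm (\<eta> s x - ?p) * norm (U s (\<eta> s x))" by (rule norm_cauchy_schwarz)
      also have "\<dots> \<le> norm (\<eta> s x - ?p) * (C * norm (\<eta> s x - ?p))" by (rule mult_left_mono[OF l]) simp
      finally show "2 * ((\<eta> s x - ?p) \<bullet> U s (\<eta> s x)) \<le> 2 * C * ?g s"
        by (simp add: dot_square_norm power2_eq_square mult_ac)
    qed
    also have "\<dots> \<le> ?g 0 * exp (2 * C * t2)" using t C(1) by (intro mult_left_mono) auto
    also have "\<dots> = (exp (C * t2) * norm (x - ?p))\<^sup>2"
      using \<eta> x by (simp add: is_flow_def dot_square_norm power_mult_distrib mult_ac flip: exp_double)
    finally have "(norm (\<eta> t x - ?p))\<^sup>2 \<le> (exp (C * t2) * norm (x - ?p))\<^sup>2" by (simp add: dot_square_norm)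
    then show ?thesis by (rule power2_le_imp_le) simp
  qed
  then show ?thesis by (intro that[of "exp (C * t2)"]) auto
qed

end

section \<open>Energy of a variation and its second derivative\<close>

lemma integral_M_cong: "(\<And>x. x \<in> fund \<Longrightarrow> f x = g x) \<Longrightarrow> integral_M f = integral_M g"
  unfolding integral_M_def set_lebesgue_integral_def
  by (rule Bochner_Integration.integral_cong) (auto split: split_indicator)

text \<open>Borel measurability of the inner integral is what allows the time integral to pass from
  \<open>lebesgue\<close> to \<open>lborel\<close>.\<close>

lemma Int_on_parameter_measurable:
  fixes g :: "'a::euclidean_space \<times> 'b::euclidean_space \<Rightarrow> real"
  assumes A: "compact A" and B: "compact B" and g: "continuous_on (A \<times> B) g"
  shows "(\<lambda>s. indicator A s *\<^sub>R Int_on B (\<lambda>x. g (s, x))) \<in> borel_measurable lborel"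
proof -
  have "(\<lambda>p. indicator (A \<times> B) p *\<^sub>R g p) \<in> borel_measurable borel"
    by (rule borel_measurable_continuous_on_indicator[OF _ g]) (intro borel_compact compact_Times A B)
  then have "(\<lambda>(s, x). indicator (A \<times> B) (s, x) *\<^sub>R g (s, x)) \<in> borel_measurable (lborel \<Otimes>\<^sub>M lborel)"
    by (simp add: lborel_prod case_prod_beta')
  from lborel.borel_measurable_lebesgue_integral[OF this]
  have "(\<lambda>s. LBINT x. indicator (A \<times> B) (s, x) *\<^sub>R g (s, x)) \<in> borel_measurable lborel" .
  moreover have "(\<lambda>s. LBINT x. indicator (A \<times> B) (s, x) *\<^sub>R g (s, x)) = (\<lambda>s. indicator A s *\<^sub>R Int_on B (\<lambda>x. g (s, x)))"
    unfolding set_lebesgue_integral_def by (auto simp: indicator_times mult.assoc fun_eq_iff)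
  ultimately show ?thesis by simp
qed

text \<open>A single integral over a compact product, to which Fubini and differentiation under the
  integral sign apply.\<close>

lemma energy_eq:
  assumes t12: "t1 < t2"
    and \<gamma>: "\<And>t x. \<lbrakk>t \<in> {t1..t2}; x \<in> fund\<rbrakk> \<Longrightarrow> ((\<lambda>s. \<gamma> s x) has_vector_derivative \<gamma>t (t, x)) (at t within {t1..t2})"
    and c: "continuous_on ({t1..t2} \<times> fund) \<gamma>t"
  shows "energy t1 t2 \<gamma> = 1/2 * Int_on ({t1..t2} \<times> fund) (\<lambda>p. (norm (\<gamma>t p))\<^sup>2)"
proof -
  have cn: "continuous_on ({t1..t2} \<times> fund) (\<lambda>p. (norm (\<gamma>t p))\<^sup>2)" by (intro continuous_intros c)
  have inner: "integral_M (\<lambda>x. (norm (vector_derivative (\<lambda>s. \<gamma> s x) (at t within {t1..t2})))\<^sup>2) = Int_on fund (\<lambda>x. (norm (\<gamma>t (t, x)))\<^sup>2)"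
    if t: "t \<in> {t1..t2}" for t
  proof -
    have "integral_M (\<lambda>x. (norm (vector_derivative (\<lambda>s. \<gamma> s x) (at t within {t1..t2})))\<^sup>2) = integral_M (\<lambda>x. (norm (\<gamma>t (t, x)))\<^sup>2)"
      by (rule integral_M_cong) (simp add: vector_derivative_solid[OF solid_real_interval(1)[OF t12] t \<gamma>[OF t]])
    also have "\<dots> = Int_on fund (\<lambda>x. (norm (\<gamma>t (t, x)))\<^sup>2)"
    proof (rule integral_M_Int_on)
      have "continuous_on fund (\<lambda>x. (t, x))" by (intro continuous_intros)
      moreover have "(\<lambda>x. (t, x)) ` fund \<subseteq> {t1..t2} \<times> fund" using t by auto
      ultimately show "continuous_on fund (\<lambda>x. (norm (\<gamma>t (t, x)))\<^sup>2)" by (rule continuous_on_compose2[OF cn])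
    qed
    finally show ?thesis .
  qed
  have "energy t1 t2 \<gamma> = 1/2 * set_lebesgue_integral lebesgue {t1..t2} (\<lambda>t. Int_on fund (\<lambda>x. (norm (\<gamma>t (t, x)))\<^sup>2))"
    unfolding energy_def set_lebesgue_integral_def
    by (rule arg_cong[where f="\<lambda>x. 1/2 * x"], rule Bochner_Integration.integral_cong)
      (auto simp: inner[unfolded set_lebesgue_integral_def] split: split_indicator)
  also have "set_lebesgue_integral lebesgue {t1..t2} (\<lambda>t. Int_on fund (\<lambda>x. (norm (\<gamma>t (t, x)))\<^sup>2))
      = Int_on {t1..t2} (\<lambda>t. Int_on fund (\<lambda>x. (norm (\<gamma>t (t, x)))\<^sup>2))"
    unfolding set_lebesgue_integral_def[of _ "{t1..t2}"]
    by (rule integral_completion[OF Int_on_parameter_measurable[OF compact_Icc compact_fund cn]])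
  also have "\<dots> = Int_on ({t1..t2} \<times> fund) (\<lambda>p. (norm (\<gamma>t p))\<^sup>2)"
    by (rule Int_on_Times(1)[OF compact_Icc compact_fund cn, symmetric])
  finally show ?thesis .
qed

lemma variation_time_derivative:
  assumes S: "S = A \<times> {t1..t2} \<times> cyl" and H: "smooth_on (\<lambda>(\<sigma>, t, x). H \<sigma> t x) S"
    and "\<sigma> \<in> A" "t \<in> {t1..t2}" "x \<in> cyl"
  shows "((\<lambda>s. H \<sigma> s x) has_vector_derivative dird S (\<lambda>(\<sigma>, t, x). H \<sigma> t x) (0, 1, 0) (\<sigma>, t, x)) (at t within {t1..t2})"
proof -
  let ?F = "\<lambda>(\<sigma>, t, x). H \<sigma> t x"
  have "(?F has_derivative frechet_derivative ?F (at (\<sigma>, t, x) within S)) (at (\<sigma>, t, x) within S)"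
    by (rule smooth_on_has_derivative[OF H]) (use assms in auto)
  from has_derivative_slice_right[OF this[unfolded S]] assms(3)
  have "((\<lambda>p. ?F (\<sigma>, p)) has_derivative (\<lambda>v. frechet_derivative ?F (at (\<sigma>, t, x) within S) (0, v))) (at (t, x) within {t1..t2} \<times> cyl)"
    by (simp add: S)
  from has_vector_derivative_slice_left[OF this assms(5)] show ?thesis by (simp add: zero_prod_def)
qed

text \<open>As \<open>deriv\<close> is total, the existence of \<open>D\<close> is what makes
  \<open>deriv (deriv E) 0\<close> a genuine second derivative. If it were negative, then
  \<open>E' 0 = 0\<close> would make \<open>E'\<close> negative just to the right of 0, and the mean
  value theorem would put \<open>E\<close> below \<open>E 0\<close>.\<close>

lemma local_min_second_derivative:
  fixes E E' :: "real \<Rightarrow> real"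
  assumes \<epsilon>: "0 < \<epsilon>"
    and E: "\<And>\<sigma>. \<sigma> \<in> {-\<epsilon><..<\<epsilon>} \<Longrightarrow> (E has_real_derivative E' \<sigma>) (at \<sigma>)"
    and E': "(E' has_real_derivative D) (at 0)"
    and min: "\<forall>\<^sub>F \<sigma> in nhds 0. E 0 \<le> E \<sigma>"
  shows "0 \<le> deriv (deriv E) 0"
proof (rule ccontr)
  assume neg: "\<not> 0 \<le> deriv (deriv E) 0"
  have dE: "deriv E \<sigma> = E' \<sigma>" if "\<sigma> \<in> {-\<epsilon><..<\<epsilon>}" for \<sigma> using E[OF that] by (rule DERIV_imp_deriv)
  have "(deriv E has_real_derivative D) (at 0)"
    by (rule has_field_derivative_transform_within_open[OF E', of "{-\<epsilon><..<\<epsilon>}"]) (use \<epsilon> dE in auto)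
  then have "deriv (deriv E) 0 = D" by (rule DERIV_imp_deriv)
  then have D: "D < 0" using neg by simp
  obtain d where d: "0 < d" "\<And>\<sigma>. \<bar>\<sigma>\<bar> < d \<Longrightarrow> E 0 \<le> E \<sigma>"
    using min by (auto simp: eventually_nhds_metric dist_real_def)
  have "E' 0 = 0"
    by (rule DERIV_local_min[OF E[of 0] d(1)]) (use \<epsilon> d in auto)
  obtain d2 where d2: "0 < d2" "\<And>h. \<lbrakk>0 < h; h < d2\<rbrakk> \<Longrightarrow> E' (0 + h) < E' 0"
    using DERIV_neg_dec_right[OF E' D] by auto
  define h where "h = min \<epsilon> (min d d2) / 2"
  have h: "0 < h" "h < \<epsilon>" "h < d" "h < d2" using \<epsilon> d(1) d2(1) by (auto simp: h_def)
  have "\<exists>z>0. z < h \<and> E h - E 0 = (h - 0) * E' z"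
    by (rule MVT2[OF h(1)]) (use E h in auto)
  then obtain z where z: "0 < z" "z < h" "E h - E 0 = h * E' z" by auto
  have "E' z < 0" using d2(2)[of z] z h \<open>E' 0 = 0\<close> by simp
  then have "E h < E 0" using z(3) h(1) mult_pos_neg[of h "E' z"] by simp
  then show False using d(2)[of h] h by simp
qed

text \<open>Reduces the second variation to a comparison of energies: smoothness of the family lets
  the energy be differentiated twice under the integral, after which the second derivative test
  applies.\<close>

lemma energy_min_not_shortening:
  assumes t12: "t1 < t2" and \<epsilon>: "0 < \<epsilon>"
    and H: "smooth_on (\<lambda>(\<sigma>, t, x). H \<sigma> t x) ({-\<epsilon><..<\<epsilon>} \<times> {t1..t2} \<times> cyl)"
    and min: "\<forall>\<^sub>F \<sigma> in nhds 0. energy t1 t2 (H 0) \<le> energy t1 t2 (H \<sigma>)"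
  shows "\<not> curve_shortening t1 t2 H"
proof -
  let ?A = "{-\<epsilon><..<\<epsilon>}" and ?K = "{t1..t2} \<times> fund"
  define S where "S = ?A \<times> {t1..t2} \<times> cyl"
  define HF where "HF = (\<lambda>(\<sigma>, t, x). H \<sigma> t x)"
  have sm: "smooth_on HF S" using H by (simp add: HF_def S_def)
  define G where "G = dird S HF (0, 1, 0)"
  define G1 where "G1 = dird S G (1, 0)"
  define G2 where "G2 = dird S G1 (1, 0)"
  have smG: "smooth_on G S" unfolding G_def by (rule smooth_on_dird[OF sm])
  have smG1: "smooth_on G1 S" unfolding G1_def by (rule smooth_on_dird[OF smG])
  have smG2: "smooth_on G2 S" unfolding G2_def by (rule smooth_on_dird[OF smG1])
  have sub: "?A \<times> ?K \<subseteq> S" using fund_subset_cyl by (auto simp: S_def)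
  have cK: "compact ?K" by (intro compact_Times compact_Icc compact_fund)
  have slice: "continuous_on ?K (\<lambda>p. g (\<sigma>, p))" if "smooth_on g S" "\<sigma> \<in> ?A" for g :: "real \<times> real \<times> (real^3) \<Rightarrow> real^3" and \<sigma>
  proof -
    have "continuous_on ?K (\<lambda>p. (\<sigma>, p))" by (intro continuous_intros)
    moreover have "(\<lambda>p. (\<sigma>, p)) ` ?K \<subseteq> S" using that(2) sub by auto
    ultimately show ?thesis by (rule continuous_on_compose2[OF smooth_on_continuous[OF that(1)]])
  qed
  have \<sigma>der: "((\<lambda>\<sigma>. g (\<sigma>, p)) has_vector_derivative dird S g (1, 0) (\<sigma>, p)) (at \<sigma> within ?A)"
    if "smooth_on g S" "\<sigma> \<in> ?A" "p \<in> ?K" for g :: "real \<times> real \<times> (real^3) \<Rightarrow> real^3" and \<sigma> p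
  proof -
    have p: "p \<in> {t1..t2} \<times> cyl" using that(3) fund_subset_cyl by auto
    have "(g has_derivative frechet_derivative g (at (\<sigma>, p) within S)) (at (\<sigma>, p) within S)"
      by (rule smooth_on_has_derivative[OF that(1)]) (use that p in \<open>auto simp: S_def\<close>)
    from has_vector_derivative_slice_left[OF this[unfolded S_def] p] show ?thesis by (simp add: S_def)
  qed
  define E where "E \<sigma> = energy t1 t2 (H \<sigma>)" for \<sigma>
  have E_eq: "E \<sigma> = 1/2 * Int_on ?K (\<lambda>p. G (\<sigma>, p) \<bullet> G (\<sigma>, p))" if "\<sigma> \<in> ?A" for \<sigma>
  proof -
    have "E \<sigma> = 1/2 * Int_on ?K (\<lambda>p. (norm (G (\<sigma>, p)))\<^sup>2)"
      unfolding E_def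
    proof (rule energy_eq[OF t12])
      show "((\<lambda>s. H \<sigma> s x) has_vector_derivative G (\<sigma>, t, x)) (at t within {t1..t2})"
        if "t \<in> {t1..t2}" "x \<in> fund" for t x
        unfolding G_def HF_def
        by (rule variation_time_derivative[OF S_def H[folded S_def]]) (use that \<open>\<sigma> \<in> ?A\<close> fund_subset_cyl in auto)
      show "continuous_on ?K (\<lambda>p. G (\<sigma>, p))" by (rule slice[OF smG that])
    qed
    then show ?thesis by (simp add: dot_square_norm)
  qed
  have d1: "((\<lambda>\<sigma>. Int_on ?K (\<lambda>p. G (\<sigma>, p) \<bullet> G (\<sigma>, p))) has_real_derivative Int_on ?K (\<lambda>p. 2 * (G (\<sigma>, p) \<bullet> G1 (\<sigma>, p)))) (at \<sigma> within ?A)"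
    if \<sigma>: "\<sigma> \<in> ?A" for \<sigma>
  proof (rule has_real_derivative_Int_on[OF cK _ \<sigma>])
    show "((\<lambda>\<sigma>. G (\<sigma>, p) \<bullet> G (\<sigma>, p)) has_real_derivative 2 * (G (\<sigma>, p) \<bullet> G1 (\<sigma>, p))) (at \<sigma> within ?A)"
      if "\<sigma> \<in> ?A" "p \<in> ?K" for \<sigma> p
      using bounded_bilinear.has_vector_derivative[OF bounded_bilinear_inner \<sigma>der[OF smG that] \<sigma>der[OF smG that]]
      by (simp add: has_real_derivative_iff_has_vector_derivative inner_commute G1_def)
    show "continuous_on ?K (\<lambda>p. G (\<sigma>, p) \<bullet> G (\<sigma>, p))" if "\<sigma> \<in> ?A" for \<sigma>
      by (intro continuous_intros slice smG that)
    have "continuous_on (?A \<times> ?K) (\<lambda>q. 2 * (G q \<bullet> G1 q))"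
      by (intro continuous_intros continuous_on_subset[OF smooth_on_continuous sub] smG smG1)
    then show "continuous_on (?A \<times> ?K) (\<lambda>(\<sigma>, p). 2 * (G (\<sigma>, p) \<bullet> G1 (\<sigma>, p)))" by (simp add: case_prod_beta')
  qed auto
  have d2: "((\<lambda>\<sigma>. Int_on ?K (\<lambda>p. G (\<sigma>, p) \<bullet> G1 (\<sigma>, p))) has_real_derivative
      Int_on ?K (\<lambda>p. G (\<sigma>, p) \<bullet> G2 (\<sigma>, p) + G1 (\<sigma>, p) \<bullet> G1 (\<sigma>, p))) (at \<sigma> within ?A)"
    if \<sigma>: "\<sigma> \<in> ?A" for \<sigma>
  proof (rule has_real_derivative_Int_on[OF cK _ \<sigma>])
    show "((\<lambda>\<sigma>. G (\<sigma>, p) \<bullet> G1 (\<sigma>, p)) has_real_derivative G (\<sigma>, p) \<bullet> G2 (\<sigma>, p) + G1 (\<sigma>, p) \<bullet> G1 (\<sigma>, p)) (at \<sigma> within ?A)"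
      if "\<sigma> \<in> ?A" "p \<in> ?K" for \<sigma> p
      using bounded_bilinear.has_vector_derivative[OF bounded_bilinear_inner \<sigma>der[OF smG that] \<sigma>der[OF smG1 that]]
      by (simp add: has_real_derivative_iff_has_vector_derivative G1_def G2_def)
    show "continuous_on ?K (\<lambda>p. G (\<sigma>, p) \<bullet> G1 (\<sigma>, p))" if "\<sigma> \<in> ?A" for \<sigma>
      by (intro continuous_intros slice smG smG1 that)
    have "continuous_on (?A \<times> ?K) (\<lambda>q. G q \<bullet> G2 q + G1 q \<bullet> G1 q)"
      by (intro continuous_intros continuous_on_subset[OF smooth_on_continuous sub] smG smG1 smG2)
    then show "continuous_on (?A \<times> ?K) (\<lambda>(\<sigma>, p). G (\<sigma>, p) \<bullet> G2 (\<sigma>, p) + G1 (\<sigma>, p) \<bullet> G1 (\<sigma>, p))" by (simp add: case_prod_beta')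
  qed auto
  have opA: "at \<sigma> within ?A = at \<sigma>" if "\<sigma> \<in> ?A" for \<sigma> by (rule at_within_open[OF that]) simp
  have "0 \<le> deriv (deriv E) 0"
  proof (rule local_min_second_derivative[OF \<epsilon>])
    show "(E has_real_derivative Int_on ?K (\<lambda>p. G (\<sigma>, p) \<bullet> G1 (\<sigma>, p))) (at \<sigma>)" if \<sigma>: "\<sigma> \<in> ?A" for \<sigma>
    proof -
      have "((\<lambda>\<sigma>. 1/2 * Int_on ?K (\<lambda>p. G (\<sigma>, p) \<bullet> G (\<sigma>, p))) has_real_derivative 1/2 * Int_on ?K (\<lambda>p. 2 * (G (\<sigma>, p) \<bullet> G1 (\<sigma>, p)))) (at \<sigma>)"
        using DERIV_cmult[OF d1[OF \<sigma>]] unfolding opA[OF \<sigma>] .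
      then have "((\<lambda>\<sigma>. 1/2 * Int_on ?K (\<lambda>p. G (\<sigma>, p) \<bullet> G (\<sigma>, p))) has_real_derivative Int_on ?K (\<lambda>p. G (\<sigma>, p) \<bullet> G1 (\<sigma>, p))) (at \<sigma>)"
        unfolding set_integral_mult_right by simp
      then show ?thesis
        by (rule has_field_derivative_transform_within_open[of _ _ _ ?A]) (use \<sigma> E_eq in auto)
    qed
    have "0 \<in> ?A" using \<epsilon> by simp
    then show "((\<lambda>\<sigma>. Int_on ?K (\<lambda>p. G (\<sigma>, p) \<bullet> G1 (\<sigma>, p))) has_real_derivative
      Int_on ?K (\<lambda>p. G (0, p) \<bullet> G2 (0, p) + G1 (0, p) \<bullet> G1 (0, p))) (at 0)"
      using d2[of 0] opA[of 0] by simp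
    show "\<forall>\<^sub>F \<sigma> in nhds 0. E 0 \<le> E \<sigma>" unfolding E_def by (rule min)
  qed
  then show ?thesis unfolding curve_shortening_def E_def by simp
qed

section \<open>Comparison of energies near the circle\<close>

context euler_odd
begin

text \<open>The Hessian and the model form agree on the circle, so by uniform continuity on a
  compact set they stay close nearby, uniformly in \<open>t\<close> and in the angle. Two space
  points occur: the Hessian is needed at points \<open>y\<close> near the moved particle, the form
  at its label \<open>x\<close>.\<close>

lemma HP_near_circle:
  assumes t12: "0 \<le> t1" "t2 < T" and e: "0 < e"
  obtains \<rho> where "0 < \<rho>" "\<rho> \<le> 1/2"
    "\<And>t \<theta> x y v. \<lbrakk>t \<in> {t1..t2}; x \<in> cyl; y \<in> cyl; norm (x - cylpt 1 \<theta> 0) < \<rho>; norm (y - cylpt 1 \<theta> 0) < \<rho>\<rbrakk>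
       \<Longrightarrow> HP t y v \<bullet> v \<le> index_form t x v + e * (norm v)\<^sup>2"
proof -
  \<comment> \<open>The linear map of \<open>index_form\<close>: the horizontal part of
    \<open>x\<close> plays the role of \<open>e_r\<close>, with which it coincides on the
    circle.\<close>
  define N where "N t x v = ((axial_strain' t - (axial_strain t)\<^sup>2) * (x$1 * v$1 + x$2 * v$2)) *\<^sub>R (\<chi> i. if i = 3 then 0 else x$i)
     - ((axial_strain' t + (axial_strain t)\<^sup>2) * v$3) *\<^sub>R e_z" for t and x v :: "real^3"
  have Nform: "N t x v \<bullet> v = index_form t x v" for t x v
    by (simp add: N_def index_form_def inner_diff_left inner_3 power2_eq_square algebra_simps)
  have Nlin: "linear (N t x)" for t x
    by (rule linearI) (simp_all add: N_def vec_eq_iff algebra_simps)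
  have Np: "N t (cylpt 1 \<theta> 0) v = HP t (cylpt 1 \<theta> 0) v" if "t \<in> {0..<T}" for t \<theta> v
    unfolding HP_circle_form[OF that] N_def by (simp add: vec_eq_iff forall_3 inner_3 mult.commute)
  let ?K0 = "{x \<in> cyl. \<bar>x$3\<bar> \<le> 1}"
  define K where "K = {t1..t2} \<times> ?K0 \<times> ?K0"
  define \<Psi> where "\<Psi> i q = HP (fst q) (fst (snd q)) (axis i 1) - N (fst q) (snd (snd q)) (axis i 1)" for i and q :: "real \<times> (real^3) \<times> (real^3)"
  have sub: "{t1..t2} \<subseteq> {0..<T}" using t12 by auto
  have "\<exists>r>0. \<forall>p\<in>K. \<forall>q\<in>K. dist q p < r \<longrightarrow> dist (\<Psi> i q) (\<Psi> i p) < e / 3" for i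
  proof -
    have "continuous_on K (\<lambda>q. (fst q, fst (snd q)))" by (intro continuous_intros)
    moreover have "(\<lambda>q. (fst q, fst (snd q))) ` K \<subseteq> dom" using sub by (auto simp: dom_def K_def)
    ultimately have 1: "continuous_on K (\<lambda>q. (\<lambda>(t, x). HP t x (axis i 1)) (fst q, fst (snd q)))"
      by (rule continuous_on_compose2[OF HP_continuous])
    have s: "continuous_on K (\<lambda>q. axial_strain (fst q))" "continuous_on K (\<lambda>q. axial_strain' (fst q))"
      by (rule continuous_on_compose2[OF strain_continuous(1)] continuous_on_compose2[OF strain_continuous(2)];
          use sub in \<open>auto simp: K_def intro!: continuous_intros\<close>)+
    have v: "continuous_on K (\<lambda>q. (\<chi> i. if i = 3 then 0 else (snd (snd q) :: real^3)$i))"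
    proof -
      have eq: "(\<lambda>q::real \<times> (real^3) \<times> (real^3). (\<chi> i. if i = 3 then 0 else (snd (snd q) :: real^3)$i)) = (\<lambda>q. snd (snd q) - (snd (snd q) $ 3) *\<^sub>R e_z)"
        by (auto simp: vec_eq_iff forall_3 fun_eq_iff)
      show ?thesis unfolding eq by (intro continuous_intros)
    qed
    have 2: "continuous_on K (\<lambda>q. N (fst q) (snd (snd q)) (axis i 1))"
      unfolding N_def by (intro continuous_intros s v)
    have "continuous_on K (\<Psi> i)"
      unfolding \<Psi>_def[abs_def] using continuous_on_diff[OF 1 2] by simp
    moreover have "compact K" unfolding K_def by (intro compact_Times compact_Icc compact_cyl_strip)
    ultimately have uc: "uniformly_continuous_on K (\<Psi> i)" by (rule compact_uniformly_continuous)
    have "0 < e / 3" using e by simp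
    from uniformly_continuous_onE[OF uc this] show ?thesis by metis
  qed
  then obtain r where r: "\<And>i. 0 < r i" "\<And>i p q. \<lbrakk>p \<in> K; q \<in> K; dist q p < r i\<rbrakk> \<Longrightarrow> dist (\<Psi> i q) (\<Psi> i p) < e / 3"
    by metis
  \<comment> \<open>The pair \<open>(y, x)\<close> is at distance below \<open>2 \<rho>\<close> from
    the circle point taken twice, hence the halved minimum. The cap \<open>1/2\<close> keeps heights
    within the compact strip and later gives \<open>1/4 \<le> rsq x\<close>. The share
    \<open>e / 3\<close> above accounts for the three columns.\<close>
  define \<rho> where "\<rho> = min (1/2) (Min (range r) / 2)"
  have "0 < Min (range r)" using r(1) by (simp add: Min_gr_iff)
  then have \<rho>: "0 < \<rho>" "\<rho> \<le> 1/2" by (auto simp: \<rho>_def)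
  have \<rho>r: "2 * \<rho> \<le> r i" for i
  proof -
    have "Min (range r) \<le> r i" by (rule Min_le) auto
    moreover have "2 * \<rho> \<le> Min (range r)" unfolding \<rho>_def by linarith
    ultimately show ?thesis by linarith
  qed
  have "HP t y v \<bullet> v \<le> index_form t x v + e * (norm v)\<^sup>2"
    if t: "t \<in> {t1..t2}" and xy: "x \<in> cyl" "y \<in> cyl" "norm (x - cylpt 1 \<theta> 0) < \<rho>" "norm (y - cylpt 1 \<theta> 0) < \<rho>" for t \<theta> x y v
  proof -
    let ?p = "cylpt 1 \<theta> 0"
    have t': "t \<in> {0..<T}" using t sub by auto
    have n3: "\<bar>u$3\<bar> \<le> 1" if "norm (u - ?p) < \<rho>" for u
      using component_le_norm_cart[of "u - ?p" 3] that \<rho>(2) by simp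
    have K: "(t, ?p, ?p) \<in> K" "(t, y, x) \<in> K" using t xy n3 by (auto simp: K_def)
    have close: "norm (HP t y (axis i 1) - N t x (axis i 1)) \<le> e / 3" for i
    proof -
      have "dist (t, y, x) (t, ?p, ?p) \<le> norm (y - ?p) + norm (x - ?p)"
        using sqrt_sum_squares_le_sum_abs[of "norm (y - ?p)" "norm (x - ?p)"] by (simp add: dist_Pair_Pair dist_norm norm_Pair)
      then have "dist (t, y, x) (t, ?p, ?p) < r i" using xy(3,4) \<rho>r[of i] by linarith
      from r(2)[OF K this] show ?thesis by (simp add: \<Psi>_def Np[OF t'] dist_norm)
    qed
    have "HP t y v - N t x v = (\<Sum>i\<in>UNIV. v$i *\<^sub>R (HP t y (axis i 1) - N t x (axis i 1)))"
      using linear_vec3_expand[OF HP_linear[OF t' xy(2)], of v] linear_vec3_expand[OF Nlin, of t x v]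
      by (simp add: sum_subtractf scaleR_diff_right)
    also have "norm \<dots> \<le> (\<Sum>i\<in>UNIV. norm (v$i *\<^sub>R (HP t y (axis i 1) - N t x (axis i 1))))" by (rule norm_sum)
    also have "\<dots> \<le> (\<Sum>i\<in>(UNIV::3 set). norm v * (e / 3))"
      unfolding norm_scaleR using close component_le_norm_cart[of v] by (intro sum_mono mult_mono) auto
    also have "\<dots> = e * norm v" by simp
    finally have "norm (HP t y v - N t x v) \<le> e * norm v" .
    then have "norm (HP t y v - N t x v) * norm v \<le> e * norm v * norm v" by (rule mult_right_mono) simp
    then have "(HP t y v - N t x v) \<bullet> v \<le> e * (norm v)\<^sup>2"
      using norm_cauchy_schwarz[of "HP t y v - N t x v" v] by (simp add: power2_eq_square)
    then show ?thesis by (simp add: inner_diff_left Nform)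
  qed
  then show ?thesis using that \<rho> by blast
qed

text \<open>The chain rule for \<open>F\<close> along \<open>(t, \<eta> t)\<close> assembles the
  material derivative of the velocity, which the momentum equation equates with minus the pressure
  gradient.\<close>

lemma flow_acceleration:
  assumes \<eta>: "\<And>t. t \<in> {t1..t2} \<Longrightarrow> (\<eta> has_vector_derivative U t (\<eta> t)) (at t within {t1..t2})"
    "\<And>t. t \<in> {t1..t2} \<Longrightarrow> \<eta> t \<in> cyl" and t12: "0 \<le> t1" "t2 < T" and t: "t \<in> {t1..t2}"
  shows "((\<lambda>t. U t (\<eta> t)) has_vector_derivative - grad (P t) (\<eta> t)) (at t within {t1..t2})"
proof -
  have tT: "t \<in> {0..<T}" using t t12 by auto
  let ?D = "frechet_derivative F (at (t, \<eta> t) within dom)"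
  have path: "((\<lambda>t. (t, \<eta> t)) has_derivative (\<lambda>h. (h, h *\<^sub>R U t (\<eta> t)))) (at t within {t1..t2})"
    using \<eta>(1)[OF t] by (auto simp: has_vector_derivative_def intro!: has_derivative_Pair)
  have sub: "(\<lambda>t. (t, \<eta> t)) ` {t1..t2} \<subseteq> dom" using t12 \<eta>(2) by (auto simp: dom_def)
  have FD: "(F has_derivative ?D) (at (t, \<eta> t) within dom)"
    by (rule smooth_on_has_derivative[OF smooth_F]) (use tT \<eta>(2)[OF t] in \<open>simp add: dom_iff\<close>)
  have "((\<lambda>t. F (t, \<eta> t)) has_derivative (\<lambda>h. ?D (h, h *\<^sub>R U t (\<eta> t)))) (at t within {t1..t2})"
    using diff_chain_within[OF path has_derivative_subset[OF FD sub]] by (simp add: o_def)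
  moreover have "?D (h, h *\<^sub>R U t (\<eta> t)) = h *\<^sub>R (- grad (P t) (\<eta> t))" for h
  proof -
    have lin: "linear ?D" by (rule has_derivative_linear[OF FD])
    have "(h, h *\<^sub>R U t (\<eta> t)) = h *\<^sub>R ((1, 0) + (0, U t (\<eta> t)))" by simp
    then have "?D (h, h *\<^sub>R U t (\<eta> t)) = h *\<^sub>R (?D (1, 0) + ?D (0, U t (\<eta> t)))"
      by (simp only: linear_cmul[OF lin] linear_add[OF lin])
    also have "?D (1, 0) + ?D (0, U t (\<eta> t)) = - grad (P t) (\<eta> t)"
      using momentum[OF tT \<eta>(2)[OF t]] by (simp add: Ut_def DU_def)
    finally show ?thesis .
  qed
  ultimately show ?thesis by (simp add: has_vector_derivative_def F_def)
qed

text \<open>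
  Since the variation preserves volume, the integral of \<open>P\<close> along it is constant, so the change of
  energy is half the integral of \<open>|\<xi>'|\<^sup>2\<close> minus the second-order Taylor remainder of \<open>P\<close>, where
  \<open>\<xi>\<close> is the displacement \<open>H \<sigma> - \<eta>\<close>; close to the circle this is nonnegative pointwise.
\<close>

lemma not_shortening_near_circle:
  assumes \<eta>: "is_flow T U \<eta>" and t12: "0 \<le> t1" "t1 < t2" "t2 < T"
  shows "\<exists>N. nbhd_circle 1 N \<and>
    \<not> (\<exists>\<epsilon> H. is_variation \<eta> t1 t2 \<epsilon> H \<and> supported_in \<eta> t1 t2 \<epsilon> H N \<and> curve_shortening t1 t2 H)"
proof -
  let ?I = "{t1..t2}"
  have sub: "?I \<subseteq> {0..<T}" using t12 by auto
  obtain B where B: "\<And>t. t \<in> ?I \<Longrightarrow> \<bar>axial_strain t\<bar> \<le> B"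
  proof -
    have "bounded (axial_strain ` ?I)"
      by (intro compact_imp_bounded compact_continuous_image continuous_on_subset[OF strain_continuous(1) sub] compact_Icc)
    then obtain B where "\<forall>u\<in>axial_strain ` ?I. norm u \<le> B" unfolding bounded_iff by blast
    then have "\<bar>axial_strain t\<bar> \<le> B" if "t \<in> ?I" for t using that by auto
    then show ?thesis by (rule that)
  qed
  \<comment> \<open>The Riccati margin of \<open>index_form_positive\<close>; a quarter of it is the
    error that the Hessian may have.\<close>
  define \<mu> where "\<mu> = exp (- (2 * B + 2) * (t2 - t1))"
  have \<mu>0: "0 < \<mu> / 4" by (simp add: \<mu>_def)
  obtain \<rho> where \<rho>: "0 < \<rho>" "\<rho> \<le> 1/2"
    and HPle: "\<And>t \<theta> x y v. \<lbrakk>t \<in> ?I; x \<in> cyl; y \<in> cyl; norm (x - cylpt 1 \<theta> 0) < \<rho>; norm (y - cylpt 1 \<theta> 0) < \<rho>\<rbrakk>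
       \<Longrightarrow> HP t y v \<bullet> v \<le> index_form t x v + \<mu> / 4 * (norm v)\<^sup>2"
    using HP_near_circle[OF t12(1,3) \<mu>0] by metis
  have t20: "0 \<le> t2" using t12 by simp
  obtain C where C: "0 < C" "\<And>x \<theta> t. \<lbrakk>x \<in> cyl; t \<in> {0..t2}\<rbrakk> \<Longrightarrow>
    norm (\<eta> t x - cylpt 1 \<theta> 0) \<le> C * norm (x - cylpt 1 \<theta> 0)"
    using flow_near_circle[OF \<eta> t20 t12(3)] by metis
  \<comment> \<open>Particles starting within \<open>\<delta>\<close> of a circle point stay within
    \<open>C \<delta> \<le> \<rho> / 2\<close> of it, leaving room for the variation.\<close>
  define \<delta> where "\<delta> = min \<rho> (\<rho> / (2 * C))"
  have \<delta>: "0 < \<delta>" "\<delta> \<le> \<rho>" "C * \<delta> \<le> \<rho> / 2"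
  proof -
    show "0 < \<delta>" "\<delta> \<le> \<rho>" using \<rho> C by (auto simp: \<delta>_def)
    have "C * \<delta> \<le> C * (\<rho> / (2 * C))" using C by (intro mult_left_mono) (auto simp: \<delta>_def)
    then show "C * \<delta> \<le> \<rho> / 2" using C by simp
  qed
  \<comment> \<open>The circle is repeated in every period, as a neighbourhood in the quotient
    requires.\<close>
  define N where "N = cyl \<inter> (\<Union>\<theta>. \<Union>k::int. ball (cylpt 1 \<theta> (2 * pi * of_int k)) \<delta>)"
  have nb: "nbhd_circle 1 N"
    unfolding nbhd_circle_def
  proof (intro conjI allI)
    show "openin (top_of_set cyl) N" unfolding N_def by (intro openin_open_Int open_UN ballI open_ball)
    have shift: "x + s *\<^sub>R e_z \<in> ball (cylpt 1 \<theta> (z + s)) \<delta> \<longleftrightarrow> x \<in> ball (cylpt 1 \<theta> z) \<delta>" for x \<theta> z s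
    proof -
      have "cylpt 1 \<theta> (z + s) - (x + s *\<^sub>R e_z) = cylpt 1 \<theta> z - x" by (simp add: vec_eq_iff forall_3)
      then show ?thesis unfolding mem_ball dist_norm by (rule arg_cong)
    qed
    show "x + (2 * pi) *\<^sub>R e_z \<in> N \<longleftrightarrow> x \<in> N" for x
    proof
      assume "x \<in> N"
      then obtain \<theta> and k :: int where "x \<in> cyl" "x \<in> ball (cylpt 1 \<theta> (2 * pi * of_int k)) \<delta>" by (auto simp: N_def)
      moreover have "2 * pi * of_int k + 2 * pi = 2 * pi * of_int (k + 1)" by (simp add: algebra_simps)
      ultimately have "x + (2 * pi) *\<^sub>R e_z \<in> cyl" "x + (2 * pi) *\<^sub>R e_z \<in> ball (cylpt 1 \<theta> (2 * pi * of_int (k + 1))) \<delta>"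
        using shift[of x "2 * pi" \<theta> "2 * pi * of_int k"] by simp_all
      then show "x + (2 * pi) *\<^sub>R e_z \<in> N" unfolding N_def by blast
    next
      assume "x + (2 * pi) *\<^sub>R e_z \<in> N"
      then obtain \<theta> and k :: int where k: "x + (2 * pi) *\<^sub>R e_z \<in> cyl" "x + (2 * pi) *\<^sub>R e_z \<in> ball (cylpt 1 \<theta> (2 * pi * of_int k)) \<delta>"
        unfolding N_def by blast
      have eq: "2 * pi * of_int k = 2 * pi * of_int (k - 1) + 2 * pi" by (simp add: algebra_simps)
      have "x \<in> cyl" "x \<in> ball (cylpt 1 \<theta> (2 * pi * of_int (k - 1))) \<delta>"
        using k unfolding eq shift by simp_all
      then show "x \<in> N" unfolding N_def by blast
    qed
    show "cylpt 1 \<theta> 0 \<in> N" for \<theta>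
    proof -
      have "cylpt 1 \<theta> 0 \<in> ball (cylpt 1 \<theta> (2 * pi * of_int 0)) \<delta>" using \<delta> by simp
      then show ?thesis unfolding N_def using circle_in_cyl by blast
    qed
  qed
  \<comment> \<open>The other copies of the circle are at height at least \<open>2 pi\<close> in
    absolute value, whereas \<open>fund\<close> ends at \<open>pi\<close> and
    \<open>\<delta>\<close> is less than 1.\<close>
  have near: "\<exists>\<theta>. norm (x - cylpt 1 \<theta> 0) < \<delta>" if x: "x \<in> N" "x \<in> fund" for x
  proof -
    obtain \<theta> and k :: int where k: "x \<in> ball (cylpt 1 \<theta> (2 * pi * of_int k)) \<delta>" using x(1) unfolding N_def by blast
    have "\<bar>2 * pi * of_int k - x$3\<bar> \<le> norm (cylpt 1 \<theta> (2 * pi * of_int k) - x)"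
      using component_le_norm_cart[of "cylpt 1 \<theta> (2 * pi * of_int k) - x" 3] by simp
    also have "\<dots> < 1" using k \<delta> \<rho> by (simp add: dist_norm)
    finally have "\<bar>2 * pi * of_int k\<bar> < pi + 1" using x(2) by (auto simp: fund_iff)
    then have lt: "2 * pi * \<bar>of_int k\<bar> < pi + 1" by (simp add: abs_mult)
    have "k = 0"
    proof (rule ccontr)
      assume "k \<noteq> 0"
      then have "1 \<le> \<bar>real_of_int k\<bar>" by linarith
      then have "2 * pi * 1 \<le> 2 * pi * \<bar>of_int k\<bar>" by (intro mult_left_mono) auto
      then show False using lt pi_gt3 by linarith
    qed
    then show ?thesis using k by (auto simp: dist_norm norm_minus_commute)
  qed
  have "\<not> curve_shortening t1 t2 H" if var: "is_variation \<eta> t1 t2 \<epsilon> H" and sup: "supported_in \<eta> t1 t2 \<epsilon> H N" for \<epsilon> H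
  proof (rule energy_min_not_shortening[OF t12(2)])
    let ?A = "{-\<epsilon><..<\<epsilon>}"
    show \<epsilon>: "0 < \<epsilon>" and smH: "smooth_on (\<lambda>(\<sigma>, t, x). H \<sigma> t x) (?A \<times> ?I \<times> cyl)"
      using var by (auto simp: is_variation_def)
    have H0: "H 0 t x = \<eta> t x" if "t \<in> ?I" "x \<in> cyl" for t x using var that by (auto simp: is_variation_def)
    have Hends: "H \<sigma> t1 x = \<eta> t1 x" "H \<sigma> t2 x = \<eta> t2 x" if "\<sigma> \<in> ?A" "x \<in> cyl" for \<sigma> x
      using var that by (auto simp: is_variation_def)
    have HD: "H \<sigma> t \<in> Diff_mu" if "\<sigma> \<in> ?A" "t \<in> ?I" for \<sigma> t using var that by (auto simp: is_variation_def)
    have Hcyl: "H \<sigma> t x \<in> cyl" if "\<sigma> \<in> ?A" "t \<in> ?I" "x \<in> cyl" for \<sigma> t x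
      using HD[OF that(1,2)] that(3) by (auto simp: Diff_mu_def bij_betw_def)
    let ?K = "?I \<times> fund"
    have cK: "compact ?K" by (intro compact_Times compact_Icc compact_fund)
    define S where "S = ?A \<times> ?I \<times> cyl"
    define HF where "HF = (\<lambda>(\<sigma>, t, x). H \<sigma> t x)"
    have smHF: "smooth_on HF S" using smH by (simp add: HF_def S_def)
    define G where "G = dird S HF (0, 1, 0)"
    have smG: "smooth_on G S" unfolding G_def by (rule smooth_on_dird[OF smHF])
    have SK: "?A \<times> ?K \<subseteq> S" using fund_subset_cyl by (auto simp: S_def)
    have slice: "continuous_on ?K (\<lambda>p. g (\<sigma>, p))" if "smooth_on g S" "\<sigma> \<in> ?A" for g :: "real \<times> real \<times> (real^3) \<Rightarrow> real^3" and \<sigma>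
    proof -
      have "continuous_on ?K (\<lambda>p. (\<sigma>, p))" by (intro continuous_intros)
      moreover have "(\<lambda>p. (\<sigma>, p)) ` ?K \<subseteq> S" using that(2) SK by auto
      ultimately show ?thesis by (rule continuous_on_compose2[OF smooth_on_continuous[OF that(1)]])
    qed
    have Ht: "((\<lambda>s. H \<sigma> s x) has_vector_derivative G (\<sigma>, t, x)) (at t within ?I)"
      if "\<sigma> \<in> ?A" "t \<in> ?I" "x \<in> cyl" for \<sigma> t x
      unfolding G_def HF_def by (rule variation_time_derivative[OF S_def smH[folded S_def] that])
    have \<eta>t: "((\<lambda>s. H 0 s x) has_vector_derivative U t (H 0 t x)) (at t within ?I)" if t: "t \<in> ?I" and x: "x \<in> cyl" for t x
    proof -
      have "((\<lambda>s. \<eta> s x) has_vector_derivative U t (\<eta> t x)) (at t within {0..<T})"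
        using \<eta> x t sub by (auto simp: is_flow_def)
      then have "((\<lambda>s. \<eta> s x) has_vector_derivative U t (\<eta> t x)) (at t within ?I)"
        by (rule has_vector_derivative_within_subset[OF _ sub])
      then show ?thesis
        unfolding H0[OF t x] by (rule has_vector_derivative_transform[OF t, rotated]) (simp add: H0[OF _ x])
    qed
    have zA: "0 \<in> ?A" using \<epsilon> by simp
    have G0: "G (0, t, x) = U t (H 0 t x)" if "t \<in> ?I" "x \<in> cyl" for t x
      using vector_derivative_solid[OF solid_real_interval(1)[OF t12(2)] that(1) Ht[OF zA that]]
        vector_derivative_solid[OF solid_real_interval(1)[OF t12(2)] that(1) \<eta>t[OF that]] by simp
    have e_eq: "energy t1 t2 (H \<sigma>) = 1/2 * Int_on ?K (\<lambda>p. (norm (G (\<sigma>, p)))\<^sup>2)" if "\<sigma> \<in> ?A" for \<sigma>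
      by (rule energy_eq[OF t12(2)]) (use that Ht fund_subset_cyl slice[OF smG that] in auto)
    \<comment> \<open>By compactness of \<open>?K\<close>, for small \<open>\<sigma>\<close> every
      particle is displaced by at most \<open>\<rho> / 4\<close>. Both ends of the segment from the
      old to the new position then lie in the ball of radius \<open>\<rho>\<close>.\<close>
    have "continuous_on (?A \<times> ?K) HF" by (rule continuous_on_subset[OF smooth_on_continuous[OF smHF] SK])
    then obtain X where X: "0 \<in> X" "open X" "\<forall>\<sigma>\<in>X \<inter> ?A. \<forall>p\<in>?K. dist (HF (\<sigma>, p)) (HF (0, p)) \<le> \<rho> / 4"
      using continuous_on_prod_compactE[OF _ cK zA, of HF "\<rho> / 4"] \<rho>(1) by auto
    have main: "energy t1 t2 (H 0) \<le> energy t1 t2 (H \<sigma>)" if \<sigma>: "\<sigma> \<in> X \<inter> ?A" for \<sigma>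
    proof -
      have \<sigma>A: "\<sigma> \<in> ?A" using \<sigma> by simp
      define \<xi> where "\<xi> p = HF (\<sigma>, p) - HF (0, p)" for p
      define \<xi>t where "\<xi>t p = G (\<sigma>, p) - G (0, p)" for p
      define y where "y p = HF (0, p)" for p
      have c\<xi>: "continuous_on ?K \<xi>" "continuous_on ?K \<xi>t" "continuous_on ?K y"
        unfolding \<xi>_def[abs_def] \<xi>t_def[abs_def] y_def[abs_def]
        by (intro continuous_intros slice smHF smG \<sigma>A zA)+
      have ycyl: "y (t, x) \<in> cyl" "y (t, x) + \<xi> (t, x) \<in> cyl" if "t \<in> ?I" "x \<in> cyl" for t x
        using Hcyl[OF zA that] Hcyl[OF \<sigma>A that] by (simp_all add: y_def \<xi>_def HF_def)
      have \<xi>d: "((\<lambda>s. \<xi> (s, x)) has_vector_derivative \<xi>t (t, x)) (at t within ?I)" if "t \<in> ?I" "x \<in> cyl" for t x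
        using has_vector_derivative_diff[OF Ht[OF \<sigma>A that] Ht[OF zA that]] by (simp add: \<xi>_def \<xi>t_def HF_def)
      have \<xi>ends: "\<xi> (t1, x) = 0" "\<xi> (t2, x) = 0" if "x \<in> cyl" for x
        using Hends[OF \<sigma>A that] Hends[OF zA that] by (simp_all add: \<xi>_def HF_def)
      have cyK: "continuous_on ?K (\<lambda>p. (fst p, y p))" by (intro continuous_intros c\<xi>)
      have imy: "(\<lambda>p. (fst p, y p)) ` ?K \<subseteq> dom" 
      proof
        fix q assume "q \<in> (\<lambda>p. (fst p, y p)) ` ?K"
        then obtain t x where q: "t \<in> ?I" "x \<in> fund" "q = (t, y (t, x))" by auto
        have "y (t, x) \<in> cyl" using ycyl(1)[OF q(1)] q(2) fund_subset_cyl by blast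
        then show "q \<in> dom" using q sub by (simp add: dom_iff subset_iff)
      qed
      have cU: "continuous_on ?K (\<lambda>p. U (fst p) (y p))"
        using continuous_on_compose2[OF U_continuous cyK imy] by simp
      have cg: "continuous_on ?K (\<lambda>p. grad (P (fst p)) (y p))"
        using continuous_on_compose2[OF grad_P_continuous cyK imy] by simp
      have cq: "continuous_on ?K (\<lambda>p. index_form (fst p) (snd p) (\<xi> p))"
      proof -
        have s: "continuous_on ?K (\<lambda>p. axial_strain (fst p))" "continuous_on ?K (\<lambda>p. axial_strain' (fst p))"
          by (rule continuous_on_compose2[OF strain_continuous(1)] continuous_on_compose2[OF strain_continuous(2)];
              use sub in \<open>auto intro!: continuous_intros\<close>)+
        show ?thesis unfolding index_form_def by (intro continuous_intros s c\<xi>)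
      qed
      have zero_out: "\<xi> (t, x) = 0" if "t \<in> ?I" "x \<in> fund" "x \<notin> N" for t x
      proof -
        have x: "x \<in> cyl - N" using that fund_subset_cyl by auto
        have "H \<sigma> t x = \<eta> t x" "H 0 t x = \<eta> t x"
          using sup \<sigma>A zA that(1) x unfolding supported_in_def by blast+
        then show ?thesis by (simp add: \<xi>_def HF_def)
      qed
      \<comment> \<open>Integration by parts in time along a trajectory: the velocity has derivative
        minus the pressure gradient, and \<open>\<xi>\<close> vanishes at both end times.\<close>
      have parts: "Int_on ?I (\<lambda>t. U t (y (t, x)) \<bullet> \<xi>t (t, x)) = Int_on ?I (\<lambda>t. grad (P t) (y (t, x)) \<bullet> \<xi> (t, x))"
        if x: "x \<in> fund" for x
      proof -
        have xc: "x \<in> cyl" using x fund_subset_cyl by auto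
        have sl: "continuous_on ?I (\<lambda>t. k (t, x))" if "continuous_on ?K k" for k :: "real \<times> (real^3) \<Rightarrow> real"
        proof -
          have "continuous_on ?I (\<lambda>t. (t, x))" by (intro continuous_intros)
          moreover have "(\<lambda>t. (t, x)) ` ?I \<subseteq> ?K" using x by auto
          ultimately show ?thesis by (rule continuous_on_compose2[OF that])
        qed
        have c1: "continuous_on ?I (\<lambda>t. U t (y (t, x)) \<bullet> \<xi>t (t, x))" and c2: "continuous_on ?I (\<lambda>t. grad (P t) (y (t, x)) \<bullet> \<xi> (t, x))"
          using sl[OF continuous_on_inner[OF cU c\<xi>(2)]] sl[OF continuous_on_inner[OF cg c\<xi>(1)]] by simp_all
        have "Int_on ?I (\<lambda>t. U t (y (t, x)) \<bullet> \<xi>t (t, x) - grad (P t) (y (t, x)) \<bullet> \<xi> (t, x))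
          = U t2 (y (t2, x)) \<bullet> \<xi> (t2, x) - U t1 (y (t1, x)) \<bullet> \<xi> (t1, x)"
        proof (rule Int_on_FTC)
          fix t assume t: "t \<in> ?I"
          have "((\<lambda>t. U t (y (t, x))) has_vector_derivative - grad (P t) (y (t, x))) (at t within ?I)"
            by (rule flow_acceleration[OF _ _ t12(1,3) t]) (use \<eta>t xc ycyl in \<open>auto simp: y_def HF_def\<close>)
          from bounded_bilinear.has_vector_derivative[OF bounded_bilinear_inner this \<xi>d[OF t xc]]
          show "((\<lambda>t. U t (y (t, x)) \<bullet> \<xi> (t, x)) has_real_derivative
              U t (y (t, x)) \<bullet> \<xi>t (t, x) - grad (P t) (y (t, x)) \<bullet> \<xi> (t, x)) (at t within ?I)"
            by (simp add: has_real_derivative_iff_has_vector_derivative)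
        next
          show "continuous_on ?I (\<lambda>t. U t (y (t, x)) \<bullet> \<xi>t (t, x) - grad (P t) (y (t, x)) \<bullet> \<xi> (t, x))"
            by (rule continuous_on_diff[OF c1 c2])
        qed (use t12 in simp)
        then show ?thesis using Int_on_diff[OF compact_Icc c1 c2] \<xi>ends[OF xc] by simp
      qed
      \<comment> \<open>A bound for the Taylor remainder of \<open>P\<close>; \<open>2 q\<close> is
        exactly what \<open>index_form_positive\<close> subtracts from the kinetic term.\<close>
      define q where "q p = 1/2 * (index_form (fst p) (snd p) (\<xi> p) + \<mu> / 4 * (norm (\<xi> p))\<^sup>2)" for p
      have cqq: "continuous_on ?K q" unfolding q_def[abs_def] by (intro continuous_intros cq c\<xi>)
      have taylor: "P t (y (t, x) + \<xi> (t, x)) - P t (y (t, x)) - grad (P t) (y (t, x)) \<bullet> \<xi> (t, x) \<le> q (t, x)"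
        if t: "t \<in> ?I" and x: "x \<in> fund" for t x
      proof (cases "x \<in> N")
        case False
        then show ?thesis using zero_out[OF t x] by (simp add: q_def index_form_def)
      next
        case True
        have xc: "x \<in> cyl" using x fund_subset_cyl by auto
        obtain \<theta> where \<theta>: "norm (x - cylpt 1 \<theta> 0) < \<delta>" using near[OF True x] by blast
        let ?p = "cylpt 1 \<theta> 0"
        let ?Z = "cyl \<inter> ball ?p \<rho>"
        have t0: "t \<in> {0..t2}" "t \<in> {0..<T}" using t t12 by auto
        have "norm (y (t, x) - ?p) \<le> C * norm (x - ?p)"
          using C(2)[OF xc t0(1)] H0[OF t xc] by (simp add: y_def HF_def)
        also have "\<dots> \<le> C * \<delta>" using C(1) \<theta> by (intro mult_left_mono) auto
        finally have yp: "norm (y (t, x) - ?p) \<le> \<rho> / 2" using \<delta>(3) by simp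
        have "norm (\<xi> (t, x)) \<le> \<rho> / 4" using X(3) \<sigma> t x by (auto simp: \<xi>_def dist_norm)
        then have zp: "norm (y (t, x) + \<xi> (t, x) - ?p) < \<rho>"
          using yp norm_triangle_ineq[of "y (t, x) - ?p" "\<xi> (t, x)"] \<rho>(1) by (simp add: algebra_simps)
        have "P t (y (t, x) + \<xi> (t, x)) - P t (y (t, x)) - grad (P t) (y (t, x)) \<bullet> \<xi> (t, x)
           \<le> (index_form t x (\<xi> (t, x)) + \<mu> / 4 * (norm (\<xi> (t, x)))\<^sup>2) / 2"
        proof (rule taylor_upper[where S="?Z" and g="grad (P t)" and h="HP t"])
          show "convex ?Z" by (intro convex_Int convex_cyl convex_ball)
          show "y (t, x) \<in> ?Z" using ycyl[OF t xc] yp \<rho>(1) by (simp add: dist_norm norm_minus_commute)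
          show "y (t, x) + \<xi> (t, x) \<in> ?Z" using ycyl[OF t xc] zp by (simp add: dist_norm norm_minus_commute)
          show "(P t has_derivative (\<lambda>h. grad (P t) z \<bullet> h)) (at z within ?Z)" if "z \<in> ?Z" for z
            by (rule has_derivative_subset[OF P_deriv[OF t0(2)]]) (use that in auto)
          show "(grad (P t) has_derivative HP t z) (at z within ?Z)" if "z \<in> ?Z" for z
            by (rule has_derivative_subset[OF grad_P_deriv[OF t0(2)]]) (use that in auto)
          show "HP t z (\<xi> (t, x)) \<bullet> \<xi> (t, x) \<le> index_form t x (\<xi> (t, x)) + \<mu> / 4 * (norm (\<xi> (t, x)))\<^sup>2" if "z \<in> ?Z" for z
            by (rule HPle[OF t xc]) (use that \<theta> \<delta>(2) in \<open>auto simp: dist_norm norm_minus_commute\<close>)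
        qed
        then show ?thesis by (simp add: q_def)
      qed
      \<comment> \<open>Both \<open>H \<sigma> t\<close> and \<open>H 0 t\<close> preserve volume,
        so \<open>P t\<close> has the same integral along them. The Taylor estimate then bounds the
        integral of its linear term from below by minus that of \<open>q\<close>.\<close>
      have volume: "0 \<le> Int_on fund (\<lambda>x. grad (P t) (y (t, x)) \<bullet> \<xi> (t, x) + q (t, x))" if t: "t \<in> ?I" for t
      proof -
        have tT: "t \<in> {0..<T}" using t sub by auto
        have sl: "continuous_on fund (\<lambda>x. k (t, x))" if "continuous_on ?K k" for k :: "real \<times> (real^3) \<Rightarrow> 'b::topological_space"
        proof -
          have "continuous_on fund (\<lambda>x. (t, x))" by (intro continuous_intros)
          moreover have "(\<lambda>x. (t, x)) ` fund \<subseteq> ?K" using t by auto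
          ultimately show ?thesis by (rule continuous_on_compose2[OF that])
        qed
        have cP: "continuous_on cyl (P t)" by (rule C1_torus_continuous[OF P_C1[OF tT]])
        have perP: "z_periodic (P t)" by (rule C1_torusD(1)[OF P_C1[OF tT]])
        have "Int_on fund (\<lambda>x. P t (y (t, x) + \<xi> (t, x))) = Int_on fund (P t)"
          using Int_on_fund_volume_preserving[OF HD[OF \<sigma>A t] perP cP] by (simp add: y_def \<xi>_def HF_def)
        moreover have "Int_on fund (\<lambda>x. P t (y (t, x))) = Int_on fund (P t)"
          using Int_on_fund_volume_preserving[OF HD[OF zA t] perP cP] by (simp add: y_def HF_def)
        moreover have cc: "continuous_on fund (\<lambda>x. P t (y (t, x) + \<xi> (t, x)))" "continuous_on fund (\<lambda>x. P t (y (t, x)))"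
          by (rule continuous_on_compose2[OF cP]; use ycyl t fund_subset_cyl in \<open>auto intro!: continuous_intros sl c\<xi>\<close>)+
        ultimately have "0 = Int_on fund (\<lambda>x. P t (y (t, x) + \<xi> (t, x)) - P t (y (t, x)))"
          using Int_on_diff[OF compact_fund cc] by simp
        also have "\<dots> \<le> Int_on fund (\<lambda>x. grad (P t) (y (t, x)) \<bullet> \<xi> (t, x) + q (t, x))"
        proof (rule Int_on_mono[OF compact_fund continuous_on_diff[OF cc]])
          show "continuous_on fund (\<lambda>x. grad (P t) (y (t, x)) \<bullet> \<xi> (t, x) + q (t, x))"
            using sl[OF continuous_on_add[OF continuous_on_inner[OF cg c\<xi>(1)] cqq]] by simp
          show "P t (y (t, x) + \<xi> (t, x)) - P t (y (t, x)) \<le> grad (P t) (y (t, x)) \<bullet> \<xi> (t, x) + q (t, x)" if "x \<in> fund" for x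
            using taylor[OF t that] by simp
        qed
        finally show ?thesis .
      qed
      have cg\<xi>: "continuous_on ?K (\<lambda>p. grad (P (fst p)) (y p) \<bullet> \<xi> p)" by (intro continuous_intros cg c\<xi>)
      have cU\<xi>: "continuous_on ?K (\<lambda>p. U (fst p) (y p) \<bullet> \<xi>t p)" by (intro continuous_intros cU c\<xi>)
      have cN: "continuous_on ?K (\<lambda>p. (norm (\<xi>t p))\<^sup>2)" by (intro continuous_intros c\<xi>)
      have cU2: "continuous_on ?K (\<lambda>p. (norm (U (fst p) (y p)))\<^sup>2)" by (intro continuous_intros cU)
      have I1: "0 \<le> Int_on ?K (\<lambda>p. grad (P (fst p)) (y p) \<bullet> \<xi> p) + Int_on ?K q"
      proof -
        have "0 \<le> Int_on ?K (\<lambda>p. grad (P (fst p)) (y p) \<bullet> \<xi> p + q p)"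
          unfolding Int_on_Times(1)[OF compact_Icc compact_fund continuous_on_add[OF cg\<xi> cqq]]
          by (rule Int_on_nonneg) (use volume in simp)
        then show ?thesis by (simp add: Int_on_add[OF cK cg\<xi> cqq])
      qed
      have I2: "Int_on ?K (\<lambda>p. U (fst p) (y p) \<bullet> \<xi>t p) = Int_on ?K (\<lambda>p. grad (P (fst p)) (y p) \<bullet> \<xi> p)"
        unfolding Int_on_Times(2)[OF compact_Icc compact_fund cU\<xi>] Int_on_Times(2)[OF compact_Icc compact_fund cg\<xi>]
        by (rule Int_on_cong) (use parts in simp)
      have I3: "0 \<le> Int_on ?K (\<lambda>p. (norm (\<xi>t p))\<^sup>2) - 2 * Int_on ?K q"
      proof -
        have cq2: "continuous_on ?K (\<lambda>p. 2 * q p)" by (intro continuous_intros cqq)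
        have "0 \<le> Int_on ?K (\<lambda>p. (norm (\<xi>t p))\<^sup>2 - 2 * q p)"
          unfolding Int_on_Times(2)[OF compact_Icc compact_fund continuous_on_diff[OF cN cq2]]
        proof (rule Int_on_nonneg)
          fix x assume x: "x \<in> fund"
          have xc: "x \<in> cyl" using x fund_subset_cyl by auto
          show "0 \<le> Int_on ?I (\<lambda>t. (norm (\<xi>t (t, x)))\<^sup>2 - 2 * q (t, x))"
          proof (cases "x \<in> N")
            case False
            show ?thesis by (rule Int_on_nonneg) (simp add: q_def index_form_def zero_out[OF _ x False])
          next
            case True
            obtain \<theta> where \<theta>: "norm (x - cylpt 1 \<theta> 0) < \<delta>" using near[OF True x] by blast
            have r1: "1/4 \<le> rsq x"
            proof -
              have le: "norm (x$1, x$2) \<ge> 1 / 2"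
              proof -
                have "norm ((cos \<theta>, sin \<theta>) - (x$1, x$2)) \<le> norm (x - cylpt 1 \<theta> 0)"
                  unfolding norm_eq_sqrt_inner inner_3 by (simp add: inner_Pair power2_eq_square algebra_simps)
                moreover have "norm (cos \<theta>, sin \<theta>) = 1" by (simp add: norm_Pair)
                ultimately show ?thesis using norm_triangle_ineq2[of "(cos \<theta>, sin \<theta>)" "(x$1, x$2)"] \<theta> \<delta>(2) \<rho>(2) by linarith
              qed
              have "(1/2)\<^sup>2 \<le> (norm (x$1, x$2))\<^sup>2" by (rule power_mono[OF le]) simp
              then show ?thesis by (simp add: norm_Pair rsq_def power2_eq_square)
            qed
            have r2: "rsq x \<le> 1" using xc by (simp add: cyl_iff)
            have "0 \<le> Int_on ?I (\<lambda>t. (norm (\<xi>t (t, x)))\<^sup>2 - index_form t x (\<xi> (t, x)) - \<mu> / 4 * (norm (\<xi> (t, x)))\<^sup>2)"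
            proof (rule index_form_positive[OF t12(1) less_imp_le[OF t12(2)] t12(3) B \<mu>_def r1 r2])
              have "continuous_on ?I (\<lambda>t. (t, x))" by (intro continuous_intros)
              moreover have "(\<lambda>t. (t, x)) ` ?I \<subseteq> ?K" using x by auto
              ultimately show "continuous_on ?I (\<lambda>t. \<xi>t (t, x))" by (rule continuous_on_compose2[OF c\<xi>(2)])
            qed (use \<xi>d \<xi>ends xc in auto)
            also have "\<dots> = Int_on ?I (\<lambda>t. (norm (\<xi>t (t, x)))\<^sup>2 - 2 * q (t, x))"
              by (rule Int_on_cong) (simp add: q_def algebra_simps)
            finally show ?thesis .
          qed
        qed
        then show ?thesis using Int_on_diff[OF cK cN cq2] by simp
      qed
      \<comment> \<open>Expansion of \<open>|U + \<xi>\<^sub>t|^2\<close>. The cross term becomes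
        twice the pressure term by \<open>I2\<close>, which is at least \<open>-2\<close> times the
        integral of \<open>q\<close> by \<open>I1\<close>, and \<open>I3\<close> absorbs
        this.\<close>
      have "Int_on ?K (\<lambda>p. (norm (G (\<sigma>, p)))\<^sup>2) =
          Int_on ?K (\<lambda>p. (norm (U (fst p) (y p)))\<^sup>2 + (2 * (U (fst p) (y p) \<bullet> \<xi>t p) + (norm (\<xi>t p))\<^sup>2))"
      proof (rule Int_on_cong)
        fix p assume "p \<in> ?K"
        then have "G (0, p) = U (fst p) (y p)" using G0[of "fst p" "snd p"] fund_subset_cyl by (auto simp: y_def HF_def)
        then have G: "G (\<sigma>, p) = U (fst p) (y p) + \<xi>t p" by (simp add: \<xi>t_def)
        show "(norm (G (\<sigma>, p)))\<^sup>2 = (norm (U (fst p) (y p)))\<^sup>2 + (2 * (U (fst p) (y p) \<bullet> \<xi>t p) + (norm (\<xi>t p))\<^sup>2)"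
          unfolding G power2_norm_eq_inner by (simp add: inner_add_left inner_add_right inner_commute)
      qed
      also have "\<dots> = Int_on ?K (\<lambda>p. (norm (U (fst p) (y p)))\<^sup>2) + (2 * Int_on ?K (\<lambda>p. U (fst p) (y p) \<bullet> \<xi>t p) + Int_on ?K (\<lambda>p. (norm (\<xi>t p))\<^sup>2))"
      proof -
        have c2: "continuous_on ?K (\<lambda>p. 2 * (U (fst p) (y p) \<bullet> \<xi>t p))" by (intro continuous_intros cU\<xi>)
        show ?thesis
          by (simp add: Int_on_add[OF cK cU2 continuous_on_add[OF c2 cN]] Int_on_add[OF cK c2 cN])
      qed
      also have "Int_on ?K (\<lambda>p. (norm (U (fst p) (y p)))\<^sup>2) = Int_on ?K (\<lambda>p. (norm (G (0, p)))\<^sup>2)"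
        by (rule Int_on_cong) (use G0 fund_subset_cyl in \<open>auto simp: y_def HF_def\<close>)
      finally have "Int_on ?K (\<lambda>p. (norm (G (0, p)))\<^sup>2) \<le> Int_on ?K (\<lambda>p. (norm (G (\<sigma>, p)))\<^sup>2)"
        using I1 I2 I3 by linarith
      then show ?thesis unfolding e_eq[OF \<sigma>A] e_eq[OF zA] by simp
    qed
    have "open (X \<inter> ?A)" "0 \<in> X \<inter> ?A" using X zA by auto
    then show "\<forall>\<^sub>F \<sigma> in nhds 0. energy t1 t2 (H 0) \<le> energy t1 t2 (H \<sigma>)"
      using main eventually_nhds by blast
  qed
  then show ?thesis using nb by blast
qed

end

section \<open>Concentrating divergence-free fields\<close>

lemma Ck_on_cong:
  assumes "\<And>x. x \<in> S \<Longrightarrow> f x = g x" "Ck_on k f S"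
  shows "Ck_on k g S"
  using assms
proof (induction k arbitrary: f g)
  case 0
  then show ?case by (simp cong: continuous_on_cong)
next
  case (Suc k)
  have iff: "(f has_derivative D) (at x within S) \<longleftrightarrow> (g has_derivative D) (at x within S)" if "x \<in> S" for x D
    using that Suc.prems(1) by (metis has_derivative_transform)
  have fr: "frechet_derivative f (at x within S) = frechet_derivative g (at x within S)" if "x \<in> S" for x
    unfolding frechet_derivative_def using iff[OF that] by simp
  have "g differentiable_on S"
    using Suc.prems(2) iff unfolding Ck_on.simps differentiable_on_def differentiable_def by blast
  moreover have "Ck_on k (\<lambda>x. frechet_derivative g (at x within S) v) S" for v
    by (rule Suc.IH[of "\<lambda>x. frechet_derivative f (at x within S) v"]) (use Suc.prems(2) fr in auto)
  ultimately show ?case by simp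
qed

text \<open>A class of everywhere differentiable functions that is closed under directional
  derivatives consists of smooth functions, by induction on the order.\<close>

lemma smooth_on_derivative_closed:
  assumes S: "solid S" and f: "C f"
    and D: "\<And>g. C g \<Longrightarrow> \<exists>D. (\<forall>x. (g has_derivative D x) (at x)) \<and> (\<forall>v. C (\<lambda>x. D x v))"
  shows "smooth_on f S"
  unfolding smooth_on_def
proof
  fix k
  show "Ck_on k f S" using f
  proof (induction k arbitrary: f)
    case 0
    then obtain D where "\<And>x. (f has_derivative D x) (at x)" using D by blast
    then show ?case
      using has_derivative_continuous continuous_at_imp_continuous_on by (metis Ck_on.simps(1))
  next
    case (Suc k)
    obtain D where D': "\<And>x. (f has_derivative D x) (at x)" "\<And>v. C (\<lambda>x. D x v)" using D[OF Suc.prems] by blast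
    have w: "(f has_derivative D x) (at x within S)" for x by (rule has_derivative_at_withinI[OF D'(1)])
    have "Ck_on k (\<lambda>x. frechet_derivative f (at x within S) v) S" for v
      by (rule Ck_on_cong[OF _ Suc.IH[OF D'(2)]]) (simp add: frechet_derivative_solid[OF S _ w])
    moreover have "f differentiable_on S" using w unfolding differentiable_on_def differentiable_def by blast
    ultimately show ?case by simp
  qed
qed

text \<open>Large enough for the stream functions of the test fields and closed under
  differentiation, so smoothness needs no order-by-order estimate.\<close>

inductive elementary :: "(real^3 \<Rightarrow> real) \<Rightarrow> bool" where
  elementary_const: "elementary (\<lambda>x. c)"
| elementary_coord: "elementary (\<lambda>x. x $ i)"
| elementary_add: "elementary f \<Longrightarrow> elementary g \<Longrightarrow> elementary (\<lambda>x. f x + g x)"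
| elementary_mult: "elementary f \<Longrightarrow> elementary g \<Longrightarrow> elementary (\<lambda>x. f x * g x)"
| elementary_sin: "elementary f \<Longrightarrow> elementary (\<lambda>x. sin (f x))"
| elementary_cos: "elementary f \<Longrightarrow> elementary (\<lambda>x. cos (f x))"

lemma elementary_cmult: "elementary f \<Longrightarrow> elementary (\<lambda>x. c * f x)"
  by (intro elementary.intros)

lemma elementary_minus: "elementary f \<Longrightarrow> elementary (\<lambda>x. - f x)"
  using elementary_cmult[of f "- 1"] by simp

lemma elementary_diff: "elementary f \<Longrightarrow> elementary g \<Longrightarrow> elementary (\<lambda>x. f x - g x)"
  using elementary_add[of f "\<lambda>x. - g x"] elementary_minus[of g] by simp

lemma elementary_power: "elementary f \<Longrightarrow> elementary (\<lambda>x. f x ^ n)"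
  by (induction n) (auto intro: elementary.intros)

lemma elementary_rsq: "elementary rsq"
  unfolding rsq_def by (intro elementary.intros elementary_power)

lemma elementary_derivative:
  assumes "elementary f"
  shows "\<exists>D. (\<forall>x. (f has_derivative D x) (at x)) \<and> (\<forall>v. elementary (\<lambda>x. D x v))"
  using assms
proof induction
  case (elementary_const c)
  show ?case by (rule exI[of _ "\<lambda>x v. 0"]) (auto intro: elementary.intros)
next
  case (elementary_coord i)
  show ?case
    by (rule exI[of _ "\<lambda>x v. v $ i"])
      (auto intro: elementary.intros bounded_linear_imp_has_derivative bounded_linear_vec_nth)
next
  case (elementary_add f g)
  then obtain Df Dg where "\<forall>x. (f has_derivative Df x) (at x)" "\<forall>v. elementary (\<lambda>x. Df x v)"
    "\<forall>x. (g has_derivative Dg x) (at x)" "\<forall>v. elementary (\<lambda>x. Dg x v)" by blast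
  then show ?case
    by (intro exI[of _ "\<lambda>x v. Df x v + Dg x v"]) (auto intro!: elementary.intros has_derivative_add)
next
  case (elementary_mult f g)
  then obtain Df Dg where "\<forall>x. (f has_derivative Df x) (at x)" "\<forall>v. elementary (\<lambda>x. Df x v)"
    "\<forall>x. (g has_derivative Dg x) (at x)" "\<forall>v. elementary (\<lambda>x. Dg x v)" by blast
  then show ?case using elementary_mult
    by (intro exI[of _ "\<lambda>x v. f x * Dg x v + Df x v * g x"]) (auto intro!: elementary.intros has_derivative_mult)
next
  case (elementary_sin f)
  then obtain Df where "\<forall>x. (f has_derivative Df x) (at x)" "\<forall>v. elementary (\<lambda>x. Df x v)" by blast
  then show ?case using elementary_sin
    by (intro exI[of _ "\<lambda>x v. Df x v * cos (f x)"]) (auto intro!: elementary.intros has_derivative_sin)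
next
  case (elementary_cos f)
  then obtain Df where "\<forall>x. (f has_derivative Df x) (at x)" "\<forall>v. elementary (\<lambda>x. Df x v)" by blast
  then have "(\<forall>x. ((\<lambda>x. cos (f x)) has_derivative (\<lambda>v. Df x v * - sin (f x))) (at x)) \<and> (\<forall>v. elementary (\<lambda>x. Df x v * - sin (f x)))"
    using elementary_cos by (intro conjI allI has_derivative_cos elementary.intros elementary_minus) auto
  then show ?case by (rule exI[of _ "\<lambda>x v. Df x v * - sin (f x)"])
qed

lemma elementary_frechet_derivative:
  "elementary f \<Longrightarrow> (f has_derivative frechet_derivative f (at x)) (at x)"
  using elementary_derivative[of f] frechet_derivative_works unfolding differentiable_def by blast

lemma elementary_smooth: "elementary f \<Longrightarrow> solid S \<Longrightarrow> smooth_on f S"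
  by (rule smooth_on_derivative_closed[where C=elementary]) (auto intro: elementary_derivative)

lemma elementary_field_smooth:
  fixes V :: "real^3 \<Rightarrow> real^3"
  assumes "\<And>i. elementary (\<lambda>x. V x $ i)" "solid S"
  shows "smooth_on V S"
proof (rule smooth_on_derivative_closed[where C="\<lambda>V. \<forall>i. elementary (\<lambda>x. V x $ i)"])
  fix g :: "real^3 \<Rightarrow> real^3" assume "\<forall>i. elementary (\<lambda>x. g x $ i)"
  then have "\<forall>i. \<exists>D. (\<forall>x. ((\<lambda>x. g x $ i) has_derivative D x) (at x)) \<and> (\<forall>v. elementary (\<lambda>x. D x v))"
    using elementary_derivative by blast
  then obtain D where D: "\<And>i x. ((\<lambda>x. g x $ i) has_derivative D i x) (at x)" "\<And>i v. elementary (\<lambda>x. D i x v)" by metis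
  have "(g has_derivative (\<lambda>v. \<chi> i. D i x v)) (at x)" for x
    unfolding has_derivative_componentwise_within[of g] by (auto simp: Basis_vec_def inner_axis D(1))
  then show "\<exists>D. (\<forall>x. (g has_derivative D x) (at x)) \<and> (\<forall>v. \<forall>i. elementary (\<lambda>x. D x v $ i))"
    using D(2) by (intro exI[of _ "\<lambda>x v. \<chi> i. D i x v"]) auto
qed (use assms in auto)

text \<open>Taken in the whole space, where elementary functions live; on the cylinder it agrees
  with \<open>pd\<close> because derivatives within a solid set are unique.\<close>

definition pdu :: "3 \<Rightarrow> (real^3 \<Rightarrow> real) \<Rightarrow> real^3 \<Rightarrow> real" where
  "pdu i f x = frechet_derivative f (at x) (axis i 1)"

text \<open>The field with Stokes stream function \<open>r\<^sup>2 f\<close>.\<close>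

definition stream_field :: "(real^3 \<Rightarrow> real) \<Rightarrow> real^3 \<Rightarrow> real^3" where
  "stream_field f x = (- (x$1 * pdu 3 f x)) *\<^sub>R axis 1 1 + (- (x$2 * pdu 3 f x)) *\<^sub>R axis 2 1
     + (2 * f x + (x$1 * pdu 1 f x + x$2 * pdu 2 f x)) *\<^sub>R axis 3 1"

lemma pdu_eq: "(f has_derivative D) (at x) \<Longrightarrow> pdu i f x = D (axis i 1)"
  unfolding pdu_def using frechet_derivative_at by metis

lemma elementary_pdu:
  assumes "elementary f"
  shows "elementary (pdu i f)"
proof -
  obtain D where D: "\<And>x. (f has_derivative D x) (at x)" "\<And>v. elementary (\<lambda>x. D x v)"
    using elementary_derivative[OF assms] by blast
  then have "pdu i f = (\<lambda>x. D x (axis i 1))" using pdu_eq by blast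
  then show ?thesis using D(2) by simp
qed

lemma pdu_commute:
  assumes "elementary f"
  shows "pdu j (pdu i f) x = pdu i (pdu j f) x"
  using mixed_partials[where v="axis i 1" and w="axis j 1" and x=x, OF solid_UNIV UNIV_I elementary_smooth[OF assms solid_UNIV]]
  by (simp add: pdu_def[abs_def])

lemma elementary_pdu_derivative:
  assumes "elementary f"
  shows "(f has_derivative (\<lambda>v. v$1 * pdu 1 f x + v$2 * pdu 2 f x + v$3 * pdu 3 f x)) (at x)"
proof -
  obtain D where D: "(f has_derivative D) (at x)" using elementary_derivative[OF assms] by blast
  have "D v = v$1 * pdu 1 f x + v$2 * pdu 2 f x + v$3 * pdu 3 f x" for v
    using linear_vec3_expand[OF has_derivative_linear[OF D], of v] by (simp add: sum_3 pdu_eq[OF D])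
  then have "D = (\<lambda>v. v$1 * pdu 1 f x + v$2 * pdu 2 f x + v$3 * pdu 3 f x)" by blast
  then show ?thesis using D by simp
qed

lemma stream_field_nth [simp]:
  "stream_field f x $ 1 = - (x$1 * pdu 3 f x)" "stream_field f x $ 2 = - (x$2 * pdu 3 f x)"
  "stream_field f x $ 3 = 2 * f x + (x$1 * pdu 1 f x + x$2 * pdu 2 f x)"
  by (simp_all add: stream_field_def)

lemma elementary_stream_field: "elementary f \<Longrightarrow> elementary (\<lambda>x. stream_field f x $ i)"
  using exhaust_3[of i]
  by (auto intro!: elementary.intros elementary_minus elementary_pdu)

text \<open>The divergence cancels by equality of mixed partial derivatives. On the wall the radial
  component is minus the \<open>z\<close>-derivative of \<open>f\<close>, which is 0 because
  \<open>f\<close> vanishes along vertical lines there.\<close>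

lemma stream_field_T_id:
  assumes f: "elementary f" and per: "\<And>x. f (x + (2 * pi) *\<^sub>R e_z) = f x" and bd: "\<And>x. rsq x = 1 \<Longrightarrow> f x = 0"
  shows "stream_field f \<in> T_id_Diff_mu"
proof -
  have "smooth_on (stream_field f) cyl"
    by (rule elementary_field_smooth[OF elementary_stream_field[OF f] solid_cyl])
  moreover have "z_periodic (stream_field f)"
  proof -
    have "pdu i f (x + (2 * pi) *\<^sub>R e_z) = pdu i f x" for i x
    proof -
      let ?D = "frechet_derivative f (at (x + (2 * pi) *\<^sub>R e_z))"
      have "(f has_derivative ?D) (at (x + (2 * pi) *\<^sub>R e_z))"
        by (rule elementary_frechet_derivative[OF f])
      moreover have "((\<lambda>x. x + (2 * pi) *\<^sub>R e_z) has_derivative (\<lambda>v. v)) (at x)" by (auto intro!: derivative_eq_intros)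
      ultimately have "((\<lambda>x. f (x + (2 * pi) *\<^sub>R e_z)) has_derivative ?D) (at x)"
        using diff_chain_at[of "\<lambda>x. x + (2 * pi) *\<^sub>R e_z" "\<lambda>v. v" x f ?D] by (simp add: o_def)
      then have "(f has_derivative ?D) (at x)" unfolding per .
      from pdu_eq[OF this, of i] show ?thesis by (simp add: pdu_def)
    qed
    then show ?thesis by (simp add: z_periodic_def vec_eq_iff forall_3 per)
  qed
  moreover have "tangent_bdry (stream_field f)"
    unfolding tangent_bdry_def
  proof (intro allI)
    fix \<theta> z
    have "pdu 3 f (cylpt 1 \<theta> z) = 0"
    proof -
      have "frechet_derivative f (at (cylpt 1 \<theta> z)) e_z = 0"
      proof (rule derivative_along_zero_path[where L="\<lambda>u. u" and J=UNIV and s=z and \<gamma>="\<lambda>s. cylpt 1 \<theta> s" and S=UNIV and G=f])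
        show "((\<lambda>s. cylpt 1 \<theta> s) has_vector_derivative e_z) (at z within UNIV)" by (rule cylpt_deriv_axial)
        show "(f has_derivative frechet_derivative f (at (cylpt 1 \<theta> z))) (at (cylpt 1 \<theta> z) within UNIV)"
          using elementary_frechet_derivative[OF f] by simp
      qed (auto simp: solid_UNIV bd bounded_linear_ident)
      then show ?thesis by (simp add: pdu_def e_z_axis)
    qed
    then show "stream_field f (cylpt 1 \<theta> z) \<bullet> e_r \<theta> = 0" by (simp add: inner_3)
  qed
  moreover have "divergence (stream_field f) x = 0" if x: "x \<in> cyl" for x
  proof -
    have d: "(pdu i f has_derivative (\<lambda>v. v$1 * pdu 1 (pdu i f) x + v$2 * pdu 2 (pdu i f) x + v$3 * pdu 3 (pdu i f) x)) (at x within cyl)" for i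
      by (rule has_derivative_at_withinI[OF elementary_pdu_derivative[OF elementary_pdu[OF f]]])
    have d0: "(f has_derivative (\<lambda>v. v$1 * pdu 1 f x + v$2 * pdu 2 f x + v$3 * pdu 3 f x)) (at x within cyl)"
      by (rule has_derivative_at_withinI[OF elementary_pdu_derivative[OF f]])
    have nth: "((\<lambda>x::real^3. x$i) has_derivative (\<lambda>v. v$i)) (at x within cyl)" for i
      by (rule bounded_linear_imp_has_derivative[OF bounded_linear_vec_nth])
    let ?d = "\<lambda>i v. v$1 * pdu 1 (pdu i f) x + v$2 * pdu 2 (pdu i f) x + v$3 * pdu 3 (pdu i f) x"
    let ?V = "\<lambda>v::real^3. (- (x$1 * ?d 3 v + v$1 * pdu 3 f x)) *\<^sub>R axis 1 1 + (- (x$2 * ?d 3 v + v$2 * pdu 3 f x)) *\<^sub>R axis 2 1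
     + (2 * (v$1 * pdu 1 f x + v$2 * pdu 2 f x + v$3 * pdu 3 f x) + ((x$1 * ?d 1 v + v$1 * pdu 1 f x) + (x$2 * ?d 2 v + v$2 * pdu 2 f x))) *\<^sub>R axis 3 1 :: real^3"
    have "(stream_field f has_derivative ?V) (at x within cyl)"
      unfolding stream_field_def[abs_def]
      by (intro has_derivative_add has_derivative_scaleR_left has_derivative_minus has_derivative_mult has_derivative_mult_right d d0 nth)
    then have fr: "frechet_derivative (stream_field f) (at x within cyl) = ?V" by (rule frechet_derivative_solid[OF solid_cyl x])
    show ?thesis
      unfolding divergence_def pd_def fr
      using pdu_commute[OF f, of 1 3 x] pdu_commute[OF f, of 2 3 x] by (simp add: sum_3 algebra_simps)
  qed
  ultimately show ?thesis by (simp add: T_id_Diff_mu_def)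
qed

lemma pdu_mult:
  assumes "elementary f" "elementary g"
  shows "pdu i (\<lambda>x. f x * g x) x = f x * pdu i g x + pdu i f x * g x"
proof -
  show ?thesis
    using pdu_eq[OF has_derivative_mult[OF elementary_frechet_derivative[OF assms(1)] elementary_frechet_derivative[OF assms(2)]]]
    by (simp add: pdu_def)
qed

text \<open>Separates the scales: for an oscillating \<open>g\<close> of size \<open>1/k\<close>,
  the first term is small and the second, with the derivatives of \<open>g\<close>, has size
  1.\<close>

lemma stream_field_mult:
  assumes "elementary f" "elementary g"
  shows "stream_field (\<lambda>x. f x * g x) x = g x *\<^sub>R stream_field f x
    + f x *\<^sub>R vector [- (x$1 * pdu 3 g x), - (x$2 * pdu 3 g x), x$1 * pdu 1 g x + x$2 * pdu 2 g x]"
  by (simp add: vec_eq_iff forall_3 pdu_mult[OF assms] algebra_simps)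

lemma pdu_oscillation:
  assumes "k \<noteq> 0"
  shows "pdu i (\<lambda>x. sin (k * x$3) / k) x = cos (k * x$3) * axis i 1 $ 3"
    "pdu i (\<lambda>x. cos (k * x$3) / k) x = - sin (k * x$3) * axis i 1 $ 3"
    "pdu i (\<lambda>x. sin (k * rsq x) / (2 * k)) x = cos (k * rsq x) * (x$1 * axis i 1 $ 1 + x$2 * axis i 1 $ 2)"
    "pdu i (\<lambda>x. cos (k * rsq x) / (2 * k)) x = - sin (k * rsq x) * (x$1 * axis i 1 $ 1 + x$2 * axis i 1 $ 2)"
proof -
  have nth: "((\<lambda>x::real^3. x$i) has_derivative (\<lambda>v. v$i)) (at x)" for i
    by (rule bounded_linear_imp_has_derivative[OF bounded_linear_vec_nth])
  have r: "(rsq has_derivative (\<lambda>v. 2 * (x$1 * v$1 + x$2 * v$2))) (at x)"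
    unfolding rsq_def by (auto intro!: derivative_eq_intros nth simp: algebra_simps)
  have 1: "((\<lambda>x. sin (k * x$3) / k) has_derivative (\<lambda>v. cos (k * x$3) * v$3)) (at x)"
    using assms by (auto intro!: derivative_eq_intros nth)
  have 2: "((\<lambda>x. cos (k * x$3) / k) has_derivative (\<lambda>v. - sin (k * x$3) * v$3)) (at x)"
    using assms by (auto intro!: derivative_eq_intros nth)
  have 3: "((\<lambda>x. sin (k * rsq x) / (2 * k)) has_derivative (\<lambda>v. cos (k * rsq x) * (x$1 * v$1 + x$2 * v$2))) (at x)"
    using assms by (auto intro!: derivative_eq_intros r)
  have 4: "((\<lambda>x. cos (k * rsq x) / (2 * k)) has_derivative (\<lambda>v. - sin (k * rsq x) * (x$1 * v$1 + x$2 * v$2))) (at x)"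
    using assms by (auto intro!: derivative_eq_intros r)
  show "pdu i (\<lambda>x. sin (k * x$3) / k) x = cos (k * x$3) * axis i 1 $ 3"
    "pdu i (\<lambda>x. cos (k * x$3) / k) x = - sin (k * x$3) * axis i 1 $ 3"
    "pdu i (\<lambda>x. sin (k * rsq x) / (2 * k)) x = cos (k * rsq x) * (x$1 * axis i 1 $ 1 + x$2 * axis i 1 $ 2)"
    "pdu i (\<lambda>x. cos (k * rsq x) / (2 * k)) x = - sin (k * rsq x) * (x$1 * axis i 1 $ 1 + x$2 * axis i 1 $ 2)"
    by (rule pdu_eq[OF 1], rule pdu_eq[OF 2], rule pdu_eq[OF 3], rule pdu_eq[OF 4])
qed

text \<open>On \<open>fund\<close> it reaches its maximum 1 exactly on the circle, so high powers
  concentrate there, and it is periodic and elementary.\<close>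

definition peak :: "real^3 \<Rightarrow> real" where "peak x = rsq x * ((1 + cos (x$3)) / 2)"

lemma half_cos_bounds: "0 \<le> (1 + cos z) / 2" "(1 + cos z) / 2 \<le> (1::real)"
proof -
  have "0 \<le> 1 + cos z" using cos_ge_minus_one[of z] by argo
  then show "0 \<le> (1 + cos z) / 2" by simp
  show "(1 + cos z) / 2 \<le> 1" by simp
qed

lemma peak_bounds:
  assumes "x \<in> cyl"
  shows "0 \<le> peak x" "peak x \<le> 1"
proof -
  note c = half_cos_bounds[of "x$3"]
  show "0 \<le> peak x" unfolding peak_def by (rule mult_nonneg_nonneg) (use c in auto)
  show "peak x \<le> 1" unfolding peak_def by (rule mult_le_one) (use c assms in \<open>auto simp: cyl_iff\<close>)
qed

lemma peak_eq_1:
  assumes x: "x \<in> fund" and p: "peak x = 1"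
  obtains \<theta> where "x = cylpt 1 \<theta> 0"
proof -
  have xc: "x \<in> cyl" using x fund_subset_cyl by auto
  note c = half_cos_bounds[of "x$3"]
  have r: "rsq x \<le> 1" using xc by (simp add: cyl_iff)
  have "1 \<le> rsq x" using mult_left_mono[OF c(2) rsq_nonneg[of x]] p by (simp add: peak_def)
  then have r1: "rsq x = 1" using r by simp
  then have "cos (x$3) = 1" using p by (simp add: peak_def)
  then have "x$3 = 0"
    using cos_monotone_0_pi[of 0 "\<bar>x$3\<bar>"] x by (cases "x$3 = 0") (auto simp: fund_iff)
  moreover obtain s \<theta> where s: "s \<in> {0..1}" "x = cylpt s \<theta> (x$3)" using xc by (rule cyl_cylpt)
  moreover have "s = 1" using s r1 rsq_cylpt[of s \<theta> "x$3"] by (simp add: power2_eq_1_iff)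
  ultimately show ?thesis using that by metis
qed

lemma continuous_peak: "continuous_on S peak"
  unfolding peak_def[abs_def] by (intro continuous_intros) simp

text \<open>Laplace's method. Where \<open>f \<ge> - c\<close>, a compact set off the circle,
  \<open>peak\<close> is at most \<open>1 - 2 \<delta>\<close>, so its powers are negligible against
  those on the region \<open>peak \<ge> 1 - \<delta>\<close>. The factor \<open>1 - rsq x\<close>
  vanishes on the circle itself, but its weight over that region is a fixed positive number.\<close>

lemma concentration:
  assumes f: "continuous_on fund f" and c: "0 < c" "\<And>\<theta>. f (cylpt 1 \<theta> 0) < - c"
  obtains m where "Int_on fund (\<lambda>x. f x * ((1 - rsq x) * peak x ^ m)\<^sup>2) < 0"
proof -
  define Bad where "Bad = {x \<in> fund. - c \<le> f x}"
  have "compact Bad"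
  proof -
    have "closed (fund \<inter> f -` {- c..})"
      by (rule continuous_closed_preimage[OF f]) (auto intro: compact_imp_closed compact_fund)
    then have "compact (fund \<inter> (fund \<inter> f -` {- c..}))" by (rule compact_Int_closed[OF compact_fund])
    moreover have "fund \<inter> (fund \<inter> f -` {- c..}) = Bad" by (auto simp: Bad_def)
    ultimately show ?thesis by simp
  qed
  have lt: "peak x < 1" if "x \<in> Bad" for x
  proof -
    have x: "x \<in> fund" "x \<in> cyl" using that fund_subset_cyl by (auto simp: Bad_def)
    have "peak x \<noteq> 1"
    proof
      assume "peak x = 1"
      then obtain \<theta> where "x = cylpt 1 \<theta> 0" using peak_eq_1[OF x(1)] by metis
      then show False using c(2)[of \<theta>] that by (simp add: Bad_def)
    qed
    then show ?thesis using peak_bounds(2)[OF x(2)] by simp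
  qed
  obtain \<delta> where \<delta>: "0 < \<delta>" "\<delta> \<le> 1/4" "\<And>x. x \<in> Bad \<Longrightarrow> peak x \<le> 1 - 2 * \<delta>"
  proof (cases "Bad = {}")
    case True
    then show ?thesis using that[of "1/4"] by simp
  next
    case False
    obtain x0 where x0: "x0 \<in> Bad" "\<And>x. x \<in> Bad \<Longrightarrow> peak x \<le> peak x0"
      using continuous_attains_sup[OF \<open>compact Bad\<close> False continuous_peak] by blast
    define d where "d = min (1/4) ((1 - peak x0) / 2)"
    have "0 < d" "d \<le> 1/4" "2 * d \<le> 1 - peak x0" using lt[OF x0(1)] by (auto simp: d_def min_def)
    then show ?thesis using that[of d] x0(2) by fastforce
  qed
  obtain M where M: "0 < M" "\<And>x. x \<in> fund \<Longrightarrow> f x + c \<le> M"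
  proof -
    have "bounded (f ` fund)" by (intro compact_imp_bounded compact_continuous_image f compact_fund)
    then obtain B where "0 < B" "\<And>x. x \<in> fund \<Longrightarrow> \<bar>f x\<bar> \<le> B" by (auto simp: bounded_pos)
    then show ?thesis using that[of "B + c"] c by fastforce
  qed
  let ?w = "\<lambda>x. (1 - rsq x)\<^sup>2"
  \<comment> \<open>A continuous cutoff to the region \<open>peak > 1 - \<delta>\<close>, with
    values at most 1 on the cylinder; there \<open>(peak^m)^2\<close> is at least
    \<open>((1 - \<delta>)^m)^2\<close>.\<close>
  define h where "h x = max 0 (peak x - (1 - \<delta>))" for x
  have ch: "continuous_on fund h" unfolding h_def[abs_def] by (intro continuous_intros continuous_peak)
  define I0 where "I0 = Int_on fund (\<lambda>x. ?w x * h x)"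
  have I0: "0 < I0"
  proof (rule ccontr)
    assume "\<not> 0 < I0"
    then have le: "Int_on fund (\<lambda>x. ?w x * h x) \<le> 0" by (simp add: I0_def)
    \<comment> \<open>The point at radius \<open>s\<close>, angle 0 and height 0 has
      \<open>rsq = 1 - \<delta> / 2\<close>: it is off the wall and yet inside the cutoff, so both
      factors of the integrand are positive there.\<close>
    define s where "s = sqrt (1 - \<delta> / 2)"
    have s2: "s\<^sup>2 = 1 - \<delta> / 2" using \<delta> by (simp add: s_def)
    have s: "s \<in> {0..1}" using \<delta> by (auto simp: s_def)
    have x: "cylpt s 0 0 \<in> fund" using cylpt_in_cyl[OF s] by (simp add: fund_iff)
    have "?w (cylpt s 0 0) * h (cylpt s 0 0) = 0"
    proof (rule Int_on_eq_0D[OF compact_fund solid_fund _ _ le x])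
      show "continuous_on fund (\<lambda>x. ?w x * h x)" by (intro continuous_intros ch)
    qed (simp add: h_def)
    moreover have "h (cylpt s 0 0) = \<delta> / 2" using \<delta>(1) by (simp add: h_def peak_def s2 max_def)
    moreover have "1 - rsq (cylpt s 0 0) = \<delta> / 2" by (simp add: s2)
    ultimately show False using \<delta>(1) by simp
  qed
  define V where "V = measure lborel fund"
  \<comment> \<open>The squared ratio of the two levels of \<open>peak\<close>; its powers compare
    the bad set with the good region.\<close>
  define \<rho> where "\<rho> = ((1 - 2 * \<delta>) / (1 - \<delta>))\<^sup>2"
  have \<rho>: "0 \<le> \<rho>" "\<rho> < 1"
  proof -
    have "(1 - 2 * \<delta>) / (1 - \<delta>) < 1" "0 \<le> (1 - 2 * \<delta>) / (1 - \<delta>)" using \<delta> by (auto simp: divide_less_eq)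
    then show "0 \<le> \<rho>" "\<rho> < 1" unfolding \<rho>_def by (auto simp: power_less_one_iff)
  qed
  have "(\<lambda>m. V * (M * \<rho> ^ m)) \<longlonglongrightarrow> V * (M * 0)"
    by (intro tendsto_intros LIMSEQ_power_zero) (use \<rho> in simp)
  then have "(\<lambda>m. V * (M * \<rho> ^ m)) \<longlonglongrightarrow> 0" by simp
  moreover have "0 < c * I0" using c I0 by simp
  ultimately have "\<forall>\<^sub>F m in sequentially. V * (M * \<rho> ^ m) < c * I0" by (rule order_tendstoD(2))
  then obtain m where m: "V * (M * \<rho> ^ m) < c * I0" by (auto simp: eventually_sequentially)
  let ?g = "((1 - \<delta>) ^ m)\<^sup>2"
  have g0: "0 < ?g" using \<delta> by simp
  \<comment> \<open>Write \<open>f\<close> as \<open>(f + c) - c\<close>. The first summand can be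
    positive only on \<open>Bad\<close>, where the weight is small; the second is bounded below by
    means of \<open>h\<close>.\<close>
  have pt: "f x * ((1 - rsq x) * peak x ^ m)\<^sup>2 \<le> ?g * (M * \<rho> ^ m) - c * (?g * (?w x * h x))" if x: "x \<in> fund" for x
  proof -
    have xc: "x \<in> cyl" using x fund_subset_cyl by auto
    note pb = peak_bounds[OF xc]
    have w01: "0 \<le> ?w x" "?w x \<le> 1"
      using xc rsq_nonneg[of x] by (auto simp: cyl_iff intro!: power_le_one)
    have lower: "?g * h x \<le> (peak x ^ m)\<^sup>2"
    proof (cases "1 - \<delta> \<le> peak x")
      case True
      then have "?g \<le> (peak x ^ m)\<^sup>2" using \<delta> by (intro power_mono) auto
      moreover have "h x \<le> 1" "0 \<le> h x" using pb \<delta> by (auto simp: h_def)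
      ultimately have "?g * h x \<le> (peak x ^ m)\<^sup>2 * 1" by (intro mult_mono) auto
      then show ?thesis by simp
    qed (simp add: h_def)
    then have "?w x * (?g * h x) \<le> ?w x * (peak x ^ m)\<^sup>2" using w01 by (intro mult_left_mono) auto
    then have 1: "c * (?g * (?w x * h x)) \<le> c * (?w x * (peak x ^ m)\<^sup>2)" using c by (simp add: mult_ac)
    have 2: "(f x + c) * (?w x * (peak x ^ m)\<^sup>2) \<le> ?g * (M * \<rho> ^ m)"
    proof (cases "x \<in> Bad")
      case True
      have "(peak x ^ m)\<^sup>2 \<le> ((1 - 2 * \<delta>) ^ m)\<^sup>2" using \<delta>(3)[OF True] pb by (intro power_mono) auto
      also have "\<dots> = ?g * \<rho> ^ m"
      proof -
        have "(1 - 2 * \<delta>) ^ m = (1 - \<delta>) ^ m * ((1 - 2 * \<delta>) / (1 - \<delta>)) ^ m"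
          using \<delta> by (simp add: power_divide)
        moreover have "\<rho> ^ m = (((1 - 2 * \<delta>) / (1 - \<delta>)) ^ m)\<^sup>2"
          unfolding \<rho>_def by (simp only: power_mult[symmetric] mult.commute)
        ultimately show ?thesis by (simp only: power_mult_distrib)
      qed
      finally have le: "?w x * (peak x ^ m)\<^sup>2 \<le> 1 * (?g * \<rho> ^ m)" using w01 by (intro mult_mono) auto
      have "(f x + c) * (?w x * (peak x ^ m)\<^sup>2) \<le> M * (1 * (?g * \<rho> ^ m))"
        by (rule mult_mono[OF M(2)[OF x] le]) (use M w01 in auto)
      then show ?thesis by (simp add: mult_ac)
    next
      case False
      then have "f x + c \<le> 0" using x by (simp add: Bad_def)
      then have "(f x + c) * (?w x * (peak x ^ m)\<^sup>2) \<le> 0" using w01 by (intro mult_nonpos_nonneg) auto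
      moreover have "0 \<le> ?g * (M * \<rho> ^ m)" using M \<rho> by simp
      ultimately show ?thesis by linarith
    qed
    have "f x * ((1 - rsq x) * peak x ^ m)\<^sup>2 = (f x + c) * (?w x * (peak x ^ m)\<^sup>2) - c * (?w x * (peak x ^ m)\<^sup>2)"
      unfolding power_mult_distrib by argo
    then show ?thesis using 1 2 by linarith
  qed
  have "Int_on fund (\<lambda>x. f x * ((1 - rsq x) * peak x ^ m)\<^sup>2) \<le> Int_on fund (\<lambda>x. ?g * (M * \<rho> ^ m) - c * (?g * (?w x * h x)))"
    by (rule Int_on_mono[OF compact_fund _ _ pt]) (intro continuous_intros f continuous_peak ch)+
  also have "\<dots> = V * (?g * (M * \<rho> ^ m)) - c * (?g * I0)"
  proof -
    have k1: "continuous_on fund (\<lambda>x. ?g * (M * \<rho> ^ m))" "continuous_on fund (\<lambda>x. c * (?g * (?w x * h x)))"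
      by (intro continuous_intros ch)+
    show ?thesis
      unfolding Int_on_diff[OF compact_fund k1] Int_on_const[OF compact_fund] set_integral_mult_right I0_def V_def
      by (simp only: mult_ac)
  qed
  also have "\<dots> = ?g * (V * (M * \<rho> ^ m) - c * I0)" by (simp add: algebra_simps)
  also have "\<dots> < 0" using g0 m by (simp add: mult_less_0_iff)
  finally show ?thesis by (rule that)
qed

text \<open>The mixed terms of the sine and cosine fields cancel in the sum, so no integral of an
  oscillating product has to be estimated.\<close>

lemma quadratic_rotation:
  fixes L :: "real^3 \<Rightarrow> real^3"
  assumes "linear L" and C: "C\<^sup>2 + S\<^sup>2 = (1::real)"
  shows "L ((S / k) *\<^sub>R \<beta> + C *\<^sub>R W) \<bullet> ((S / k) *\<^sub>R \<beta> + C *\<^sub>R W) + L ((C / k) *\<^sub>R \<beta> + (- S) *\<^sub>R W) \<bullet> ((C / k) *\<^sub>R \<beta> + (- S) *\<^sub>R W)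
    = L W \<bullet> W + (1 / k\<^sup>2) * (L \<beta> \<bullet> \<beta>)"
proof -
  have "L ((S / k) *\<^sub>R \<beta> + C *\<^sub>R W) \<bullet> ((S / k) *\<^sub>R \<beta> + C *\<^sub>R W) + L ((C / k) *\<^sub>R \<beta> + (- S) *\<^sub>R W) \<bullet> ((C / k) *\<^sub>R \<beta> + (- S) *\<^sub>R W)
     = (C\<^sup>2 + S\<^sup>2) * (L W \<bullet> W) + ((C\<^sup>2 + S\<^sup>2) / k\<^sup>2) * (L \<beta> \<bullet> \<beta>)"
    by (simp add: linear_add[OF assms(1)] linear_diff[OF assms(1)] linear_cmul[OF assms(1)] linear_neg[OF assms(1)]
        inner_add_left inner_add_right inner_diff_left inner_diff_right power2_eq_square add_divide_distrib algebra_simps)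
  then show ?thesis unfolding C by simp
qed

text \<open>The factor \<open>1 - rsq x\<close> makes the resulting stream functions vanish on the
  wall, which the tangency condition needs.\<close>

definition amplitude :: "nat \<Rightarrow> real^3 \<Rightarrow> real" where
  "amplitude m x = (1 - rsq x) * peak x ^ m"

lemma elementary_amplitude: "elementary (amplitude m)"
proof -
  have "elementary (\<lambda>x. (1 - rsq x) * (rsq x * ((1/2) * (1 + cos (x$3)))) ^ m)"
    by (intro elementary_mult elementary_diff elementary_power elementary_add elementary_const elementary_rsq elementary_cos elementary_coord)
  then show ?thesis by (simp add: amplitude_def[abs_def] peak_def)
qed

lemma amplitude_periodic: "amplitude m (x + (2 * pi) *\<^sub>R e_z) = amplitude m x"
  by (simp add: amplitude_def peak_def)

lemma oscillating_field_T_id: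
  assumes g: "elementary g" "\<And>x. g (x + (2 * pi) *\<^sub>R e_z) = g x"
  shows "stream_field (\<lambda>x. amplitude m x * g x) \<in> T_id_Diff_mu"
  by (rule stream_field_T_id) (auto intro: elementary_mult elementary_amplitude g simp: amplitude_periodic g(2), simp add: amplitude_def)

context euler_odd
begin

lemma HP_form_continuous:
  assumes t: "t \<in> {0..<T}" and V: "continuous_on fund V" "continuous_on fund W"
  shows "continuous_on fund (\<lambda>x. HP t x (V x) \<bullet> W x)"
proof -
  have "continuous_on fund (\<lambda>x. (\<Sum>i\<in>UNIV. V x $ i *\<^sub>R HP t x (axis i 1)) \<bullet> W x)"
    by (intro continuous_intros fund_continuous[OF HP_continuous t] V)
  moreover have "(\<Sum>i\<in>UNIV. V x $ i *\<^sub>R HP t x (axis i 1)) = HP t x (V x)" if "x \<in> fund" for x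
    by (rule linear_vec3_expand[OF HP_linear[OF t], symmetric]) (use that fund_subset_cyl in auto)
  ultimately show ?thesis by (simp cong: continuous_on_cong)
qed

text \<open>
  Stream functions \<open>A sin (k z) / k\<close> and \<open>A sin (k r\<^sup>2) / (2 k)\<close>, and their cosine counterparts, give fields
  oscillating in the radial and axial directions.  The sum of the four quadratic forms is, up to
  \<open>O(1/k\<^sup>2)\<close>, the integral of \<open>A\<^sup>2\<close> times the trace of the form over these two directions, which
  is negative at the circle where \<open>A\<^sup>2\<close> concentrates.
\<close>

lemma negative_direction:
  assumes t: "t \<in> {0..<T}" and s: "axial_strain t \<noteq> 0"
  obtains V where "V \<in> T_id_Diff_mu" "\<And>z. V (cylpt 1 0 z) $ 2 = 0"
    "Int_on fund (\<lambda>x. HP t x (V x) \<bullet> V x) + (axial_strain t)\<^sup>2 / 2 * Int_on fund (\<lambda>x. V x \<bullet> V x) < 0"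
proof -
  let ?\<kappa> = "(axial_strain t)\<^sup>2 / 2"
  \<comment> \<open>The form is shifted by \<open>s^2 / 2\<close> times the identity. On the circle
    its trace over the radial and axial directions is still
    \<open>- 2 s^2 + s^2 = - s^2\<close>.\<close>
  define L where "L x v = HP t x v + ?\<kappa> *\<^sub>R v" for x v
  have L: "linear (L x)" if "x \<in> cyl" for x
    using HP_linear[OF t that] unfolding L_def[abs_def]
    by (intro linear_compose_add linear_compose_scale_right linear_id[unfolded id_def])
  have cL: "continuous_on fund (\<lambda>x. L x (V x) \<bullet> V x)" if "continuous_on fund V" for V
    unfolding L_def inner_add_left by (intro continuous_intros HP_form_continuous t that)
  \<comment> \<open>The leading directions of the oscillating fields: \<open>Wr\<close> is
    \<open>- r e_r\<close> for oscillation in \<open>z\<close>, and \<open>Wz\<close> is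
    \<open>r^2 e_z\<close> for oscillation in \<open>r^2\<close>. On the circle both are unit
    vectors.\<close>
  define Wr :: "real^3 \<Rightarrow> real^3" where "Wr x = vector [- (x$1), - (x$2), 0]" for x
  define Wz :: "real^3 \<Rightarrow> real^3" where "Wz x = rsq x *\<^sub>R e_z" for x
  have cW: "continuous_on fund Wr" "continuous_on fund Wz"
  proof -
    have "Wr = (\<lambda>x. (- (x$1)) *\<^sub>R axis 1 1 + (- (x$2)) *\<^sub>R axis 2 1)"
      by (auto simp: Wr_def fun_eq_iff vec_eq_iff forall_3)
    moreover have "continuous_on fund (\<lambda>x::real^3. (- (x$1)) *\<^sub>R axis 1 1 + (- (x$2)) *\<^sub>R axis 2 1 :: real^3)"
      by (intro continuous_intros)
    ultimately show "continuous_on fund Wr" by simp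
    show "continuous_on fund Wz" unfolding Wz_def[abs_def] by (intro continuous_intros)
  qed
  define f where "f x = L x (Wr x) \<bullet> Wr x + L x (Wz x) \<bullet> Wz x" for x
  have cf: "continuous_on fund f" unfolding f_def[abs_def] by (intro continuous_on_add cL cW)
  have fc: "f (cylpt 1 \<theta> 0) < - (?\<kappa>)" for \<theta>
  proof -
    have "Wr (cylpt 1 \<theta> 0) = - e_r \<theta>" "Wz (cylpt 1 \<theta> 0) = e_z"
      by (simp_all add: Wr_def Wz_def vec_eq_iff forall_3)
    then have "f (cylpt 1 \<theta> 0) = - (axial_strain t)\<^sup>2"
      by (simp add: f_def L_def HP_circle_form[OF t] inner_add_left inner_diff_left)
    then show ?thesis using s by simp
  qed
  have "0 < ?\<kappa>" using s by simp
  then obtain m where m: "Int_on fund (\<lambda>x. f x * ((1 - rsq x) * peak x ^ m)\<^sup>2) < 0"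
    using concentration[OF cf _ fc] by metis
  define J where "J = Int_on fund (\<lambda>x. f x * ((1 - rsq x) * peak x ^ m)\<^sup>2)"
  let ?A = "amplitude m"
  define \<beta> where "\<beta> = stream_field ?A"
  have c\<beta>: "continuous_on fund \<beta>"
    unfolding \<beta>_def
    by (rule continuous_on_subset[OF smooth_on_continuous[OF elementary_field_smooth[OF elementary_stream_field[OF elementary_amplitude] solid_UNIV]]]) simp
  define R where "R = Int_on fund (\<lambda>x. L x (\<beta> x) \<bullet> \<beta> x)"
  \<comment> \<open>The remainder of the four forms is
    \<open>(1/k^2 + 1/(2 k)^2) R = (1 + 1/4) R / k^2\<close>; this \<open>k\<close> makes it smaller
    than \<open>- J\<close>.\<close>
  obtain k :: nat where k: "0 < k" "(1 + 1/4) * \<bar>R\<bar> < - J * real k"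
  proof -
    have "0 < - J" using m by (simp add: J_def)
    then obtain k :: nat where k: "(1 + 1/4) * \<bar>R\<bar> / (- J) < real k" using reals_Archimedean2 by blast
    then have "(1 + 1/4) * \<bar>R\<bar> < real k * (- J)" using \<open>0 < - J\<close> by (simp only: pos_divide_less_eq)
    then have *: "(1 + 1/4) * \<bar>R\<bar> < - J * real k" by (simp only: mult.commute)
    have "0 < k"
    proof (rule ccontr)
      assume "\<not> 0 < k"
      then show False using * by simp
    qed
    then show ?thesis using * that by blast
  qed
  define g1 where "g1 = (\<lambda>x::real^3. sin (real k * x$3) / real k)"
  define g2 where "g2 = (\<lambda>x::real^3. cos (real k * x$3) / real k)"
  define g3 where "g3 = (\<lambda>x::real^3. sin (real k * rsq x) / (2 * real k))"
  define g4 where "g4 = (\<lambda>x::real^3. cos (real k * rsq x) / (2 * real k))"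
  have kn: "real k \<noteq> 0" using k(1) by simp
  have el: "elementary g1" "elementary g2" "elementary g3" "elementary g4"
  proof -
    have "elementary (\<lambda>x. (1 / real k) * sin (real k * x$3))" "elementary (\<lambda>x. (1 / real k) * cos (real k * x$3))"
      "elementary (\<lambda>x. (1 / (2 * real k)) * sin (real k * rsq x))" "elementary (\<lambda>x. (1 / (2 * real k)) * cos (real k * rsq x))"
      by (intro elementary_mult elementary_const elementary_sin elementary_cos elementary_coord elementary_rsq)+
    then show "elementary g1" "elementary g2" "elementary g3" "elementary g4"
      by (simp_all add: g1_def g2_def g3_def g4_def)
  qed
  have per0: "sin (real k * (z + 2 * pi)) = sin (real k * z)" "cos (real k * (z + 2 * pi)) = cos (real k * z)" for z
  proof -
    have "real k * (z + 2 * pi) = real k * z + 2 * real k * pi" by (simp add: algebra_simps)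
    then show "sin (real k * (z + 2 * pi)) = sin (real k * z)" "cos (real k * (z + 2 * pi)) = cos (real k * z)"
      by (simp_all add: sin_add cos_add)
  qed
  have per: "g1 (x + (2 * pi) *\<^sub>R e_z) = g1 x" "g2 (x + (2 * pi) *\<^sub>R e_z) = g2 x" "g3 (x + (2 * pi) *\<^sub>R e_z) = g3 x" "g4 (x + (2 * pi) *\<^sub>R e_z) = g4 x" for x
    by (simp_all add: g1_def g2_def g3_def g4_def per0)
  define V where "V g = stream_field (\<lambda>x. ?A x * g x)" for g
  have VT: "V g \<in> T_id_Diff_mu" if "g \<in> {g1, g2, g3, g4}" for g
    unfolding V_def by (rule oscillating_field_T_id) (use that el per in auto)
  have V2: "V g (cylpt 1 0 z) $ 2 = 0" for g z by (simp add: V_def)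
  have cV: "continuous_on fund (V g)" if "g \<in> {g1, g2, g3, g4}" for g
    using VT[OF that] continuous_on_subset[OF smooth_on_continuous fund_subset_cyl] by (auto simp: T_id_Diff_mu_def)
  have Veq: "V g1 x = (sin (real k * x$3) / real k) *\<^sub>R \<beta> x + cos (real k * x$3) *\<^sub>R (?A x *\<^sub>R Wr x)"
    "V g2 x = (cos (real k * x$3) / real k) *\<^sub>R \<beta> x + (- sin (real k * x$3)) *\<^sub>R (?A x *\<^sub>R Wr x)"
    "V g3 x = (sin (real k * rsq x) / (2 * real k)) *\<^sub>R \<beta> x + cos (real k * rsq x) *\<^sub>R (?A x *\<^sub>R Wz x)"
    "V g4 x = (cos (real k * rsq x) / (2 * real k)) *\<^sub>R \<beta> x + (- sin (real k * rsq x)) *\<^sub>R (?A x *\<^sub>R Wz x)" for x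
    unfolding V_def stream_field_mult[OF elementary_amplitude el(1)] stream_field_mult[OF elementary_amplitude el(2)]
      stream_field_mult[OF elementary_amplitude el(3)] stream_field_mult[OF elementary_amplitude el(4)] \<beta>_def[symmetric]
    unfolding g1_def g2_def g3_def g4_def pdu_oscillation[OF kn]
    by (simp_all add: vec_eq_iff forall_3 Wr_def Wz_def rsq_def power2_eq_square algebra_simps)
  define \<Phi> where "\<Phi> g = Int_on fund (\<lambda>x. L x (V g x) \<bullet> V g x)" for g
  have cLV: "continuous_on fund (\<lambda>x. L x (V g x) \<bullet> V g x)" if "g \<in> {g1, g2, g3, g4}" for g
    by (rule cL[OF cV[OF that]])
  have "\<Phi> g1 + \<Phi> g2 + (\<Phi> g3 + \<Phi> g4) = Int_on fund (\<lambda>x. L x (V g1 x) \<bullet> V g1 x + L x (V g2 x) \<bullet> V g2 x + (L x (V g3 x) \<bullet> V g3 x + L x (V g4 x) \<bullet> V g4 x))"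
    unfolding \<Phi>_def by (simp add: Int_on_add[OF compact_fund] cLV continuous_on_add)
  also have "\<dots> = Int_on fund (\<lambda>x. f x * ((1 - rsq x) * peak x ^ m)\<^sup>2 + (1 / (real k)\<^sup>2 + 1 / (2 * real k)\<^sup>2) * (L x (\<beta> x) \<bullet> \<beta> x))"
  proof (rule Int_on_cong)
    fix x assume "x \<in> fund"
    then have lin: "linear (L x)" using L fund_subset_cyl by auto
    have sc: "(cos (real k * x$3))\<^sup>2 + (sin (real k * x$3))\<^sup>2 = 1" "(cos (real k * rsq x))\<^sup>2 + (sin (real k * rsq x))\<^sup>2 = 1"
      by simp_all
    have A: "L x (?A x *\<^sub>R W) \<bullet> (?A x *\<^sub>R W) = (?A x)\<^sup>2 * (L x W \<bullet> W)" for W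
      by (simp add: linear_cmul[OF lin] power2_eq_square)
    have amp: "(1 - rsq x) * peak x ^ m = ?A x" by (simp add: amplitude_def)
    show "L x (V g1 x) \<bullet> V g1 x + L x (V g2 x) \<bullet> V g2 x + (L x (V g3 x) \<bullet> V g3 x + L x (V g4 x) \<bullet> V g4 x)
      = f x * ((1 - rsq x) * peak x ^ m)\<^sup>2 + (1 / (real k)\<^sup>2 + 1 / (2 * real k)\<^sup>2) * (L x (\<beta> x) \<bullet> \<beta> x)"
      unfolding Veq quadratic_rotation[OF lin sc(1)] quadratic_rotation[OF lin sc(2)] A amp f_def
      by (simp add: algebra_simps)
  qed
  also have "\<dots> = J + (1 / (real k)\<^sup>2 + 1 / (2 * real k)\<^sup>2) * R"
  proof -
    have c1: "continuous_on fund (\<lambda>x. f x * ((1 - rsq x) * peak x ^ m)\<^sup>2)" by (intro continuous_intros cf continuous_peak)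
    have c2: "continuous_on fund (\<lambda>x. (1 / (real k)\<^sup>2 + 1 / (2 * real k)\<^sup>2) * (L x (\<beta> x) \<bullet> \<beta> x))"
      by (intro continuous_on_mult continuous_on_const cL c\<beta>)
    show ?thesis unfolding Int_on_add[OF compact_fund c1 c2] J_def R_def set_integral_mult_right ..
  qed
  also have "\<dots> < 0"
  proof -
    have k1: "1 \<le> real k" using k(1) by simp
    have eq: "1 / (real k)\<^sup>2 + 1 / (2 * real k)\<^sup>2 = (1 + 1/4) / (real k)\<^sup>2" by (simp add: power_mult_distrib field_simps)
    have "(1 + 1/4) * R \<le> (1 + 1/4) * \<bar>R\<bar>" by simp
    also have "\<dots> < - J * real k" by (rule k(2))
    also have "\<dots> \<le> - J * (real k)\<^sup>2"
      using m k1 by (intro mult_left_mono) (auto simp: J_def power2_eq_square)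
    finally have "(1 + 1/4) * R / (real k)\<^sup>2 < - J" using k(1) by (simp only: pos_divide_less_eq zero_less_power of_nat_0_less_iff)
    then show ?thesis unfolding eq by simp
  qed
  \<comment> \<open>Only the sum of the four forms is controlled, and a negative sum has a negative
    summand.\<close>
  finally have "\<Phi> g1 < 0 \<or> \<Phi> g2 < 0 \<or> \<Phi> g3 < 0 \<or> \<Phi> g4 < 0" by linarith
  then obtain g where g: "g \<in> {g1, g2, g3, g4}" "\<Phi> g < 0" by blast
  have "\<Phi> g = Int_on fund (\<lambda>x. HP t x (V g x) \<bullet> V g x + ?\<kappa> * (V g x \<bullet> V g x))"
    unfolding \<Phi>_def L_def by (simp add: inner_add_left)
  also have "\<dots> = Int_on fund (\<lambda>x. HP t x (V g x) \<bullet> V g x) + ?\<kappa> * Int_on fund (\<lambda>x. V g x \<bullet> V g x)"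
  proof -
    have c2: "continuous_on fund (\<lambda>x. ?\<kappa> * (V g x \<bullet> V g x))" by (intro continuous_on_mult continuous_on_const continuous_on_inner cV g)
    show ?thesis unfolding Int_on_add[OF compact_fund HP_form_continuous[OF t cV[OF g(1)] cV[OF g(1)]] c2] set_integral_mult_right ..
  qed
  finally show ?thesis using that[OF VT[OF g(1)] V2] g(2) by simp
qed

end

section \<open>Sectional curvature\<close>

lemma L2_inner_self_zeroD:
  assumes V: "continuous_on fund V" "z_periodic V" and I: "Int_on fund (\<lambda>x. V x \<bullet> V x) \<le> 0" and x: "x \<in> cyl"
  shows "V x = 0"
proof (rule z_periodic_zeroI[OF V(2) _ x])
  fix y assume "y \<in> fund"
  have "V y \<bullet> V y = 0"
    by (rule Int_on_eq_0D[OF compact_fund solid_fund _ _ I \<open>y \<in> fund\<close>]) (auto intro!: continuous_intros V(1))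
  then show "V y = 0" by simp
qed

lemma L2_inner_Int_on:
  "\<lbrakk>continuous_on fund V; continuous_on fund W\<rbrakk> \<Longrightarrow> L2_inner V W = Int_on fund (\<lambda>x. V x \<bullet> W x)"
  unfolding L2_inner_def by (rule integral_M_Int_on) (intro continuous_intros)

text \<open>The Gram-Schmidt combination \<open>Z = A W - B V\<close> has squared norm
  \<open>A (A C - B^2)\<close>. It is nonzero by linear independence, and a continuous periodic
  field of norm 0 vanishes on the cylinder.\<close>

lemma L2_Cauchy_Schwarz_strict:
  assumes V: "continuous_on fund V" "z_periodic V" and W: "continuous_on fund W" "z_periodic W" and li: "lin_indep V W"
  shows "0 < L2_inner V V" "0 < L2_inner V V * L2_inner W W - (L2_inner V W)\<^sup>2"
proof -
  define A where "A = Int_on fund (\<lambda>x. V x \<bullet> V x)"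
  define B where "B = Int_on fund (\<lambda>x. V x \<bullet> W x)"
  define C where "C = Int_on fund (\<lambda>x. W x \<bullet> W x)"
  have A: "0 < A"
  proof (rule ccontr)
    assume "\<not> 0 < A"
    then have "V x = 0" if "x \<in> cyl" for x using L2_inner_self_zeroD[OF V _ that] by (simp add: A_def)
    then show False using li unfolding lin_indep_def by (metis add.right_neutral scaleR_zero_left scaleR_zero_right zero_neq_one)
  qed
  define Z where "Z x = (- B) *\<^sub>R V x + A *\<^sub>R W x" for x
  have cZ: "continuous_on fund Z" unfolding Z_def[abs_def] by (intro continuous_intros V W)
  have pZ: "z_periodic Z" using V(2) W(2) by (simp add: z_periodic_def Z_def)
  have "0 < Int_on fund (\<lambda>x. Z x \<bullet> Z x)"
  proof (rule ccontr)
    assume "\<not> 0 < Int_on fund (\<lambda>x. Z x \<bullet> Z x)"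
    then have "\<forall>x\<in>cyl. (- B) *\<^sub>R V x + A *\<^sub>R W x = 0"
      using L2_inner_self_zeroD[OF cZ pZ] unfolding Z_def by fastforce
    then have "A = 0" using li unfolding lin_indep_def by blast
    then show False using A by simp
  qed
  also have "Int_on fund (\<lambda>x. Z x \<bullet> Z x) = A * (A * C - B\<^sup>2)"
  proof -
    have c: "continuous_on fund (\<lambda>x. B\<^sup>2 * (V x \<bullet> V x))" "continuous_on fund (\<lambda>x. A\<^sup>2 * (W x \<bullet> W x))"
      "continuous_on fund (\<lambda>x. (2 * A * B) * (V x \<bullet> W x))"
      by (intro continuous_intros V W)+
    have "Int_on fund (\<lambda>x. Z x \<bullet> Z x)
      = Int_on fund (\<lambda>x. B\<^sup>2 * (V x \<bullet> V x) + A\<^sup>2 * (W x \<bullet> W x) - (2 * A * B) * (V x \<bullet> W x))"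
      by (rule Int_on_cong)
        (simp add: Z_def inner_add_left inner_add_right inner_diff_left inner_diff_right inner_commute power2_eq_square algebra_simps)
    also have "\<dots> = B\<^sup>2 * A + A\<^sup>2 * C - (2 * A * B) * B"
      unfolding Int_on_diff[OF compact_fund continuous_on_add[OF c(1,2)] c(3)] Int_on_add[OF compact_fund c(1,2)]
        set_integral_mult_right A_def[symmetric] B_def[symmetric] C_def[symmetric] ..
    also have "\<dots> = A * (A * C - B\<^sup>2)" by (simp add: power2_eq_square algebra_simps)
    finally show ?thesis .
  qed
  finally have "0 < A * C - B\<^sup>2" using A by (simp add: zero_less_mult_iff)
  then show "0 < L2_inner V V" "0 < L2_inner V V * L2_inner W W - (L2_inner V W)\<^sup>2"
    using A unfolding L2_inner_Int_on[OF V(1) V(1)] L2_inner_Int_on[OF W(1) W(1)] L2_inner_Int_on[OF V(1) W(1)] A_def B_def C_def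
    by simp_all
qed

context euler_odd
begin

abbreviation "initial_energy \<equiv> Int_on fund (\<lambda>x. U 0 x \<bullet> U 0 x)"

lemma U_fund_continuous: "t \<in> {0..<T} \<Longrightarrow> continuous_on fund (U t)"
  by (rule fund_continuous[OF U_continuous])

text \<open>The potential term only lowers the numerator, which is at most \<open>- \<kappa>\<close>
  times the squared norm of \<open>V\<close>. The Gram determinant is at most that norm times the
  squared norm of \<open>U t\<close>, which is conserved; hence a constant independent of
  \<open>t\<close>.\<close>

lemma curvature_upper:
  assumes t: "t \<in> {0..<T}" and V: "V \<in> T_id_Diff_mu" and li: "lin_indep (U t) V" and \<kappa>: "0 \<le> \<kappa>"
    and neg: "Int_on fund (\<lambda>x. HP t x (V x) \<bullet> V x) + \<kappa> * Int_on fund (\<lambda>x. V x \<bullet> V x) \<le> 0"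
  shows "sectional_curvature (P t) (U t) V \<le> - (\<kappa> / initial_energy)"
proof -
  have cV: "continuous_on fund V" and pV: "z_periodic V"
    using V continuous_on_subset[OF smooth_on_continuous fund_subset_cyl] by (auto simp: T_id_Diff_mu_def)
  note cU = U_fund_continuous[OF t]
  define E where "E = L2_inner (U t) (U t)"
  define W where "W = L2_inner V V"
  define D where "D = E * W - (L2_inner (U t) V)\<^sup>2"
  have E: "0 < E" and D: "0 < D"
    using L2_Cauchy_Schwarz_strict[OF cU U_periodic[OF t] cV pV li] by (simp_all add: E_def W_def D_def)
  have Eeq: "E = initial_energy" unfolding E_def L2_inner_Int_on[OF cU cU] by (rule energy_conserved[OF t])
  have "D \<le> E * W" by (simp add: D_def)
  have h: "integral_M (\<lambda>x. hessian (P t) x (V x) (V x)) = Int_on fund (\<lambda>x. HP t x (V x) \<bullet> V x)"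
  proof -
    have eq: "hessian (P t) x (V x) (V x) = HP t x (V x) \<bullet> V x" if "x \<in> fund" for x
      using that fund_subset_cyl by (intro hessian_P[OF t]) auto
    have "continuous_on fund (\<lambda>x. hessian (P t) x (V x) (V x))"
      using HP_form_continuous[OF t cV cV] by (simp add: eq cong: continuous_on_cong)
    then show ?thesis using eq by (simp add: integral_M_Int_on cong: Int_on_cong)
  qed
  define q where "q = integral_M (\<lambda>x. (norm (grad (curv_potential (U t) V) x))\<^sup>2)"
  \<comment> \<open>This holds whatever \<open>curv_potential\<close> chooses: the integral of a
    nonnegative function is nonnegative, with default value 0 if it is not integrable.\<close>
  have "0 \<le> q" unfolding q_def by (rule integral_M_nonneg) simp
  moreover have "Int_on fund (\<lambda>x. HP t x (V x) \<bullet> V x) \<le> - (\<kappa> * W)"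
    using neg by (simp add: W_def L2_inner_Int_on[OF cV cV])
  moreover have "\<kappa> / E * D \<le> \<kappa> / E * (E * W)"
    using \<open>D \<le> E * W\<close> \<kappa> E by (intro mult_left_mono) auto
  ultimately have "Int_on fund (\<lambda>x. HP t x (V x) \<bullet> V x) - q \<le> - (\<kappa> / E) * D" using E by simp
  then have "(Int_on fund (\<lambda>x. HP t x (V x) \<bullet> V x) - q) / D \<le> - (\<kappa> / E)" using D by (simp only: pos_divide_le_eq)
  then show ?thesis unfolding sectional_curvature_def h Eeq[symmetric] D_def E_def W_def q_def .
qed

text \<open>On the wall line at angle 0 the field \<open>V\<close> has no swirl, whereas the swirl
  of \<open>U\<close> there has slope \<open>\<nu> \<noteq> 0\<close> at height 0. So the
  coefficient of \<open>U\<close> in a linear relation is 0.\<close>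

lemma lin_indep_U:
  assumes t: "t \<in> {0..<T}" and s: "swirl_slope t \<noteq> 0" and V: "\<And>z. V (cylpt 1 0 z) $ 2 = 0"
    and y: "y \<in> cyl" "V y \<noteq> 0"
  shows "lin_indep (U t) V"
  unfolding lin_indep_def
proof (intro allI impI)
  fix \<alpha> \<beta> :: real assume 0: "\<forall>x\<in>cyl. \<alpha> *\<^sub>R U t x + \<beta> *\<^sub>R V x = 0"
  have "\<alpha> = 0"
  proof (rule ccontr)
    assume "\<alpha> \<noteq> 0"
    have "U t (cylpt 1 0 z) \<bullet> e_theta 0 = 0" for z
    proof -
      have "(\<alpha> *\<^sub>R U t (cylpt 1 0 z) + \<beta> *\<^sub>R V (cylpt 1 0 z)) $ 2 = 0" using 0 by simp
      then show ?thesis using \<open>\<alpha> \<noteq> 0\<close> V by (simp add: inner_3)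
    qed
    then have "DU t (cylpt 1 0 0) e_z \<bullet> e_theta 0 = 0"
      by (intro derivative_along_zero_path[where J="UNIV" and s=0 and v="e_z" and G'="DU t (cylpt 1 0 0)" and \<gamma>="\<lambda>s. cylpt 1 0 s" and G="U t" and S=cyl and L="\<lambda>u. u \<bullet> e_theta 0"])
        (auto simp: solid_UNIV intro!: cylpt_deriv_axial U_deriv bounded_linear_inner_left t[simplified])
    then show False using s by (simp add: swirl_slope_def)
  qed
  then show "\<alpha> = 0 \<and> \<beta> = 0" using 0 y by auto
qed

text \<open>Independence from \<open>e_z\<close> shows that \<open>U 0\<close> is not zero; the
  energy is a denominator in the curvature bound.\<close>

lemma initial_energy_pos:
  assumes "0 \<in> {0..<T}" "swirl_slope 0 \<noteq> 0"
  shows "0 < initial_energy"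
proof -
  have z: "z_periodic (\<lambda>x::real^3. e_z)" by (simp add: z_periodic_def)
  have "lin_indep (U 0) (\<lambda>x. e_z)"
    by (rule lin_indep_U[OF assms, where y="cylpt 1 0 0"]) (auto simp: vec_eq_iff forall_3)
  from L2_Cauchy_Schwarz_strict(1)[OF U_fund_continuous[OF assms(1)] U_periodic[OF assms(1)] _ z this]
  show ?thesis by (simp add: L2_inner_Int_on U_fund_continuous[OF assms(1)])
qed

text \<open>When the strain vanishes, the constant field \<open>e_z\<close> shows that the infimum is not positive.\<close>

lemma curvature_inf:
  assumes t: "t \<in> {0..<T}" and s: "swirl_slope t \<noteq> 0"
  shows "(INF V\<in>{V \<in> T_id_Diff_mu. lin_indep (U t) V}. ereal (sectional_curvature (P t) (U t) V))
     \<le> - ereal (1 / (2 * initial_energy) * (axial_strain t)\<^sup>2)"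
proof -
  obtain V where V: "V \<in> T_id_Diff_mu" "lin_indep (U t) V"
    "Int_on fund (\<lambda>x. HP t x (V x) \<bullet> V x) + (axial_strain t)\<^sup>2 / 2 * Int_on fund (\<lambda>x. V x \<bullet> V x) \<le> 0"
  proof (cases "axial_strain t = 0")
    case True
    have "(\<lambda>x. e_z) \<in> T_id_Diff_mu"
    proof -
      have "smooth_on (\<lambda>x::real^3. e_z) cyl"
        by (rule elementary_field_smooth[OF elementary_const solid_cyl])
      moreover have "divergence (\<lambda>x. e_z) x = 0" if "x \<in> cyl" for x
        by (simp add: divergence_def pd_def frechet_derivative_solid[OF solid_cyl that has_derivative_const])
      ultimately show ?thesis by (simp add: T_id_Diff_mu_def z_periodic_def tangent_bdry_def)
    qed
    moreover have "lin_indep (U t) (\<lambda>x. e_z)"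
      by (rule lin_indep_U[OF t s, where y="cylpt 1 0 0"]) (auto simp: vec_eq_iff forall_3)
    moreover have "Int_on fund (\<lambda>x. HP t x e_z \<bullet> e_z) = 0"
    proof (rule Int_on_fund_derivative_vertical[where g="\<lambda>x. grad (P t) x \<bullet> e_z" and g'="\<lambda>x v. HP t x v \<bullet> e_z"])
      have "z_periodic (\<lambda>x. grad (P t) x \<bullet> e_z)" by (rule C1_torus_derivative_periodic[OF P_C1[OF t]])
      then show "C1_torus (\<lambda>x. grad (P t) x \<bullet> e_z) (\<lambda>x v. HP t x v \<bullet> e_z)"
        using slice_continuous[OF HP_continuous t]
        by (auto simp: C1_torus_def z_periodic_def intro!: has_derivative_inner_left grad_P_deriv[OF t] continuous_intros)
    qed
    ultimately show ?thesis using that[of "\<lambda>x. e_z"] True by simp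
  next
    case False
    obtain V where V: "V \<in> T_id_Diff_mu" "\<And>z. V (cylpt 1 0 z) $ 2 = 0"
      "Int_on fund (\<lambda>x. HP t x (V x) \<bullet> V x) + (axial_strain t)\<^sup>2 / 2 * Int_on fund (\<lambda>x. V x \<bullet> V x) < 0"
      using negative_direction[OF t False] by blast
    have "\<exists>y\<in>cyl. V y \<noteq> 0"
    proof (rule ccontr)
      assume "\<not> (\<exists>y\<in>cyl. V y \<noteq> 0)"
      then have "V y = 0" if "y \<in> fund" for y using that fund_subset_cyl by auto
      then have "Int_on fund (\<lambda>x. HP t x (V x) \<bullet> V x) = Int_on fund (\<lambda>x. 0)" "Int_on fund (\<lambda>x. V x \<bullet> V x) = Int_on fund (\<lambda>x. 0)"
        by (intro Int_on_cong; simp)+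
      then show False using V(3) by simp
    qed
    then obtain y where "y \<in> cyl" "V y \<noteq> 0" by blast
    then have "lin_indep (U t) V" by (rule lin_indep_U[OF t s, where V=V, OF V(2)])
    then show ?thesis using that[of V] V(1,3) by simp
  qed
  have "sectional_curvature (P t) (U t) V \<le> - ((axial_strain t)\<^sup>2 / 2 / initial_energy)"
    by (rule curvature_upper[OF t V(1,2) _ V(3)]) simp
  then show ?thesis using V(1,2) by (intro INF_lower2[of V]) (auto simp: field_simps)
qed

lemma curvature_blowup:
  assumes inf: "(\<integral>\<^sup>+t\<in>{0..<T}. ennreal ((axial_strain t)\<^sup>2) \<partial>lborel) = \<infinity>"
    and s: "\<And>t. t \<in> {0..<T} \<Longrightarrow> swirl_slope t \<noteq> 0" and T: "0 < T"
  shows "time_integral T (\<lambda>t. INF V\<in>{V \<in> T_id_Diff_mu. lin_indep (U t) V}.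
      ereal (sectional_curvature (P t) (U t) V)) = - \<infinity>"
proof -
  have E: "0 < initial_energy" using initial_energy_pos s T by simp
  show ?thesis
    by (rule time_integral_minus_infinity[where g="\<lambda>t. 1 / (2 * initial_energy) * (axial_strain t)\<^sup>2"])
      (use curvature_inf s E scaled_strain_blowup[OF inf, of "1 / (2 * initial_energy)"] in auto)
qed

end

theorem theorem1p5:
  fixes U \<eta> :: "real \<Rightarrow> real^3 \<Rightarrow> real^3"
    and P :: "real \<Rightarrow> real^3 \<Rightarrow> real"
    and a b c :: "real \<Rightarrow> real \<Rightarrow> real \<Rightarrow> real"
    and T r0 :: real
  assumes "0 < T"
    and "euler_solution T U P"
    and "axisymmetric T U a b c"
    and "is_flow T U \<eta>"
    and "odd_in_z (c 0)" and "odd_in_z (b 0)"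
    and "r0 = 0 \<or> r0 = 1"
    and "(\<integral>\<^sup>+t\<in>{0..<T}. ennreal (norm (curl (U t) (cylpt r0 0 0))) \<partial>lborel) = \<infinity>"
  shows "(\<forall>t1 t2. 0 \<le> t1 \<and> t1 < t2 \<and> t2 < T \<longrightarrow>
            (\<exists>N. nbhd_circle r0 N \<and>
               \<not> (\<exists>\<epsilon> H. is_variation \<eta> t1 t2 \<epsilon> H \<and> supported_in \<eta> t1 t2 \<epsilon> H N \<and>
                        curve_shortening t1 t2 H)))
       \<and> time_integral T (\<lambda>t. INF x\<in>cyl. ereal (laplacian (P t) x)) = -\<infinity>
       \<and> time_integral T (\<lambda>t. INF V\<in>{V \<in> T_id_Diff_mu. lin_indep (U t) V}.
             ereal (sectional_curvature (P t) (U t) V)) = -\<infinity>"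
proof -
  interpret euler_odd T U P a b c
    using assms by unfold_locales auto
  note blowup = strain_blowup[OF assms(7,8)]
  show ?thesis
    using not_shortening_near_circle[OF assms(4)] laplacian_blowup[OF blowup(2)]
      curvature_blowup[OF blowup(2,3) assms(1)] blowup(1) by blast
qed

end
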